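(* Let $d\ge2$ and let $\psi:\mathbb{R}^{d-1}\to\mathbb{R}$ satisfy, for some constants $\ell>0$ and $L$, $\psi(x')>\ell>0$ and $|\psi(x')-\psi(y')|\le L|x'-y'|$ for all $x',y'\in\mathbb{R}^{d-1}$. Let $w$ be an $M$-confined weight function on $\mathbb{R}^d$ with confinement region $S\subset\mathbb{R}^{d-1}$ and let $\sigma>\frac12$. Assume that $\mathbb{R}^{d-1}\setminus S$ has positive measure. Consider the self-adjoint operator $H_w=-i\frac{\psi}{w}\frac{\partial}{\partial x_1}:D_w^{\mathrm{symm}}\subset L^2_w(\mathbb{R}^d)\to L^2_w(\mathbb{R}^d)$. Then $$\lim_{T\to\infty}\frac{1}{2T}\int_{-T}^{T}e^{itH_w}\,dt=P_w$$ in the uniform operator topology on $\mathcal{B}(\mathcal{Y}^\sigma,\mathcal{Y}^{-\sigma})$, where $P_w$ is the orthogonal projection (in $L^2_w(\mathbb{R}^d)$) onto the kernel of $H_w$.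
   Context: Points of $\mathbb{R}^d$ are written $x=(x_1,x')$, $x'=(x_2,\dots,x_d)\in\mathbb{R}^{d-1}$. A positive bounded weight $0<w\in L^\infty(\mathbb{R}^d)$ is $M$-confined ($M>0$) with confinement region $S\subset\mathbb{R}^{d-1}$ if $w(x_1,x')=1$ for all $x'\in\mathbb{R}^{d-1}\setminus S$ and $\|w(\cdot,x')\|_{L^1(\mathbb{R})}<M$ for all $x'\in S$. $L^2_w(\mathbb{R}^d)$ is the Hilbert space with inner product $(f,g)_{L^2_w}=\int_{\mathbb{R}^d}f\overline g\,w\,dx$; $L^2_{w(\cdot,x')}(\mathbb{R})$ is the one with inner product $\int_{\mathbb{R}}f\overline g\,w(\cdot,x')\,ds$. For $x'\in\mathbb{R}^{d-1}$ let $H_w^{x'}=-i\frac{\psi(x')}{w(\cdot,x')}\frac{d}{dx}$ (distributional derivative) on $$D^{x'}=\left\{g\in L^2_{w(\cdot,x')}(\mathbb{R})\ \Big|\ H_w^{x'}g\in L^2_{w(\cdot,x')}(\mathbb{R}),\ \lim_{x\to\infty}g(x)=\lim_{x\to-\infty}g(x)\right\}.$$ The symmetric domain is $$D_w^{\mathrm{symm}}=\left\{f\in L^2_w(\mathbb{R}^d)\ \Big|\ f(\cdot,x')\in D^{x'}\text{ a.e. }x',\ \int_{\mathbb{R}^{d-1}}\|H_w^{x'}f(\cdot,x')\|^2_{L^2_{w(\cdot,x')}(\mathbb{R})}\,dx'<\infty\right\},$$ on which $(H_wf)(\cdot,x')=H_w^{x'}f(\cdot,x')$ is self-adjoint. $\mathcal{Y}^\sigma$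 is the space of $r:\mathbb{R}^d\to\mathbb{C}$ with $r(\cdot,x')\in L^{2,\sigma}(\mathbb{R})$ for $x'\notin S$ and $r(\cdot,x')\in L^2_{w(\cdot,x')}(\mathbb{R})$ for $x'\in S$, with finite norm $$\|r\|_{\mathcal{Y}^\sigma}^2=\int_S\|r(\cdot,x')\|^2_{L^2_{w(\cdot,x')}(\mathbb{R})}\,dx'+\int_{\mathbb{R}^{d-1}\setminus S}\|r(\cdot,x')\|^2_{L^{2,\sigma}(\mathbb{R})}\,dx',$$ where $\|g\|_{L^{2,\sigma}(\mathbb{R})}^2=\int_{\mathbb{R}}(1+s^2)^\sigma|g(s)|^2\,ds$. $\mathcal{Y}^{-\sigma}$ is the dual space of $\mathcal{Y}^\sigma$ with respect to the inner product of $L^2_w(\mathbb{R}^d)$, so that $\mathcal{Y}^\sigma\subset L^2_w(\mathbb{R}^d)\subset\mathcal{Y}^{-\sigma}$ and bounded operators on $L^2_w(\mathbb{R}^d)$ are regarded as elements of $\mathcal{B}(\mathcal{Y}^\sigma,\mathcal{Y}^{-\sigma})$, the space of bounded linear operators $\mathcal{Y}^\sigma\to\mathcal{Y}^{-\sigma}$ with the operator norm. The integral over $t$ is understood in the strong sense on $L^2_w(\mathbb{R}^d)$. *)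

theory Defs
  imports "HOL-Analysis.Analysis"
begin

section \<open>The spaces \<open>L\<^sup>2(M)\<close>\<close>

text \<open>
  Elements of \<open>L\<^sup>2(M)\<close> are represented by square-integrable functions; equality in \<open>L\<^sup>2(M)\<close> is
  equality almost everywhere, so objects that are unique in \<open>L\<^sup>2(M)\<close> are unique up to null sets below.
  Weighted spaces are obtained by taking for \<open>M\<close> a measure with density, so that the inner product
  is \<open>\<integral> f \<cdot> cnj g \<cdot> w\<close>.
\<close>

definition L2 :: "'a measure \<Rightarrow> ('a \<Rightarrow> complex) set" where
  "L2 M = {f \<in> borel_measurable M. integrable M (\<lambda>x. (cmod (f x))\<^sup>2)}"

definition L2_inner :: "'a measure \<Rightarrow> ('a \<Rightarrow> complex) \<Rightarrow> ('a \<Rightarrow> complex) \<Rightarrow> complex" where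
  "L2_inner M f g = (\<integral>x. f x * cnj (g x) \<partial>M)"

definition L2_norm :: "'a measure \<Rightarrow> ('a \<Rightarrow> complex) \<Rightarrow> real" where
  "L2_norm M f = sqrt (\<integral>x. (cmod (f x))\<^sup>2 \<partial>M)"

section \<open>Operators on \<open>L\<^sup>2(M)\<close>\<close>

text \<open>An unbounded operator \<open>H\<close> is given by its graph, the set of pairs \<open>(f, H f)\<close>.\<close>

type_synonym 'a operator_graph = "(('a \<Rightarrow> complex) \<times> ('a \<Rightarrow> complex)) set"

definition op_kernel :: "'a operator_graph \<Rightarrow> ('a \<Rightarrow> complex) set" where
  "op_kernel H = {f. (f, \<lambda>_. 0) \<in> H}"

definition orth_projection ::
    "'a measure \<Rightarrow> ('a \<Rightarrow> complex) set \<Rightarrow> ('a \<Rightarrow> complex) \<Rightarrow> ('a \<Rightarrow> complex)" where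
  "orth_projection M N f = (SOME p. p \<in> N \<and> (\<forall>n\<in>N. L2_inner M (\<lambda>x. f x - p x) n = 0))"

definition unitary_L2 :: "'a measure \<Rightarrow> (('a \<Rightarrow> complex) \<Rightarrow> ('a \<Rightarrow> complex)) \<Rightarrow> bool" where
  "unitary_L2 M V \<longleftrightarrow>
     (\<forall>f\<in>L2 M. V f \<in> L2 M) \<and>
     (\<forall>f\<in>L2 M. \<forall>g\<in>L2 M. \<forall>a b. AE x in M. V (\<lambda>y. a * f y + b * g y) x = a * V f x + b * V g x) \<and>
     (\<forall>f\<in>L2 M. \<forall>g\<in>L2 M. L2_inner M (V f) (V g) = L2_inner M f g) \<and>
     (\<forall>g\<in>L2 M. \<exists>f\<in>L2 M. AE x in M. V f x = g x)"

definition unitary_group ::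
    "'a measure \<Rightarrow> (real \<Rightarrow> ('a \<Rightarrow> complex) \<Rightarrow> ('a \<Rightarrow> complex)) \<Rightarrow> bool" where
  "unitary_group M U \<longleftrightarrow>
     (\<forall>t. unitary_L2 M (U t)) \<and>
     (\<forall>f\<in>L2 M. AE x in M. U 0 f x = f x) \<and>
     (\<forall>s t. \<forall>f\<in>L2 M. AE x in M. U (s + t) f x = U s (U t f) x) \<and>
     (\<forall>t. \<forall>f\<in>L2 M. ((\<lambda>s. L2_norm M (\<lambda>x. U s f x - U t f x)) \<longlongrightarrow> 0) (at t))"

text \<open>
  \<open>e\<^sup>i\<^sup>t\<^sup>H\<close> for a self-adjoint operator \<open>H\<close> is the strongly continuous unitary group whose infinitesimal
  generator is \<open>iH\<close>, domains included.  By Stone's theorem it exists, and it is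
  unique up to null sets.
\<close>

definition generates_group ::
    "'a measure \<Rightarrow> 'a operator_graph \<Rightarrow> (real \<Rightarrow> ('a \<Rightarrow> complex) \<Rightarrow> ('a \<Rightarrow> complex)) \<Rightarrow> bool" where
  "generates_group M H U \<longleftrightarrow> unitary_group M U \<and>
     (\<forall>f\<in>L2 M. \<forall>g\<in>L2 M. (f, g) \<in> H \<longleftrightarrow>
        ((\<lambda>h. L2_norm M (\<lambda>x. (U h f x - f x) / complex_of_real h - \<i> * g x)) \<longlongrightarrow> 0) (at 0))"

definition exp_i ::
    "'a measure \<Rightarrow> 'a operator_graph \<Rightarrow> real \<Rightarrow> ('a \<Rightarrow> complex) \<Rightarrow> ('a \<Rightarrow> complex)" where
  "exp_i M H = (SOME U. generates_group M H U)"

text \<open>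
  The \<open>L\<^sup>2(M)\<close>-valued Riemann integral of \<open>F\<close> over \<open>[a, b]\<close>: the limit in \<open>L\<^sup>2(M)\<close> of the Riemann sums.
  For norm-continuous \<open>F\<close> it exists, and it is the usual strong integral.
\<close>

definition L2_has_integral ::
    "'a measure \<Rightarrow> (real \<Rightarrow> 'a \<Rightarrow> complex) \<Rightarrow> real \<Rightarrow> real \<Rightarrow> ('a \<Rightarrow> complex) \<Rightarrow> bool" where
  "L2_has_integral M F a b I \<longleftrightarrow>
     (\<forall>t\<in>{a..b}. F t \<in> L2 M) \<and> I \<in> L2 M \<and>
     (\<forall>e>0. \<exists>\<delta>>0. \<forall>p. p tagged_division_of {a..b} \<and> (\<lambda>t. ball t \<delta>) fine p \<longrightarrow>
        L2_norm M (\<lambda>x. (\<Sum>(t, k)\<in>p. measure lborel k *\<^sub>R F t x) - I x) < e)"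

definition L2_integral ::
    "'a measure \<Rightarrow> real \<Rightarrow> real \<Rightarrow> (real \<Rightarrow> 'a \<Rightarrow> complex) \<Rightarrow> ('a \<Rightarrow> complex)" where
  "L2_integral M a b F = (SOME I. L2_has_integral M F a b I)"

definition time_average ::
    "'a measure \<Rightarrow> 'a operator_graph \<Rightarrow> real \<Rightarrow> ('a \<Rightarrow> complex) \<Rightarrow> ('a \<Rightarrow> complex)" where
  "time_average M H T f =
     (\<lambda>x. complex_of_real (1 / (2 * T)) * L2_integral M (- T) T (\<lambda>t. exp_i M H t f) x)"

section \<open>The distributional derivative on the line\<close>

definition test_fun :: "(real \<Rightarrow> real) \<Rightarrow> bool" where
  "test_fun \<phi> \<longleftrightarrow> (\<forall>n x. (deriv ^^ n) \<phi> differentiable at x) \<and> (\<exists>R. \<forall>x. \<bar>x\<bar> > R \<longrightarrow> \<phi> x = 0)"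

definition distr_deriv :: "(real \<Rightarrow> complex) \<Rightarrow> (real \<Rightarrow> complex) \<Rightarrow> bool" where
  "distr_deriv g g' \<longleftrightarrow>
     (\<forall>a b. g absolutely_integrable_on {a..b}) \<and> (\<forall>a b. g' absolutely_integrable_on {a..b}) \<and>
     (\<forall>\<phi>. test_fun \<phi> \<longrightarrow>
        (\<integral>s. deriv \<phi> s *\<^sub>R g s \<partial>lebesgue) = - (\<integral>s. \<phi> s *\<^sub>R g' s \<partial>lebesgue))"

text \<open>The limits at \<open>\<plusminus>\<infinity>\<close> are those of the continuous representative.\<close>

definition equal_limits :: "(real \<Rightarrow> complex) \<Rightarrow> bool" where
  "equal_limits g \<longleftrightarrow> (\<exists>G c. continuous_on UNIV G \<and> (AE s in lebesgue. g s = G s) \<and>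
     (G \<longlongrightarrow> c) at_top \<and> (G \<longlongrightarrow> c) at_bot)"

section \<open>Confined weights and the operator \<open>H\<^sub>w\<close>\<close>

text \<open>
  \<open>\<real>\<^sup>d\<close> is \<open>real \<times> (real ^ 'n)\<close>, with points \<open>(x\<^sub>1, x')\<close>; thus \<open>d - 1 = CARD('n) \<ge> 1\<close>.
  Measurability is Lebesgue measurability throughout.  As \<open>w\<close> is an element of \<open>L\<^sup>\<infinity>\<close>, its positivity and
  boundedness are required almost everywhere, whereas the two conditions that define \<open>S\<close> are
  required for every \<open>x'\<close>.
\<close>

definition confined_weight ::
    "real \<Rightarrow> (real ^ 'n) set \<Rightarrow> (real \<times> (real ^ 'n) \<Rightarrow> real) \<Rightarrow> bool" where
  "confined_weight M S w \<longleftrightarrow>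
     M > 0 \<and> S \<in> sets lebesgue \<and>
     w \<in> borel_measurable lebesgue \<and>
     (AE x in lebesgue. 0 < w x) \<and> (\<exists>C. AE x in lebesgue. \<bar>w x\<bar> \<le> C) \<and>
     (\<forall>x'. x' \<notin> S \<longrightarrow> (\<forall>s. w (s, x') = 1)) \<and>
     (\<forall>x'\<in>S. (\<lambda>s. w (s, x')) \<in> borel_measurable lebesgue \<and>
        (\<integral>\<^sup>+ s. ennreal \<bar>w (s, x')\<bar> \<partial>lebesgue) < ennreal M)"

definition weight_measure :: "(real \<times> (real ^ 'n) \<Rightarrow> real) \<Rightarrow> (real \<times> (real ^ 'n)) measure" where
  "weight_measure w = density lebesgue (\<lambda>x. ennreal (w x))"

definition fibre_measure :: "(real \<times> (real ^ 'n) \<Rightarrow> real) \<Rightarrow> real ^ 'n \<Rightarrow> real measure" where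
  "fibre_measure w x' = density lebesgue (\<lambda>s. ennreal (w (s, x')))"

definition fibre_op_rel ::
    "(real ^ 'n \<Rightarrow> real) \<Rightarrow> (real \<times> (real ^ 'n) \<Rightarrow> real) \<Rightarrow> real ^ 'n \<Rightarrow>
      (real \<Rightarrow> complex) \<Rightarrow> (real \<Rightarrow> complex) \<Rightarrow> bool" where
  "fibre_op_rel \<psi> w x' g h \<longleftrightarrow> (\<exists>g'. distr_deriv g g' \<and>
     (AE s in lebesgue. h s = - \<i> * complex_of_real (\<psi> x' / w (s, x')) * g' s))"

definition fibre_op ::
    "(real ^ 'n \<Rightarrow> real) \<Rightarrow> (real \<times> (real ^ 'n) \<Rightarrow> real) \<Rightarrow> real ^ 'n \<Rightarrow>
      (real \<Rightarrow> complex) \<Rightarrow> (real \<Rightarrow> complex)" where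
  "fibre_op \<psi> w x' g = (SOME h. fibre_op_rel \<psi> w x' g h)"

text \<open>
  Existence of an \<open>h\<close> includes that \<open>g\<close> is locally integrable, hence a distribution; \<open>g \<in> L\<^sup>2\<close> alone
  does not imply this if \<open>w\<close> is not bounded below.
\<close>

definition fibre_dom ::
    "(real ^ 'n \<Rightarrow> real) \<Rightarrow> (real \<times> (real ^ 'n) \<Rightarrow> real) \<Rightarrow> real ^ 'n \<Rightarrow> (real \<Rightarrow> complex) set" where
  "fibre_dom \<psi> w x' = {g \<in> L2 (fibre_measure w x').
     (\<exists>h. fibre_op_rel \<psi> w x' g h) \<and> fibre_op \<psi> w x' g \<in> L2 (fibre_measure w x') \<and>
     equal_limits g}"

definition symm_dom ::
    "(real ^ 'n \<Rightarrow> real) \<Rightarrow> (real \<times> (real ^ 'n) \<Rightarrow> real) \<Rightarrow> (real \<times> (real ^ 'n) \<Rightarrow> complex) set" where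
  "symm_dom \<psi> w = {f \<in> L2 (weight_measure w).
     (AE x' in lebesgue. (\<lambda>s. f (s, x')) \<in> fibre_dom \<psi> w x') \<and>
     (\<integral>\<^sup>+ x'. ennreal ((L2_norm (fibre_measure w x') (fibre_op \<psi> w x' (\<lambda>s. f (s, x'))))\<^sup>2) \<partial>lebesgue)
       < \<infinity>}"

text \<open>
  \<open>(H\<^sub>w f)(\<cdot>, x') = H\<^sub>w\<^sup>x\<^sup>' f(\<cdot>, x')\<close> only fixes each section of \<open>H\<^sub>w f\<close> up to a null set, and arbitrary choices
  of the sections need not be jointly measurable.  So \<open>H\<^sub>w f\<close> is the element of \<open>L\<^sup>2\<^sub>w\<close> whose
  sections are almost everywhere the prescribed ones.
\<close>

definition H_op ::
    "(real ^ 'n \<Rightarrow> real) \<Rightarrow> (real \<times> (real ^ 'n) \<Rightarrow> real) \<Rightarrow> (real \<times> (real ^ 'n)) operator_graph" where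
  "H_op \<psi> w = {(f, h). f \<in> symm_dom \<psi> w \<and> h \<in> L2 (weight_measure w) \<and>
     (AE x' in lebesgue. AE s in lebesgue. h (s, x') = fibre_op \<psi> w x' (\<lambda>s. f (s, x')) s)}"

section \<open>The space \<open>\<Y>\<^sup>\<sigma>\<close>, its dual, and \<open>\<B>(\<Y>\<^sup>\<sigma>, \<Y>\<^sup>-\<^sup>\<sigma>)\<close>\<close>

definition japanese_measure :: "real \<Rightarrow> real measure" where
  "japanese_measure \<sigma> = density lebesgue (\<lambda>s. ennreal ((1 + s\<^sup>2) powr \<sigma>))"

definition Y_norm_sq ::
    "(real ^ 'n) set \<Rightarrow> (real \<times> (real ^ 'n) \<Rightarrow> real) \<Rightarrow> real \<Rightarrow> (real \<times> (real ^ 'n) \<Rightarrow> complex) \<Rightarrow> ennreal" where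
  "Y_norm_sq S w \<sigma> r =
     (\<integral>\<^sup>+ x'\<in>S. ennreal ((L2_norm (fibre_measure w x') (\<lambda>s. r (s, x')))\<^sup>2) \<partial>lebesgue) +
     (\<integral>\<^sup>+ x'\<in>- S. ennreal ((L2_norm (japanese_measure \<sigma>) (\<lambda>s. r (s, x')))\<^sup>2) \<partial>lebesgue)"

definition Y_space ::
    "(real ^ 'n) set \<Rightarrow> (real \<times> (real ^ 'n) \<Rightarrow> real) \<Rightarrow> real \<Rightarrow> (real \<times> (real ^ 'n) \<Rightarrow> complex) set" where
  "Y_space S w \<sigma> = {r \<in> borel_measurable lebesgue.
     (AE x' in lebesgue.
        (x' \<notin> S \<longrightarrow> (\<lambda>s. r (s, x')) \<in> L2 (japanese_measure \<sigma>)) \<and>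
        (x' \<in> S \<longrightarrow> (\<lambda>s. r (s, x')) \<in> L2 (fibre_measure w x'))) \<and>
     Y_norm_sq S w \<sigma> r < \<infinity>}"

definition Y_ball ::
    "(real ^ 'n) set \<Rightarrow> (real \<times> (real ^ 'n) \<Rightarrow> real) \<Rightarrow> real \<Rightarrow> (real \<times> (real ^ 'n) \<Rightarrow> complex) set" where
  "Y_ball S w \<sigma> = {r \<in> Y_space S w \<sigma>. sqrt (enn2real (Y_norm_sq S w \<sigma> r)) \<le> 1}"

text \<open>
  The inner product is conjugate linear in its second argument, so \<open>\<Y>\<^sup>-\<^sup>\<sigma>\<close> consists of the bounded
  conjugate-linear functionals on \<open>\<Y>\<^sup>\<sigma>\<close>, an element \<open>u\<close> of \<open>L\<^sup>2\<^sub>w\<close> being the functional \<open>r \<mapsto> (u, r)\<close>.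
\<close>

definition Y_dual_norm ::
    "(real ^ 'n) set \<Rightarrow> (real \<times> (real ^ 'n) \<Rightarrow> real) \<Rightarrow> real \<Rightarrow>
      ((real \<times> (real ^ 'n) \<Rightarrow> complex) \<Rightarrow> complex) \<Rightarrow> ennreal" where
  "Y_dual_norm S w \<sigma> \<xi> = (SUP r\<in>Y_ball S w \<sigma>. ennreal (cmod (\<xi> r)))"

definition Y_dual ::
    "(real ^ 'n) set \<Rightarrow> (real \<times> (real ^ 'n) \<Rightarrow> real) \<Rightarrow> real \<Rightarrow>
      ((real \<times> (real ^ 'n) \<Rightarrow> complex) \<Rightarrow> complex) set" where
  "Y_dual S w \<sigma> = {\<xi>.
     (\<forall>q\<in>Y_space S w \<sigma>. \<forall>r\<in>Y_space S w \<sigma>. \<forall>a b.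
        \<xi> (\<lambda>x. a * q x + b * r x) = cnj a * \<xi> q + cnj b * \<xi> r) \<and>
     Y_dual_norm S w \<sigma> \<xi> < \<infinity>}"

definition B_norm ::
    "(real ^ 'n) set \<Rightarrow> (real \<times> (real ^ 'n) \<Rightarrow> real) \<Rightarrow> real \<Rightarrow>
      ((real \<times> (real ^ 'n) \<Rightarrow> complex) \<Rightarrow> (real \<times> (real ^ 'n) \<Rightarrow> complex) \<Rightarrow> complex) \<Rightarrow> ennreal" where
  "B_norm S w \<sigma> \<Lambda> = (SUP f\<in>Y_ball S w \<sigma>. Y_dual_norm S w \<sigma> (\<Lambda> f))"

definition B_space ::
    "(real ^ 'n) set \<Rightarrow> (real \<times> (real ^ 'n) \<Rightarrow> real) \<Rightarrow> real \<Rightarrow>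
      ((real \<times> (real ^ 'n) \<Rightarrow> complex) \<Rightarrow> (real \<times> (real ^ 'n) \<Rightarrow> complex) \<Rightarrow> complex) set" where
  "B_space S w \<sigma> = {\<Lambda>.
     (\<forall>f\<in>Y_space S w \<sigma>. \<Lambda> f \<in> Y_dual S w \<sigma>) \<and>
     (\<forall>f\<in>Y_space S w \<sigma>. \<forall>g\<in>Y_space S w \<sigma>. \<forall>a b. \<forall>r\<in>Y_space S w \<sigma>.
        \<Lambda> (\<lambda>x. a * f x + b * g x) r = a * \<Lambda> f r + b * \<Lambda> g r) \<and>
     B_norm S w \<sigma> \<Lambda> < \<infinity>}"

definition as_B ::
    "(real \<times> (real ^ 'n) \<Rightarrow> real) \<Rightarrow>
      ((real \<times> (real ^ 'n) \<Rightarrow> complex) \<Rightarrow> (real \<times> (real ^ 'n) \<Rightarrow> complex)) \<Rightarrow>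
      (real \<times> (real ^ 'n) \<Rightarrow> complex) \<Rightarrow> (real \<times> (real ^ 'n) \<Rightarrow> complex) \<Rightarrow> complex" where
  "as_B w A = (\<lambda>f r. L2_inner (weight_measure w) (A f) r)"

end

theory Submission
  imports Defs "HOL-Library.Real_Mod"
begin

text \<open>
  In the coordinate \<open>y = \<integral> w(s, x') ds\<close>, running over \<open>(0, m(x'))\<close> on a fibre of finite mass \<open>m(x')\<close> and over
  \<open>\<real>\<close> on a fibre with \<open>w = 1\<close>, the fibre operator is \<open>-i \<psi>(x') d/dy\<close>, and equal limits at \<open>\<plusminus>\<infinity>\<close> are
  periodicity. So \<open>e\<^sup>i\<^sup>t\<^sup>H f = f \<circ> \<Phi>\<^sub>t\<close> for the flow \<open>\<Phi>\<^sub>t\<close> that moves \<open>y\<close> at speed \<open>\<psi>(x')\<close>, a rotation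
  on the confined fibres and a translation on the others.

  Time averages fix the invariant functions and send \<open>q = H g\<close> to a function of norm at most \<open>\<parallel>g\<parallel> / T\<close>.
  Write \<open>f = p + q + e\<close>, where \<open>p\<close> is the mean of \<open>f\<close> on each confined fibre and \<open>0\<close> elsewhere. On a
  confined fibre \<open>q = f - p\<close> has integral \<open>0\<close>, so its primitive \<open>g\<close> is periodic, and it is controlled
  because \<open>m \<le> M\<close> and \<open>\<psi> > l\<close>. On the other fibres \<open>q\<close> is \<open>f\<close> cut off to \<open>[-R, R]\<close> with its integral
  spread over \<open>[-r, r]\<close>, so that \<open>g\<close> is supported in \<open>[-r, r]\<close>. The error \<open>e\<close> is small in \<open>L\<^sup>2\<close> uniformly
  on the unit ball of \<open>\<Y>\<^sup>\<sigma>\<close>. Since \<open>q\<close> is orthogonal to the invariant functions and \<open>e\<close> is arbitrarily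
  small, \<open>p\<close> is the projection of \<open>f\<close> to the kernel.
\<close>

section \<open>The spaces \<open>L\<^sup>2(M)\<close>\<close>

text \<open>\<open>exp_i\<close>, \<open>L2_integral\<close>, \<open>orth_projection\<close> and
  \<open>fibre_op\<close> are Hilbert choices, so exhibiting a flow is not enough: uniqueness up to
  null sets must be shown for the generated group, the Riemann integral, the distributional
  derivative and the projection. Measurability is the other obstacle: composing Lebesgue measurable
  functions with the flow is delicate, so the analysis uses Borel representatives, and completions
  appear only in the translation to the statement. The generator is handled in integrated form
  (\<open>flow_gen\<close>), which can be compared fibre by fibre with f = c + (i / \<psi>) times
  the primitive of w h. The remainder has two sources: the tail outside [-R, R], of relative squared
  size (1 + R^2)^(-\<sigma>), and the total A, with |A|^2 at most 2 R |f|^2, spread over length 2 r,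
  of squared size |A|^2 / (2 r), at most (R / r) |f|^2. Hence r has to be much larger than R.
  Estimates in L^2 suffice because the unit ball of Y lies in that of L^2, which bounds the dual
  norm by the L^2 norm.\<close>

lemma cnj_borel_measurable [measurable]: "cnj \<in> borel_measurable borel"
  by (intro borel_measurable_continuous_onI continuous_intros)

text \<open>A non-integrable function has Bochner integral 0 by convention, so the bound can be used
  before integrability is known.\<close>

lemma norm_integral_le_nn_integral:
  fixes f :: "'a \<Rightarrow> 'b::{banach, second_countable_topology}"
  shows "ennreal (norm (integral\<^sup>L M f)) \<le> (\<integral>\<^sup>+x. ennreal (norm (f x)) \<partial>M)"
  by (cases "integrable M f") (auto simp: integral_norm_bound_ennreal not_integrable_integral_eq)

lemma L2_iff_nn_integral:
  "f \<in> L2 M \<longleftrightarrow> f \<in> borel_measurable M \<and> (\<integral>\<^sup>+x. ennreal ((cmod (f x))\<^sup>2) \<partial>M) < \<infinity>"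
  unfolding L2_def by (auto simp: integrable_iff_bounded)

lemma L2_measurable: "f \<in> L2 M \<Longrightarrow> f \<in> borel_measurable M"
  by (simp add: L2_def)

lemma L2_integrable: "f \<in> L2 M \<Longrightarrow> integrable M (\<lambda>x. (cmod (f x))\<^sup>2)"
  by (simp add: L2_def)

lemma L2_norm_nonneg [simp]: "L2_norm M f \<ge> 0"
  by (simp add: L2_norm_def)

lemma L2_norm_power2: "(L2_norm M f)\<^sup>2 = (\<integral>x. (cmod (f x))\<^sup>2 \<partial>M)"
  by (simp add: L2_norm_def)

lemma nn_integral_L2_norm:
  "f \<in> L2 M \<Longrightarrow> (\<integral>\<^sup>+x. ennreal ((cmod (f x))\<^sup>2) \<partial>M) = ennreal ((L2_norm M f)\<^sup>2)"
  unfolding L2_norm_power2 by (intro nn_integral_eq_integral L2_integrable) auto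

text \<open>Membership and norm bound come from one inequality in \<open>ennreal\<close>, where no
  integrability has to be known beforehand; most L^2 estimates below end with this rule.\<close>

lemma L2I_nn_integral_le:
  assumes "f \<in> borel_measurable M" "(\<integral>\<^sup>+x. ennreal ((cmod (f x))\<^sup>2) \<partial>M) \<le> ennreal (B\<^sup>2)" "B \<ge> 0"
  shows "f \<in> L2 M" "L2_norm M f \<le> B"
proof -
  show f: "f \<in> L2 M"
    unfolding L2_iff_nn_integral using assms by (auto intro: le_less_trans)
  show "L2_norm M f \<le> B"
    using assms(2,3) unfolding nn_integral_L2_norm[OF f] by (simp add: power2_le_iff_abs_le)
qed

lemma L2_norm_cong_AE:
  assumes "f \<in> borel_measurable M" "g \<in> borel_measurable M" "AE x in M. f x = g x"
  shows "L2_norm M f = L2_norm M g"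
  unfolding L2_norm_def using assms by (intro arg_cong[where f=sqrt] integral_cong_AE) auto

lemma L2_cong_AE:
  assumes "f \<in> L2 M" "g \<in> borel_measurable M" "AE x in M. f x = g x"
  shows "g \<in> L2 M"
proof -
  have "(\<integral>\<^sup>+x. ennreal ((cmod (f x))\<^sup>2) \<partial>M) = (\<integral>\<^sup>+x. ennreal ((cmod (g x))\<^sup>2) \<partial>M)"
    using assms(3) by (intro nn_integral_cong_AE) auto
  then show ?thesis using assms by (auto simp: L2_iff_nn_integral)
qed

lemma L2_zero [simp]: "(\<lambda>x. 0) \<in> L2 M" "L2_norm M (\<lambda>x. 0) = 0"
  by (auto simp: L2_def L2_norm_def)

lemma L2_norm_eq_zero_iff:
  assumes "f \<in> L2 M" shows "L2_norm M f = 0 \<longleftrightarrow> (AE x in M. f x = 0)"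
proof -
  have "L2_norm M f = 0 \<longleftrightarrow> (\<integral>x. (cmod (f x))\<^sup>2 \<partial>M) = 0" by (simp add: L2_norm_def)
  also have "\<dots> \<longleftrightarrow> (AE x in M. (cmod (f x))\<^sup>2 = 0)"
    using assms by (intro integral_nonneg_eq_0_iff_AE L2_integrable) auto
  finally show ?thesis by simp
qed

lemma L2_cmult:
  assumes "f \<in> L2 M" shows "(\<lambda>x. c * f x) \<in> L2 M" "L2_norm M (\<lambda>x. c * f x) = cmod c * L2_norm M f"
  using assms by (auto simp: L2_def L2_norm_def norm_mult power_mult_distrib real_sqrt_mult)

lemma nn_integral_mult_le_L2_norm:
  assumes f: "f \<in> L2 M" and g: "g \<in> L2 M"
  shows "(\<integral>\<^sup>+x. ennreal (cmod (f x) * cmod (g x)) \<partial>M) \<le> ennreal (L2_norm M f * L2_norm M g)"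
proof -
  note [measurable] = L2_measurable[OF f] L2_measurable[OF g]
  have "(\<integral>\<^sup>+x. ennreal (cmod (f x)) * ennreal (cmod (g x)) \<partial>M)\<^sup>2 \<le>
      (\<integral>\<^sup>+x. ennreal (cmod (f x)) ^ 2 \<partial>M) * (\<integral>\<^sup>+x. ennreal (cmod (g x)) ^ 2 \<partial>M)"
    by (rule Cauchy_Schwarz_nn_integral) auto
  also have "\<dots> = (ennreal (L2_norm M f * L2_norm M g))\<^sup>2"
    by (simp add: ennreal_power nn_integral_L2_norm f g power_mult_distrib ennreal_mult)
  finally have *: "(\<integral>\<^sup>+x. ennreal (cmod (f x) * cmod (g x)) \<partial>M)\<^sup>2 \<le> (ennreal (L2_norm M f * L2_norm M g))\<^sup>2"
    by (simp add: ennreal_mult)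
  show ?thesis
  proof (cases "\<integral>\<^sup>+x. ennreal (cmod (f x) * cmod (g x)) \<partial>M")
    case (real r)
    with * have "r\<^sup>2 \<le> (L2_norm M f * L2_norm M g)\<^sup>2"
      by (simp add: ennreal_power)
    then have "r \<le> L2_norm M f * L2_norm M g" by (rule power2_le_imp_le) simp
    with real show ?thesis by (simp add: ennreal_leI)
  next
    case top
    with * show ?thesis by (simp add: ennreal_power top_unique)
  qed
qed

lemma L2_mult_integrable:
  assumes f: "f \<in> L2 M" and g: "g \<in> L2 M"
  shows "integrable M (\<lambda>x. cmod (f x) * cmod (g x))" "integrable M (\<lambda>x. f x * g x)"
    "integrable M (\<lambda>x. f x * cnj (g x))"
proof -
  note [measurable] = L2_measurable[OF f] L2_measurable[OF g]
  have "(\<integral>\<^sup>+x. ennreal (cmod (f x) * cmod (g x)) \<partial>M) < \<infinity>"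
    using nn_integral_mult_le_L2_norm[OF f g] by (auto intro: le_less_trans)
  then show "integrable M (\<lambda>x. cmod (f x) * cmod (g x))" "integrable M (\<lambda>x. f x * g x)"
    "integrable M (\<lambda>x. f x * cnj (g x))"
    by (auto simp: integrable_iff_bounded norm_mult)
qed

lemma integral_mult_le_L2_norm:
  assumes f: "f \<in> L2 M" and g: "g \<in> L2 M"
  shows "(\<integral>x. cmod (f x) * cmod (g x) \<partial>M) \<le> L2_norm M f * L2_norm M g"
proof -
  have "ennreal (\<integral>x. cmod (f x) * cmod (g x) \<partial>M) = (\<integral>\<^sup>+x. ennreal (cmod (f x) * cmod (g x)) \<partial>M)"
    by (intro nn_integral_eq_integral[symmetric] L2_mult_integrable f g) auto
  also have "\<dots> \<le> ennreal (L2_norm M f * L2_norm M g)" by (rule nn_integral_mult_le_L2_norm[OF f g])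
  finally show ?thesis by simp
qed

lemma L2_Cauchy_Schwarz:
  assumes f: "f \<in> L2 M" and g: "g \<in> L2 M"
  shows "cmod (L2_inner M f g) \<le> L2_norm M f * L2_norm M g"
proof -
  have "cmod (L2_inner M f g) \<le> (\<integral>x. cmod (f x * cnj (g x)) \<partial>M)"
    unfolding L2_inner_def by (rule integral_norm_bound)
  also have "\<dots> \<le> L2_norm M f * L2_norm M g"
    using integral_mult_le_L2_norm[OF f g] by (simp add: norm_mult)
  finally show ?thesis .
qed

lemma L2_add:
  assumes f: "f \<in> L2 M" and g: "g \<in> L2 M"
  shows "(\<lambda>x. f x + g x) \<in> L2 M" "L2_norm M (\<lambda>x. f x + g x) \<le> L2_norm M f + L2_norm M g"
proof -
  note [measurable] = L2_measurable[OF f] L2_measurable[OF g]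
  have "(\<integral>\<^sup>+x. ennreal ((cmod (f x + g x))\<^sup>2) \<partial>M) \<le>
      (\<integral>\<^sup>+x. ennreal ((cmod (f x))\<^sup>2 + 2 * (cmod (f x) * cmod (g x)) + (cmod (g x))\<^sup>2) \<partial>M)"
  proof (intro nn_integral_mono ennreal_leI)
    fix x
    have "(cmod (f x + g x))\<^sup>2 \<le> (cmod (f x) + cmod (g x))\<^sup>2"
      by (intro power_mono norm_triangle_ineq) auto
    then show "(cmod (f x + g x))\<^sup>2 \<le> (cmod (f x))\<^sup>2 + 2 * (cmod (f x) * cmod (g x)) + (cmod (g x))\<^sup>2"
      by (simp add: power2_sum)
  qed
  also have "\<dots> = ennreal (\<integral>x. (cmod (f x))\<^sup>2 + 2 * (cmod (f x) * cmod (g x)) + (cmod (g x))\<^sup>2 \<partial>M)"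
    using L2_integrable[OF f] L2_integrable[OF g] L2_mult_integrable[OF f g]
    by (intro nn_integral_eq_integral) auto
  also have "(\<integral>x. (cmod (f x))\<^sup>2 + 2 * (cmod (f x) * cmod (g x)) + (cmod (g x))\<^sup>2 \<partial>M) =
     (L2_norm M f)\<^sup>2 + 2 * (\<integral>x. cmod (f x) * cmod (g x) \<partial>M) + (L2_norm M g)\<^sup>2"
    using L2_integrable[OF f] L2_integrable[OF g] L2_mult_integrable[OF f g]
    by (simp add: L2_norm_power2)
  also have "ennreal \<dots> \<le> ennreal ((L2_norm M f + L2_norm M g)\<^sup>2)"
    using integral_mult_le_L2_norm[OF f g] by (intro ennreal_leI) (simp add: power2_sum)
  finally have *: "(\<integral>\<^sup>+x. ennreal ((cmod (f x + g x))\<^sup>2) \<partial>M) \<le> ennreal ((L2_norm M f + L2_norm M g)\<^sup>2)" .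
  show "(\<lambda>x. f x + g x) \<in> L2 M" "L2_norm M (\<lambda>x. f x + g x) \<le> L2_norm M f + L2_norm M g"
    by (rule L2I_nn_integral_le[OF _ *]; simp)+
qed

lemma L2_diff:
  assumes f: "f \<in> L2 M" and g: "g \<in> L2 M"
  shows "(\<lambda>x. f x - g x) \<in> L2 M" "L2_norm M (\<lambda>x. f x - g x) \<le> L2_norm M f + L2_norm M g"
  using L2_add[OF f L2_cmult(1)[OF g, of "-1"]] L2_cmult(2)[OF g, of "-1"] by auto

lemma L2_norm_diff_commute: "L2_norm M (\<lambda>x. f x - g x) = L2_norm M (\<lambda>x. g x - f x)"
  unfolding L2_norm_def by (simp add: norm_minus_commute)

lemma L2_norm_diff_triangle:
  assumes "f \<in> L2 M" "g \<in> L2 M" "h \<in> L2 M"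
  shows "L2_norm M (\<lambda>x. f x - h x) \<le> L2_norm M (\<lambda>x. f x - g x) + L2_norm M (\<lambda>x. g x - h x)"
  using L2_add(2)[OF L2_diff(1)[OF assms(1,2)] L2_diff(1)[OF assms(2,3)]] by simp

lemma L2_norm_triangle_rev:
  assumes f: "f \<in> L2 M" and g: "g \<in> L2 M"
  shows "\<bar>L2_norm M f - L2_norm M g\<bar> \<le> L2_norm M (\<lambda>x. f x - g x)"
proof -
  have "L2_norm M f \<le> L2_norm M (\<lambda>x. f x - g x) + L2_norm M g"
    using L2_add(2)[OF L2_diff(1)[OF f g] g] by simp
  moreover have "L2_norm M g \<le> L2_norm M (\<lambda>x. g x - f x) + L2_norm M f"
    using L2_add(2)[OF L2_diff(1)[OF g f] f] by simp
  ultimately show ?thesis by (simp add: L2_norm_diff_commute[of _ g f])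
qed

lemma L2_sum:
  assumes "finite A" "\<And>i. i \<in> A \<Longrightarrow> f i \<in> L2 M"
  shows "(\<lambda>x. \<Sum>i\<in>A. f i x) \<in> L2 M" "L2_norm M (\<lambda>x. \<Sum>i\<in>A. f i x) \<le> (\<Sum>i\<in>A. L2_norm M (f i))"
proof -
  have "(\<lambda>x. \<Sum>i\<in>A. f i x) \<in> L2 M \<and> L2_norm M (\<lambda>x. \<Sum>i\<in>A. f i x) \<le> (\<Sum>i\<in>A. L2_norm M (f i))"
    using assms
  proof (induction A rule: finite_induct)
    case (insert i A)
    have "(\<lambda>x. f i x + (\<Sum>i\<in>A. f i x)) \<in> L2 M"
      "L2_norm M (\<lambda>x. f i x + (\<Sum>i\<in>A. f i x)) \<le> L2_norm M (f i) + L2_norm M (\<lambda>x. \<Sum>i\<in>A. f i x)"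
      using insert by (auto intro!: L2_add)
    with insert show ?case by (auto intro: order_trans)
  qed simp
  then show "(\<lambda>x. \<Sum>i\<in>A. f i x) \<in> L2 M" "L2_norm M (\<lambda>x. \<Sum>i\<in>A. f i x) \<le> (\<Sum>i\<in>A. L2_norm M (f i))"
    by auto
qed

lemma L2_inner_diff_left:
  assumes "f \<in> L2 M" "g \<in> L2 M" "h \<in> L2 M"
  shows "L2_inner M (\<lambda>x. f x - g x) h = L2_inner M f h - L2_inner M g h"
  unfolding L2_inner_def using assms by (simp add: L2_mult_integrable left_diff_distrib)

lemma L2_inner_linear_left:
  assumes "f \<in> L2 M" "g \<in> L2 M" "h \<in> L2 M"
  shows "L2_inner M (\<lambda>x. a * f x + b * g x) h = a * L2_inner M f h + b * L2_inner M g h"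
  unfolding L2_inner_def using assms by (simp add: L2_mult_integrable distrib_right mult.assoc)

lemma L2_inner_linear_right:
  assumes "f \<in> L2 M" "g \<in> L2 M" "h \<in> L2 M"
  shows "L2_inner M h (\<lambda>x. a * f x + b * g x) = cnj a * L2_inner M h f + cnj b * L2_inner M h g"
proof -
  have "(\<lambda>x. h x * cnj (a * f x + b * g x)) = (\<lambda>x. cnj a * (h x * cnj (f x)) + cnj b * (h x * cnj (g x)))"
    by (auto simp: algebra_simps)
  then show ?thesis
    unfolding L2_inner_def using assms by (simp add: L2_mult_integrable)
qed

lemma L2_inner_self: "L2_inner M f f = complex_of_real ((L2_norm M f)\<^sup>2)"
  unfolding L2_inner_def L2_norm_power2
  by (simp add: complex_norm_square[symmetric] flip: integral_complex_of_real)

lemma L2_inner_cong_AE: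
  assumes "f \<in> borel_measurable M" "f' \<in> borel_measurable M" "g \<in> borel_measurable M"
    "AE x in M. f x = f' x"
  shows "L2_inner M f g = L2_inner M f' g"
  unfolding L2_inner_def using assms by (intro integral_cong_AE) auto

lemma completion_ex_borel_measurable_complex:
  fixes f :: "'a \<Rightarrow> complex"
  assumes [measurable]: "f \<in> borel_measurable (completion M)"
  shows "\<exists>g\<in>borel_measurable M. AE x in M. f x = g x"
proof -
  obtain g1 where g1: "g1 \<in> borel_measurable M" "AE x in M. Re (f x) = g1 x"
    using completion_ex_borel_measurable_real[of "\<lambda>x. Re (f x)" M] by auto
  obtain g2 where g2: "g2 \<in> borel_measurable M" "AE x in M. Im (f x) = g2 x"
    using completion_ex_borel_measurable_real[of "\<lambda>x. Im (f x)" M] by auto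
  show ?thesis
  proof (rule bexI[where x="\<lambda>x. complex_of_real (g1 x) + \<i> * complex_of_real (g2 x)"])
    show "AE x in M. f x = complex_of_real (g1 x) + \<i> * complex_of_real (g2 x)"
      using g1(2) g2(2) by eventually_elim (simp add: complex_eq_iff)
  qed (use g1(1) g2(1) in measurable)
qed

section \<open>Oriented integrals\<close>

text \<open>With half-open intervals the kernel is additive in its endpoints at every point.\<close>

definition orient :: "real \<Rightarrow> real \<Rightarrow> real \<Rightarrow> real" where
  "orient a b t = indicator {a..<b} t - indicator {b..<a} t"

text \<open>An integral over the whole line against a kernel: measurability in the endpoints and in
  further parameters then follows from the measurability of parameter integrals.\<close>

definition oint :: "real \<Rightarrow> real \<Rightarrow> (real \<Rightarrow> complex) \<Rightarrow> complex" where
  "oint a b F = (\<integral>t. orient a b t *\<^sub>R F t \<partial>lborel)"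

definition locint :: "(real \<Rightarrow> complex) \<Rightarrow> bool" where
  "locint F \<longleftrightarrow> F \<in> borel_measurable borel \<and> (\<forall>R. (\<integral>\<^sup>+t. indicator {-R..R} t * ennreal (cmod (F t)) \<partial>lborel) < \<infinity>)"

lemma orient_measurable [measurable]:
  assumes [measurable]: "f \<in> borel_measurable M" "g \<in> borel_measurable M" "h \<in> borel_measurable M"
  shows "(\<lambda>x. orient (f x) (g x) (h x)) \<in> borel_measurable M"
  unfolding orient_def indicator_def atLeastLessThan_iff by measurable

lemma orient_add: "orient a c t = orient a b t + orient b c t"
  by (auto simp: orient_def indicator_def)

lemma orient_shift: "orient (a + c) (b + c) (t + c) = orient a b t"
  by (auto simp: orient_def indicator_def)

lemma orient_swap: "orient b a t = - orient a b t"
  by (auto simp: orient_def)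

lemma locint_measurable: "locint F \<Longrightarrow> F \<in> borel_measurable borel" by (simp add: locint_def)

lemma locint_integrable:
  assumes "locint F" "k \<in> borel_measurable borel" "\<And>t. \<bar>k t\<bar> \<le> C" "\<And>t. \<bar>t\<bar> > R \<Longrightarrow> k t = 0"
  shows "integrable lborel (\<lambda>t. k t *\<^sub>R F t)"
proof -
  note [measurable] = assms(2) locint_measurable[OF assms(1)]
  have C: "C \<ge> 0" using assms(3)[of 0] by linarith
  have "(\<integral>\<^sup>+t. ennreal (norm (k t *\<^sub>R F t)) \<partial>lborel) \<le> (\<integral>\<^sup>+t. ennreal C * (indicator {-R..R} t * ennreal (cmod (F t))) \<partial>lborel)"
  proof (intro nn_integral_mono)
    fix t
    show "ennreal (norm (k t *\<^sub>R F t)) \<le> ennreal C * (indicator {-R..R} t * ennreal (cmod (F t)))"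
    proof (cases "\<bar>t\<bar> > R")
      case False
      then have "t \<in> {-R..R}" by auto
      then show ?thesis using C assms(3)[of t] by (simp add: ennreal_mult[symmetric] mult_right_mono)
    qed (simp add: assms(4))
  qed
  also have "\<dots> = ennreal C * (\<integral>\<^sup>+t. indicator {-R..R} t * ennreal (cmod (F t)) \<partial>lborel)"
    by (intro nn_integral_cmult) measurable
  also have "\<dots> < \<infinity>"
    using assms(1) by (auto simp: locint_def ennreal_mult_less_top)
  finally show ?thesis by (auto simp: integrable_iff_bounded)
qed

lemma locint_orient_integrable: "locint F \<Longrightarrow> integrable lborel (\<lambda>t. orient a b t *\<^sub>R F t)"
  by (rule locint_integrable[where C=1 and R="max \<bar>a\<bar> \<bar>b\<bar>"]) (auto simp: orient_def indicator_def)

lemma oint_trivial [simp]: "oint a a F = 0"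
  by (simp add: oint_def orient_def)

lemma oint_zero [simp]: "oint a b (\<lambda>_. 0) = 0"
  by (simp add: oint_def)

lemma oint_add_endpoints: "locint F \<Longrightarrow> oint a c F = oint a b F + oint b c F"
  unfolding oint_def by (subst orient_add[of a c _ b])
    (simp add: scaleR_left.add locint_orient_integrable)

lemma oint_swap: "oint b a F = - oint a b F"
  unfolding oint_def by (simp add: orient_swap[of b a])

lemma oint_shift: "oint a b (\<lambda>t. F (t + c)) = oint (a + c) (b + c) F"
proof -
  have "oint (a + c) (b + c) F = (\<integral>t. orient (a + c) (b + c) (c + 1 * t) *\<^sub>R F (c + 1 * t) \<partial>lborel)"
    unfolding oint_def by (subst lborel_integral_real_affine[where c=1 and t=c]) auto
  also have "\<dots> = oint a b (\<lambda>t. F (t + c))"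
    unfolding oint_def by (simp add: orient_shift add.commute[of c])
  finally show ?thesis by simp
qed

lemma oint_scale:
  assumes "c > 0" shows "c * oint a b (\<lambda>t. F (c * t)) = oint (c * a) (c * b) F"
proof -
  have eq: "orient (c * a) (c * b) (c * t) = orient a b t" for t
    using assms by (auto simp: orient_def indicator_def)
  have "oint (c * a) (c * b) F = \<bar>c\<bar> *\<^sub>R (\<integral>t. orient (c * a) (c * b) (0 + c * t) *\<^sub>R F (0 + c * t) \<partial>lborel)"
    unfolding oint_def using assms by (intro lborel_integral_real_affine) auto
  also have "\<dots> = c * oint a b (\<lambda>t. F (c * t))"
    unfolding oint_def using assms by (simp add: eq scaleR_conv_of_real)
  finally show ?thesis by simp
qed

lemma oint_cmult: "oint a b (\<lambda>t. c * F t) = c * oint a b F"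
  unfolding oint_def by (simp flip: integral_mult_right_zero)

lemma oint_add: "locint F \<Longrightarrow> locint G \<Longrightarrow> oint a b (\<lambda>t. F t + G t) = oint a b F + oint a b G"
  unfolding oint_def by (simp add: scaleR_right_distrib locint_orient_integrable)

lemma oint_diff: "locint F \<Longrightarrow> locint G \<Longrightarrow> oint a b (\<lambda>t. F t - G t) = oint a b F - oint a b G"
  unfolding oint_def by (simp add: scaleR_right_diff_distrib locint_orient_integrable)

lemma locint_const [simp]: "locint (\<lambda>_. c)"
proof -
  have "(\<integral>\<^sup>+t. indicator {-R..R} t * ennreal (cmod c) \<partial>lborel) < \<infinity>" for R :: real
  proof -
    have "(\<integral>\<^sup>+t. indicator {-R..R} t * ennreal (cmod c) \<partial>lborel) = (\<integral>\<^sup>+t. ennreal (cmod c) * indicator {-R..R} t \<partial>lborel)"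
      by (simp add: mult.commute)
    also have "\<dots> = ennreal (cmod c) * emeasure lborel {-R..R}" by (rule nn_integral_cmult_indicator) auto
    also have "\<dots> < \<infinity>" by (auto simp: ennreal_mult_less_top emeasure_lborel_Icc_eq)
    finally show ?thesis .
  qed
  then show ?thesis by (auto simp: locint_def)
qed

lemma emeasure_lborel_Ico_if: "emeasure lborel {a..<b::real} = ennreal (if a \<le> b then b - a else 0)"
  by (cases "a \<le> b") auto

lemma oint_const: "oint a b (\<lambda>_. c) = (b - a) *\<^sub>R c"
proof -
  have "oint a b (\<lambda>_. c) = (\<integral>t. orient a b t \<partial>lborel) *\<^sub>R c"
  proof -
    have "integrable lborel (orient a b)"
      unfolding orient_def by (intro Bochner_Integration.integrable_diff integrable_real_indicator) (auto simp: emeasure_lborel_Ico_if)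
    then show ?thesis unfolding oint_def by simp
  qed
  also have "(\<integral>t. orient a b t \<partial>lborel) = b - a"
    unfolding orient_def
    by (subst Bochner_Integration.integral_diff) (auto intro!: integrable_real_indicator simp: measure_def emeasure_lborel_Ico_if)
  finally show ?thesis .
qed

lemma oint_measurable [measurable]:
  assumes [measurable]: "case_prod F \<in> borel_measurable (M \<Otimes>\<^sub>M lborel)" "a \<in> borel_measurable M" "b \<in> borel_measurable M"
  shows "(\<lambda>x. oint (a x) (b x) (F x)) \<in> borel_measurable M"
  unfolding oint_def by measurable

lemma locint_cmult: "locint F \<Longrightarrow> locint (\<lambda>t. c * F t)"
proof -
  assume F: "locint F"
  note [measurable] = locint_measurable[OF F]
  have "(\<integral>\<^sup>+t. indicator {-R..R} t * ennreal (cmod (c * F t)) \<partial>lborel) < \<infinity>" for R :: real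
  proof -
    have "(\<integral>\<^sup>+t. indicator {-R..R} t * ennreal (cmod (c * F t)) \<partial>lborel) =
        (\<integral>\<^sup>+t. ennreal (cmod c) * (indicator {-R..R} t * ennreal (cmod (F t))) \<partial>lborel)"
      by (intro nn_integral_cong) (simp add: norm_mult ennreal_mult mult_ac)
    also have "\<dots> = ennreal (cmod c) * (\<integral>\<^sup>+t. indicator {-R..R} t * ennreal (cmod (F t)) \<partial>lborel)"
      by (intro nn_integral_cmult) measurable
    also have "\<dots> < \<infinity>" using F by (auto simp: locint_def ennreal_mult_less_top)
    finally show ?thesis .
  qed
  then show ?thesis by (auto simp: locint_def)
qed

lemma locint_add:
  assumes F: "locint F" and G: "locint G" shows "locint (\<lambda>t. F t + G t)"
proof -
  note [measurable] = locint_measurable[OF F] locint_measurable[OF G]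
  have "(\<integral>\<^sup>+t. indicator {-R..R} t * ennreal (cmod (F t + G t)) \<partial>lborel) < \<infinity>" for R :: real
  proof -
    have "(\<integral>\<^sup>+t. indicator {-R..R} t * ennreal (cmod (F t + G t)) \<partial>lborel) \<le>
        (\<integral>\<^sup>+t. indicator {-R..R} t * ennreal (cmod (F t)) + indicator {-R..R} t * ennreal (cmod (G t)) \<partial>lborel)"
      by (intro nn_integral_mono) (auto simp: indicator_def norm_triangle_ineq simp flip: ennreal_plus)
    also have "\<dots> = (\<integral>\<^sup>+t. indicator {-R..R} t * ennreal (cmod (F t)) \<partial>lborel) + (\<integral>\<^sup>+t. indicator {-R..R} t * ennreal (cmod (G t)) \<partial>lborel)"
      by (intro nn_integral_add) measurable
    also have "\<dots> < \<infinity>" using F G by (auto simp: locint_def)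
    finally show ?thesis .
  qed
  then show ?thesis by (auto simp: locint_def)
qed

lemma locint_diff: "locint F \<Longrightarrow> locint G \<Longrightarrow> locint (\<lambda>t. F t - G t)"
  using locint_add[OF _ locint_cmult[of G "-1"], of F] by simp

text \<open>Minkowski's inequality for L^2-valued integrals with a constant bound. Cauchy-Schwarz in
  t bounds the square of the inner integral by |b - a| times the integral of |F|^2, and Tonelli
  exchanges the two integrations.\<close>

lemma L2_oint:
  fixes F :: "real \<Rightarrow> 'a \<Rightarrow> complex"
  assumes "sigma_finite_measure M"
    and F [measurable]: "case_prod F \<in> borel_measurable (lborel \<Otimes>\<^sub>M M)"
    and L2: "\<And>t. t \<in> {min a b..max a b} \<Longrightarrow> F t \<in> L2 M"
    and B: "\<And>t. t \<in> {min a b..max a b} \<Longrightarrow> L2_norm M (F t) \<le> B"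
  shows "(\<lambda>x. oint a b (\<lambda>t. F t x)) \<in> L2 M" "L2_norm M (\<lambda>x. oint a b (\<lambda>t. F t x)) \<le> \<bar>b - a\<bar> * B"
proof -
  interpret sigma_finite_measure M by fact
  interpret P: pair_sigma_finite lborel M ..
  have B0: "B \<ge> 0" using B[of a] L2_norm_nonneg[of M "F a"] by (simp del: L2_norm_nonneg)
  define I where "I = {min a b..max a b}"
  have [measurable]: "(\<lambda>x. oint a b (\<lambda>t. F t x)) \<in> borel_measurable M" by measurable
  have "(\<integral>\<^sup>+x. ennreal ((cmod (oint a b (\<lambda>t. F t x)))\<^sup>2) \<partial>M) \<le>
    (\<integral>\<^sup>+x. ennreal \<bar>b - a\<bar> * (\<integral>\<^sup>+t. indicator I t * ennreal ((cmod (F t x))\<^sup>2) \<partial>lborel) \<partial>M)"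
  proof (intro nn_integral_mono)
    fix x assume [measurable]: "x \<in> space M"
    have "ennreal (cmod (oint a b (\<lambda>t. F t x))) \<le> (\<integral>\<^sup>+t. ennreal (cmod (orient a b t *\<^sub>R F t x)) \<partial>lborel)"
      unfolding oint_def by (rule norm_integral_le_nn_integral)
    \<comment> \<open>The indicator is doubled so that Cauchy-Schwarz puts one copy into each
      factor; the first factor becomes the length of I.\<close>
    also have "\<dots> \<le> (\<integral>\<^sup>+t. indicator I t * (indicator I t * ennreal (cmod (F t x))) \<partial>lborel)"
      unfolding I_def
      by (intro nn_integral_mono) (auto simp: orient_def indicator_def)
    finally have "ennreal (cmod (oint a b (\<lambda>t. F t x))) ^ 2 \<le> (\<integral>\<^sup>+t. indicator I t * (indicator I t * ennreal (cmod (F t x))) \<partial>lborel) ^ 2"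
      by (intro power_mono_ennreal)
    also have "\<dots> \<le> (\<integral>\<^sup>+t. (indicator I t) ^ 2 \<partial>lborel) * (\<integral>\<^sup>+t. (indicator I t * ennreal (cmod (F t x))) ^ 2 \<partial>lborel)"
      unfolding I_def by (rule Cauchy_Schwarz_nn_integral) measurable
    also have "(\<integral>\<^sup>+t. (indicator I t) ^ 2 \<partial>lborel) = (\<integral>\<^sup>+t. indicator I t \<partial>lborel)"
      by (intro nn_integral_cong) (auto simp: indicator_def)
    also have "\<dots> = ennreal \<bar>b - a\<bar>"
      unfolding I_def by (simp add: emeasure_lborel_Icc_eq min_def max_def)
    also have "(\<integral>\<^sup>+t. (indicator I t * ennreal (cmod (F t x))) ^ 2 \<partial>lborel) = (\<integral>\<^sup>+t. indicator I t * ennreal ((cmod (F t x))\<^sup>2) \<partial>lborel)"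
      by (intro nn_integral_cong) (auto simp: indicator_def ennreal_power)
    finally show "ennreal ((cmod (oint a b (\<lambda>t. F t x)))\<^sup>2) \<le> ennreal \<bar>b - a\<bar> * (\<integral>\<^sup>+t. indicator I t * ennreal ((cmod (F t x))\<^sup>2) \<partial>lborel)"
      by (simp add: ennreal_power)
  qed
  also have "\<dots> = ennreal \<bar>b - a\<bar> * (\<integral>\<^sup>+x. (\<integral>\<^sup>+t. indicator I t * ennreal ((cmod (F t x))\<^sup>2) \<partial>lborel) \<partial>M)"
    unfolding I_def by (intro nn_integral_cmult) measurable
  also have "(\<integral>\<^sup>+x. (\<integral>\<^sup>+t. indicator I t * ennreal ((cmod (F t x))\<^sup>2) \<partial>lborel) \<partial>M) =
    (\<integral>\<^sup>+t. (\<integral>\<^sup>+x. indicator I t * ennreal ((cmod (F t x))\<^sup>2) \<partial>M) \<partial>lborel)"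
    unfolding I_def by (intro P.Fubini') measurable
  also have "\<dots> \<le> (\<integral>\<^sup>+t. ennreal (B\<^sup>2) * indicator I t \<partial>lborel)"
  proof (intro nn_integral_mono)
    fix t
    show "(\<integral>\<^sup>+x. indicator I t * ennreal ((cmod (F t x))\<^sup>2) \<partial>M) \<le> ennreal (B\<^sup>2) * indicator I t"
      using nn_integral_L2_norm[OF L2, of t] B[of t]
      by (cases "t \<in> I") (auto simp: I_def intro!: ennreal_leI power_mono)
  qed
  also have "\<dots> = ennreal (B\<^sup>2) * ennreal \<bar>b - a\<bar>"
    unfolding I_def by (subst nn_integral_cmult_indicator) (auto simp: emeasure_lborel_Icc_eq min_def max_def)
  finally have "(\<integral>\<^sup>+x. ennreal ((cmod (oint a b (\<lambda>t. F t x)))\<^sup>2) \<partial>M) \<le>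
      ennreal \<bar>b - a\<bar> * (ennreal (B\<^sup>2) * ennreal \<bar>b - a\<bar>)"
    by (meson mult_left_mono zero_le)
  also have "\<dots> = ennreal ((\<bar>b - a\<bar> * B)\<^sup>2)"
    by (simp add: B0 power_mult_distrib power2_eq_square mult_ac flip: ennreal_mult del: abs_mult_self_eq)
  finally have *: "(\<integral>\<^sup>+x. ennreal ((cmod (oint a b (\<lambda>t. F t x)))\<^sup>2) \<partial>M) \<le> ennreal ((\<bar>b - a\<bar> * B)\<^sup>2)" .
  show "(\<lambda>x. oint a b (\<lambda>t. F t x)) \<in> L2 M" "L2_norm M (\<lambda>x. oint a b (\<lambda>t. F t x)) \<le> \<bar>b - a\<bar> * B"
    by (rule L2I_nn_integral_le[OF _ *]; simp add: B0)+
qed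

text \<open>By Tonelli the x-integral of the inner integrals is at most 2 n B^2, so each inner
  integral is finite for almost every x; countably many n share one null set.\<close>

lemma AE_locally_square_integrable:
  fixes F :: "real \<Rightarrow> 'a \<Rightarrow> complex"
  assumes "sigma_finite_measure M"
    and F [measurable]: "case_prod F \<in> borel_measurable (borel \<Otimes>\<^sub>M M)"
    and L2: "\<And>t. F t \<in> L2 M"
    and B: "\<And>t. L2_norm M (F t) \<le> B"
  shows "AE x in M. \<forall>n. (\<integral>\<^sup>+t. indicator {-real n..real n} t * ennreal ((cmod (F t x))\<^sup>2) \<partial>lborel) \<noteq> \<infinity>"
proof -
  interpret sigma_finite_measure M by fact
  interpret P: pair_sigma_finite lborel M ..
  have *: "AE x in M. (\<integral>\<^sup>+t. indicator {-real n..real n} t * ennreal ((cmod (F t x))\<^sup>2) \<partial>lborel) \<noteq> \<infinity>" for n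
  proof (rule nn_integral_PInf_AE)
    have "(\<integral>\<^sup>+x. (\<integral>\<^sup>+t. indicator {-real n..real n} t * ennreal ((cmod (F t x))\<^sup>2) \<partial>lborel) \<partial>M) =
      (\<integral>\<^sup>+t. (\<integral>\<^sup>+x. indicator {-real n..real n} t * ennreal ((cmod (F t x))\<^sup>2) \<partial>M) \<partial>lborel)"
      by (intro P.Fubini') measurable
    also have "\<dots> \<le> (\<integral>\<^sup>+t. ennreal (B\<^sup>2) * indicator {-real n..real n} t \<partial>lborel)"
    proof (intro nn_integral_mono)
      fix t
      show "(\<integral>\<^sup>+x. indicator {-real n..real n} t * ennreal ((cmod (F t x))\<^sup>2) \<partial>M) \<le> ennreal (B\<^sup>2) * indicator {-real n..real n} t"
        using nn_integral_L2_norm[OF L2, of t] B[of t]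
        by (cases "t \<in> {-real n..real n}") (auto intro!: ennreal_leI power_mono)
    qed
    also have "\<dots> < \<infinity>"
      by (subst nn_integral_cmult_indicator) (auto simp: ennreal_mult_less_top)
    finally show "(\<integral>\<^sup>+x. (\<integral>\<^sup>+t. indicator {-real n..real n} t * ennreal ((cmod (F t x))\<^sup>2) \<partial>lborel) \<partial>M) \<noteq> \<infinity>" by auto
  qed measurable
  show ?thesis
    using * by (simp add: AE_all_countable)
qed

text \<open>On a bounded interval |F| \<le> 1 + |F|^2 reduces integrability to square
  integrability.\<close>

lemma locint_if_locally_square_integrable:
  assumes [measurable]: "F \<in> borel_measurable borel"
    and fin: "\<forall>n. (\<integral>\<^sup>+t. indicator {-real n..real n} t * ennreal ((cmod (F t))\<^sup>2) \<partial>lborel) \<noteq> \<infinity>"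
  shows "locint F"
proof -
  have "(\<integral>\<^sup>+t. indicator {-R..R} t * ennreal (cmod (F t)) \<partial>lborel) < \<infinity>" for R
  proof -
    obtain n where n: "R \<le> real n" using real_arch_simple by blast
    have "(\<integral>\<^sup>+t. indicator {-R..R} t * ennreal (cmod (F t)) \<partial>lborel) \<le>
      (\<integral>\<^sup>+t. indicator {-real n..real n} t + indicator {-real n..real n} t * ennreal ((cmod (F t))\<^sup>2) \<partial>lborel)"
    proof (intro nn_integral_mono)
      fix t
      have "cmod (F t) \<le> 1 + (cmod (F t))\<^sup>2"
        using sum_squares_bound[of 1 "cmod (F t)"] norm_ge_zero[of "F t"] by (simp add: power2_eq_square del: norm_ge_zero)
      then have "ennreal (cmod (F t)) \<le> 1 + ennreal ((cmod (F t))\<^sup>2)"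
        by (metis ennreal_1 ennreal_leI ennreal_plus zero_le_one zero_le_power2)
      then show "indicator {-R..R} t * ennreal (cmod (F t)) \<le> indicator {-real n..real n} t + indicator {-real n..real n} t * ennreal ((cmod (F t))\<^sup>2)"
        using n by (auto simp: indicator_def)
    qed
    also have "\<dots> = ennreal (2 * n) + (\<integral>\<^sup>+t. indicator {-real n..real n} t * ennreal ((cmod (F t))\<^sup>2) \<partial>lborel)"
      by (subst nn_integral_add) (auto simp: emeasure_lborel_Icc_eq)
    also have "\<dots> < \<infinity>" using fin by (auto simp: less_top)
    finally show ?thesis .
  qed
  then show "locint F" by (auto simp: locint_def)
qed

lemma AE_locint:
  fixes F :: "real \<Rightarrow> 'a \<Rightarrow> complex"
  assumes "sigma_finite_measure M"
    and F [measurable]: "case_prod F \<in> borel_measurable (borel \<Otimes>\<^sub>M M)"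
    and L2: "\<And>t. F t \<in> L2 M"
    and B: "\<And>t. L2_norm M (F t) \<le> B"
  shows "AE x in M. locint (\<lambda>t. F t x)"
  using AE_locally_square_integrable[OF assms] AE_space
  by eventually_elim (rule locint_if_locally_square_integrable, measurable)

section \<open>Measure-preserving flows\<close>

text \<open>The bound makes the derivative vanish everywhere. Applied to L^2 norms of differences of
  two evolutions, it gives uniqueness for first order equations without a calculus of L^2-valued
  functions.\<close>

lemma constant_if_small_increments:
  fixes \<phi> :: "real \<Rightarrow> real"
  assumes "\<And>t. \<exists>r. (r \<longlongrightarrow> 0) (at 0) \<and> (\<forall>d. d \<noteq> 0 \<longrightarrow> \<bar>\<phi> (t + d) - \<phi> t\<bar> \<le> \<bar>d\<bar> * r d)"
  shows "\<phi> t = \<phi> s"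
proof -
  have "(\<phi> has_real_derivative 0) (at t)" for t
  proof -
    obtain r where r: "(r \<longlongrightarrow> 0) (at 0)" "\<And>d. d \<noteq> 0 \<Longrightarrow> \<bar>\<phi> (t + d) - \<phi> t\<bar> \<le> \<bar>d\<bar> * r d"
      using assms by blast
    have "((\<lambda>d. (\<phi> (t + d) - \<phi> t) / d) \<longlongrightarrow> 0) (at 0)"
    proof (rule Lim_null_comparison[OF _ r(1)])
      show "\<forall>\<^sub>F d in at 0. norm ((\<phi> (t + d) - \<phi> t) / d) \<le> r d"
        using r(2) by (auto simp: eventually_at_filter divide_le_eq mult.commute)
    qed
    then show ?thesis by (simp add: DERIV_def)
  qed
  then show ?thesis using DERIV_isconst_all by blast
qed

text \<open>The group law is asked for only almost everywhere: on a fibre of finite mass a rotation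
  can carry a point to the missing endpoint of the period. In \<open>flow_add\<close> the quantifier
  over s stands inside the null set, because integrals along the orbit of \<Phi> t x use all s at
  once.\<close>

locale measure_flow = sigma_finite_measure M for M :: "'a measure" +
  fixes \<Phi> :: "real \<Rightarrow> 'a \<Rightarrow> 'a"
  assumes flow_measurable: "(\<lambda>(t, x). \<Phi> t x) \<in> borel \<Otimes>\<^sub>M M \<rightarrow>\<^sub>M M"
    and flow_preserves: "distr M M (\<Phi> t) = M"
    and flow_zero: "AE x in M. \<Phi> 0 x = x"
    and flow_add: "AE x in M. \<forall>s. \<Phi> s (\<Phi> t x) = \<Phi> (s + t) x"
    and flow_continuous: "f \<in> L2 M \<Longrightarrow> ((\<lambda>t. L2_norm M (\<lambda>x. f (\<Phi> t x) - f x)) \<longlongrightarrow> 0) (at 0)"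
begin

lemma flow_measurable_compose [measurable (raw)]:
  assumes [measurable]: "f \<in> borel_measurable N" "g \<in> N \<rightarrow>\<^sub>M M"
  shows "(\<lambda>x. \<Phi> (f x) (g x)) \<in> N \<rightarrow>\<^sub>M M"
  using measurable_compose[OF _ flow_measurable, of "\<lambda>x. (f x, g x)" N] by simp

lemma AE_flow: "AE x in M. P x \<Longrightarrow> AE x in M. P (\<Phi> t x)"
  by (rule AE_distrD[of "\<Phi> t" M M P]) (measurable, simp only: flow_preserves)

lemma integral_flow:
  fixes f :: "'a \<Rightarrow> 'b::{banach, second_countable_topology}"
  assumes [measurable]: "f \<in> borel_measurable M"
  shows "(\<integral>x. f (\<Phi> t x) \<partial>M) = (\<integral>x. f x \<partial>M)"
  using integral_distr[of "\<Phi> t" M M f] by (simp add: flow_preserves)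

lemma nn_integral_flow:
  assumes [measurable]: "f \<in> borel_measurable M"
  shows "(\<integral>\<^sup>+x. f (\<Phi> t x) \<partial>M) = (\<integral>\<^sup>+x. f x \<partial>M)"
  using nn_integral_distr[of "\<Phi> t" M M f] by (simp add: flow_preserves)

lemma L2_flow:
  assumes f: "f \<in> L2 M"
  shows "(\<lambda>x. f (\<Phi> t x)) \<in> L2 M" "L2_norm M (\<lambda>x. f (\<Phi> t x)) = L2_norm M f"
proof -
  note [measurable] = L2_measurable[OF f]
  show "(\<lambda>x. f (\<Phi> t x)) \<in> L2 M"
    using f nn_integral_flow[of "\<lambda>x. ennreal ((cmod (f x))\<^sup>2)" t] by (simp add: L2_iff_nn_integral)
  show "L2_norm M (\<lambda>x. f (\<Phi> t x)) = L2_norm M f"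
    unfolding L2_norm_def by (subst integral_flow[of "\<lambda>x. (cmod (f x))\<^sup>2"]) auto
qed

lemma L2_inner_flow:
  assumes f: "f \<in> L2 M" and g: "g \<in> L2 M"
  shows "L2_inner M (\<lambda>x. f (\<Phi> t x)) (\<lambda>x. g (\<Phi> t x)) = L2_inner M f g"
proof -
  note [measurable] = L2_measurable[OF f] L2_measurable[OF g]
  show ?thesis unfolding L2_inner_def by (rule integral_flow[of "\<lambda>x. f x * cnj (g x)"]) auto
qed

section \<open>Integrals along orbits and the generator in integrated form\<close>

lemma orbit_measurable:
  assumes [measurable]: "f \<in> borel_measurable M"
  shows "(\<lambda>(t, x). f (\<Phi> t x)) \<in> borel_measurable (lborel \<Otimes>\<^sub>M M)"
    "(\<lambda>(t, x). f (\<Phi> t x)) \<in> borel_measurable (borel \<Otimes>\<^sub>M M)"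
  by measurable

lemma AE_orbit_locint: "f \<in> L2 M \<Longrightarrow> AE x in M. locint (\<lambda>t. f (\<Phi> t x))"
  by (rule AE_locint[OF sigma_finite_measure_axioms orbit_measurable(2)[OF L2_measurable] L2_flow(1)
        order_eq_refl[OF L2_flow(2)]])

text \<open>A pointwise integral along each orbit instead of an L^2-valued one; it is meaningful for
  almost every x by \<open>AE_orbit_locint\<close>.\<close>

definition orbit_int :: "('a \<Rightarrow> complex) \<Rightarrow> real \<Rightarrow> 'a \<Rightarrow> complex" where
  "orbit_int f t x = oint 0 t (\<lambda>\<tau>. f (\<Phi> \<tau> x))"

lemma L2_orbit_int:
  assumes f: "f \<in> L2 M"
  shows "orbit_int f t \<in> L2 M"
  using L2_oint[OF sigma_finite_measure_axioms orbit_measurable(1)[OF L2_measurable[OF f]], of 0 t "L2_norm M f"]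
    L2_flow[OF f] unfolding orbit_int_def[abs_def] by auto

text \<open>The cocycle identity: shifting the time variable turns the integral over [0, s] along
  the orbit of \<Phi> t x into the one over [t, s + t] along the orbit of x.\<close>

lemma orbit_int_flow:
  assumes f: "f \<in> L2 M"
  shows "AE x in M. orbit_int f s (\<Phi> t x) = orbit_int f (t + s) x - orbit_int f t x"
  using AE_orbit_locint[OF f] flow_add[of t]
proof eventually_elim
  case (elim x)
  then have "orbit_int f s (\<Phi> t x) = oint t (s + t) (\<lambda>\<tau>. f (\<Phi> \<tau> x))"
    using oint_shift[of 0 s "\<lambda>\<tau>. f (\<Phi> \<tau> x)" t] by (simp add: orbit_int_def)
  with oint_add_endpoints[OF elim(1), of 0 "s + t" t] show ?case
    by (simp add: orbit_int_def add.commute)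
qed

text \<open>The difference is itself the integral of f \<circ> \<Phi> \<tau> - f over \<tau> between
  0 and t, to which \<open>L2_oint\<close> applies.\<close>

lemma L2_norm_orbit_int_approx:
  assumes f: "f \<in> L2 M" and B: "\<And>\<tau>. \<bar>\<tau>\<bar> \<le> \<bar>t\<bar> \<Longrightarrow> L2_norm M (\<lambda>x. f (\<Phi> \<tau> x) - f x) \<le> B"
  shows "L2_norm M (\<lambda>x. orbit_int f t x - t * f x) \<le> \<bar>t\<bar> * B"
proof -
  note [measurable] = L2_measurable[OF f]
  have [measurable]: "orbit_int f t \<in> borel_measurable M" by (rule L2_measurable[OF L2_orbit_int[OF f]])
  have "AE x in M. orbit_int f t x - t * f x = oint 0 t (\<lambda>\<tau>. f (\<Phi> \<tau> x) - f x)"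
    using AE_orbit_locint[OF f]
    by eventually_elim (simp add: orbit_int_def oint_diff oint_const scaleR_conv_of_real)
  then have "L2_norm M (\<lambda>x. orbit_int f t x - t * f x) = L2_norm M (\<lambda>x. oint 0 t (\<lambda>\<tau>. f (\<Phi> \<tau> x) - f x))"
    by (intro L2_norm_cong_AE) measurable
  also have "\<dots> \<le> \<bar>t - 0\<bar> * B"
    by (rule L2_oint[OF sigma_finite_measure_axioms])
      (auto intro!: L2_diff L2_flow f B)
  finally show ?thesis by simp
qed

lemma orbit_int_tendsto:
  assumes f: "f \<in> L2 M"
  shows "((\<lambda>d. L2_norm M (\<lambda>x. orbit_int f d x / d - f x)) \<longlongrightarrow> 0) (at 0)"
proof (rule tendstoI)
  fix e :: real assume "e > 0"
  then have "\<forall>\<^sub>F t in at 0. dist (L2_norm M (\<lambda>x. f (\<Phi> t x) - f x)) 0 < e / 2"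
    by (intro tendstoD[OF flow_continuous[OF f]]) auto
  then obtain \<delta> where \<delta>: "\<delta> > 0" "\<And>t. t \<noteq> 0 \<Longrightarrow> \<bar>t\<bar> < \<delta> \<Longrightarrow> L2_norm M (\<lambda>x. f (\<Phi> t x) - f x) < e / 2"
    by (auto simp: eventually_at dist_real_def)
  \<comment> \<open>The limit at 0 says nothing about the time 0 itself, which is supplied
    here.\<close>
  have z: "L2_norm M (\<lambda>x. f (\<Phi> 0 x) - f x) = 0"
    using flow_zero by (subst L2_norm_eq_zero_iff) (auto intro!: L2_diff L2_flow f)
  have "dist (L2_norm M (\<lambda>x. orbit_int f d x / d - f x)) 0 < e" if d: "d \<noteq> 0" "dist d 0 < \<delta>" for d
  proof -
    have "L2_norm M (\<lambda>x. f (\<Phi> \<tau> x) - f x) \<le> e / 2" if "\<bar>\<tau>\<bar> \<le> \<bar>d\<bar>" for \<tau>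
      using \<delta>(2)[of \<tau>] d that z \<open>e > 0\<close> by (cases "\<tau> = 0") (auto simp: dist_real_def)
    then have "L2_norm M (\<lambda>x. orbit_int f d x - d * f x) \<le> \<bar>d\<bar> * (e / 2)"
      by (rule L2_norm_orbit_int_approx[OF f])
    moreover have "(\<lambda>x. orbit_int f d x / d - f x) = (\<lambda>x. (1 / d) * (orbit_int f d x - d * f x))"
      using d by (auto simp: field_simps)
    moreover have "L2_norm M (\<lambda>x. (1 / d) * (orbit_int f d x - d * f x)) = L2_norm M (\<lambda>x. orbit_int f d x - d * f x) / \<bar>d\<bar>"
      by (subst L2_cmult(2)) (auto intro!: L2_diff L2_orbit_int L2_cmult f simp: norm_divide)
    ultimately have "L2_norm M (\<lambda>x. orbit_int f d x / d - f x) \<le> e / 2"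
      using d by (simp add: divide_le_eq mult.commute)
    then show ?thesis using \<open>e > 0\<close> by (simp add: dist_real_def)
  qed
  then show "\<forall>\<^sub>F d in at 0. dist (L2_norm M (\<lambda>x. orbit_int f d x / d - f x)) 0 < e"
    using \<delta>(1) unfolding eventually_at by blast
qed

text \<open>The integrated form of "the derivative of f \<circ> \<Phi> t at 0 is i h". The null set
  may depend on t; this makes the relation stable under changes on null sets and lets Fubini bring
  it to the fibres.\<close>

definition flow_gen :: "('a \<Rightarrow> complex) \<Rightarrow> ('a \<Rightarrow> complex) \<Rightarrow> bool" where
  "flow_gen f h \<longleftrightarrow> (\<forall>t. AE x in M. f (\<Phi> t x) - f x = \<i> * orbit_int h t x)"

text \<open>The norm of \<open>f \<circ> \<Phi>\<^sub>t - f - i \<integral>\<^sub>0\<^sup>t h \<circ> \<Phi>\<^sub>\<tau> d\<tau>\<close> has derivative \<open>0\<close> in \<open>t\<close> if \<open>i h\<close> is the derivative of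
  \<open>f \<circ> \<Phi>\<^sub>t\<close> at \<open>0\<close>.\<close>

lemma flow_gen_iff:
  assumes f: "f \<in> L2 M" and h: "h \<in> L2 M"
  shows "flow_gen f h \<longleftrightarrow>
    ((\<lambda>d. L2_norm M (\<lambda>x. (f (\<Phi> d x) - f x) / complex_of_real d - \<i> * h x)) \<longlongrightarrow> 0) (at 0)"
    (is "_ \<longleftrightarrow> ?lim")
proof
  assume gen: "flow_gen f h"
  have eq: "L2_norm M (\<lambda>x. (f (\<Phi> d x) - f x) / complex_of_real d - \<i> * h x) =
      L2_norm M (\<lambda>x. orbit_int h d x / d - h x)" for d
  proof -
    note [measurable] = L2_measurable[OF f] L2_measurable[OF h] L2_measurable[OF L2_orbit_int[OF h]]
    have "AE x in M. (f (\<Phi> d x) - f x) / complex_of_real d - \<i> * h x = \<i> * (orbit_int h d x / d - h x)"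
      using gen[unfolded flow_gen_def, rule_format, of d] by eventually_elim (simp add: algebra_simps)
    then have "L2_norm M (\<lambda>x. (f (\<Phi> d x) - f x) / complex_of_real d - \<i> * h x) =
        L2_norm M (\<lambda>x. \<i> * (orbit_int h d x / d - h x))"
      by (intro L2_norm_cong_AE) measurable
    also have "\<dots> = L2_norm M (\<lambda>x. orbit_int h d x / d - h x)"
      by (simp add: L2_norm_def norm_mult)
    finally show ?thesis .
  qed
  show ?lim unfolding eq by (rule orbit_int_tendsto[OF h])
next
  assume lim: ?lim
  define D where "D t x = f (\<Phi> t x) - f x - \<i> * orbit_int h t x" for t x
  have D: "D t \<in> L2 M" for t
    unfolding D_def[abs_def] by (intro L2_diff L2_cmult L2_flow f L2_orbit_int h)
  note [measurable] = L2_measurable[OF D]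
  define r where "r d = L2_norm M (\<lambda>x. (f (\<Phi> d x) - f x) / complex_of_real d - \<i> * h x) +
      L2_norm M (\<lambda>x. orbit_int h d x / d - h x)" for d
  have r: "(r \<longlongrightarrow> 0) (at 0)"
    unfolding r_def[abs_def] using tendsto_add[OF lim orbit_int_tendsto[OF h]] by simp
  have Dr: "L2_norm M (D d) \<le> \<bar>d\<bar> * r d" if "d \<noteq> 0" for d
  proof -
    have q: "(\<lambda>x. (f (\<Phi> d x) - f x) / complex_of_real d - \<i> * h x) \<in> L2 M"
      "(\<lambda>x. orbit_int h d x / d - h x) \<in> L2 M"
      using L2_diff(1)[OF L2_cmult(1)[OF L2_diff(1)[OF L2_flow(1)[OF f] f], of "1 / d"] L2_cmult(1)[OF h, of \<i>]]
         L2_diff(1)[OF L2_cmult(1)[OF L2_orbit_int[OF h], of "1 / d"] h] by simp_all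
    have "D d = (\<lambda>x. d * (((f (\<Phi> d x) - f x) / complex_of_real d - \<i> * h x) + (- \<i>) * (orbit_int h d x / d - h x)))"
      unfolding D_def[abs_def] using that by (auto simp: field_simps)
    then have "L2_norm M (D d) = \<bar>d\<bar> * L2_norm M (\<lambda>x. ((f (\<Phi> d x) - f x) / complex_of_real d - \<i> * h x) + (- \<i>) * (orbit_int h d x / d - h x))"
      by (simp only: L2_cmult(2)[OF L2_add(1)[OF q(1) L2_cmult(1)[OF q(2)]]] norm_of_real)
    also have "\<dots> \<le> \<bar>d\<bar> * r d"
      using L2_add(2)[OF q(1) L2_cmult(1)[OF q(2), of "- \<i>"]] L2_cmult(2)[OF q(2), of "- \<i>"]
      unfolding r_def by (intro mult_left_mono) simp_all
    finally show ?thesis .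
  qed
  \<comment> \<open>By the cocycle identity D (t + d) - D t is D d composed with \<Phi> t, and the
    flow is isometric. So smallness of D d near time 0 controls the increments at every t.\<close>
  have incr: "\<bar>L2_norm M (D (t + d)) - L2_norm M (D t)\<bar> \<le> L2_norm M (D d)" for t d
  proof -
    have "\<bar>L2_norm M (D (t + d)) - L2_norm M (D t)\<bar> \<le> L2_norm M (\<lambda>x. D (t + d) x - D t x)"
      by (rule L2_norm_triangle_rev[OF D D])
    also have "AE x in M. D (t + d) x - D t x = D d (\<Phi> t x)"
      using orbit_int_flow[OF h, of d t] flow_add[of t]
      by eventually_elim (simp add: D_def right_diff_distrib add.commute)
    then have "L2_norm M (\<lambda>x. D (t + d) x - D t x) = L2_norm M (\<lambda>x. D d (\<Phi> t x))"
      by (intro L2_norm_cong_AE) measurable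
    also have "\<dots> = L2_norm M (D d)" by (rule L2_flow(2)[OF D])
    finally show ?thesis .
  qed
  have "L2_norm M (D t) = L2_norm M (D 0)" for t
  proof (rule constant_if_small_increments[where \<phi>="\<lambda>t. L2_norm M (D t)"])
    fix t
    have "\<forall>d. d \<noteq> 0 \<longrightarrow> \<bar>L2_norm M (D (t + d)) - L2_norm M (D t)\<bar> \<le> \<bar>d\<bar> * r d"
      using order_trans[OF incr Dr] by simp
    with r show "\<exists>r. (r \<longlongrightarrow> 0) (at 0) \<and> (\<forall>d. d \<noteq> 0 \<longrightarrow> \<bar>L2_norm M (D (t + d)) - L2_norm M (D t)\<bar> \<le> \<bar>d\<bar> * r d)"
      by (intro exI[of _ r] conjI)
  qed
  moreover have "L2_norm M (D 0) = 0"
    unfolding L2_norm_eq_zero_iff[OF D]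
    using flow_zero by eventually_elim (simp add: D_def orbit_int_def)
  ultimately have "AE x in M. D t x = 0" for t using L2_norm_eq_zero_iff[OF D] by metis
  then show "flow_gen f h" by (simp add: flow_gen_def D_def)
qed

text \<open>Averaging f over a short piece of its orbit gives a vector in the domain, as in
  Garding's construction, and by strong continuity the average is close to f.\<close>

lemma flow_gen_dense:
  assumes f: "f \<in> L2 M" and "e > 0"
  shows "\<exists>g h. g \<in> L2 M \<and> h \<in> L2 M \<and> flow_gen g h \<and> L2_norm M (\<lambda>x. f x - g x) < e"
proof -
  have "\<forall>\<^sub>F d in at 0. dist (L2_norm M (\<lambda>x. orbit_int f d x / d - f x)) 0 < e"
    using \<open>e > 0\<close> by (intro tendstoD[OF orbit_int_tendsto[OF f]])
  then obtain \<delta> where \<delta>: "\<delta> > 0" "\<And>t. t \<noteq> 0 \<Longrightarrow> \<bar>t\<bar> < \<delta> \<Longrightarrow> L2_norm M (\<lambda>x. orbit_int f t x / t - f x) < e"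
    by (auto simp: eventually_at dist_real_def)
  define c where "c = \<delta> / 2"
  have c: "c > 0" "L2_norm M (\<lambda>x. orbit_int f c x / c - f x) < e"
    using \<delta>(1) \<delta>(2)[of c] by (auto simp: c_def)
  define g where "g x = (1 / c) * orbit_int f c x" for x
  \<comment> \<open>The derivative of g along the flow is (f \<circ> \<Phi> c - f) / c; the
    generator is this divided by i.\<close>
  define h where "h x = (- \<i> / c) * (f (\<Phi> c x) - f x)" for x
  have g: "g \<in> L2 M" unfolding g_def[abs_def] by (intro L2_cmult L2_orbit_int f)
  have h: "h \<in> L2 M" unfolding h_def[abs_def] by (intro L2_cmult L2_diff L2_flow f)
  define u where "u d x = orbit_int f d x / d - f x" for d x
  have u: "u d \<in> L2 M" for d
    using L2_diff(1)[OF L2_cmult(1)[OF L2_orbit_int[OF f], of "1 / d" d] f] by (simp add: u_def[abs_def])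
  have le: "L2_norm M (\<lambda>x. (g (\<Phi> d x) - g x) / complex_of_real d - \<i> * h x) \<le> (2 / c) * L2_norm M (u d)" for d
  proof -
    note [measurable] = L2_measurable[OF g] L2_measurable[OF h] L2_measurable[OF u]
    \<comment> \<open>The integral over [d, c + d] minus that over [0, c] equals the integral over
      [c, c + d] minus that over [0, d]. The right side consists of two short pieces, each
      controlled by u d.\<close>
    have "AE x in M. (g (\<Phi> d x) - g x) / complex_of_real d - \<i> * h x = (1 / c) * (u d (\<Phi> c x) - u d x)"
      using orbit_int_flow[OF f, of c d] orbit_int_flow[OF f, of d c]
    proof eventually_elim
      case (elim x)
      have "g (\<Phi> d x) - g x = (1 / c) * (orbit_int f d (\<Phi> c x) - orbit_int f d x)"
        using elim by (simp add: g_def diff_divide_distrib add.commute)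
      then show ?case by (simp add: h_def u_def diff_divide_distrib mult.commute[of "complex_of_real c"])
    qed
    then have "L2_norm M (\<lambda>x. (g (\<Phi> d x) - g x) / complex_of_real d - \<i> * h x) =
        L2_norm M (\<lambda>x. (1 / c) * (u d (\<Phi> c x) - u d x))"
      by (intro L2_norm_cong_AE) measurable
    also have "\<dots> = (1 / c) * L2_norm M (\<lambda>x. u d (\<Phi> c x) - u d x)"
      using c by (subst L2_cmult(2)) (auto intro!: L2_diff L2_flow u simp: norm_divide)
    also have "\<dots> \<le> (1 / c) * (L2_norm M (u d) + L2_norm M (u d))"
      using L2_diff(2)[OF L2_flow(1)[OF u] u, of d c d] c L2_flow(2)[OF u, of d c]
      by (intro mult_left_mono) auto
    finally show ?thesis by simp
  qed
  have "flow_gen g h"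
    unfolding flow_gen_iff[OF g h]
  proof (rule Lim_null_comparison)
    show "\<forall>\<^sub>F d in at 0. norm (L2_norm M (\<lambda>x. (g (\<Phi> d x) - g x) / complex_of_real d - \<i> * h x)) \<le> (2 / c) * L2_norm M (u d)"
      using le by simp
    show "((\<lambda>d. (2 / c) * L2_norm M (u d)) \<longlongrightarrow> 0) (at 0)"
      unfolding u_def using tendsto_mult_right_zero[OF orbit_int_tendsto[OF f]] by blast
  qed
  moreover have "L2_norm M (\<lambda>x. f x - g x) < e"
    using c(2) by (subst L2_norm_diff_commute) (simp add: g_def)
  ultimately show ?thesis using g h by blast
qed

lemma L2_norm_flow_diff:
  assumes f: "f \<in> L2 M"
  shows "L2_norm M (\<lambda>x. f (\<Phi> s x) - f (\<Phi> t x)) = L2_norm M (\<lambda>x. f (\<Phi> (s - t) x) - f x)"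
proof -
  note [measurable] = L2_measurable[OF f]
  have "AE x in M. f (\<Phi> s x) - f (\<Phi> t x) = f (\<Phi> (s - t) (\<Phi> t x)) - f (\<Phi> t x)"
    using flow_add[of t] by eventually_elim simp
  then have "L2_norm M (\<lambda>x. f (\<Phi> s x) - f (\<Phi> t x)) = L2_norm M (\<lambda>x. f (\<Phi> (s - t) (\<Phi> t x)) - f (\<Phi> t x))"
    by (intro L2_norm_cong_AE) measurable
  also have "\<dots> = L2_norm M (\<lambda>x. f (\<Phi> (s - t) x) - f x)"
    by (rule L2_flow(2)[OF L2_diff(1)[OF L2_flow(1)[OF f] f]])
  finally show ?thesis .
qed

section \<open>Averages over symmetric time intervals\<close>

definition flow_average :: "real \<Rightarrow> ('a \<Rightarrow> complex) \<Rightarrow> 'a \<Rightarrow> complex" where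
  "flow_average T f x = complex_of_real (1 / (2 * T)) * oint (- T) T (\<lambda>t. f (\<Phi> t x))"

lemma L2_flow_average:
  assumes f: "f \<in> L2 M" and "T > 0"
  shows "flow_average T f \<in> L2 M" "L2_norm M (flow_average T f) \<le> L2_norm M f"
proof -
  have o: "(\<lambda>x. oint (- T) T (\<lambda>t. f (\<Phi> t x))) \<in> L2 M"
    "L2_norm M (\<lambda>x. oint (- T) T (\<lambda>t. f (\<Phi> t x))) \<le> \<bar>T - - T\<bar> * L2_norm M f"
    by (rule L2_oint[OF sigma_finite_measure_axioms orbit_measurable(1)[OF L2_measurable[OF f]], where B="L2_norm M f"];
      simp add: L2_flow f)+
  show "flow_average T f \<in> L2 M" unfolding flow_average_def[abs_def] by (intro L2_cmult o)
  have "L2_norm M (flow_average T f) = 1 / (2 * T) * L2_norm M (\<lambda>x. oint (- T) T (\<lambda>t. f (\<Phi> t x)))"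
    unfolding flow_average_def[abs_def] L2_cmult(2)[OF o(1)] norm_of_real using \<open>T > 0\<close> by simp
  also have "\<dots> \<le> 1 / (2 * T) * (2 * T * L2_norm M f)"
    using o(2) \<open>T > 0\<close> by (intro mult_left_mono) auto
  finally show "L2_norm M (flow_average T f) \<le> L2_norm M f" using \<open>T > 0\<close> by simp
qed

lemma flow_average_linear:
  assumes "f \<in> L2 M" "g \<in> L2 M"
  shows "AE x in M. flow_average T (\<lambda>x. a * f x + b * g x) x = a * flow_average T f x + b * flow_average T g x"
  using AE_orbit_locint[OF L2_cmult(1)[OF assms(1), of a]] AE_orbit_locint[OF L2_cmult(1)[OF assms(2), of b]]
  by eventually_elim (simp add: flow_average_def oint_add oint_cmult algebra_simps)

text \<open>The null set on which p \<circ> \<Phi> t differs from p depends on t, so no single orbit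
  can be used directly. Instead the difference is integrated over t, and Minkowski's inequality with
  bound 0 shows that the result is null.\<close>

lemma flow_gen_const_orbit:
  assumes p: "p \<in> L2 M" and gen: "flow_gen p (\<lambda>_. 0)" and "T > 0"
  shows "AE x in M. flow_average T p x = p x"
proof -
  note [measurable] = L2_measurable[OF p]
  have inv: "AE x in M. p (\<Phi> t x) - p x = 0" for t
    using gen by (simp add: flow_gen_def orbit_int_def)
  have pp: "(\<lambda>x. p (\<Phi> t x) - p x) \<in> L2 M" for t by (intro L2_diff L2_flow p)
  have o: "(\<lambda>x. oint (- T) T (\<lambda>t. p (\<Phi> t x) - p x)) \<in> L2 M"
      "L2_norm M (\<lambda>x. oint (- T) T (\<lambda>t. p (\<Phi> t x) - p x)) \<le> \<bar>T - - T\<bar> * 0"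
    by (rule L2_oint[OF sigma_finite_measure_axioms, where B=0];
        use pp L2_norm_eq_zero_iff[OF pp] inv in \<open>auto\<close>)+
  then have "L2_norm M (\<lambda>x. oint (- T) T (\<lambda>t. p (\<Phi> t x) - p x)) = 0"
    by (auto intro: antisym)
  then have "AE x in M. oint (- T) T (\<lambda>t. p (\<Phi> t x) - p x) = 0"
    using L2_norm_eq_zero_iff[OF o(1)] by blast
  then show ?thesis
    using AE_orbit_locint[OF p]
    by eventually_elim (use \<open>T > 0\<close> in \<open>simp add: flow_average_def oint_diff oint_const scaleR_conv_of_real field_simps\<close>)
qed

text \<open>Telescoping: the integral of q over [-T, T] along an orbit is -i (g \<circ> \<Phi> T - g
  \<circ> \<Phi> (-T)), of norm at most 2 |g|, and is divided by 2 T.\<close>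

lemma flow_average_coboundary:
  assumes g: "g \<in> L2 M" and q: "q \<in> L2 M" and gen: "flow_gen g q" and "T > 0"
  shows "L2_norm M (flow_average T q) \<le> L2_norm M g / T"
proof -
  note [measurable] = L2_measurable[OF g] L2_measurable[OF q] L2_measurable[OF L2_flow_average(1)[OF q \<open>T > 0\<close>]]
  have "AE x in M. flow_average T q x = (- \<i> / (2 * T)) * (g (\<Phi> T x) - g (\<Phi> (-T) x))"
    using gen[unfolded flow_gen_def, rule_format, of T] gen[unfolded flow_gen_def, rule_format, of "-T"] AE_orbit_locint[OF q]
  proof eventually_elim
    case (elim x)
    have "oint (- T) T (\<lambda>t. q (\<Phi> t x)) = orbit_int q T x - orbit_int q (- T) x"
      using oint_add_endpoints[OF elim(3), of "-T" T 0] oint_swap[of 0 "- T" "\<lambda>t. q (\<Phi> t x)"]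
      by (simp add: orbit_int_def)
    moreover have "g (\<Phi> T x) - g (\<Phi> (-T) x) = \<i> * (orbit_int q T x - orbit_int q (- T) x)"
      using elim by (simp add: algebra_simps)
    ultimately show ?case by (simp add: flow_average_def diff_divide_distrib)
  qed
  then have "L2_norm M (flow_average T q) = L2_norm M (\<lambda>x. (- \<i> / (2 * T)) * (g (\<Phi> T x) - g (\<Phi> (-T) x)))"
    by (intro L2_norm_cong_AE) measurable
  also have "\<dots> = (1 / (2 * T)) * L2_norm M (\<lambda>x. g (\<Phi> T x) - g (\<Phi> (-T) x))"
    using \<open>T > 0\<close> by (subst L2_cmult(2)) (auto intro!: L2_diff L2_flow g simp: norm_divide norm_mult)
  also have "\<dots> \<le> (1 / (2 * T)) * (L2_norm M g + L2_norm M g)"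
    using L2_diff(2)[OF L2_flow(1)[OF g] L2_flow(1)[OF g], of T "-T"] \<open>T > 0\<close>
    by (intro mult_left_mono) (auto simp: L2_flow g)
  finally show ?thesis by simp
qed

text \<open>A quantitative mean ergodic theorem relative to any approximate splitting: the invariant
  part is reproduced, the coboundary decays in T, and the rest is only contracted.\<close>

lemma flow_average_error:
  assumes p: "p \<in> L2 M" "flow_gen p (\<lambda>_. 0)" and g: "g \<in> L2 M" and q: "q \<in> L2 M" "flow_gen g q"
    and f: "f \<in> L2 M" and "T > 0"
  shows "L2_norm M (\<lambda>x. flow_average T f x - p x) \<le> L2_norm M g / T + L2_norm M (\<lambda>x. f x - p x - q x)"
proof -
  define r where "r x = f x - p x - q x" for x
  have r: "r \<in> L2 M" unfolding r_def[abs_def] by (intro L2_diff f p q)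
  note av = L2_flow_average(1)[OF _ \<open>T > 0\<close>]
  note [measurable] = L2_measurable[OF p(1)] L2_measurable[OF av[OF f]] L2_measurable[OF av[OF q(1)]]
     L2_measurable[OF av[OF r]]
  have pr: "(\<lambda>x. 1 * p x + 1 * r x) \<in> L2 M" by (intro L2_add L2_cmult p r)
  \<comment> \<open>The explicit coefficients 1 match the shape of
    \<open>flow_average_linear\<close>.\<close>
  have f_eq: "f = (\<lambda>x. 1 * (1 * p x + 1 * r x) + 1 * q x)" by (auto simp: r_def)
  have "AE x in M. flow_average T f x - p x = flow_average T q x + flow_average T r x"
    using flow_average_linear[OF pr q(1), of T 1 1] flow_average_linear[OF p(1) r, of T 1 1]
      flow_gen_const_orbit[OF p \<open>T > 0\<close>]
  proof eventually_elim
    case (elim x)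
    have "flow_average T f x = flow_average T (\<lambda>x. 1 * (1 * p x + 1 * r x) + 1 * q x) x"
      using f_eq by simp
    then show ?case using elim by simp
  qed
  then have "L2_norm M (\<lambda>x. flow_average T f x - p x) = L2_norm M (\<lambda>x. flow_average T q x + flow_average T r x)"
    by (intro L2_norm_cong_AE) measurable
  also have "\<dots> \<le> L2_norm M (flow_average T q) + L2_norm M (flow_average T r)"
    by (rule L2_add(2)[OF av[OF q(1)] av[OF r]])
  also have "\<dots> \<le> L2_norm M g / T + L2_norm M r"
    by (intro add_mono flow_average_coboundary g q \<open>T > 0\<close> L2_flow_average r)
  finally show ?thesis by (simp add: r_def[abs_def])
qed

text \<open>Invariance of n and of the inner product under the flow makes every difference quotient
  of g orthogonal to n. Its limit i q inherits this.\<close>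

lemma L2_inner_coboundary_invariant:
  assumes n: "n \<in> L2 M" "flow_gen n (\<lambda>_. 0)" and g: "g \<in> L2 M" and q: "q \<in> L2 M" "flow_gen g q"
  shows "L2_inner M q n = 0"
proof -
  note [measurable] = L2_measurable[OF n(1)] L2_measurable[OF g]
  define u where "u d x = (g (\<Phi> d x) - g x) / complex_of_real d - \<i> * q x" for d x
  have gd: "(\<lambda>x. (1 / complex_of_real d) * (g (\<Phi> d x) - g x)) \<in> L2 M" for d
    by (intro L2_diff L2_cmult L2_flow g)
  have u: "u d \<in> L2 M" for d
    using L2_diff(1)[OF gd L2_cmult(1)[OF q(1), of \<i>]] by (simp add: u_def[abs_def])
  have z: "L2_inner M (\<lambda>x. g (\<Phi> d x)) n = L2_inner M g n" for d
  proof -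
    have "AE x in M. n (\<Phi> d x) = n x"
      using n(2) by (simp add: flow_gen_def orbit_int_def)
    then have "L2_inner M (\<lambda>x. g (\<Phi> d x)) n = L2_inner M (\<lambda>x. g (\<Phi> d x)) (\<lambda>x. n (\<Phi> d x))"
      unfolding L2_inner_def by (intro integral_cong_AE) auto
    then show ?thesis by (simp add: L2_inner_flow g n)
  qed
  have eq: "L2_inner M (u d) n = - \<i> * L2_inner M q n" for d
  proof -
    have "L2_inner M (u d) n = L2_inner M (\<lambda>x. (1 / complex_of_real d) * (g (\<Phi> d x) - g x)) n - L2_inner M (\<lambda>x. \<i> * q x) n"
      using L2_inner_diff_left[OF gd L2_cmult(1)[OF q(1), of \<i>] n(1)] by (simp add: u_def[abs_def])
    also have "L2_inner M (\<lambda>x. (1 / complex_of_real d) * (g (\<Phi> d x) - g x)) n = 0"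
      using L2_inner_linear_left[OF L2_flow(1)[OF g] g n(1), of "1/d" d "-1/d"] z[of d]
      by (simp add: diff_divide_distrib)
    also have "L2_inner M (\<lambda>x. \<i> * q x) n = \<i> * L2_inner M q n"
      using L2_inner_linear_left[OF q(1) q(1) n(1), of \<i> 0] by simp
    finally show ?thesis by simp
  qed
  have "((\<lambda>d. L2_norm M (u d) * L2_norm M n) \<longlongrightarrow> 0) (at 0)"
    using q(2) unfolding flow_gen_iff[OF g q(1)] u_def by (rule tendsto_mult_left_zero)
  moreover have "\<forall>d. cmod (L2_inner M q n) \<le> L2_norm M (u d) * L2_norm M n"
    using L2_Cauchy_Schwarz[OF u n(1)] eq by (metis mult_minus_left norm_ii norm_minus_cancel norm_mult mult_1)
  ultimately have "cmod (L2_inner M q n) \<le> 0"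
    by (intro tendsto_lowerbound[of _ 0 "at (0::real)"]) auto
  then show ?thesis by simp
qed

end

section \<open>Unitary groups and their generators\<close>

lemma unitary_L2_in_L2: "unitary_L2 N V \<Longrightarrow> f \<in> L2 N \<Longrightarrow> V f \<in> L2 N"
  by (simp add: unitary_L2_def)

lemma unitary_L2_norm:
  assumes "unitary_L2 N V" "f \<in> L2 N"
  shows "L2_norm N (V f) = L2_norm N f"
proof -
  have "L2_inner N (V f) (V f) = L2_inner N f f" using assms by (simp add: unitary_L2_def)
  then have "(L2_norm N (V f))\<^sup>2 = (L2_norm N f)\<^sup>2"
    unfolding L2_inner_self of_real_eq_iff .
  then show ?thesis by (simp add: power2_eq_iff_nonneg)
qed

lemma unitary_L2_linear:
  assumes "unitary_L2 N V" "f \<in> L2 N" "g \<in> L2 N"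
  shows "AE x in N. V (\<lambda>y. a * f y + b * g y) x = a * V f x + b * V g x"
  using assms by (simp add: unitary_L2_def)

lemma unitary_L2_norm_diff:
  assumes V: "unitary_L2 N V" and f: "f \<in> L2 N" and g: "g \<in> L2 N"
  shows "L2_norm N (\<lambda>x. V f x - V g x) = L2_norm N (\<lambda>x. f x - g x)"
proof -
  have fg: "(\<lambda>x. f x - g x) \<in> L2 N" by (intro L2_diff f g)
  have "AE x in N. V (\<lambda>y. f y - g y) x = V f x - V g x"
    using unitary_L2_linear[OF V f g, of 1 "-1"] by simp
  then have "L2_norm N (\<lambda>x. V f x - V g x) = L2_norm N (V (\<lambda>y. f y - g y))"
    by (intro L2_norm_cong_AE L2_measurable L2_diff unitary_L2_in_L2[OF V] f g) auto
  then show ?thesis by (simp add: unitary_L2_norm[OF V fg])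
qed

lemma AE_eq_iff_L2_norm_diff:
  assumes "f \<in> L2 N" "g \<in> L2 N"
  shows "(AE x in N. f x = g x) \<longleftrightarrow> L2_norm N (\<lambda>x. f x - g x) = 0"
  by (subst L2_norm_eq_zero_iff) (auto intro: L2_diff assms)

text \<open>A map in \<open>unitary_L2\<close> acts on functions, not on classes; that it respects
  null sets follows from being isometric.\<close>

lemma unitary_L2_cong_AE:
  assumes V: "unitary_L2 N V" and f: "f \<in> L2 N" and g: "g \<in> L2 N" and "AE x in N. f x = g x"
  shows "AE x in N. V f x = V g x"
  using assms(4) AE_eq_iff_L2_norm_diff[OF f g] AE_eq_iff_L2_norm_diff[OF V[THEN unitary_L2_in_L2, OF f] V[THEN unitary_L2_in_L2, OF g]]
    unitary_L2_norm_diff[OF V f g] by simp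

text \<open>The condition that \<open>generates_group\<close> imposes on a pair of the graph,
  separated from the operator so that two groups can be compared directly.\<close>

definition derives :: "'a measure \<Rightarrow> (real \<Rightarrow> ('a \<Rightarrow> complex) \<Rightarrow> ('a \<Rightarrow> complex)) \<Rightarrow> ('a \<Rightarrow> complex) \<Rightarrow> ('a \<Rightarrow> complex) \<Rightarrow> bool" where
  "derives N U f g \<longleftrightarrow> ((\<lambda>h. L2_norm N (\<lambda>x. (U h f x - f x) / complex_of_real h - \<i> * g x)) \<longlongrightarrow> 0) (at 0)"

text \<open>U t commutes with the difference quotients by the group law and preserves their norms,
  so the domain is invariant under the group.\<close>

lemma derives_orbit:
  assumes U: "unitary_group N U" and f: "f \<in> L2 N" and g: "g \<in> L2 N" and gen: "derives N U f g"
  shows "derives N U (U t f) (U t g)"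
proof -
  have u: "unitary_L2 N (U t)" for t using U by (simp add: unitary_group_def)
  note uL = unitary_L2_in_L2[OF u]
  have add: "AE x in N. U (s + t) f x = U s (U t f) x" for s t
    using U f by (simp add: unitary_group_def)
  define k where "k d x = (U d f x - f x) / complex_of_real d - \<i> * g x" for d x
  have k_eq: "k d = (\<lambda>x. (1 / complex_of_real d) * (1 * U d f x + (-1) * f x) + (- \<i>) * g x)" for d
    by (auto simp: k_def)
  have U1: "(\<lambda>x. 1 * U d f x + (-1) * f x) \<in> L2 N" for d by (intro L2_add L2_cmult uL f)
  have k: "k d \<in> L2 N" for d unfolding k_eq by (intro L2_add L2_cmult uL f g)
  have "L2_norm N (\<lambda>x. (U d (U t f) x - U t f x) / complex_of_real d - \<i> * U t g x) = L2_norm N (k d)" for d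
  proof -
    have "AE x in N. (U d (U t f) x - U t f x) / complex_of_real d - \<i> * U t g x = U t (k d) x"
      using unitary_L2_linear[OF u U1 g, of t "1 / complex_of_real d" d "- \<i>"] unitary_L2_linear[OF u uL[OF f] f, of t 1 d "-1"]
        add[of d t] add[of t d]
    proof eventually_elim
      case (elim x)
      have "U t (k d) x = (1 / complex_of_real d) * (U t (U d f) x - U t f x) - \<i> * U t g x"
        unfolding k_eq using elim by simp
      moreover have "U t (U d f) x = U d (U t f) x" using elim by (simp add: add.commute)
      ultimately show ?case by simp
    qed
    moreover have "(\<lambda>x. (U d (U t f) x - U t f x) / complex_of_real d - \<i> * U t g x) \<in> L2 N"
      using L2_diff(1)[OF L2_cmult(1)[OF L2_diff(1)[OF uL[OF uL[OF f]] uL[OF f]], of "1 / d"] L2_cmult(1)[OF uL[OF g], of \<i>]]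
      by simp
    ultimately have "L2_norm N (\<lambda>x. (U d (U t f) x - U t f x) / complex_of_real d - \<i> * U t g x) = L2_norm N (U t (k d))"
      by (intro L2_norm_cong_AE) (auto intro: L2_measurable uL k)
    then show ?thesis by (simp add: unitary_L2_norm[OF u k])
  qed
  with gen show ?thesis by (simp add: derives_def k_def[abs_def])
qed

text \<open>For f in the domain the curve V (-t) (U t f) has derivative 0: U t f stays in the
  domain, and there both groups have the same derivative. Its distance from f is therefore constant,
  and it is 0 at t = 0.\<close>

lemma unitary_group_unique_on_domain:
  assumes U: "unitary_group N U" and V: "unitary_group N V"
    and same: "\<And>f g. f \<in> L2 N \<Longrightarrow> g \<in> L2 N \<Longrightarrow> derives N U f g \<longleftrightarrow> derives N V f g"
    and f: "f \<in> L2 N" and g: "g \<in> L2 N" and gen: "derives N U f g"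
  shows "AE x in N. U t f x = V t f x"
proof -
  have u: "unitary_L2 N (U t)" and v: "unitary_L2 N (V t)" for t
    using U V by (auto simp: unitary_group_def)
  note uL = unitary_L2_in_L2[OF u] and vL = unitary_L2_in_L2[OF v]
  have addU: "AE x in N. U (s + t) f x = U s (U t f) x" for s t
    using U f by (simp add: unitary_group_def)
  have addV: "AE x in N. V (s + t) k x = V s (V t k) x" if "k \<in> L2 N" for s t k
    using V that by (simp add: unitary_group_def)
  have zero: "AE x in N. U 0 f x = f x" "k \<in> L2 N \<Longrightarrow> AE x in N. V 0 k x = k x" for k
    using U V f by (auto simp: unitary_group_def)
  define D where "D t = V (- t) (U t f)" for t
  have D: "D t \<in> L2 N" for t unfolding D_def by (intro vL uL f)
  have main: "L2_norm N (\<lambda>x. D t x - f x) = L2_norm N (\<lambda>x. D 0 x - f x)" for t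
  proof (rule constant_if_small_increments[where \<phi>="\<lambda>t. L2_norm N (\<lambda>x. D t x - f x)"])
    fix t
    define k where "k = U t f"
    define kg where "kg = U t g"
    have k: "k \<in> L2 N" and kg: "kg \<in> L2 N" by (simp_all add: k_def kg_def uL f g)
    have kU: "derives N U k kg" unfolding k_def kg_def by (rule derives_orbit[OF U f g gen])
    then have kV: "derives N V k kg" using same[OF k kg] by simp
    define a where "a d x = (U d k x - k x) / complex_of_real d - \<i> * kg x" for d x
    define b where "b d x = (V d k x - k x) / complex_of_real d - \<i> * kg x" for d x
    have a: "a d \<in> L2 N" and b: "b d \<in> L2 N" for d
      using L2_diff(1)[OF L2_cmult(1)[OF L2_diff(1)[OF uL[OF k] k], of "1 / d"] L2_cmult(1)[OF kg, of \<i>]]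
       L2_diff(1)[OF L2_cmult(1)[OF L2_diff(1)[OF vL[OF k] k], of "1 / d"] L2_cmult(1)[OF kg, of \<i>]]
      by (simp_all add: a_def[abs_def] b_def[abs_def])
    define r where "r d = L2_norm N (a d) + L2_norm N (b d)" for d
    have r: "(r \<longlongrightarrow> 0) (at 0)"
      using tendsto_add[OF kU[unfolded derives_def] kV[unfolded derives_def]]
      by (simp add: r_def[abs_def] a_def[abs_def] b_def[abs_def])
    have "\<bar>L2_norm N (\<lambda>x. D (t + d) x - f x) - L2_norm N (\<lambda>x. D t x - f x)\<bar> \<le> \<bar>d\<bar> * r d" if d: "d \<noteq> 0" for d
    proof -
      have "\<bar>L2_norm N (\<lambda>x. D (t + d) x - f x) - L2_norm N (\<lambda>x. D t x - f x)\<bar> \<le> L2_norm N (\<lambda>x. D (t + d) x - D t x)"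
        using L2_norm_triangle_rev[OF L2_diff(1)[OF D[of "t + d"] f] L2_diff(1)[OF D[of t] f]] by simp
      \<comment> \<open>With k = U t f, both terms of the increment are images under V (-(t + d)),
        of U d k and of V d k. Only their difference, of order o(d), remains.\<close>
      also have "\<dots> = L2_norm N (\<lambda>x. V (- (t + d)) (U d k) x - V (- (t + d)) (V d k) x)"
      proof (rule L2_norm_cong_AE)
        have 1: "AE x in N. V (- (t + d)) (U (t + d) f) x = V (- (t + d)) (U d k) x"
          using addU[of d t] by (intro unitary_L2_cong_AE[OF v] uL f k) (simp add: k_def add.commute)
        have 2: "AE x in N. V (- t) k x = V (- (t + d)) (V d k) x"
          using addV[OF k, of "- (t + d)" d] by simp
        show "AE x in N. D (t + d) x - D t x = V (- (t + d)) (U d k) x - V (- (t + d)) (V d k) x"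
          using 1 2 by eventually_elim (simp add: D_def k_def)
      qed (intro L2_measurable L2_diff D vL uL k)+
      also have "\<dots> = L2_norm N (\<lambda>x. U d k x - V d k x)"
        by (rule unitary_L2_norm_diff[OF v uL[OF k] vL[OF k]])
      also have "(\<lambda>x. U d k x - V d k x) = (\<lambda>x. d * (a d x - b d x))"
        using d by (auto simp: a_def b_def field_simps)
      also have "L2_norm N \<dots> = \<bar>d\<bar> * L2_norm N (\<lambda>x. a d x - b d x)"
        using L2_cmult(2)[OF L2_diff(1)[OF a b]] by simp
      also have "\<dots> \<le> \<bar>d\<bar> * r d"
        unfolding r_def by (intro mult_left_mono L2_diff a b) auto
      finally show ?thesis .
    qed
    with r show "\<exists>r. (r \<longlongrightarrow> 0) (at 0) \<and> (\<forall>d. d \<noteq> 0 \<longrightarrow>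
        \<bar>L2_norm N (\<lambda>x. D (t + d) x - f x) - L2_norm N (\<lambda>x. D t x - f x)\<bar> \<le> \<bar>d\<bar> * r d)"
      by (intro exI[of _ r] conjI) auto
  qed
  have "AE x in N. D 0 x = f x"
    using zero(1) zero(2)[OF uL[OF f], of 0] by eventually_elim (simp add: D_def)
  then have "AE x in N. D t x = f x"
    using AE_eq_iff_L2_norm_diff[OF D f] main by metis
  then have "AE x in N. V t (D t) x = V t f x"
    by (intro unitary_L2_cong_AE[OF v] D f)
  with addV[OF uL[OF f], of t "- t" t] zero(2)[OF uL[OF f], of t]
  show ?thesis by eventually_elim (simp add: D_def)
qed

text \<open>Both evolutions are isometric in f, so agreement on the dense domain suffices. This is
  what identifies the group chosen by \<open>exp_i\<close>.\<close>

lemma unitary_group_unique: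
  assumes U: "unitary_group N U" and V: "unitary_group N V"
    and same: "\<And>f g. f \<in> L2 N \<Longrightarrow> g \<in> L2 N \<Longrightarrow> derives N U f g \<longleftrightarrow> derives N V f g"
    and dense: "\<And>e. e > 0 \<Longrightarrow> \<exists>g h. g \<in> L2 N \<and> h \<in> L2 N \<and> derives N U g h \<and> L2_norm N (\<lambda>x. f x - g x) < e"
    and f: "f \<in> L2 N"
  shows "AE x in N. U t f x = V t f x"
proof -
  have u: "unitary_L2 N (U t)" and v: "unitary_L2 N (V t)"
    using U V by (auto simp: unitary_group_def)
  note uL = unitary_L2_in_L2[OF u] and vL = unitary_L2_in_L2[OF v]
  have "L2_norm N (\<lambda>x. U t f x - V t f x) \<le> 0 + e" if e: "e > 0" for e
  proof -
    obtain g h where gh: "g \<in> L2 N" "h \<in> L2 N" "derives N U g h" "L2_norm N (\<lambda>x. f x - g x) < e / 2"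
      using dense[OF half_gt_zero[OF e]] by blast
    have "L2_norm N (\<lambda>x. U t f x - V t f x) \<le> L2_norm N (\<lambda>x. U t f x - U t g x) + L2_norm N (\<lambda>x. U t g x - V t f x)"
      by (intro L2_norm_diff_triangle uL vL f gh)
    also have "L2_norm N (\<lambda>x. U t g x - V t f x) = L2_norm N (\<lambda>x. V t g x - V t f x)"
      using unitary_group_unique_on_domain[OF U V same gh(1-3), of t]
      by (intro L2_norm_cong_AE L2_measurable L2_diff uL vL f gh) auto
    also have "\<dots> = L2_norm N (\<lambda>x. f x - g x)"
      using unitary_L2_norm_diff[OF v gh(1) f] L2_norm_diff_commute[of N f g] by simp
    also have "L2_norm N (\<lambda>x. U t f x - U t g x) = L2_norm N (\<lambda>x. f x - g x)"
      by (rule unitary_L2_norm_diff[OF u f gh(1)])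
    finally show ?thesis using gh(4) by linarith
  qed
  then have "L2_norm N (\<lambda>x. U t f x - V t f x) \<le> 0" by (rule field_le_epsilon)
  then show ?thesis
    unfolding AE_eq_iff_L2_norm_diff[OF uL[OF f] vL[OF f]] by (simp add: order_antisym)
qed

section \<open>Riemann integrals with values in L^2\<close>

lemma L2_has_integralD:
  assumes "L2_has_integral N F a b I" "e > 0"
  obtains d where "d > 0" "\<And>p. p tagged_division_of {a..b} \<Longrightarrow> (\<lambda>t. ball t d) fine p \<Longrightarrow>
    L2_norm N (\<lambda>x. (\<Sum>(t, k)\<in>p. measure lborel k *\<^sub>R F t x) - I x) < e"
proof -
  have "\<exists>d>0. \<forall>p. p tagged_division_of {a..b} \<and> (\<lambda>t. ball t d) fine p \<longrightarrow>
      L2_norm N (\<lambda>x. (\<Sum>(t, k)\<in>p. measure lborel k *\<^sub>R F t x) - I x) < e"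
    using assms unfolding L2_has_integral_def by simp
  then show thesis using that by blast
qed

text \<open>A tagged division that is fine for both radii exists by Cousin's lemma, and its Riemann
  sum is close to both I and J.\<close>

lemma L2_has_integral_unique:
  assumes "a \<le> b" "L2_has_integral N F a b I" "L2_has_integral N F a b J"
  shows "AE x in N. I x = J x"
proof -
  have I: "I \<in> L2 N" and J: "J \<in> L2 N" and F: "\<And>t. t \<in> {a..b} \<Longrightarrow> F t \<in> L2 N"
    using assms by (auto simp: L2_has_integral_def)
  have "L2_norm N (\<lambda>x. I x - J x) \<le> 0 + e" if e: "e > 0" for e
  proof -
    obtain d1 where d1: "d1 > 0" "\<And>p. p tagged_division_of {a..b} \<Longrightarrow> (\<lambda>t. ball t d1) fine p \<Longrightarrow>
        L2_norm N (\<lambda>x. (\<Sum>(t, k)\<in>p. measure lborel k *\<^sub>R F t x) - I x) < e / 2"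
      using L2_has_integralD[OF assms(2) half_gt_zero[OF e]] by blast
    obtain d2 where d2: "d2 > 0" "\<And>p. p tagged_division_of {a..b} \<Longrightarrow> (\<lambda>t. ball t d2) fine p \<Longrightarrow>
        L2_norm N (\<lambda>x. (\<Sum>(t, k)\<in>p. measure lborel k *\<^sub>R F t x) - J x) < e / 2"
      using L2_has_integralD[OF assms(3) half_gt_zero[OF e]] by blast
    define d where "d = min d1 d2"
    obtain p where p: "p tagged_division_of {a..b}" "(\<lambda>t. ball t d) fine p"
      using fine_division_exists_real[of "\<lambda>t. ball t d" a b] d1 d2 by (auto simp: d_def gauge_def)
    have fine: "(\<lambda>t. ball t d1) fine p" "(\<lambda>t. ball t d2) fine p"
      using p(2) by (auto simp: fine_def d_def subset_iff)
    define R where "R x = (\<Sum>(t, k)\<in>p. measure lborel k *\<^sub>R F t x)" for x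
    have mem: "fst q \<in> {a..b}" if "q \<in> p" for q
      using tagged_division_ofD(2,3)[OF p(1), of "fst q" "snd q"] that by auto
    have R: "R \<in> L2 N"
      unfolding R_def[abs_def] scaleR_conv_of_real case_prod_beta
      by (intro L2_sum L2_cmult F mem tagged_division_of_finite[OF p(1)])
    have "L2_norm N (\<lambda>x. I x - J x) \<le> L2_norm N (\<lambda>x. I x - R x) + L2_norm N (\<lambda>x. R x - J x)"
      by (intro L2_norm_diff_triangle I J R)
    also have "\<dots> < e"
      using d1(2)[OF p(1) fine(1)] d2(2)[OF p(1) fine(2)] L2_norm_diff_commute[of N I R] by (simp add: R_def)
    finally show ?thesis by simp
  qed
  then have "L2_norm N (\<lambda>x. I x - J x) \<le> 0" by (rule field_le_epsilon)
  then show ?thesis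
    unfolding AE_eq_iff_L2_norm_diff[OF I J] by (simp add: order_antisym)
qed

text \<open>A Riemann sum uses finitely many tags, so only finitely many of the null sets, which may
  vary with t, have to be united.\<close>

lemma L2_has_integral_cong_AE:
  assumes "L2_has_integral N F a b I" and G: "\<And>t. t \<in> {a..b} \<Longrightarrow> G t \<in> L2 N"
    and ae: "\<And>t. t \<in> {a..b} \<Longrightarrow> AE x in N. F t x = G t x"
  shows "L2_has_integral N G a b I"
proof -
  have I: "I \<in> L2 N" and F: "\<And>t. t \<in> {a..b} \<Longrightarrow> F t \<in> L2 N"
    using assms by (auto simp: L2_has_integral_def)
  have "L2_norm N (\<lambda>x. (\<Sum>(t, k)\<in>p. measure lborel k *\<^sub>R F t x) - I x) =
        L2_norm N (\<lambda>x. (\<Sum>(t, k)\<in>p. measure lborel k *\<^sub>R G t x) - I x)" if p: "p tagged_division_of {a..b}" for p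
  proof (rule L2_norm_cong_AE)
    have mem: "fst q \<in> {a..b}" if "q \<in> p" for q
      using tagged_division_ofD(2,3)[OF p, of "fst q" "snd q"] that by auto
    have fin: "finite p" using p by (rule tagged_division_of_finite)
    have "AE x in N. \<forall>q\<in>p. F (fst q) x = G (fst q) x"
      using fin mem by (intro AE_finite_allI ae)
    then show "AE x in N. (\<Sum>(t, k)\<in>p. measure lborel k *\<^sub>R F t x) - I x = (\<Sum>(t, k)\<in>p. measure lborel k *\<^sub>R G t x) - I x"
      by eventually_elim (simp add: case_prod_beta)
    show "(\<lambda>x. (\<Sum>(t, k)\<in>p. measure lborel k *\<^sub>R F t x) - I x) \<in> borel_measurable N"
       "(\<lambda>x. (\<Sum>(t, k)\<in>p. measure lborel k *\<^sub>R G t x) - I x) \<in> borel_measurable N"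
      unfolding scaleR_conv_of_real case_prod_beta
      by (intro L2_measurable L2_diff L2_sum L2_cmult I F G fin mem; assumption)+
  qed
  with assms(1) G I show ?thesis unfolding L2_has_integral_def by simp
qed

text \<open>The half-open kernel and the closed interval differ only at the point b.\<close>

lemma oint_has_integral:
  assumes "locint F" "a \<le> b"
  shows "(F has_integral oint a b F) {a..b}"
proof -
  have "integrable lborel (\<lambda>t. orient a b t *\<^sub>R F t)" by (rule locint_orient_integrable[OF assms(1)])
  then have "((\<lambda>t. orient a b t *\<^sub>R F t) has_integral oint a b F) UNIV"
    unfolding oint_def by (rule has_integral_integral_lborel)
  then have "((\<lambda>t. if t \<in> {a..b} then F t else 0) has_integral oint a b F) UNIV"
    by (rule has_integral_spike[where S="{b}", rotated 2]) (use assms(2) in \<open>auto simp: orient_def indicator_def\<close>)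
  then show ?thesis unfolding has_integral_restrict_UNIV .
qed

text \<open>Additivity over a division is borrowed from the gauge integral; each interval is
  recovered from its infimum and supremum.\<close>

lemma oint_tagged_division:
  assumes F: "locint F" and p: "p tagged_division_of {a..b}" and "a \<le> b"
  shows "oint a b F = (\<Sum>(t, k)\<in>p. oint (Inf k) (Sup k) F)"
proof -
  have "integral {a..b} F = (\<Sum>(t, k)\<in>p. integral k F)"
    using oint_has_integral[OF F \<open>a \<le> b\<close>] p
    by (intro integral_combine_tagged_division_topdown[of F a b p, unfolded cbox_interval]) (rule has_integral_integrable)
  also have "\<dots> = (\<Sum>(t, k)\<in>p. oint (Inf k) (Sup k) F)"
  proof (intro sum.cong refl, clarify)
    fix t k assume "(t, k) \<in> p"
    from tagged_division_ofD(2,4)[OF p this] obtain c d where cd: "k = {c..d}" "c \<le> d" by fastforce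
    then show "integral k F = oint (Inf k) (Sup k) F"
      using oint_has_integral[OF F cd(2)] by (simp add: integral_unique)
  qed
  finally show ?thesis using oint_has_integral[OF F \<open>a \<le> b\<close>] by (simp add: integral_unique)
qed

section \<open>The unitary group of a flow\<close>

lemma L2_completion_iff: "f \<in> borel_measurable M \<Longrightarrow> f \<in> L2 (completion M) \<longleftrightarrow> f \<in> L2 M"
  by (auto simp: L2_iff_nn_integral nn_integral_completion measurable_completion)

lemma L2_norm_completion: "f \<in> borel_measurable M \<Longrightarrow> L2_norm (completion M) f = L2_norm M f"
  unfolding L2_norm_def by (subst integral_completion) auto

lemma L2_inner_completion:
  "f \<in> borel_measurable M \<Longrightarrow> g \<in> borel_measurable M \<Longrightarrow> L2_inner (completion M) f g = L2_inner M f g"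
  unfolding L2_inner_def by (subst integral_completion) auto

text \<open>A representative that is measurable for the uncompleted measure and may be composed with
  the flow. Which one is chosen matters only on a null set.\<close>

definition borel_rep :: "'a measure \<Rightarrow> ('a \<Rightarrow> complex) \<Rightarrow> 'a \<Rightarrow> complex" where
  "borel_rep M f = (SOME g. g \<in> borel_measurable M \<and> (AE x in M. f x = g x))"

lemma borel_rep:
  assumes "f \<in> borel_measurable (completion M)"
  shows "borel_rep M f \<in> borel_measurable M" "AE x in M. f x = borel_rep M f x"
proof -
  have "\<exists>g. g \<in> borel_measurable M \<and> (AE x in M. f x = g x)"
    using completion_ex_borel_measurable_complex[OF assms] by blast
  from someI_ex[OF this] show "borel_rep M f \<in> borel_measurable M" "AE x in M. f x = borel_rep M f x"
    by (auto simp: borel_rep_def)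
qed

lemma L2_borel_rep:
  assumes f: "f \<in> L2 (completion M)"
  shows "borel_rep M f \<in> L2 M" "AE x in M. f x = borel_rep M f x" "L2_norm (completion M) f = L2_norm M (borel_rep M f)"
proof -
  note r = borel_rep[OF L2_measurable[OF f]]
  show "AE x in M. f x = borel_rep M f x" by fact
  have "borel_rep M f \<in> L2 (completion M)"
    by (rule L2_cong_AE[OF f]) (use r in \<open>auto simp: AE_completion_iff measurable_completion\<close>)
  then show "borel_rep M f \<in> L2 M" using r by (simp add: L2_completion_iff)
  have "L2_norm (completion M) f = L2_norm (completion M) (borel_rep M f)"
    by (rule L2_norm_cong_AE) (use r L2_measurable[OF f] in \<open>auto simp: AE_completion_iff measurable_completion\<close>)
  then show "L2_norm (completion M) f = L2_norm M (borel_rep M f)"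
    using r by (simp add: L2_norm_completion)
qed

context measure_flow
begin

definition flow_group :: "real \<Rightarrow> ('a \<Rightarrow> complex) \<Rightarrow> 'a \<Rightarrow> complex" where
  "flow_group t f x = borel_rep M f (\<Phi> t x)"

lemma flow_group_L2: "f \<in> L2 (completion M) \<Longrightarrow> flow_group t f \<in> L2 M"
  unfolding flow_group_def[abs_def] by (intro L2_flow L2_borel_rep)

lemma flow_group_L2_completion: "f \<in> L2 (completion M) \<Longrightarrow> flow_group t f \<in> L2 (completion M)"
  using flow_group_L2 by (simp add: L2_completion_iff L2_measurable)

lemma flow_group_rep:
  assumes "f \<in> L2 (completion M)" "g \<in> borel_measurable M" "AE x in M. f x = g x"
  shows "AE x in M. flow_group t f x = g (\<Phi> t x)"
proof -
  have "AE x in M. borel_rep M f x = g x"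
    using L2_borel_rep(2)[OF assms(1)] assms(3) by eventually_elim simp
  then show ?thesis unfolding flow_group_def by (rule AE_flow)
qed

lemma unitary_L2_flow_group: "unitary_L2 (completion M) (flow_group t)"
  unfolding unitary_L2_def
proof (intro conjI ballI allI)
  fix f assume f: "f \<in> L2 (completion M)"
  show "flow_group t f \<in> L2 (completion M)" using f by (rule flow_group_L2_completion)
next
  fix f g a b assume f: "f \<in> L2 (completion M)" and g: "g \<in> L2 (completion M)"
  note rf = L2_borel_rep[OF f] and rg = L2_borel_rep[OF g]
  have "AE x in M. flow_group t (\<lambda>y. a * f y + b * g y) x = a * borel_rep M f (\<Phi> t x) + b * borel_rep M g (\<Phi> t x)"
    using rf rg by (intro flow_group_rep[where g="\<lambda>x. a * borel_rep M f x + b * borel_rep M g x"] L2_add L2_cmult f g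
        borel_measurable_add borel_measurable_times borel_measurable_const L2_measurable[OF rf(1)] L2_measurable[OF rg(1)]) auto
  then show "AE x in completion M. flow_group t (\<lambda>y. a * f y + b * g y) x = a * flow_group t f x + b * flow_group t g x"
    by (simp add: AE_completion_iff flow_group_def)
next
  fix f g assume f: "f \<in> L2 (completion M)" and g: "g \<in> L2 (completion M)"
  note rf = L2_borel_rep[OF f] and rg = L2_borel_rep[OF g]
  have "L2_inner (completion M) (flow_group t f) (flow_group t g) = L2_inner M (borel_rep M f) (borel_rep M g)"
    unfolding flow_group_def[abs_def]
    by (simp add: L2_inner_completion L2_measurable L2_flow rf rg L2_inner_flow)
  also have "\<dots> = L2_inner (completion M) (borel_rep M f) (borel_rep M g)"
    by (simp add: L2_inner_completion L2_measurable rf rg)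
  also have "\<dots> = L2_inner (completion M) f g"
    unfolding L2_inner_def
  proof (rule integral_cong_AE)
    show "AE x in completion M. borel_rep M f x * cnj (borel_rep M g x) = f x * cnj (g x)"
      unfolding AE_completion_iff using rf(2) rg(2) by eventually_elim simp
  qed (use L2_measurable[OF f] L2_measurable[OF g] L2_measurable[OF rf(1)] L2_measurable[OF rg(1)] in \<open>measurable, auto intro: measurable_completion\<close>)
  finally show "L2_inner (completion M) (flow_group t f) (flow_group t g) = L2_inner (completion M) f g" .
next
  fix g assume g: "g \<in> L2 (completion M)"
  note rg = L2_borel_rep[OF g]
  show "\<exists>f\<in>L2 (completion M). AE x in completion M. flow_group t f x = g x"
  proof (intro bexI)
    have f: "flow_group (- t) g \<in> L2 (completion M)" using g by (rule flow_group_L2_completion)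
    show "flow_group (- t) g \<in> L2 (completion M)" by fact
    have "AE x in M. flow_group t (flow_group (- t) g) x = flow_group (- t) g (\<Phi> t x)"
      by (rule flow_group_rep[OF f]) (auto intro: L2_measurable flow_group_L2 g)
    then show "AE x in completion M. flow_group t (flow_group (- t) g) x = g x"
      unfolding AE_completion_iff using flow_add[of t] rg(2) flow_zero
      by eventually_elim (simp add: flow_group_def)
  qed
qed

lemma unitary_group_flow_group: "unitary_group (completion M) flow_group"
  unfolding unitary_group_def
proof (intro conjI ballI allI unitary_L2_flow_group)
  fix f assume f: "f \<in> L2 (completion M)"
  note rf = L2_borel_rep[OF f]
  show "AE x in completion M. flow_group 0 f x = f x"
    unfolding AE_completion_iff using flow_zero rf(2) by eventually_elim (simp add: flow_group_def)
next
  fix s t f assume f: "f \<in> L2 (completion M)"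
  have "AE x in M. flow_group s (flow_group t f) x = flow_group t f (\<Phi> s x)"
    by (rule flow_group_rep) (auto intro: L2_measurable flow_group_L2 flow_group_L2_completion f)
  then show "AE x in completion M. flow_group (s + t) f x = flow_group s (flow_group t f) x"
    unfolding AE_completion_iff using flow_add[of s] by eventually_elim (simp add: flow_group_def add.commute)
next
  fix t f assume f: "f \<in> L2 (completion M)"
  note rf = L2_borel_rep[OF f]
  have eq: "L2_norm (completion M) (\<lambda>x. flow_group s f x - flow_group t f x) =
       L2_norm M (\<lambda>x. borel_rep M f (\<Phi> (s - t) x) - borel_rep M f x)" for s
    using L2_norm_flow_diff[OF rf(1), of s t] L2_norm_completion[OF L2_measurable[OF L2_diff(1)[OF flow_group_L2[OF f, of s] flow_group_L2[OF f, of t]]]]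
    by (simp add: flow_group_def)
  have "((\<lambda>s. L2_norm M (\<lambda>x. borel_rep M f (\<Phi> (s - t) x) - borel_rep M f x)) \<longlongrightarrow> 0) (at t)"
    using LIM_offset[OF flow_continuous[OF rf(1)], of "- t"] by simp
  then show "((\<lambda>s. L2_norm (completion M) (\<lambda>x. flow_group s f x - flow_group t f x)) \<longlongrightarrow> 0) (at t)"
    by (simp add: eq)
qed

lemma derives_flow_group_iff:
  assumes f: "f \<in> L2 (completion M)" and h: "h \<in> L2 (completion M)"
  shows "derives (completion M) flow_group f h \<longleftrightarrow> flow_gen (borel_rep M f) (borel_rep M h)"
proof -
  note rf = L2_borel_rep[OF f] and rh = L2_borel_rep[OF h]
  note m [measurable] = L2_measurable[OF rf(1)] L2_measurable[OF rh(1)]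
  note mc [measurable] = measurable_completion[OF m(1)] measurable_completion[OF m(2)]
    L2_measurable[OF f] L2_measurable[OF h]
  have "L2_norm (completion M) (\<lambda>x. (flow_group d f x - f x) / complex_of_real d - \<i> * h x) =
    L2_norm M (\<lambda>x. (borel_rep M f (\<Phi> d x) - borel_rep M f x) / complex_of_real d - \<i> * borel_rep M h x)" for d
  proof -
    note [measurable] = L2_measurable[OF flow_group_L2_completion[OF f, of d]]
    have "(\<lambda>x. (borel_rep M f (\<Phi> d x) - borel_rep M f x) / complex_of_real d - \<i> * borel_rep M h x) \<in> borel_measurable M"
      by measurable
    note this [THEN measurable_completion, measurable]
    have "L2_norm (completion M) (\<lambda>x. (flow_group d f x - f x) / complex_of_real d - \<i> * h x) =
      L2_norm (completion M) (\<lambda>x. (borel_rep M f (\<Phi> d x) - borel_rep M f x) / complex_of_real d - \<i> * borel_rep M h x)"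
    proof (rule L2_norm_cong_AE)
      show "AE x in completion M. (flow_group d f x - f x) / complex_of_real d - \<i> * h x =
          (borel_rep M f (\<Phi> d x) - borel_rep M f x) / complex_of_real d - \<i> * borel_rep M h x"
        unfolding AE_completion_iff using rf(2) rh(2) by eventually_elim (simp add: flow_group_def)
    qed measurable
    also have "\<dots> = L2_norm M (\<lambda>x. (borel_rep M f (\<Phi> d x) - borel_rep M f x) / complex_of_real d - \<i> * borel_rep M h x)"
      by (rule L2_norm_completion) measurable
    finally show ?thesis .
  qed
  then show ?thesis unfolding derives_def flow_gen_iff[OF rf(1) rh(1)] by simp
qed

lemma flow_gen_cong_AE:
  assumes "f \<in> L2 M" "h \<in> L2 M" "f' \<in> L2 M" "h' \<in> L2 M"
    and ae: "AE x in M. f x = f' x" "AE x in M. h x = h' x" and "flow_gen f h"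
  shows "flow_gen f' h'"
proof -
  note [measurable] = assms(1-4)[THEN L2_measurable]
  have "L2_norm M (\<lambda>x. (f (\<Phi> d x) - f x) / complex_of_real d - \<i> * h x) =
     L2_norm M (\<lambda>x. (f' (\<Phi> d x) - f' x) / complex_of_real d - \<i> * h' x)" for d
  proof (rule L2_norm_cong_AE)
    show "AE x in M. (f (\<Phi> d x) - f x) / complex_of_real d - \<i> * h x = (f' (\<Phi> d x) - f' x) / complex_of_real d - \<i> * h' x"
      using ae AE_flow[OF ae(1), of d] by eventually_elim simp
  qed measurable
  with assms(7) show ?thesis unfolding flow_gen_iff[OF assms(1,2)] flow_gen_iff[OF assms(3,4)] by simp
qed

lemma flow_group_dense:
  assumes f: "f \<in> L2 (completion M)" and "e > 0"
  shows "\<exists>g h. g \<in> L2 (completion M) \<and> h \<in> L2 (completion M) \<and> derives (completion M) flow_group g h \<and>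
    L2_norm (completion M) (\<lambda>x. f x - g x) < e"
proof -
  note rf = L2_borel_rep[OF f]
  obtain g h where gh: "g \<in> L2 M" "h \<in> L2 M" "flow_gen g h" "L2_norm M (\<lambda>x. borel_rep M f x - g x) < e"
    using flow_gen_dense[OF rf(1) \<open>e > 0\<close>] by blast
  have c: "g \<in> L2 (completion M)" "h \<in> L2 (completion M)"
    using gh by (simp_all add: L2_completion_iff L2_measurable)
  have "derives (completion M) flow_group g h"
    unfolding derives_flow_group_iff[OF c]
    using L2_borel_rep[OF c(1)] L2_borel_rep[OF c(2)] gh by (intro flow_gen_cong_AE[OF gh(1,2) _ _ _ _ gh(3)]) auto
  moreover have "L2_norm (completion M) (\<lambda>x. f x - g x) = L2_norm M (\<lambda>x. borel_rep M f x - g x)"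
  proof -
    have "(\<lambda>x. borel_rep M f x - g x) \<in> L2 M" by (intro L2_diff rf gh)
    note m = L2_measurable[OF this]
    have "L2_norm (completion M) (\<lambda>x. f x - g x) = L2_norm (completion M) (\<lambda>x. borel_rep M f x - g x)"
      using rf(2) by (intro L2_norm_cong_AE measurable_completion[OF m] L2_measurable L2_diff f c)
        (auto simp: AE_completion_iff)
    then show ?thesis using L2_norm_completion[OF m] by simp
  qed
  ultimately show ?thesis using gh(4) c by (intro exI[of _ g] exI[of _ h]) simp
qed

text \<open>The Riemann sum minus the pointwise integral is the sum over the intervals k of the
  integrals of f \<circ> \<Phi> t - f \<circ> \<Phi> s over s in k, where t is the tag. Strong
  continuity and Minkowski's inequality bound each by e' times the length of k.\<close>

lemma flow_has_integral:
  assumes f: "f \<in> L2 M" and "a \<le> b"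
  shows "L2_has_integral M (\<lambda>t x. f (\<Phi> t x)) a b (\<lambda>x. oint a b (\<lambda>t. f (\<Phi> t x)))"
  unfolding L2_has_integral_def
proof (intro conjI ballI allI impI)
  show "(\<lambda>x. f (\<Phi> t x)) \<in> L2 M" for t by (rule L2_flow[OF f])
  have om: "case_prod (\<lambda>t x. f (\<Phi> t x)) \<in> borel_measurable (lborel \<Otimes>\<^sub>M M)"
    using orbit_measurable(1)[OF L2_measurable[OF f]] by simp
  show I: "(\<lambda>x. oint a b (\<lambda>t. f (\<Phi> t x))) \<in> L2 M"
    by (rule L2_oint[OF sigma_finite_measure_axioms om, where B="L2_norm M f"]) (auto simp: L2_flow f)
  fix e :: real assume "e > 0"
  \<comment> \<open>Adding 1 to b - a avoids a division by 0 when a = b; the factor 2 keeps the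
    final bound e' * (b - a) strictly below e.\<close>
  define e' where "e' = e / (2 * (b - a + 1))"
  have e': "e' > 0" using \<open>e > 0\<close> \<open>a \<le> b\<close> by (simp add: e'_def)
  have "e * (b - a) < e * (2 * (b - a + 1))"
    using \<open>e > 0\<close> \<open>a \<le> b\<close> by (intro mult_strict_left_mono) auto
  then have e'_less: "e' * (b - a) < e"
    using \<open>a \<le> b\<close> by (simp add: e'_def divide_less_eq)
  have "\<forall>\<^sub>F t in at 0. dist (L2_norm M (\<lambda>x. f (\<Phi> t x) - f x)) 0 < e'"
    using e' by (intro tendstoD[OF flow_continuous[OF f]]) auto
  then obtain \<delta> where \<delta>: "\<delta> > 0" "\<And>t. t \<noteq> 0 \<Longrightarrow> \<bar>t\<bar> < \<delta> \<Longrightarrow> L2_norm M (\<lambda>x. f (\<Phi> t x) - f x) < e'"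
    by (auto simp: eventually_at dist_real_def)
  \<comment> \<open>One \<delta> serves all tags because the norm of the difference depends on s - t
    only.\<close>
  have close: "L2_norm M (\<lambda>x. f (\<Phi> s x) - f (\<Phi> t x)) \<le> e'" if "\<bar>s - t\<bar> < \<delta>" for s t
    using \<delta>(2)[of "s - t"] that e' L2_norm_flow_diff[OF f, of s t] by (cases "s = t") auto
  note [measurable] = L2_measurable[OF f]
  have "L2_norm M (\<lambda>x. (\<Sum>(t, k)\<in>p. measure lborel k *\<^sub>R f (\<Phi> t x)) - oint a b (\<lambda>t. f (\<Phi> t x))) < e"
    if p: "p tagged_division_of {a..b}" "(\<lambda>t. ball t \<delta>) fine p" for p
  proof -
    have fin: "finite p" using p by auto
    define G where "G q x = oint (Inf (snd q)) (Sup (snd q)) (\<lambda>s. f (\<Phi> (fst q) x) - f (\<Phi> s x))" for q x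
    have q: "\<exists>c d. k = {c..d} \<and> c \<le> t \<and> t \<le> d \<and> {c..d} \<subseteq> ball t \<delta>" if "(t, k) \<in> p" for t k
      using tagged_division_ofD(2,4)[OF p(1) that] fineD[OF p(2) that] by fastforce
    have G: "G q \<in> L2 M \<and> L2_norm M (G q) \<le> measure lborel (snd q) * e'" if qp: "q \<in> p" for q
    proof -
      obtain t k where tk: "q = (t, k)" by fastforce
      obtain c d where cd: "k = {c..d}" "c \<le> t" "t \<le> d" "{c..d} \<subseteq> ball t \<delta>"
        using q qp tk by blast
      have eq: "G (t, k) = (\<lambda>x. oint c d (\<lambda>s. f (\<Phi> t x) - f (\<Phi> s x)))"
        using cd by (auto simp: G_def)
      have ms: "case_prod (\<lambda>s x. f (\<Phi> t x) - f (\<Phi> s x)) \<in> borel_measurable (lborel \<Otimes>\<^sub>M M)" by measurable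
      have "L2_norm M (\<lambda>x. f (\<Phi> t x) - f (\<Phi> s x)) \<le> e'" if "s \<in> {min c d..max c d}" for s
        using cd that by (intro close) (auto simp: subset_eq dist_real_def)
      moreover have "(\<lambda>x. f (\<Phi> t x) - f (\<Phi> s x)) \<in> L2 M" for s by (intro L2_diff L2_flow f)
      ultimately show ?thesis unfolding tk eq
        using L2_oint[OF sigma_finite_measure_axioms ms, of c d e'] cd by simp
    qed
    have "AE x in M. (\<Sum>(t, k)\<in>p. measure lborel k *\<^sub>R f (\<Phi> t x)) - oint a b (\<lambda>t. f (\<Phi> t x)) = (\<Sum>q\<in>p. G q x)"
      using AE_orbit_locint[OF f]
    proof eventually_elim
      case (elim x)
      have "(\<Sum>(t, k)\<in>p. measure lborel k *\<^sub>R f (\<Phi> t x)) - oint a b (\<lambda>t. f (\<Phi> t x)) =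
        (\<Sum>(t, k)\<in>p. measure lborel k *\<^sub>R f (\<Phi> t x) - oint (Inf k) (Sup k) (\<lambda>t. f (\<Phi> t x)))"
        unfolding oint_tagged_division[OF elim p(1) \<open>a \<le> b\<close>] by (simp add: case_prod_beta sum_subtractf)
      also have "\<dots> = (\<Sum>q\<in>p. G q x)"
      proof (intro sum.cong refl, clarify)
        fix t k assume "(t, k) \<in> p"
        then obtain c d where cd: "k = {c..d}" "c \<le> t" "t \<le> d" using q by blast
        then show "measure lborel k *\<^sub>R f (\<Phi> t x) - oint (Inf k) (Sup k) (\<lambda>t. f (\<Phi> t x)) = G (t, k) x"
          by (simp add: G_def oint_diff elim oint_const)
      qed
      finally show ?case .
    qed
    then have "L2_norm M (\<lambda>x. (\<Sum>(t, k)\<in>p. measure lborel k *\<^sub>R f (\<Phi> t x)) - oint a b (\<lambda>t. f (\<Phi> t x))) = L2_norm M (\<lambda>x. \<Sum>q\<in>p. G q x)"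
      using G L2_measurable[OF I] by (intro L2_norm_cong_AE) (auto intro!: borel_measurable_sum borel_measurable_diff simp: case_prod_beta L2_measurable)
    also have "\<dots> \<le> (\<Sum>q\<in>p. L2_norm M (G q))" using G fin by (intro L2_sum) auto
    also have "\<dots> \<le> (\<Sum>q\<in>p. measure lborel (snd q) * e')" using G by (intro sum_mono) auto
    also have "\<dots> = (\<Sum>(t, k)\<in>p. measure lborel k) * e'" by (simp add: sum_distrib_right case_prod_beta)
    also have "(\<Sum>(t, k)\<in>p. measure lborel k) = b - a"
      using additive_content_tagged_division[of p a b] p \<open>a \<le> b\<close> by (simp add: cbox_interval)
    finally show ?thesis using e'_less by (simp add: mult.commute)
  qed
  then show "\<exists>\<delta>>0. \<forall>p. p tagged_division_of {a..b} \<and> (\<lambda>t. ball t \<delta>) fine p \<longrightarrow>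
      L2_norm M (\<lambda>x. (\<Sum>(t, k)\<in>p. measure lborel k *\<^sub>R f (\<Phi> t x)) - oint a b (\<lambda>t. f (\<Phi> t x))) < e"
    using \<delta>(1) by blast
qed

lemma L2_has_integral_completion:
  assumes "L2_has_integral M F a b I" "a \<le> b"
  shows "L2_has_integral (completion M) F a b I"
proof -
  have I: "I \<in> L2 M" and F: "\<And>t. t \<in> {a..b} \<Longrightarrow> F t \<in> L2 M"
    using assms by (auto simp: L2_has_integral_def)
  have "L2_norm (completion M) (\<lambda>x. (\<Sum>(t, k)\<in>p. measure lborel k *\<^sub>R F t x) - I x) =
    L2_norm M (\<lambda>x. (\<Sum>(t, k)\<in>p. measure lborel k *\<^sub>R F t x) - I x)" if p: "p tagged_division_of {a..b}" for p
  proof (rule L2_norm_completion)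
    have "fst q \<in> {a..b}" if "q \<in> p" for q
      using tagged_division_ofD(2,3)[OF p, of "fst q" "snd q"] that by auto
    then show "(\<lambda>x. (\<Sum>(t, k)\<in>p. measure lborel k *\<^sub>R F t x) - I x) \<in> borel_measurable M"
      unfolding case_prod_beta
      by (intro borel_measurable_diff borel_measurable_sum borel_measurable_scaleR borel_measurable_const L2_measurable I F)
  qed
  with assms(1) show ?thesis
    using I F unfolding L2_has_integral_def by (simp add: L2_completion_iff L2_measurable)
qed

section \<open>Identification of the chosen group and the chosen time average with the flow\<close>

context
  fixes H :: "'a operator_graph"
  assumes H: "\<And>f h. f \<in> L2 (completion M) \<Longrightarrow> h \<in> L2 (completion M) \<Longrightarrow>
    (f, h) \<in> H \<longleftrightarrow> flow_gen (borel_rep M f) (borel_rep M h)"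
begin

lemma generates_flow_group: "generates_group (completion M) H flow_group"
  unfolding generates_group_def
  using unitary_group_flow_group H derives_flow_group_iff unfolding derives_def by simp

text \<open>\<open>flow_group\<close> shows that the choice in \<open>exp_i\<close> is made from a
  nonempty set, and uniqueness of the generated group identifies the chosen element with it.\<close>

lemma exp_i_flow:
  assumes f: "f \<in> L2 (completion M)"
  shows "exp_i (completion M) H t f \<in> L2 (completion M)" "AE x in completion M. exp_i (completion M) H t f x = flow_group t f x"
proof -
  have g: "generates_group (completion M) H (exp_i (completion M) H)"
    unfolding exp_i_def using generates_flow_group by (rule someI[of "generates_group (completion M) H"])
  then have U: "unitary_group (completion M) (exp_i (completion M) H)" by (simp add: generates_group_def)
  then show "exp_i (completion M) H t f \<in> L2 (completion M)"
    using f by (simp add: unitary_group_def unitary_L2_def)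
  have same: "derives (completion M) flow_group f h \<longleftrightarrow> derives (completion M) (exp_i (completion M) H) f h"
    if "f \<in> L2 (completion M)" "h \<in> L2 (completion M)" for f h
    using g generates_flow_group that unfolding generates_group_def derives_def by blast
  have "AE x in completion M. flow_group t f x = exp_i (completion M) H t f x"
    by (rule unitary_group_unique[OF unitary_group_flow_group U same flow_group_dense[OF f] f])
  then show "AE x in completion M. exp_i (completion M) H t f x = flow_group t f x"
    by eventually_elim simp
qed

text \<open>The pointwise integral along orbits is one Riemann integral of the chosen group; by
  uniqueness the choice in \<open>L2_integral\<close> agrees with it almost everywhere.\<close>

lemma time_average_flow:
  assumes f: "f \<in> L2 (completion M)" and "T > 0"
  shows "time_average (completion M) H T f \<in> L2 (completion M)"
    "AE x in M. time_average (completion M) H T f x = flow_average T (borel_rep M f) x"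
proof -
  note rf = L2_borel_rep[OF f]
  have "L2_has_integral (completion M) (\<lambda>t x. borel_rep M f (\<Phi> t x)) (- T) T (\<lambda>x. oint (- T) T (\<lambda>t. borel_rep M f (\<Phi> t x)))"
    using \<open>T > 0\<close> by (intro L2_has_integral_completion flow_has_integral rf) auto
  then have int: "L2_has_integral (completion M) (\<lambda>t. exp_i (completion M) H t f) (- T) T (\<lambda>x. oint (- T) T (\<lambda>t. borel_rep M f (\<Phi> t x)))"
  proof (rule L2_has_integral_cong_AE)
    show "AE x in completion M. borel_rep M f (\<Phi> t x) = exp_i (completion M) H t f x" for t
      using exp_i_flow(2)[OF f, of t] by eventually_elim (simp add: flow_group_def)
  qed (rule exp_i_flow[OF f])
  define J where "J = L2_integral (completion M) (- T) T (\<lambda>t. exp_i (completion M) H t f)"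
  have J: "L2_has_integral (completion M) (\<lambda>t. exp_i (completion M) H t f) (- T) T J"
    unfolding J_def L2_integral_def using int
    by (rule someI[of "L2_has_integral (completion M) (\<lambda>t. exp_i (completion M) H t f) (- T) T"])
  have ta: "time_average (completion M) H T f = (\<lambda>x. complex_of_real (1 / (2 * T)) * J x)"
    by (simp add: time_average_def J_def)
  show "time_average (completion M) H T f \<in> L2 (completion M)"
    unfolding ta using J by (intro L2_cmult) (simp add: L2_has_integral_def)
  have "AE x in M. J x = oint (- T) T (\<lambda>t. borel_rep M f (\<Phi> t x))"
    using L2_has_integral_unique[OF _ J int] \<open>T > 0\<close> by (simp add: AE_completion_iff)
  then show "AE x in M. time_average (completion M) H T f x = flow_average T (borel_rep M f) x"
    by eventually_elim (simp add: ta flow_average_def)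
qed

end

end

section \<open>Test functions\<close>

text \<open>Smoothness without a formula for the n-th derivative: it is enough to exhibit a class of
  differentiable functions that \<open>deriv\<close> maps into itself.\<close>

lemma smooth_if_closed_class:
  assumes step: "\<And>\<phi>. \<phi> \<in> F \<Longrightarrow> (\<forall>x. \<phi> differentiable at x) \<and> deriv \<phi> \<in> F" and "\<phi> \<in> F"
  shows "(deriv ^^ n) \<phi> differentiable at (x :: real)"
proof -
  have "(deriv ^^ n) \<phi> \<in> F" by (induction n) (use assms in auto)
  with step show ?thesis by blast
qed

lemma DERIV_zero_if_quadratic_bound:
  fixes f :: "real \<Rightarrow> real"
  assumes bound: "\<And>y. \<bar>f y\<bar> \<le> C * (y - x)\<^sup>2"
  shows "(f has_real_derivative 0) (at x)"
proof -
  have fx: "f x = 0" using bound[of x] by simp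
  have "((\<lambda>h. (f (x + h) - f x) / h) \<longlongrightarrow> 0) (at 0)"
  proof (rule Lim_null_comparison)
    have "\<bar>f (x + h) / h\<bar> \<le> C * \<bar>h\<bar>" if "h \<noteq> 0" for h
      using bound[of "x + h"] that by (simp add: divide_le_eq power2_eq_square mult.assoc)
    then show "\<forall>\<^sub>F h in at 0. norm ((f (x + h) - f x) / h) \<le> C * \<bar>h\<bar>"
      using fx by (auto simp: eventually_at_filter)
    show "((\<lambda>h. C * \<bar>h\<bar>) \<longlongrightarrow> 0) (at 0)"
      by (rule tendsto_eq_intros refl | simp)+
  qed
  then show ?thesis by (simp add: DERIV_def)
qed

text \<open>From (u / n)^n \<le> (1 + u / n)^n \<le> exp u, which gives the bound n^n for n >
  0.\<close>

lemma power_times_exp_minus_bounded: "\<exists>K. \<forall>u\<ge>0. u ^ n * exp (- u) \<le> (K :: real)"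
proof (cases "n = 0")
  case False
  have "u ^ n * exp (- u) \<le> real n ^ n" if "u \<ge> 0" for u
  proof -
    have "(u / n) ^ n \<le> (1 + u / n) ^ n" using that by (intro power_mono) auto
    also have "\<dots> \<le> exp u"
      using that False by (intro exp_ge_one_plus_x_over_n_power_n) auto
    finally have "u ^ n \<le> real n ^ n * exp u" using False by (simp add: power_divide field_simps)
    then show ?thesis by (simp add: exp_minus field_simps)
  qed
  then show ?thesis by blast
qed (auto intro!: exI[of _ 1])

text \<open>The bump exp (-c / ((x - a) (b - x))) together with all rational factors that
  differentiation can produce. The parameter c is sent to 0 in
  \<open>fundamental_lemma\<close>.\<close>

definition bump_class :: "real \<Rightarrow> real \<Rightarrow> real \<Rightarrow> real poly \<Rightarrow> nat \<Rightarrow> real \<Rightarrow> real" where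
  "bump_class a b c P k x = (if a < x \<and> x < b
     then poly P x / ((x - a) * (b - x)) ^ k * exp (- (c / ((x - a) * (b - x)))) else 0)"

text \<open>Put q = (y - a) (b - y). Boundedness of u^(k + 2) exp (-u) at u = c / q absorbs the pole
  q^(-k) and leaves a factor q^2, while q \<le> (b - a) |y - x| for either endpoint x.\<close>

lemma bump_class_quadratic_bound:
  assumes ab: "a < b" and c: "c > 0" and x: "x = a \<or> x = b"
  shows "\<exists>C. \<forall>y. \<bar>bump_class a b c P k y\<bar> \<le> C * (y - x)\<^sup>2"
proof -
  have "compact ((\<lambda>y. \<bar>poly P y\<bar>) ` {a..b})"
    by (intro compact_continuous_image continuous_intros) auto
  then obtain A where A: "\<And>y. a \<le> y \<Longrightarrow> y \<le> b \<Longrightarrow> \<bar>poly P y\<bar> \<le> A"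
    using compact_imp_bounded bounded_real by (force simp: bounded_iff)
  obtain K where K: "\<And>u. u \<ge> 0 \<Longrightarrow> u ^ (k + 2) * exp (- u) \<le> (K :: real)"
    using power_times_exp_minus_bounded[of "k + 2"] by blast
  have A0: "A \<ge> 0" using A[of a] ab by linarith
  have K0: "K \<ge> 0" using K[of 0] by simp
  define C where "C = A * (K / c ^ (k + 2)) * (b - a)\<^sup>2"
  have C0: "C \<ge> 0" using A0 K0 c by (simp add: C_def)
  have "\<bar>bump_class a b c P k y\<bar> \<le> C * (y - x)\<^sup>2" for y
  proof (cases "a < y \<and> y < b")
    case True
    define q where "q = (y - a) * (b - y)"
    have q: "q > 0" using True by (simp add: q_def)
    have "q \<le> (b - a) * \<bar>y - x\<bar>"
      using x
    proof
      assume "x = a"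
      then show ?thesis using True by (auto simp: q_def mult.commute intro!: mult_mono)
    next
      assume "x = b"
      then show ?thesis using True by (auto simp: q_def intro!: mult_mono)
    qed
    then have "q\<^sup>2 \<le> ((b - a) * \<bar>y - x\<bar>)\<^sup>2" using q by (intro power_mono) auto
    then have q2: "q\<^sup>2 \<le> (b - a)\<^sup>2 * (y - x)\<^sup>2" by (simp add: power_mult_distrib)
    have "(c / q) ^ (k + 2) * exp (- (c / q)) \<le> K" using q c by (intro K) auto
    then have "exp (- (c / q)) / q ^ k \<le> K / c ^ (k + 2) * q\<^sup>2"
      using q c by (simp add: power_divide field_simps power_add power2_eq_square)
    have "\<bar>bump_class a b c P k y\<bar> = \<bar>poly P y\<bar> * (exp (- (c / q)) / q ^ k)"
      using True q by (simp add: bump_class_def q_def abs_mult)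
    also have "\<dots> \<le> A * (K / c ^ (k + 2) * ((b - a)\<^sup>2 * (y - x)\<^sup>2))"
    proof (intro mult_mono)
      show "exp (- (c / q)) / q ^ k \<le> K / c ^ (k + 2) * ((b - a)\<^sup>2 * (y - x)\<^sup>2)"
        using \<open>exp (- (c / q)) / q ^ k \<le> _\<close> q2 K0 c by (meson mult_left_mono order_trans divide_nonneg_pos zero_less_power)
    qed (use A[of y] True A0 q in auto)
    finally show ?thesis by (simp add: C_def mult.assoc)
  qed (auto simp: bump_class_def C0)
  then show ?thesis by blast
qed

text \<open>Inside the interval, differentiating P / Q^k * exp (-c / Q) and taking Q^(k + 2) as
  common denominator gives exactly the numerator P'. At the two endpoints the quadratic bound makes
  the derivative 0.\<close>

lemma bump_class_DERIV:
  fixes P :: "real poly" and k :: nat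
  assumes ab: "a < b" and c: "c > 0"
  defines "Q \<equiv> [:-a, 1:] * [:b, -1:]"
  defines "P' \<equiv> pderiv P * Q ^ 2 - smult (of_nat k) (pderiv Q * P * Q) + smult c (pderiv Q * P)"
  shows "(bump_class a b c P k has_real_derivative bump_class a b c P' (k + 2) x) (at x)"
proof -
  consider "a < x" "x < b" | "x < a \<or> x > b" | "x = a \<or> x = b" by linarith
  then show ?thesis
  proof cases
    case 1
    have Q: "poly Q y = (y - a) * (b - y)" for y by (simp add: Q_def algebra_simps)
    have nz: "poly Q x \<noteq> 0" using 1 by (simp add: Q)
    have "((\<lambda>y. poly P y / poly Q y ^ k * exp (- (c / poly Q y))) has_real_derivative
        (poly (pderiv P) x * poly Q x ^ k - poly P x * (real k * (poly (pderiv Q) x * poly Q x ^ (k - 1)))) /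
          (poly Q x ^ k * poly Q x ^ k) * exp (- (c / poly Q x)) +
        poly P x / poly Q x ^ k * (exp (- (c / poly Q x)) * (c * poly (pderiv Q) x / (poly Q x * poly Q x)))) (at x)"
      using nz by (auto intro!: derivative_eq_intros) (simp add: field_simps)
    moreover have "(poly (pderiv P) x * poly Q x ^ k - poly P x * (real k * (poly (pderiv Q) x * poly Q x ^ (k - 1)))) /
          (poly Q x ^ k * poly Q x ^ k) * exp (- (c / poly Q x)) +
        poly P x / poly Q x ^ k * (exp (- (c / poly Q x)) * (c * poly (pderiv Q) x / (poly Q x * poly Q x))) =
        poly P' x / poly Q x ^ (k + 2) * exp (- (c / poly Q x))"
      using nz by (cases k) (simp_all add: P'_def field_simps power2_eq_square)
    ultimately have "((\<lambda>y. poly P y / poly Q y ^ k * exp (- (c / poly Q y))) has_real_derivative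
        bump_class a b c P' (k + 2) x) (at x)"
      using 1 by (simp add: bump_class_def Q)
    then show ?thesis
      by (rule has_field_derivative_transform_within_open[where S="{a<..<b}"]) (use 1 in \<open>auto simp: bump_class_def Q\<close>)
  next
    case 2
    have "((\<lambda>_. 0) has_real_derivative 0) (at x)" by simp
    then have "(bump_class a b c P k has_real_derivative 0) (at x)"
      by (rule has_field_derivative_transform_within_open[where S="{..<a} \<union> {b<..}"]) (use 2 in \<open>auto simp: bump_class_def\<close>)
    then show ?thesis using 2 by (auto simp: bump_class_def)
  next
    case 3
    then obtain C where "\<And>y. \<bar>bump_class a b c P k y\<bar> \<le> C * (y - x)\<^sup>2"
      using bump_class_quadratic_bound[OF ab c] by blast
    then have "(bump_class a b c P k has_real_derivative 0) (at x)"
      by (rule DERIV_zero_if_quadratic_bound)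
    then show ?thesis using 3 by (auto simp: bump_class_def)
  qed
qed

definition bump :: "real \<Rightarrow> real \<Rightarrow> real \<Rightarrow> real \<Rightarrow> real" where
  "bump a b c x = (if a < x \<and> x < b then exp (- (c / ((x - a) * (b - x)))) else 0)"

lemma test_fun_bump:
  assumes "a < b" "c > 0" shows "test_fun (bump a b c)"
proof -
  have "(deriv ^^ n) \<phi> differentiable at x" if "\<phi> \<in> {bump_class a b c P k | P k. True}" for n x \<phi>
  proof (rule smooth_if_closed_class[OF _ that])
    fix \<phi> assume "\<phi> \<in> {bump_class a b c P k | P k. True}"
    then obtain P k where \<phi>: "\<phi> = bump_class a b c P k" by blast
    obtain P' where D: "\<And>x. (\<phi> has_real_derivative bump_class a b c P' (k + 2) x) (at x)"
      using bump_class_DERIV[OF assms, of P k] \<phi> by blast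
    then have "deriv \<phi> = bump_class a b c P' (k + 2)" by (auto simp: fun_eq_iff DERIV_imp_deriv)
    with D show "(\<forall>x. \<phi> differentiable at x) \<and> deriv \<phi> \<in> {bump_class a b c P k | P k. True}"
      using real_differentiable_def by blast
  qed
  moreover have "bump a b c = bump_class a b c 1 0"
    by (auto simp: bump_def bump_class_def)
  ultimately have "\<forall>n x. (deriv ^^ n) (bump a b c) differentiable at x" by blast
  moreover have "\<forall>x. \<bar>x\<bar> > max \<bar>a\<bar> \<bar>b\<bar> \<longrightarrow> bump a b c x = 0" by (auto simp: bump_def)
  ultimately show ?thesis unfolding test_fun_def by blast
qed

lemma bump_le_1: "c > 0 \<Longrightarrow> \<bar>bump a b c x\<bar> \<le> 1"
  by (auto simp: bump_def)

lemma test_fun_differentiable: "test_fun \<phi> \<Longrightarrow> (\<phi> has_real_derivative deriv \<phi> x) (at x)"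
  unfolding test_fun_def using DERIV_deriv_iff_real_differentiable[of \<phi> x] by (metis funpow_0)

lemma test_fun_isCont: "test_fun \<phi> \<Longrightarrow> isCont \<phi> x"
  using test_fun_differentiable DERIV_isCont by blast

lemma test_fun_deriv: assumes "test_fun \<phi>" shows "test_fun (deriv \<phi>)"
proof -
  obtain R where R: "\<And>x. \<bar>x\<bar> > R \<Longrightarrow> \<phi> x = 0" using assms unfolding test_fun_def by blast
  have "deriv \<phi> x = 0" if "\<bar>x\<bar> > R" for x
  proof -
    have "((\<lambda>_. 0) has_real_derivative 0) (at x)" by simp
    then have "(\<phi> has_real_derivative 0) (at x)"
      by (rule has_field_derivative_transform_within_open[where S="{y. \<bar>y\<bar> > R}"])
        (use that R in \<open>auto intro!: open_Collect_less continuous_intros\<close>)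
    then show ?thesis by (rule DERIV_imp_deriv)
  qed
  moreover have "(deriv ^^ n) (deriv \<phi>) differentiable at x" for n x
    using assms unfolding test_fun_def by (metis funpow_Suc_right comp_apply)
  ultimately show ?thesis unfolding test_fun_def by blast
qed

lemma test_fun_support:
  assumes "test_fun \<phi>"
  obtains R where "R > 0" "\<And>x. \<bar>x\<bar> > R \<Longrightarrow> \<phi> x = 0"
proof -
  obtain R where "\<And>x. \<bar>x\<bar> > R \<Longrightarrow> \<phi> x = 0" using assms unfolding test_fun_def by blast
  then show thesis using that[of "max R 1"] by auto
qed

lemma test_fun_measurable: "test_fun \<phi> \<Longrightarrow> \<phi> \<in> borel_measurable borel"
  by (intro borel_measurable_continuous_onI continuous_at_imp_continuous_on) (auto intro: test_fun_isCont)

lemma test_fun_bounded: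
  assumes "test_fun \<phi>" shows "\<exists>C. \<forall>x. \<bar>\<phi> x\<bar> \<le> C"
proof -
  obtain R where R: "R > 0" "\<And>x. \<bar>x\<bar> > R \<Longrightarrow> \<phi> x = 0" using test_fun_support[OF assms] by blast
  have "compact (\<phi> ` {-R..R})"
    by (intro compact_continuous_image continuous_at_imp_continuous_on) (auto intro: test_fun_isCont assms)
  then obtain C where C: "\<And>x. x \<in> {-R..R} \<Longrightarrow> \<bar>\<phi> x\<bar> \<le> C"
    using compact_imp_bounded by (force simp: bounded_iff)
  have "\<bar>\<phi> x\<bar> \<le> max C 0" for x
    using C[of x] R(2)[of x] by (cases "\<bar>x\<bar> > R") (auto simp: abs_le_iff not_less)
  then show ?thesis by blast
qed

lemma test_fun_locint_integrable:
  assumes "test_fun \<phi>" "locint F"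
  shows "integrable lborel (\<lambda>s. \<phi> s *\<^sub>R F s)"
proof -
  obtain R where R: "R > 0" "\<And>x. \<bar>x\<bar> > R \<Longrightarrow> \<phi> x = 0" using test_fun_support[OF assms(1)] by blast
  obtain C where "\<forall>x. \<bar>\<phi> x\<bar> \<le> C" using test_fun_bounded[OF assms(1)] by blast
  with R show ?thesis
    by (intro locint_integrable[OF assms(2) test_fun_measurable[OF assms(1)], of C R]) auto
qed

lemma test_fun_integrable: "test_fun \<phi> \<Longrightarrow> integrable lborel \<phi>"
  using test_fun_locint_integrable[of \<phi> "\<lambda>_. 1"] by (simp add: scaleR_conv_of_real complex_of_real_integrable_eq)

lemma test_fun_lincomb:
  assumes "test_fun \<phi>" "test_fun \<zeta>"
  shows "test_fun (\<lambda>x. \<phi> x + \<alpha> * \<zeta> x)"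
proof -
  obtain R where R: "R > 0" "\<And>x. \<bar>x\<bar> > R \<Longrightarrow> \<phi> x = 0" using test_fun_support[OF assms(1)] by blast
  obtain R' where R': "R' > 0" "\<And>x. \<bar>x\<bar> > R' \<Longrightarrow> \<zeta> x = 0" using test_fun_support[OF assms(2)] by blast
  let ?F = "{(\<lambda>x. \<phi> x + \<alpha> * \<zeta> x) | \<phi> \<zeta>. test_fun \<phi> \<and> test_fun \<zeta>}"
  have "(deriv ^^ n) (\<lambda>x. \<phi> x + \<alpha> * \<zeta> x) differentiable at x" for n x
  proof (rule smooth_if_closed_class[where F="?F"])
    fix \<theta> assume "\<theta> \<in> ?F"
    then obtain f g where fg: "\<theta> = (\<lambda>x. f x + \<alpha> * g x)" "test_fun f" "test_fun g" by blast
    have D: "(\<theta> has_real_derivative deriv f x + \<alpha> * deriv g x) (at x)" for x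
      unfolding fg(1) by (intro DERIV_add DERIV_cmult test_fun_differentiable fg)
    then have "deriv \<theta> = (\<lambda>x. deriv f x + \<alpha> * deriv g x)"
      by (auto simp: fun_eq_iff intro: DERIV_imp_deriv)
    with D show "(\<forall>x. \<theta> differentiable at x) \<and> deriv \<theta> \<in> ?F"
      using real_differentiable_def test_fun_deriv[OF fg(2)] test_fun_deriv[OF fg(3)] by blast
  qed (use assms in blast)
  moreover have "\<forall>x. \<bar>x\<bar> > max R R' \<longrightarrow> \<phi> x + \<alpha> * \<zeta> x = 0" using R R' by auto
  ultimately show ?thesis unfolding test_fun_def by blast
qed

text \<open>The primitive normalised at -R vanishes to the left because \<theta> does; it vanishes
  to the right because its value there is the total integral.\<close>

lemma test_fun_primitive:
  assumes \<theta>: "test_fun \<theta>" and zero: "(\<integral>x. \<theta> x \<partial>lborel) = 0"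
  shows "\<exists>\<phi>. test_fun \<phi> \<and> deriv \<phi> = \<theta>"
proof -
  obtain R where R: "R > 0" "\<And>x. \<bar>x\<bar> > R \<Longrightarrow> \<theta> x = 0" using test_fun_support[OF \<theta>] by blast
  obtain F where F: "\<And>x. (F has_vector_derivative \<theta> x) (at x)"
    using einterval_antiderivative[of "-\<infinity>" "\<infinity>" \<theta>] test_fun_isCont[OF \<theta>] by auto
  define \<phi> where "\<phi> x = F x - F (- R)" for x
  have D: "(\<phi> has_real_derivative \<theta> x) (at x)" for x
    unfolding \<phi>_def[abs_def] using F[of x]
    by (auto intro!: derivative_eq_intros simp: has_real_derivative_iff_has_vector_derivative)
  have d: "deriv \<phi> = \<theta>" using D by (auto intro: DERIV_imp_deriv)
  have cont: "continuous_on A \<phi>" for A using D by (intro DERIV_continuous_on) (auto intro: has_field_derivative_at_within)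
  have D0: "(\<phi> has_real_derivative 0) (at y)" if "\<bar>y\<bar> > R" for y
    using D[of y] R(2)[OF that] by simp
  have left: "\<phi> x = 0" if "x < - R" for x
  proof -
    have "\<phi> (- R) = \<phi> x"
      using that by (intro DERIV_isconst_end[of x "- R" \<phi>] cont) (use R(1) in \<open>auto intro!: D0\<close>)
    then show ?thesis by (simp add: \<phi>_def)
  qed
  have "(\<theta> has_integral (\<phi> R - \<phi> (- R))) {-R..R}"
    using R(1) D by (intro fundamental_theorem_of_calculus)
      (auto simp flip: has_real_derivative_iff_has_vector_derivative intro: has_field_derivative_at_within)
  moreover have "(\<theta> has_integral 0) {-R..R}"
  proof -
    have "(\<theta> has_integral 0) UNIV"
      using has_integral_integral_lborel[OF test_fun_integrable[OF \<theta>]] zero by simp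
    then have "((\<lambda>x. if x \<in> {-R..R} then \<theta> x else 0) has_integral 0) UNIV"
      by (rule has_integral_eq[rotated]) (use R(2) in force)
    then show ?thesis unfolding has_integral_restrict_UNIV .
  qed
  ultimately have "\<phi> R - \<phi> (- R) = 0" by (rule has_integral_unique)
  then have "\<phi> R = 0" by (simp add: \<phi>_def)
  have right: "\<phi> x = 0" if "x > R" for x
  proof -
    have "\<phi> x = \<phi> R"
      using that by (intro DERIV_isconst_end[of R x \<phi>] cont) (use R(1) in \<open>auto intro!: D0\<close>)
    with \<open>\<phi> R = 0\<close> show ?thesis by simp
  qed
  have "(deriv ^^ n) \<phi> differentiable at x" for n x
  proof (cases n)
    case 0 then show ?thesis using D real_differentiable_def by auto
  next
    case (Suc m)
    then have "(deriv ^^ n) \<phi> = (deriv ^^ m) \<theta>" by (simp add: funpow_Suc_right d del: funpow.simps)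
    then show ?thesis using \<theta> unfolding test_fun_def by simp
  qed
  moreover have "\<forall>x. \<bar>x\<bar> > R \<longrightarrow> \<phi> x = 0" using left right by force
  ultimately have "test_fun \<phi>" unfolding test_fun_def by blast
  with d show ?thesis by blast
qed

section \<open>The fundamental lemma and the distributional derivative\<close>

text \<open>\<open>ennreal\<close> truncates negative values, so \<open>ennreal (u t)\<close> and
  \<open>ennreal (- u t)\<close> are the densities u^+ and u^-. The hypothesis says that the two
  finite measures agree on half-lines, hence they are equal, and densities are unique almost
  everywhere.\<close>

lemma AE_zero_if_tail_integrals_zero:
  fixes u :: "real \<Rightarrow> real"
  assumes u: "integrable lborel u" and zero: "\<And>x. (\<integral>t. indicator {x<..} t * u t \<partial>lborel) = 0"
  shows "AE t in lborel. u t = 0"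
proof -
  have [measurable]: "u \<in> borel_measurable borel" using u by auto
  have split: "u t = max 0 (u t) - max 0 (- u t)" for t by auto
  have up: "integrable lborel (\<lambda>t. max 0 (u t))" and um: "integrable lborel (\<lambda>t. max 0 (- u t))"
    using u by auto
  have tail: "integrable lborel (\<lambda>t. indicator {x<..} t * max 0 (u t))" "integrable lborel (\<lambda>t. indicator {x<..} t * max 0 (- u t))" for x
    using integrable_mult_indicator[OF _ up, of "{x<..}"] integrable_mult_indicator[OF _ um, of "{x<..}"] by auto
  have em: "emeasure (density lborel (\<lambda>t. ennreal (u t))) {x<..} = ennreal (\<integral>t. indicator {x<..} t * max 0 (u t) \<partial>lborel)"
       "emeasure (density lborel (\<lambda>t. ennreal (- u t))) {x<..} = ennreal (\<integral>t. indicator {x<..} t * max 0 (- u t) \<partial>lborel)" for x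
  proof -
    have "emeasure (density lborel (\<lambda>t. ennreal (u t))) {x<..} = (\<integral>\<^sup>+t. ennreal (indicator {x<..} t * max 0 (u t)) \<partial>lborel)"
      by (subst emeasure_density) (auto intro!: nn_integral_cong simp: indicator_def max_def ennreal_neg)
    then show "emeasure (density lborel (\<lambda>t. ennreal (u t))) {x<..} = ennreal (\<integral>t. indicator {x<..} t * max 0 (u t) \<partial>lborel)"
      using tail by (subst nn_integral_eq_integral[symmetric]) auto
    have "emeasure (density lborel (\<lambda>t. ennreal (- u t))) {x<..} = (\<integral>\<^sup>+t. ennreal (indicator {x<..} t * max 0 (- u t)) \<partial>lborel)"
      by (subst emeasure_density) (auto intro!: nn_integral_cong simp: indicator_def max_def ennreal_neg)
    then show "emeasure (density lborel (\<lambda>t. ennreal (- u t))) {x<..} = ennreal (\<integral>t. indicator {x<..} t * max 0 (- u t) \<partial>lborel)"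
      using tail by (subst nn_integral_eq_integral[symmetric]) auto
  qed
  have "density lborel (\<lambda>t. ennreal (u t)) = density lborel (\<lambda>t. ennreal (- u t))"
  proof (rule measure_eqI_lessThan)
    fix x :: real
    have "(\<integral>t. indicator {x<..} t * u t \<partial>lborel) =
       (\<integral>t. indicator {x<..} t * max 0 (u t) - indicator {x<..} t * max 0 (- u t) \<partial>lborel)"
      by (intro Bochner_Integration.integral_cong refl) (auto simp: indicator_def)
    also have "\<dots> = (\<integral>t. indicator {x<..} t * max 0 (u t) \<partial>lborel) - (\<integral>t. indicator {x<..} t * max 0 (- u t) \<partial>lborel)"
      using tail by (rule Bochner_Integration.integral_diff)
    finally show "emeasure (density lborel (\<lambda>t. ennreal (u t))) {x<..} = emeasure (density lborel (\<lambda>t. ennreal (- u t))) {x<..}"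
      unfolding em using zero[of x] by simp
    show "emeasure (density lborel (\<lambda>t. ennreal (u t))) {x<..} < \<infinity>" unfolding em by simp
  qed auto
  then have "AE t in lborel. ennreal (u t) = ennreal (- u t)"
    by (intro sigma_finite_measure.density_unique[OF sigma_finite_lborel]) auto
  then show ?thesis
    by eventually_elim (metis ennreal_eq_0_iff ennreal_inj linorder_le_cases neg_0_le_iff_le neg_le_0_iff_le order_antisym)
qed

text \<open>Cutting v to (-R, R) makes it integrable, and its tail integrals are interval integrals.
  The tail criterion is applied to real and imaginary part, and R runs through the positive
  integers.\<close>

lemma AE_zero_if_interval_integrals_zero:
  assumes v: "locint v" and zero: "\<And>a b. a < b \<Longrightarrow> (\<integral>t. indicator {a<..<b} t *\<^sub>R v t \<partial>lborel) = 0"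
  shows "AE t in lborel. v t = 0"
proof -
  note [measurable] = locint_measurable[OF v]
  have main: "AE t in lborel. indicator {-R<..<R} t *\<^sub>R v t = 0" if R: "R > 0" for R :: real
  proof -
    have iv: "integrable lborel (\<lambda>t. indicator {a<..<b} t *\<^sub>R v t)" for a b :: real
      by (rule locint_integrable[OF v, where C=1 and R="max \<bar>a\<bar> \<bar>b\<bar>"]) (auto simp: indicator_def)
    have tail: "(\<integral>t. indicator {x<..} t *\<^sub>R (indicator {-R<..<R} t *\<^sub>R v t) \<partial>lborel) = 0" for x
    proof (cases "max x (-R) < R")
      case True
      have "(\<integral>t. indicator {x<..} t *\<^sub>R (indicator {-R<..<R} t *\<^sub>R v t) \<partial>lborel) =
        (\<integral>t. indicator {max x (-R)<..<R} t *\<^sub>R v t \<partial>lborel)"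
        by (intro Bochner_Integration.integral_cong refl) (auto simp: indicator_def)
      then show ?thesis using zero[OF True] by simp
    next
      case False
      then have "(\<lambda>t. indicator {x<..} t *\<^sub>R (indicator {-R<..<R} t *\<^sub>R v t)) = (\<lambda>_. 0)"
        using R by (auto simp: indicator_def fun_eq_iff)
      then show ?thesis by simp
    qed
    have ti: "integrable lborel (\<lambda>t. indicator {x<..} t *\<^sub>R (indicator {-R<..<R} t *\<^sub>R v t))" for x
      by (rule integrable_mult_indicator[OF _ iv]) auto
    have "AE t in lborel. Re (indicator {-R<..<R} t *\<^sub>R v t) = 0"
    proof (rule AE_zero_if_tail_integrals_zero)
      show "integrable lborel (\<lambda>t. Re (indicator {-R<..<R} t *\<^sub>R v t))" using iv by (rule integrable_Re)
      show "(\<integral>t. indicator {x<..} t * Re (indicator {-R<..<R} t *\<^sub>R v t) \<partial>lborel) = 0" for x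
        using integral_Re[OF ti[of x]] tail[of x] by (simp add: mult.assoc)
    qed
    moreover have "AE t in lborel. Im (indicator {-R<..<R} t *\<^sub>R v t) = 0"
    proof (rule AE_zero_if_tail_integrals_zero)
      show "integrable lborel (\<lambda>t. Im (indicator {-R<..<R} t *\<^sub>R v t))" using iv by (rule integrable_Im)
      show "(\<integral>t. indicator {x<..} t * Im (indicator {-R<..<R} t *\<^sub>R v t) \<partial>lborel) = 0" for x
        using integral_Im[OF ti[of x]] tail[of x] by (simp add: mult.assoc)
    qed
    ultimately show ?thesis by eventually_elim (simp add: complex_eq_iff)
  qed
  have "AE t in lborel. \<forall>n. indicator {-real (Suc n)<..<real (Suc n)} t *\<^sub>R v t = 0"
    unfolding AE_all_countable by (intro allI main) simp
  then show ?thesis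
  proof eventually_elim
    case (elim t)
    obtain n where "\<bar>t\<bar> < real (Suc n)" using reals_Archimedean2[of "\<bar>t\<bar>"] by (metis less_Suc_eq of_nat_less_iff order_less_trans)
    then have "t \<in> {-real (Suc n)<..<real (Suc n)}" by auto
    with elim show ?case by (metis indicator_simps(1) scaleR_one)
  qed
qed

text \<open>As c tends to 0 the bumps on (a, b) converge pointwise to the indicator of (a, b) and
  stay below it. Dominated convergence therefore turns the hypothesis on test functions into
  vanishing integrals over intervals.\<close>

lemma fundamental_lemma:
  assumes v: "locint v" and zero: "\<And>\<zeta>. test_fun \<zeta> \<Longrightarrow> (\<integral>s. \<zeta> s *\<^sub>R v s \<partial>lborel) = 0"
  shows "AE s in lborel. v s = 0"
proof (rule AE_zero_if_interval_integrals_zero[OF v])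
  fix a b :: real assume ab: "a < b"
  note [measurable] = locint_measurable[OF v]
  define c where "c n = 1 / real (Suc n)" for n
  have c: "c n > 0" for n by (simp add: c_def)
  have c_lim: "c \<longlonglongrightarrow> 0" unfolding c_def[abs_def] using LIMSEQ_inverse_real_of_nat by (simp add: inverse_eq_divide)
  have bm: "bump a b (c n) \<in> borel_measurable borel" for n
    by (rule test_fun_measurable[OF test_fun_bump[OF ab c]])
  have "(\<lambda>n. \<integral>s. bump a b (c n) s *\<^sub>R v s \<partial>lborel) \<longlonglongrightarrow> (\<integral>s. indicator {a<..<b} s *\<^sub>R v s \<partial>lborel)"
  proof (rule integral_dominated_convergence)
    show "integrable lborel (\<lambda>s. cmod (indicator {a<..<b} s *\<^sub>R v s))"
      by (intro integrable_norm locint_integrable[OF v, where C=1 and R="max \<bar>a\<bar> \<bar>b\<bar>"]) (auto simp: indicator_def)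
    show "AE s in lborel. (\<lambda>n. bump a b (c n) s *\<^sub>R v s) \<longlonglongrightarrow> indicator {a<..<b} s *\<^sub>R v s"
    proof (intro AE_I2 tendsto_scaleR tendsto_const)
      fix s
      show "(\<lambda>n. bump a b (c n) s) \<longlonglongrightarrow> indicator {a<..<b} s"
      proof (cases "a < s \<and> s < b")
        case True
        have "(\<lambda>n. exp (- (c n / ((s - a) * (b - s))))) \<longlonglongrightarrow> exp (- (0 / ((s - a) * (b - s))))"
          using True by (intro tendsto_intros c_lim) auto
        with True show ?thesis by (simp add: bump_def)
      next
        case False
        then have "bump a b (c n) s = 0" "indicator {a<..<b} s = (0::real)" for n by (auto simp: bump_def)
        then show ?thesis by simp
      qed
    qed
    show "AE s in lborel. norm (bump a b (c n) s *\<^sub>R v s) \<le> cmod (indicator {a<..<b} s *\<^sub>R v s)" for n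
    proof (intro AE_I2)
      fix s show "norm (bump a b (c n) s *\<^sub>R v s) \<le> cmod (indicator {a<..<b} s *\<^sub>R v s)"
        using bump_le_1[OF c, of a b n s] by (cases "a < s \<and> s < b") (auto simp: mult_left_le_one_le bump_def)
    qed
  qed (use bm in measurable)
  then have "(\<lambda>n::nat. 0) \<longlonglongrightarrow> (\<integral>s. indicator {a<..<b} s *\<^sub>R v s \<partial>lborel)"
    by (simp add: zero[OF test_fun_bump[OF ab c]])
  then show "(\<integral>s. indicator {a<..<b} s *\<^sub>R v s \<partial>lborel) = 0"
    by (simp add: LIMSEQ_const_iff)
qed

text \<open>Subtracting a multiple of a fixed bump \<eta> from \<zeta> gives a test function of
  integral 0, which is a derivative. So u acts on \<zeta> as the constant c, the \<eta>-weighted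
  mean of u, and the fundamental lemma applies to u - c.\<close>

lemma du_Bois_Reymond:
  assumes u: "locint u" and zero: "\<And>\<phi>. test_fun \<phi> \<Longrightarrow> (\<integral>s. deriv \<phi> s *\<^sub>R u s \<partial>lborel) = 0"
  shows "\<exists>c. AE s in lborel. u s = c"
proof -
  define \<eta> where "\<eta> = bump 0 1 1"
  have \<eta>: "test_fun \<eta>" unfolding \<eta>_def by (rule test_fun_bump) auto
  have \<eta>0: "\<eta> s \<ge> 0" for s by (simp add: \<eta>_def bump_def)
  define m where "m = (\<integral>s. \<eta> s \<partial>lborel)"
  have "m \<noteq> 0"
  proof
    assume "m = 0"
    then have "AE s in lborel. \<eta> s = 0"
      unfolding m_def by (subst (asm) integral_nonneg_eq_0_iff_AE) (auto intro: test_fun_integrable[OF \<eta>] simp: \<eta>0)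
    then have "AE s in lborel. s \<notin> {0<..<1::real}"
      by eventually_elim (auto simp: \<eta>_def bump_def split: if_splits)
    then have "{0<..<1::real} \<in> null_sets lborel" by (subst (asm) AE_iff_null_sets[symmetric]) auto
    then show False by (simp add: null_sets_def)
  qed
  define c where "c = (\<integral>s. \<eta> s *\<^sub>R u s \<partial>lborel) /\<^sub>R m"
  have "AE s in lborel. u s - c = 0"
  proof (rule fundamental_lemma)
    show "locint (\<lambda>s. u s - c)" by (rule locint_diff[OF u locint_const])
    fix \<zeta> assume \<zeta>: "test_fun \<zeta>"
    define I where "I = (\<integral>s. \<zeta> s \<partial>lborel)"
    define \<theta> where "\<theta> = (\<lambda>x. \<zeta> x + (- I / m) * \<eta> x)"
    have \<theta>: "test_fun \<theta>" unfolding \<theta>_def by (rule test_fun_lincomb[OF \<zeta> \<eta>])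
    have "(\<integral>x. \<theta> x \<partial>lborel) = I + (- I / m) * m"
      unfolding \<theta>_def I_def m_def
      by (subst Bochner_Integration.integral_add) (auto intro!: test_fun_integrable[OF \<zeta>] test_fun_integrable[OF \<eta>])
    then have "(\<integral>x. \<theta> x \<partial>lborel) = 0" using \<open>m \<noteq> 0\<close> by simp
    then obtain \<phi> where \<phi>: "test_fun \<phi>" "deriv \<phi> = \<theta>" using test_fun_primitive[OF \<theta>] by blast
    have "0 = (\<integral>s. \<theta> s *\<^sub>R u s \<partial>lborel)" using zero[OF \<phi>(1)] \<phi>(2) by simp
    also have "\<dots> = (\<integral>s. \<zeta> s *\<^sub>R u s + (- I / m) *\<^sub>R (\<eta> s *\<^sub>R u s) \<partial>lborel)"
      unfolding \<theta>_def
      by (intro Bochner_Integration.integral_cong refl) (simp add: scaleR_conv_of_real algebra_simps)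
    also have "\<dots> = (\<integral>s. \<zeta> s *\<^sub>R u s \<partial>lborel) - I *\<^sub>R c"
      using test_fun_locint_integrable[OF \<zeta> u] test_fun_locint_integrable[OF \<eta> u]
      by (simp add: c_def scaleR_conv_of_real field_simps)
    finally have "(\<integral>s. \<zeta> s *\<^sub>R u s \<partial>lborel) = I *\<^sub>R c" by simp
    moreover have "(\<integral>s. \<zeta> s *\<^sub>R c \<partial>lborel) = I *\<^sub>R c"
      unfolding I_def using test_fun_integrable[OF \<zeta>] by simp
    ultimately show "(\<integral>s. \<zeta> s *\<^sub>R (u s - c) \<partial>lborel) = 0"
      using test_fun_locint_integrable[OF \<zeta> u] test_fun_locint_integrable[OF \<zeta> locint_const, of c]
      by (simp add: scaleR_right_diff_distrib)
  qed
  then show ?thesis by auto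
qed

section \<open>Primitives and integration by parts\<close>

lemma locint_if_continuous:
  assumes "continuous_on UNIV f" shows "locint f"
proof -
  have [measurable]: "f \<in> borel_measurable borel" using assms by (rule borel_measurable_continuous_onI)
  have "(\<integral>\<^sup>+t. indicator {-R..R} t * ennreal (cmod (f t)) \<partial>lborel) < \<infinity>" for R :: real
  proof -
    have "integrable lborel (\<lambda>t. indicator {-R..R} t *\<^sub>R f t)"
      by (rule borel_integrable_compact) (auto intro: continuous_on_subset[OF assms])
    then have "(\<integral>\<^sup>+t. ennreal (norm (indicator {-R..R} t *\<^sub>R f t)) \<partial>lborel) < \<infinity>"
      by (simp add: integrable_iff_bounded)
    also have "(\<integral>\<^sup>+t. ennreal (norm (indicator {-R..R} t *\<^sub>R f t)) \<partial>lborel) = (\<integral>\<^sup>+t. indicator {-R..R} t * ennreal (cmod (f t)) \<partial>lborel)"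
      by (intro nn_integral_cong) (auto simp: indicator_def)
    finally show ?thesis .
  qed
  then show ?thesis by (auto simp: locint_def)
qed

lemma oint_continuous:
  assumes k: "locint k" shows "continuous_on UNIV (\<lambda>s. oint 0 s k)"
proof -
  have "isCont (\<lambda>s. oint 0 s k) x" for x
  proof -
    have "(\<lambda>n. oint 0 (y n) k) \<longlonglongrightarrow> oint 0 x k" if y: "y \<longlonglongrightarrow> x" for y
    proof -
      obtain B where B: "\<And>n. \<bar>y n\<bar> \<le> B" using convergent_imp_Bseq[OF convergentI[OF y]] by (auto simp: Bseq_def)
      define R where "R = max B \<bar>x\<bar>"
      note [measurable] = locint_measurable[OF k]
      show ?thesis
        unfolding oint_def
      proof (rule integral_dominated_convergence)
        show "integrable lborel (\<lambda>t. cmod (indicator {-R..R} t *\<^sub>R k t))"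
          by (intro integrable_norm locint_integrable[OF k, where C=1 and R=R]) (auto simp: indicator_def)
        \<comment> \<open>The kernel jumps at t = x; at every other t it is eventually
          constant.\<close>
        show "AE t in lborel. (\<lambda>n. orient 0 (y n) t *\<^sub>R k t) \<longlonglongrightarrow> orient 0 x t *\<^sub>R k t"
          using AE_lborel_singleton[of x]
        proof eventually_elim
          case (elim t)
          have "\<forall>\<^sub>F n in sequentially. orient 0 (y n) t = orient 0 x t"
          proof (cases "t < x")
            case True
            then have "\<forall>\<^sub>F n in sequentially. t < y n" using order_tendstoD(1)[OF y] by blast
            then show ?thesis by eventually_elim (use True in \<open>auto simp: orient_def indicator_def\<close>)
          next
            case False
            then have "\<forall>\<^sub>F n in sequentially. t > y n" using order_tendstoD(2)[OF y] elim by force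
            then show ?thesis by eventually_elim (use False elim in \<open>auto simp: orient_def indicator_def\<close>)
          qed
          then have "(\<lambda>n. orient 0 (y n) t) \<longlonglongrightarrow> orient 0 x t" by (rule tendsto_eventually)
          then show ?case by (intro tendsto_scaleR tendsto_const)
        qed
        show "AE t in lborel. norm (orient 0 (y n) t *\<^sub>R k t) \<le> cmod (indicator {-R..R} t *\<^sub>R k t)" for n
          using B[of n] by (intro AE_I2) (auto simp: orient_def indicator_def R_def)
      qed measurable
    qed
    then show ?thesis by (simp add: continuous_at_sequentially comp_def)
  qed
  then show ?thesis by (simp add: continuous_on_eq_continuous_at)
qed

text \<open>The inner integral of the Fubini argument in the next lemma. For fixed t the kernel is,
  up to sign and a null set, the indicator of the half-line beyond t as seen from 0, so only the
  boundary value at t survives.\<close>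

lemma integral_deriv_test_fun:
  assumes \<phi>: "test_fun \<phi>"
  shows "(\<integral>s. orient 0 s t * deriv \<phi> s \<partial>lborel) = - \<phi> t"
proof -
  obtain R where R: "R > 0" "\<And>x. \<bar>x\<bar> > R \<Longrightarrow> \<phi> x = 0" using test_fun_support[OF \<phi>] by blast
  obtain R' where R': "R' > 0" "\<And>x. \<bar>x\<bar> > R' \<Longrightarrow> deriv \<phi> x = 0" using test_fun_support[OF test_fun_deriv[OF \<phi>]] by blast
  define K where "K = max (max R R') \<bar>t\<bar> + 1"
  have cont: "continuous_on A (deriv \<phi>)" for A
    by (intro continuous_at_imp_continuous_on) (auto intro: test_fun_isCont test_fun_deriv \<phi>)
  have FTC: "(\<integral>s. indicator {a..b} s *\<^sub>R deriv \<phi> s \<partial>lborel) = \<phi> b - \<phi> a" if "a \<le> b" for a b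
    using that cont test_fun_differentiable[OF \<phi>]
    by (intro integral_FTC_atLeastAtMost)
      (auto simp flip: has_real_derivative_iff_has_vector_derivative intro: has_field_derivative_at_within)
  show ?thesis
  proof (cases "t \<ge> 0")
    case True
    have "(\<integral>s. orient 0 s t * deriv \<phi> s \<partial>lborel) = (\<integral>s. indicator {t..K} s *\<^sub>R deriv \<phi> s \<partial>lborel)"
    proof (intro integral_cong_AE)
      show "AE s in lborel. orient 0 s t * deriv \<phi> s = indicator {t..K} s *\<^sub>R deriv \<phi> s"
        using AE_lborel_singleton[of t]
        by eventually_elim (use True R'(2) in \<open>auto simp: orient_def indicator_def K_def\<close>)
    qed (use test_fun_measurable[OF test_fun_deriv[OF \<phi>]] in measurable)
    also have "\<dots> = - \<phi> t"
      using FTC[of t K] R(2)[of K] by (simp add: K_def)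
    finally show ?thesis .
  next
    case False
    have "(\<integral>s. orient 0 s t * deriv \<phi> s \<partial>lborel) = (\<integral>s. - (indicator {-K..t} s *\<^sub>R deriv \<phi> s) \<partial>lborel)"
    proof (intro integral_cong_AE)
      show "AE s in lborel. orient 0 s t * deriv \<phi> s = - (indicator {-K..t} s *\<^sub>R deriv \<phi> s)"
        using AE_lborel_singleton[of t]
        by eventually_elim (use False R'(2) in \<open>auto simp: orient_def indicator_def K_def\<close>)
    qed (use test_fun_measurable[OF test_fun_deriv[OF \<phi>]] in measurable)
    also have "\<dots> = - \<phi> t"
      using FTC[of "-K" t] R(2)[of "-K"] by (simp add: K_def)
    finally show ?thesis .
  qed
qed

text \<open>Writing the primitive with the orientation kernel turns the left side into a double
  integral. Fubini replaces the product rule, since the primitive of a locally integrable k need not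
  be differentiable everywhere.\<close>

lemma integral_by_parts_test_fun:
  assumes k: "locint k" and \<phi>: "test_fun \<phi>"
  shows "(\<integral>s. deriv \<phi> s *\<^sub>R oint 0 s k \<partial>lborel) = - (\<integral>s. \<phi> s *\<^sub>R k s \<partial>lborel)"
proof -
  have d: "test_fun (deriv \<phi>)" by (rule test_fun_deriv[OF \<phi>])
  note [measurable] = locint_measurable[OF k] test_fun_measurable[OF d]
  obtain R where R: "R > 0" "\<And>x. \<bar>x\<bar> > R \<Longrightarrow> deriv \<phi> x = 0" using test_fun_support[OF d] by blast
  have int_k: "integrable lborel (\<lambda>t. indicator {-R..R} t *\<^sub>R k t)"
    by (rule locint_integrable[OF k, where C=1 and R=R]) (auto simp: indicator_def)
  have bound: "cmod ((deriv \<phi> s * orient 0 s t) *\<^sub>R k t) \<le> \<bar>deriv \<phi> s\<bar> * cmod (indicator {-R..R} t *\<^sub>R k t)" for s t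
  proof (cases "\<bar>s\<bar> > R")
    case False
    then show ?thesis by (auto simp: orient_def indicator_def abs_mult)
  qed (simp add: R)
  have prod: "integrable (lborel \<Otimes>\<^sub>M lborel) (\<lambda>(s, t). \<bar>deriv \<phi> s\<bar> * cmod (indicator {-R..R} t *\<^sub>R k t))"
  proof (rule lborel_pair.Fubini_integrable)
    show "integrable lborel (\<lambda>s. \<integral>t. norm (case (s, t) of (s, t) \<Rightarrow> \<bar>deriv \<phi> s\<bar> * cmod (indicator {-R..R} t *\<^sub>R k t)) \<partial>lborel)"
      using test_fun_integrable[OF d] by (simp add: abs_mult)
    show "AE s in lborel. integrable lborel (\<lambda>t. case (s, t) of (s, t) \<Rightarrow> \<bar>deriv \<phi> s\<bar> * cmod (indicator {-R..R} t *\<^sub>R k t))"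
      using integrable_norm[OF int_k] by (intro AE_I2) (simp only: split, rule integrable_mult_right)
  qed measurable
  have "integrable (lborel \<Otimes>\<^sub>M lborel) (\<lambda>(s, t). (deriv \<phi> s * orient 0 s t) *\<^sub>R k t)"
    by (rule Bochner_Integration.integrable_bound[OF prod]) (use bound in auto)
  then have "(\<integral>t. (\<integral>s. (deriv \<phi> s * orient 0 s t) *\<^sub>R k t \<partial>lborel) \<partial>lborel) =
    (\<integral>s. (\<integral>t. (deriv \<phi> s * orient 0 s t) *\<^sub>R k t \<partial>lborel) \<partial>lborel)"
    by (rule lborel_pair.Fubini_integral)
  also have "(\<lambda>s. \<integral>t. (deriv \<phi> s * orient 0 s t) *\<^sub>R k t \<partial>lborel) = (\<lambda>s. deriv \<phi> s *\<^sub>R oint 0 s k)"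
    by (simp add: oint_def flip: scaleR_scaleR)
  also have "(\<lambda>t. \<integral>s. (deriv \<phi> s * orient 0 s t) *\<^sub>R k t \<partial>lborel) = (\<lambda>t. - (\<phi> t *\<^sub>R k t))"
  proof
    fix t
    have "integrable lborel (\<lambda>s. deriv \<phi> s * orient 0 s t)"
      by (rule Bochner_Integration.integrable_bound[OF test_fun_integrable[OF d]])
        (auto simp: abs_mult orient_def indicator_def)
    then show "(\<integral>s. (deriv \<phi> s * orient 0 s t) *\<^sub>R k t \<partial>lborel) = - (\<phi> t *\<^sub>R k t)"
      using integral_deriv_test_fun[OF \<phi>, of t] by (simp add: mult.commute)
  qed
  finally show ?thesis by simp
qed

section \<open>Distributional derivatives of Borel representatives\<close>

lemma AE_lebesgue_iff: "(AE x in lebesgue. P x) \<longleftrightarrow> (AE x in lborel. P x)"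
  by (rule AE_completion_iff)

text \<open>Links the integrability clause of \<open>distr_deriv\<close> to Borel representatives.
  Forward, g is Lebesgue measurable as the pointwise limit of its truncations to [-n, n].\<close>

lemma locint_rep_iff:
  "(\<forall>a b. g absolutely_integrable_on {a..b}) \<longleftrightarrow> (\<exists>k. locint k \<and> (AE s in lborel. g s = k s))"
proof
  assume g: "\<forall>a b. g absolutely_integrable_on {a..b}"
  have mn: "(\<lambda>s. indicator {-real n..real n} s *\<^sub>R g s) \<in> borel_measurable lebesgue" for n
    using borel_measurable_integrable[OF g[unfolded set_integrable_def, rule_format]] .
  have "g \<in> borel_measurable lebesgue"
  proof (rule borel_measurable_LIMSEQ_metric[OF mn])
    fix s :: real
    obtain N where N: "\<bar>s\<bar> \<le> real N" using real_arch_simple by blast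
    have "\<forall>\<^sub>F n in sequentially. indicator {-real n..real n} s *\<^sub>R g s = g s"
      using eventually_ge_at_top[of N] by eventually_elim (use N in \<open>auto simp: indicator_def\<close>)
    then show "(\<lambda>n. indicator {-real n..real n} s *\<^sub>R g s) \<longlonglongrightarrow> g s" by (rule tendsto_eventually)
  qed
  then obtain k where k [measurable]: "k \<in> borel_measurable lborel" and ae: "AE s in lborel. g s = k s"
    using completion_ex_borel_measurable_complex by blast
  have "(\<integral>\<^sup>+t. indicator {-R..R} t * ennreal (cmod (k t)) \<partial>lborel) < \<infinity>" for R
  proof -
    have "(\<integral>\<^sup>+t. indicator {-R..R} t * ennreal (cmod (k t)) \<partial>lborel) = (\<integral>\<^sup>+t. indicator {-R..R} t * ennreal (cmod (k t)) \<partial>lebesgue)"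
      by (simp add: nn_integral_completion)
    also have "\<dots> = (\<integral>\<^sup>+t. ennreal (norm (indicator {-R..R} t *\<^sub>R g t)) \<partial>lebesgue)"
      using ae unfolding AE_lebesgue_iff[symmetric] by (intro nn_integral_cong_AE, eventually_elim) (auto simp: indicator_def)
    also have "\<dots> < \<infinity>" using g by (simp add: set_integrable_def integrable_iff_bounded)
    finally show ?thesis .
  qed
  then have "locint k" using k by (auto simp: locint_def)
  with ae show "\<exists>k. locint k \<and> (AE s in lborel. g s = k s)" by blast
next
  assume "\<exists>k. locint k \<and> (AE s in lborel. g s = k s)"
  then obtain k where k: "locint k" "AE s in lborel. g s = k s" by blast
  show "\<forall>a b. g absolutely_integrable_on {a..b}"
  proof (intro allI)
    fix a b :: real
    have "integrable lborel (\<lambda>t. indicator {a..b} t *\<^sub>R k t)"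
      by (rule locint_integrable[OF k(1), where C=1 and R="max \<bar>a\<bar> \<bar>b\<bar>"]) (auto simp: indicator_def)
    then have i: "integrable lebesgue (\<lambda>t. indicator {a..b} t *\<^sub>R k t)"
      by (simp add: integrable_completion)
    have ae: "AE t in lebesgue. indicator {a..b} t *\<^sub>R k t = indicator {a..b} t *\<^sub>R g t"
      unfolding AE_lebesgue_iff using k(2) by eventually_elim simp
    have "(\<lambda>t. indicator {a..b} t *\<^sub>R g t) \<in> borel_measurable lebesgue"
      by (rule borel_measurable_AE[OF borel_measurable_integrable[OF i] ae])
    then show "g absolutely_integrable_on {a..b}"
      unfolding set_integrable_def by (rule integrable_cong_AE_imp[OF i _ ae])
  qed
qed

lemma integral_lebesgue_rep:
  assumes [measurable]: "k \<in> borel_measurable borel" "\<phi> \<in> borel_measurable borel" and ae: "AE s in lborel. g s = (k s :: complex)"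
  shows "(\<integral>s. (\<phi> s :: real) *\<^sub>R g s \<partial>lebesgue) = (\<integral>s. \<phi> s *\<^sub>R k s \<partial>lborel)"
proof -
  have k: "k \<in> borel_measurable lebesgue" "\<phi> \<in> borel_measurable lebesgue" by (auto intro: measurable_completion)
  have "AE s in lebesgue. k s = g s" unfolding AE_lebesgue_iff using ae by eventually_elim simp
  then have g: "g \<in> borel_measurable lebesgue" by (rule borel_measurable_AE[OF k(1)])
  have "(\<integral>s. \<phi> s *\<^sub>R g s \<partial>lebesgue) = (\<integral>s. \<phi> s *\<^sub>R k s \<partial>lebesgue)"
    using ae unfolding AE_lebesgue_iff[symmetric]
    by (intro integral_cong_AE borel_measurable_scaleR k g) auto
  also have "\<dots> = (\<integral>s. \<phi> s *\<^sub>R k s \<partial>lborel)"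
    by (rule integral_completion) auto
  finally show ?thesis .
qed

lemma distr_deriv_iff:
  assumes u: "locint u" "AE s in lborel. g s = u s" and k: "locint k" "AE s in lborel. g' s = k s"
  shows "distr_deriv g g' \<longleftrightarrow>
    (\<forall>\<phi>. test_fun \<phi> \<longrightarrow> (\<integral>s. deriv \<phi> s *\<^sub>R u s \<partial>lborel) = - (\<integral>s. \<phi> s *\<^sub>R k s \<partial>lborel))"
proof -
  have "\<forall>a b. g absolutely_integrable_on {a..b}" "\<forall>a b. g' absolutely_integrable_on {a..b}"
    using u k locint_rep_iff by blast+
  moreover have "(\<integral>s. deriv \<phi> s *\<^sub>R g s \<partial>lebesgue) = (\<integral>s. deriv \<phi> s *\<^sub>R u s \<partial>lborel)"
     "(\<integral>s. \<phi> s *\<^sub>R g' s \<partial>lebesgue) = (\<integral>s. \<phi> s *\<^sub>R k s \<partial>lborel)" if "test_fun \<phi>" for \<phi>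
    using integral_lebesgue_rep[OF locint_measurable[OF u(1)] test_fun_measurable[OF test_fun_deriv[OF that]] u(2)]
      integral_lebesgue_rep[OF locint_measurable[OF k(1)] test_fun_measurable[OF that] k(2)] .
  ultimately show ?thesis unfolding distr_deriv_def by auto
qed

text \<open>Forward by du Bois-Reymond for g minus the primitive, backward by integration by parts.
  Test functions disappear here; what remains is an equation that can be moved along the coordinate
  y.\<close>

lemma distr_deriv_iff_oint:
  assumes k: "locint k" "AE s in lborel. g' s = k s"
  shows "distr_deriv g g' \<longleftrightarrow> (\<exists>c. AE s in lborel. g s = c + oint 0 s k)"
proof
  assume D: "distr_deriv g g'"
  then have "\<forall>a b. g absolutely_integrable_on {a..b}" by (simp add: distr_deriv_def)
  then obtain u where u: "locint u" "AE s in lborel. g s = u s" using locint_rep_iff by blast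
  have o: "locint (\<lambda>s. oint 0 s k)" by (rule locint_if_continuous[OF oint_continuous[OF k(1)]])
  have "\<exists>c. AE s in lborel. u s - oint 0 s k = c"
  proof (rule du_Bois_Reymond[OF locint_diff[OF u(1) o]])
    fix \<phi> assume \<phi>: "test_fun \<phi>"
    have "(\<integral>s. deriv \<phi> s *\<^sub>R u s \<partial>lborel) = (\<integral>s. deriv \<phi> s *\<^sub>R oint 0 s k \<partial>lborel)"
      using D[unfolded distr_deriv_iff[OF u k]] \<phi> integral_by_parts_test_fun[OF k(1) \<phi>] by simp
    then show "(\<integral>s. deriv \<phi> s *\<^sub>R (u s - oint 0 s k) \<partial>lborel) = 0"
      using test_fun_locint_integrable[OF test_fun_deriv[OF \<phi>] u(1)] test_fun_locint_integrable[OF test_fun_deriv[OF \<phi>] o]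
      by (simp add: scaleR_right_diff_distrib)
  qed
  then obtain c where "AE s in lborel. u s - oint 0 s k = c" by blast
  with u(2) have "AE s in lborel. g s = c + oint 0 s k" by eventually_elim auto
  then show "\<exists>c. AE s in lborel. g s = c + oint 0 s k" by blast
next
  assume "\<exists>c. AE s in lborel. g s = c + oint 0 s k"
  then obtain c where c: "AE s in lborel. g s = c + oint 0 s k" by blast
  have o: "locint (\<lambda>s. oint 0 s k)" by (rule locint_if_continuous[OF oint_continuous[OF k(1)]])
  have "(\<integral>s. deriv \<phi> s *\<^sub>R (c + oint 0 s k) \<partial>lborel) = - (\<integral>s. \<phi> s *\<^sub>R k s \<partial>lborel)" if \<phi>: "test_fun \<phi>" for \<phi>
  proof -
    have d: "test_fun (deriv \<phi>)" by (rule test_fun_deriv[OF \<phi>])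
    have "(\<integral>s. deriv \<phi> s *\<^sub>R c \<partial>lborel) = 0"
      using integral_by_parts_test_fun[of "\<lambda>_. 0" \<phi>] \<phi>
    proof -
      obtain R where R: "R > 0" "\<And>x. \<bar>x\<bar> > R \<Longrightarrow> \<phi> x = 0" using test_fun_support[OF \<phi>] by blast
      obtain R' where R': "R' > 0" "\<And>x. \<bar>x\<bar> > R' \<Longrightarrow> deriv \<phi> x = 0" using test_fun_support[OF d] by blast
      have supp: "deriv \<phi> x \<noteq> 0 \<Longrightarrow> \<bar>x\<bar> \<le> R'" for x using R'(2)[of x] by force
      define K where "K = max R R' + 1"
      have "(\<integral>s. deriv \<phi> s \<partial>lborel) = (\<integral>s. indicator {-K..K} s *\<^sub>R deriv \<phi> s \<partial>lborel)"
        by (intro Bochner_Integration.integral_cong refl) (use supp R'(1) in \<open>force simp: indicator_def K_def abs_le_iff\<close>)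
      also have "\<dots> = \<phi> K - \<phi> (-K)"
      proof (intro integral_FTC_atLeastAtMost)
        show "continuous_on {-K..K} (deriv \<phi>)"
          by (intro continuous_at_imp_continuous_on) (auto intro: test_fun_isCont d)
        show "- K \<le> K" using R(1) by (simp add: K_def)
      qed (use test_fun_differentiable[OF \<phi>] in \<open>auto simp flip: has_real_derivative_iff_has_vector_derivative intro: has_field_derivative_at_within\<close>)
      also have "\<dots> = 0" using R(2)[of K] R(2)[of "-K"] R(1) by (simp add: K_def)
      finally show ?thesis using test_fun_integrable[OF d] by simp
    qed
    then show ?thesis
      using integral_by_parts_test_fun[OF k(1) \<phi>] test_fun_locint_integrable[OF d locint_const, of c]
        test_fun_locint_integrable[OF d o] by (simp add: scaleR_add_right)
  qed
  then show "distr_deriv g g'"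
    unfolding distr_deriv_iff[OF locint_add[OF locint_const o] c k] by blast
qed

text \<open>The fundamental lemma for the difference of the two derivatives. It makes the choice in
  \<open>fibre_op\<close> harmless up to null sets.\<close>

lemma distr_deriv_unique:
  assumes "distr_deriv g g1" "distr_deriv g g2"
  shows "AE s in lborel. g1 s = g2 s"
proof -
  obtain u where u: "locint u" "AE s in lborel. g s = u s" using assms(1) locint_rep_iff by (metis distr_deriv_def)
  obtain k1 where k1: "locint k1" "AE s in lborel. g1 s = k1 s" using assms(1) locint_rep_iff by (metis distr_deriv_def)
  obtain k2 where k2: "locint k2" "AE s in lborel. g2 s = k2 s" using assms(2) locint_rep_iff by (metis distr_deriv_def)
  have "AE s in lborel. k1 s - k2 s = 0"
  proof (rule fundamental_lemma[OF locint_diff[OF k1(1) k2(1)]])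
    fix \<phi> assume \<phi>: "test_fun \<phi>"
    have "(\<integral>s. \<phi> s *\<^sub>R k1 s \<partial>lborel) = (\<integral>s. \<phi> s *\<^sub>R k2 s \<partial>lborel)"
      using assms(1)[unfolded distr_deriv_iff[OF u k1], rule_format, OF \<phi>]
        assms(2)[unfolded distr_deriv_iff[OF u k2], rule_format, OF \<phi>] by simp
    then show "(\<integral>s. \<phi> s *\<^sub>R (k1 s - k2 s) \<partial>lborel) = 0"
      using test_fun_locint_integrable[OF \<phi> k1(1)] test_fun_locint_integrable[OF \<phi> k2(1)]
      by (simp add: scaleR_right_diff_distrib)
  qed
  with k1(2) k2(2) show ?thesis by eventually_elim simp
qed

section \<open>Continuity of translations\<close>

lemma lborel_translation_integral:
  assumes "f \<in> borel_measurable borel"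
  shows "(\<integral>\<^sup>+y. f (y + t) \<partial>lborel) = (\<integral>\<^sup>+y. f y \<partial>(lborel :: real measure))"
  using nn_integral_real_affine[OF assms, of 1 t] by (simp add: add.commute)

lemma L2_translation:
  assumes f: "f \<in> L2 (lborel :: real measure)"
  shows "(\<lambda>y. f (y + t)) \<in> L2 lborel" "L2_norm lborel (\<lambda>y. f (y + t)) = L2_norm lborel f"
proof -
  have [measurable]: "f \<in> borel_measurable borel" using L2_measurable[OF f] by simp
  have eq: "(\<integral>\<^sup>+y. ennreal ((cmod (f (y + t)))\<^sup>2) \<partial>lborel) = (\<integral>\<^sup>+y. ennreal ((cmod (f y))\<^sup>2) \<partial>lborel)"
    by (rule lborel_translation_integral) auto
  show *: "(\<lambda>y. f (y + t)) \<in> L2 lborel" using f eq by (simp add: L2_iff_nn_integral)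
  have "(L2_norm lborel (\<lambda>y. f (y + t)))\<^sup>2 = (L2_norm lborel f)\<^sup>2"
    using eq unfolding nn_integral_L2_norm[OF *] nn_integral_L2_norm[OF f] by simp
  then show "L2_norm lborel (\<lambda>y. f (y + t)) = L2_norm lborel f" by (simp add: power2_eq_iff_nonneg)
qed

text \<open>Regularity squeezes A between a compact K and an open U. If t is smaller than a radius
  by which K can be enlarged inside U, then A and its translate can differ only in the thin sets A -
  K and U - A and their translates.\<close>

lemma indicator_translation_continuous:
  fixes A :: "real set"
  assumes A: "A \<in> sets borel" "emeasure lborel A < \<infinity>"
  shows "((\<lambda>t. L2_norm lborel (\<lambda>y. indicator A (y + t) - indicator A y :: complex)) \<longlongrightarrow> 0) (at 0)"
proof (rule tendstoI)
  fix \<epsilon> :: real assume "\<epsilon> > 0"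
  \<comment> \<open>Four pieces of measure at most e give 4 e = \<epsilon>^2 / 2, strictly below
    \<epsilon>^2.\<close>
  define e where "e = \<epsilon>\<^sup>2 / 8"
  have e: "e > 0" using \<open>\<epsilon> > 0\<close> by (simp add: e_def)
  obtain U where U: "open U" "A \<subseteq> U" "emeasure lborel (U - A) < ennreal e"
    using outer_regular_lborel[OF A(1) e] by blast
  \<comment> \<open>Inner regularity is applied to a finite measure, Lebesgue measure restricted to
    A.\<close>
  have dA: "emeasure (density lborel (indicator A)) B = emeasure lborel (A \<inter> B)" if "B \<in> sets borel" for B
    using that A(1) by (subst emeasure_density) (auto simp: nn_integral_indicator ac_simps simp flip: indicator_inter_arith)
  have SUP_eq: "emeasure lborel A = (SUP K \<in> {K. K \<subseteq> A \<and> compact K}. emeasure lborel K)"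
  proof -
    have "emeasure (density lborel (indicator A)) A = (SUP K \<in> {K. K \<subseteq> A \<and> compact K}. emeasure (density lborel (indicator A)) K)"
      by (rule inner_regular) (use A dA[of UNIV] in auto)
    also have "\<dots> = (SUP K \<in> {K. K \<subseteq> A \<and> compact K}. emeasure lborel K)"
      by (intro SUP_cong refl) (auto simp: dA Int_absorb1 compact_imp_closed)
    finally show ?thesis using dA[OF A(1)] by simp
  qed
  have "\<exists>K. K \<subseteq> A \<and> compact K \<and> emeasure lborel A < emeasure lborel K + ennreal e"
  proof (rule ccontr)
    assume "\<not> ?thesis"
    then have "(SUP K \<in> {K. K \<subseteq> A \<and> compact K}. emeasure lborel K + ennreal e) \<le> emeasure lborel A"
      by (intro SUP_least) (auto simp: not_less)
    also have "(SUP K \<in> {K. K \<subseteq> A \<and> compact K}. emeasure lborel K + ennreal e) =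
        (SUP K \<in> {K. K \<subseteq> A \<and> compact K}. emeasure lborel K) + ennreal e"
      by (rule ennreal_SUP_add_left) (auto intro!: exI[of _ "{}"])
    finally have "emeasure lborel A + ennreal e \<le> emeasure lborel A" unfolding SUP_eq[symmetric] .
    then show False using A(2) e by (cases "emeasure lborel A") (auto simp flip: ennreal_plus)
  qed
  then obtain K where K: "K \<subseteq> A" "compact K" "emeasure lborel A < emeasure lborel K + ennreal e" by blast
  have bK [measurable]: "K \<in> sets borel" using K(2) by (intro borel_closed compact_imp_closed)
  note [measurable] = A(1)
  have [measurable]: "U \<in> sets borel" using U by auto
  have AK: "emeasure lborel (A - K) < ennreal e"
  proof -
    have "emeasure lborel (A - K) = emeasure lborel A - emeasure lborel K"
      using K emeasure_compact_finite[OF K(2)] A by (intro emeasure_Diff) auto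
    also have "\<dots> < ennreal e"
      using K(3) emeasure_compact_finite[OF K(2)] emeasure_mono[of K A lborel] K(1) A
      by (subst minus_less_iff_ennreal) (auto simp: add.commute)
    finally show ?thesis .
  qed
  obtain \<delta> where \<delta>: "\<delta> > 0" "(\<Union>x\<in>K. ball x \<delta>) \<subseteq> U"
    using compact_subset_open_imp_ball_epsilon_subset[OF K(2) U(1)] K(1) U(2) by blast
  have shift: "emeasure lborel {y. y + t \<in> B} = emeasure lborel B" if [measurable]: "B \<in> sets borel" for B and t :: real
    using lborel_translation_integral[of "indicator B" t] by (simp add: nn_integral_indicator indicator_def[of "{y. y + t \<in> B}"] indicator_def[of B "_ + t"] flip: nn_integral_indicator)
  have main: "L2_norm lborel (\<lambda>y. indicator A (y + t) - indicator A y :: complex) < \<epsilon>" if t: "\<bar>t\<bar> < \<delta>" for t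
  proof -
    \<comment> \<open>The four pieces, in order: y + t in A but not in K; y in U but not in A; y in
      A but not in K; y + t in U but not in A.\<close>
    define V where "V = {y. y + t \<in> A - K} \<union> (U - A) \<union> (A - K) \<union> {y. y + t \<in> U - A}"
    have [measurable]: "V \<in> sets borel" unfolding V_def by measurable
    have sub: "(cmod (indicator A (y + t) - indicator A y))\<^sup>2 \<le> indicator V y" for y
    proof -
      have "y \<in> U" if "y + t \<in> K"
      proof -
        have "y \<in> ball (y + t) \<delta>" using t by (simp add: dist_real_def)
        then show ?thesis using \<delta>(2) that by blast
      qed
      moreover have "y + t \<in> U" if "y \<in> K"
      proof -
        have "y + t \<in> ball y \<delta>" using t by (simp add: dist_real_def)
        then show ?thesis using \<delta>(2) that by blast
      qed
      ultimately show ?thesis unfolding V_def indicator_def by auto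
    qed
    have "emeasure lborel V \<le> ennreal e + ennreal e + ennreal e + ennreal e"
    proof -
      have "emeasure lborel V \<le> emeasure lborel {y. y + t \<in> A - K} + emeasure lborel (U - A) + emeasure lborel (A - K) + emeasure lborel {y. y + t \<in> U - A}"
        unfolding V_def by (intro order_trans[OF emeasure_subadditive] add_mono order_refl) auto
      also have "\<dots> \<le> ennreal e + ennreal e + ennreal e + ennreal e"
        using U(3) AK shift[of "A - K" t] shift[of "U - A" t] by (intro add_mono) (simp_all del: Diff_iff)
      finally show ?thesis .
    qed
    also have "\<dots> = ennreal (4 * e)" using e by (simp flip: ennreal_plus)
    finally have V: "emeasure lborel V \<le> ennreal (4 * e)" .
    have "(\<integral>\<^sup>+y. ennreal ((cmod (indicator A (y + t) - indicator A y))\<^sup>2) \<partial>lborel) \<le> (\<integral>\<^sup>+y. ennreal (indicator V y) \<partial>lborel)"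
      by (intro nn_integral_mono ennreal_leI sub)
    also have "\<dots> = emeasure lborel V" by (simp add: ennreal_indicator)
    also have "\<dots> \<le> ennreal ((sqrt (4 * e))\<^sup>2)" using V e by simp
    finally have "L2_norm lborel (\<lambda>y. indicator A (y + t) - indicator A y :: complex) \<le> sqrt (4 * e)"
      using e by (intro L2I_nn_integral_le) auto
    also have "\<dots> < \<epsilon>"
    proof -
      have "4 * e < \<epsilon>\<^sup>2" using \<open>\<epsilon> > 0\<close> by (simp add: e_def)
      then show ?thesis using \<open>\<epsilon> > 0\<close> by (metis real_sqrt_less_iff real_sqrt_abs abs_of_pos)
    qed
    finally show ?thesis .
  qed
  show "\<forall>\<^sub>F t in at 0. dist (L2_norm lborel (\<lambda>y. indicator A (y + t) - indicator A y :: complex)) 0 < \<epsilon>"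
    unfolding eventually_at using \<delta>(1) main by (auto simp: dist_real_def intro!: exI[of _ \<delta>])
qed

lemma L2_translation_continuous_add:
  assumes f: "f \<in> L2 lborel" and g: "g \<in> L2 lborel"
    and "((\<lambda>t. L2_norm lborel (\<lambda>y. f (y + t) - f y)) \<longlongrightarrow> 0) (at 0)"
    and "((\<lambda>t. L2_norm lborel (\<lambda>y. g (y + t) - g y)) \<longlongrightarrow> 0) (at (0::real))"
  shows "((\<lambda>t. L2_norm lborel (\<lambda>y. (f (y + t) + g (y + t)) - (f y + g y))) \<longlongrightarrow> 0) (at 0)"
proof (rule Lim_null_comparison)
  show "((\<lambda>t. L2_norm lborel (\<lambda>y. f (y + t) - f y) + L2_norm lborel (\<lambda>y. g (y + t) - g y)) \<longlongrightarrow> 0) (at 0)"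
    using tendsto_add[OF assms(3,4)] by simp
  have "L2_norm lborel (\<lambda>y. (f (y + t) + g (y + t)) - (f y + g y)) \<le>
      L2_norm lborel (\<lambda>y. f (y + t) - f y) + L2_norm lborel (\<lambda>y. g (y + t) - g y)" for t
    using L2_add(2)[OF L2_diff(1)[OF L2_translation(1)[OF f] f] L2_diff(1)[OF L2_translation(1)[OF g] g], of t t]
    by (simp add: algebra_simps)
  then show "\<forall>\<^sub>F t in at 0. norm (L2_norm lborel (\<lambda>y. (f (y + t) + g (y + t)) - (f y + g y))) \<le>
      L2_norm lborel (\<lambda>y. f (y + t) - f y) + L2_norm lborel (\<lambda>y. g (y + t) - g y)" by simp
qed

text \<open>Approximate f in L^2 by a simple function, whose nonzero level sets have finite measure
  and are covered by the indicator case. Translation is isometric, so the approximation error is the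
  same before and after it.\<close>

lemma L2_translation_continuous:
  fixes f :: "real \<Rightarrow> complex"
  assumes f: "f \<in> L2 lborel"
  shows "((\<lambda>t. L2_norm lborel (\<lambda>y. f (y + t) - f y)) \<longlongrightarrow> 0) (at 0)"
proof -
  have [measurable]: "f \<in> borel_measurable borel" using L2_measurable[OF f] by simp
  obtain s where s: "\<And>i. simple_function lborel (s i)" "\<And>x. (\<lambda>i. s i x) \<longlonglongrightarrow> f x" "\<And>i x. dist (s i x) 0 \<le> 2 * dist (f x) 0"
    using borel_measurable_implies_sequence_metric[of f lborel 0] by auto
  have [measurable]: "s i \<in> borel_measurable borel" for i
    using borel_measurable_simple_function[OF s(1)] by simp
  have norm_le: "cmod (s i x) \<le> 2 * cmod (f x)" for i x using s(3)[of i x] by simp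
  have sL2: "s i \<in> L2 lborel" for i
  proof -
    have "integrable lborel (\<lambda>x. 4 * (cmod (f x))\<^sup>2)" using L2_integrable[OF f] by simp
    then have "integrable lborel (\<lambda>x. (cmod (s i x))\<^sup>2)"
    proof (rule Bochner_Integration.integrable_bound)
      show "AE x in lborel. norm ((cmod (s i x))\<^sup>2) \<le> norm (4 * (cmod (f x))\<^sup>2)"
      proof (intro AE_I2)
        fix x
        have "(cmod (s i x))\<^sup>2 \<le> (2 * cmod (f x))\<^sup>2" by (intro power_mono norm_le) simp
        then show "norm ((cmod (s i x))\<^sup>2) \<le> norm (4 * (cmod (f x))\<^sup>2)" by (simp add: power_mult_distrib)
      qed
    qed auto
    then show ?thesis by (simp add: L2_def)
  qed
  have simple: "((\<lambda>t. L2_norm lborel (\<lambda>y. s i (y + t) - s i y)) \<longlongrightarrow> 0) (at 0)" for i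
  proof -
    define A where "A c = {x. s i x = c}" for c
    have [measurable]: "A c \<in> sets borel" for c unfolding A_def by measurable
    define C where "C = range (s i) - {0}"
    have finC: "finite C" using s(1)[of i] by (simp add: C_def simple_function_def)
    have s_eq: "s i = (\<lambda>x. \<Sum>c\<in>C. c * indicator (A c) x)"
    proof
      fix x
      have "(\<Sum>c\<in>C. c * indicator (A c) x) = (\<Sum>c\<in>C. if c = s i x then c else 0)"
        by (intro sum.cong refl) (auto simp: A_def indicator_def)
      also have "\<dots> = s i x" using finC by (auto simp: C_def)
      finally show "s i x = (\<Sum>c\<in>C. c * indicator (A c) x)" by simp
    qed
    have finA: "emeasure lborel (A c) < \<infinity>" if "c \<in> C" for c
    proof -
      have "ennreal ((cmod c)\<^sup>2) * emeasure lborel (A c) = (\<integral>\<^sup>+x. ennreal ((cmod c)\<^sup>2) * indicator (A c) x \<partial>lborel)"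
        by (subst nn_integral_cmult_indicator) auto
      also have "\<dots> \<le> (\<integral>\<^sup>+x. ennreal ((cmod (s i x))\<^sup>2) \<partial>lborel)"
        by (intro nn_integral_mono) (auto simp: A_def indicator_def)
      also have "\<dots> < \<infinity>" using sL2[of i] by (simp add: L2_iff_nn_integral)
      finally show ?thesis using that by (auto simp: C_def ennreal_mult_less_top)
    qed
    have indL2: "(\<lambda>x. c * indicator (A c) x) \<in> L2 lborel" if "c \<in> C" for c
    proof (rule L2_cmult)
      have "(\<integral>\<^sup>+x. ennreal ((cmod (indicator (A c) x))\<^sup>2) \<partial>lborel) = emeasure lborel (A c)"
      proof -
        have "(\<integral>\<^sup>+x. ennreal ((cmod (indicator (A c) x))\<^sup>2) \<partial>lborel) = (\<integral>\<^sup>+x. indicator (A c) x \<partial>lborel)"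
          by (intro nn_integral_cong) (auto simp: indicator_def)
        then show ?thesis by simp
      qed
      then show "indicator (A c) \<in> L2 lborel" using finA[OF that] by (simp add: L2_iff_nn_integral)
    qed
    have "D \<subseteq> C \<Longrightarrow> ((\<lambda>t. L2_norm lborel (\<lambda>y. (\<Sum>c\<in>D. c * indicator (A c) (y + t)) - (\<Sum>c\<in>D. c * indicator (A c) y))) \<longlongrightarrow> 0) (at 0)" if "finite D" for D
      using that
    proof (induction D)
      case (insert c D)
      then have c: "c \<in> C" by simp
      have "L2_norm lborel (\<lambda>y. c * indicator (A c) (y + t) - c * indicator (A c) y) =
          cmod c * L2_norm lborel (\<lambda>y. indicator (A c) (y + t) - indicator (A c) y :: complex)" for t
        by (simp add: L2_norm_def norm_mult power_mult_distrib real_sqrt_mult flip: right_diff_distrib)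
      then have 1: "((\<lambda>t. L2_norm lborel (\<lambda>y. c * indicator (A c) (y + t) - c * indicator (A c) y)) \<longlongrightarrow> 0) (at 0)"
        using tendsto_mult_right_zero[OF indicator_translation_continuous[OF _ finA[OF c]], of "cmod c"] by simp
      have 2: "(\<lambda>y. \<Sum>c\<in>D. c * indicator (A c) y) \<in> L2 lborel"
        using insert by (intro L2_sum indL2) auto
      have 3: "((\<lambda>t. L2_norm lborel (\<lambda>y. (\<Sum>c\<in>D. c * indicator (A c) (y + t)) - (\<Sum>c\<in>D. c * indicator (A c) y))) \<longlongrightarrow> 0) (at 0)"
        using insert by blast
      show ?case
        unfolding sum.insert[OF insert.hyps] by (rule L2_translation_continuous_add[OF indL2[OF c] 2 1 3])
    qed simp
    from this[OF finC] show ?thesis unfolding s_eq by simp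
  qed
  have approx: "(\<lambda>i. L2_norm lborel (\<lambda>x. s i x - f x)) \<longlonglongrightarrow> 0"
  proof -
    have "(\<lambda>i. \<integral>x. (cmod (s i x - f x))\<^sup>2 \<partial>lborel) \<longlonglongrightarrow> (\<integral>x. (0::real) \<partial>(lborel :: real measure))"
    \<comment> \<open>The constant 9 is (2 + 1)^2, because the simple functions satisfy |s i| \<le>
      2 |f|.\<close>
    proof (rule integral_dominated_convergence[where w="\<lambda>x. 9 * (cmod (f x))\<^sup>2"])
      show "integrable lborel (\<lambda>x. 9 * (cmod (f x))\<^sup>2)" using L2_integrable[OF f] by simp
      show "AE x in lborel. (\<lambda>i. (cmod (s i x - f x))\<^sup>2) \<longlonglongrightarrow> 0"
      proof (intro AE_I2)
        fix x
        have "(\<lambda>i. (cmod (s i x - f x))\<^sup>2) \<longlonglongrightarrow> (cmod (f x - f x))\<^sup>2"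
          by (intro tendsto_intros s)
        then show "(\<lambda>i. (cmod (s i x - f x))\<^sup>2) \<longlonglongrightarrow> 0" by simp
      qed
      show "AE x in lborel. norm ((cmod (s i x - f x))\<^sup>2) \<le> 9 * (cmod (f x))\<^sup>2" for i
      proof (intro AE_I2)
        fix x
        have "cmod (s i x - f x) \<le> 3 * cmod (f x)"
          using norm_triangle_ineq4[of "s i x" "f x"] norm_le[of i x] by simp
        then have "(cmod (s i x - f x))\<^sup>2 \<le> (3 * cmod (f x))\<^sup>2" by (intro power_mono) auto
        then show "norm ((cmod (s i x - f x))\<^sup>2) \<le> 9 * (cmod (f x))\<^sup>2" by (simp add: power_mult_distrib)
      qed
    qed auto
    then show ?thesis unfolding L2_norm_def using tendsto_real_sqrt by fastforce
  qed
  show ?thesis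
  proof (rule tendstoI)
    fix e :: real assume "e > 0"
    then have "\<forall>\<^sub>F i in sequentially. dist (L2_norm lborel (\<lambda>x. s i x - f x)) 0 < e / 4"
      by (intro tendstoD[OF approx]) auto
    then obtain i where i: "L2_norm lborel (\<lambda>x. s i x - f x) < e / 4"
      by (auto simp: eventually_sequentially)
    have "\<forall>\<^sub>F t in at 0. dist (L2_norm lborel (\<lambda>y. s i (y + t) - s i y)) 0 < e / 4"
      using \<open>e > 0\<close> by (intro tendstoD[OF simple]) auto
    then show "\<forall>\<^sub>F t in at 0. dist (L2_norm lborel (\<lambda>y. f (y + t) - f y)) 0 < e"
    proof eventually_elim
      case (elim t)
      have "L2_norm lborel (\<lambda>y. f (y + t) - f y) \<le> L2_norm lborel (\<lambda>y. f (y + t) - s i (y + t)) + L2_norm lborel (\<lambda>y. s i (y + t) - f y)"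
        by (intro L2_norm_diff_triangle L2_translation f sL2)
      also have "L2_norm lborel (\<lambda>y. s i (y + t) - f y) \<le> L2_norm lborel (\<lambda>y. s i (y + t) - s i y) + L2_norm lborel (\<lambda>y. s i y - f y)"
        by (intro L2_norm_diff_triangle L2_translation f sL2)
      also have "L2_norm lborel (\<lambda>y. f (y + t) - s i (y + t)) = L2_norm lborel (\<lambda>y. s i y - f y)"
        using L2_translation(2)[OF L2_diff(1)[OF f sL2[of i]], of t] by (simp add: L2_norm_diff_commute)
      finally show ?case using i elim \<open>e > 0\<close> by (simp add: dist_real_def)
    qed
  qed
qed

section \<open>Straightening a fibre\<close>

definition finite_mass :: "(real \<Rightarrow> real) \<Rightarrow> bool" where
  "finite_mass w \<longleftrightarrow> (\<integral>\<^sup>+s. ennreal (w s) \<partial>lborel) < \<infinity>"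

text \<open>The value \<open>0\<close> for infinite mass makes \<open>y rmod mass w = y\<close> in that case.\<close>

definition mass :: "(real \<Rightarrow> real) \<Rightarrow> real" where
  "mass w = (if finite_mass w then enn2real (\<integral>\<^sup>+s. ennreal (w s) \<partial>lborel) else 0)"

lemma mass_infinite: "\<not> finite_mass w \<Longrightarrow> mass w = 0"
  by (simp add: mass_def)

text \<open>The coordinate y of the overview. The open half-line matches the half-open intervals of
  \<open>orient\<close>. For infinite mass the weights considered are 1, so y is s itself.\<close>

definition cum :: "(real \<Rightarrow> real) \<Rightarrow> real \<Rightarrow> real" where
  "cum w s = (if finite_mass w then enn2real (\<integral>\<^sup>+t. indicator {..<s} t * ennreal (w t) \<partial>lborel) else s)"

text \<open>The inverse of \<open>cum\<close>, extended with period \<open>mass w\<close>. Multiples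
  of the period correspond to the point at infinity, which no s represents; the value 0 there is an
  arbitrary default and concerns a null set.\<close>

definition uncum :: "(real \<Rightarrow> real) \<Rightarrow> real \<Rightarrow> real" where
  "uncum w y = (if finite_mass w then
     (if y rmod mass w = 0 then 0 else (THE s. cum w s = y rmod mass w)) else y)"

definition fibre_shift :: "(real \<Rightarrow> real) \<Rightarrow> real \<Rightarrow> real \<Rightarrow> real" where
  "fibre_shift w c s = uncum w (cum w s + c)"

definition fibre_range :: "(real \<Rightarrow> real) \<Rightarrow> real set" where
  "fibre_range w = (if finite_mass w then {0<..<mass w} else UNIV)"

lemma rmod_measurable [measurable]:
  assumes [measurable]: "f \<in> borel_measurable M" "g \<in> borel_measurable M"
  shows "(\<lambda>x. f x rmod g x :: real) \<in> borel_measurable M"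
  unfolding rmod_def by measurable

lemma rmod_add_left_eq: "(x rmod m + c) rmod m = (x + c) rmod m"
  using rmod_add[of "x rmod m" m c] rmod_add[of x m c] by simp

lemma rmod_eq_diff_floor: "y rmod m = y + of_int (- \<lfloor>y / \<bar>m\<bar>\<rfloor>) * \<bar>m\<bar>"
  by (cases "m = 0") (auto simp: rmod_conv_frac frac_def field_simps)

lemma eventually_less_real: "\<forall>\<^sub>F n in sequentially. c < real n"
  using filterlim_real_sequentially unfolding filterlim_at_top_dense by blast

lemma AE_lborel_ex:
  assumes "AE x in (lborel :: 'a::euclidean_space measure). P x" shows "\<exists>x. P x"
proof (rule ccontr)
  assume "\<not> ?thesis"
  with assms have "AE x in (lborel :: 'a measure). False" by auto
  then have "(UNIV :: 'a set) \<in> null_sets lborel" by (subst (asm) AE_iff_null_sets[of UNIV, symmetric, simplified]) auto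
  then show False by (auto simp: null_sets_def)
qed

lemma AE_lborel_shift:
  "AE y in (lborel :: real measure). P y \<Longrightarrow> AE y in lborel. P (y + c)"
proof -
  assume "AE y in (lborel :: real measure). P y"
  then obtain N where N: "{y. \<not> P y} \<subseteq> N" "N \<in> null_sets lborel" by (auto elim!: AE_E3 simp: eventually_ae_filter)
  have "AE y in lborel. y \<notin> N" using N(2) by (rule AE_not_in)
  then have "AE y in (lborel :: real measure). c + 1 * y \<notin> N"
    using N(2) by (intro AE_borel_affine) (auto dest: null_setsD2)
  then show ?thesis by eventually_elim (use N(1) in \<open>auto simp: add.commute\<close>)
qed

text \<open>The two kinds of fibre: any positive weight of finite mass, or the constant weight 1.
  Positivity at every point makes \<open>cum\<close> strictly increasing; it is arranged later by
  the choice of a representative.\<close>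

locale fibre_weight =
  fixes w :: "real \<Rightarrow> real"
  assumes w_measurable [measurable]: "w \<in> borel_measurable borel"
    and w_pos: "\<And>s. w s > 0"
    and w_infinite_mass: "\<not> finite_mass w \<Longrightarrow> w = (\<lambda>_. 1)"
begin

abbreviation D :: "real measure" where "D \<equiv> density lborel (\<lambda>s. ennreal (w s))"

lemma AE_D_iff: "(AE s in D. P s) \<longleftrightarrow> (AE s in lborel. P s)"
  by (subst AE_density) (auto simp: w_pos)

lemma sets_D [simp, measurable_cong]: "sets D = sets borel"
  by simp

lemma nn_integral_D: "f \<in> borel_measurable borel \<Longrightarrow> (\<integral>\<^sup>+s. f s \<partial>D) = (\<integral>\<^sup>+s. ennreal (w s) * f s \<partial>lborel)"
  by (rule nn_integral_density) auto

lemma integral_D: "f \<in> borel_measurable borel \<Longrightarrow> (\<integral>s. f s \<partial>D) = (\<integral>s. w s *\<^sub>R (f s :: complex) \<partial>lborel)"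
  by (rule integral_density) (auto intro!: AE_I2 less_imp_le[OF w_pos])

lemma locint_w: "locint (\<lambda>s. complex_of_real (w s))"
proof (cases "finite_mass w")
  case True
  have "(\<integral>\<^sup>+t. indicator {-R..R} t * ennreal (cmod (complex_of_real (w t))) \<partial>lborel) < \<infinity>" for R :: real
  proof -
    have "(\<integral>\<^sup>+t. indicator {-R..R} t * ennreal (cmod (complex_of_real (w t))) \<partial>lborel) \<le> (\<integral>\<^sup>+t. ennreal (w t) \<partial>lborel)"
      by (intro nn_integral_mono) (auto simp: indicator_def less_imp_le[OF w_pos])
    then show ?thesis using True by (auto simp: finite_mass_def intro: le_less_trans)
  qed
  then show ?thesis by (simp add: locint_def)
next
  case False
  then show ?thesis using w_infinite_mass locint_const[of 1] by simp
qed

lemma sigma_finite_D: "sigma_finite_measure D"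
  by (subst sigma_finite_measure.sigma_finite_iff_density_finite[OF sigma_finite_lborel]) auto

lemma finite_mass_facts:
  assumes fin: "finite_mass w"
  shows "integrable lborel w" "mass w = (\<integral>s. w s \<partial>lborel)" "cum w s = (\<integral>t. indicator {..<s} t * w t \<partial>lborel)"
    "integrable lborel (\<lambda>t. indicator {..<s} t * w t)"
proof -
  show int: "integrable lborel w"
    using fin w_pos by (auto simp: integrable_iff_bounded finite_mass_def less_imp_le)
  have "(\<integral>\<^sup>+s. ennreal (w s) \<partial>lborel) = ennreal (\<integral>s. w s \<partial>lborel)"
    by (intro nn_integral_eq_integral int) (simp add: w_pos less_imp_le)
  then show "mass w = (\<integral>s. w s \<partial>lborel)"
    using fin by (simp add: mass_def Bochner_Integration.integral_nonneg less_imp_le[OF w_pos])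
  show i: "integrable lborel (\<lambda>t. indicator {..<s} t * w t)"
    using integrable_mult_indicator[OF _ int, of "{..<s}"] by simp
  have "(\<integral>\<^sup>+t. indicator {..<s} t * ennreal (w t) \<partial>lborel) = (\<integral>\<^sup>+t. ennreal (indicator {..<s} t * w t) \<partial>lborel)"
    by (intro nn_integral_cong) (auto simp: indicator_def)
  also have "\<dots> = ennreal (\<integral>t. indicator {..<s} t * w t \<partial>lborel)"
    by (intro nn_integral_eq_integral i) (simp add: w_pos less_imp_le)
  finally show "cum w s = (\<integral>t. indicator {..<s} t * w t \<partial>lborel)"
    using fin by (simp add: cum_def Bochner_Integration.integral_nonneg less_imp_le[OF w_pos])
qed

section \<open>The coordinate y and its periodic inverse\<close>

lemma cum_diff: "complex_of_real (cum w b - cum w a) = oint a b (\<lambda>s. complex_of_real (w s))"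
proof (cases "finite_mass w")
  case True
  note f = finite_mass_facts[OF True]
  have "cum w b - cum w a = (\<integral>t. indicator {..<b} t * w t - indicator {..<a} t * w t \<partial>lborel)"
    unfolding f(3) by (rule Bochner_Integration.integral_diff[symmetric]) (rule f(4))+
  also have "\<dots> = (\<integral>t. orient a b t * w t \<partial>lborel)"
    by (intro Bochner_Integration.integral_cong refl) (auto simp: orient_def indicator_def)
  finally show ?thesis
    unfolding oint_def by (simp add: scaleR_conv_of_real flip: of_real_mult integral_complex_of_real)
next
  case False
  then show ?thesis using w_infinite_mass by (simp add: cum_def oint_const scaleR_conv_of_real)
qed

lemma continuous_cum: "continuous_on UNIV (cum w)"
proof -
  have eq: "cum w = (\<lambda>s. cum w 0 + Re (oint 0 s (\<lambda>s. complex_of_real (w s))))"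
    by (auto simp: fun_eq_iff simp flip: cum_diff)
  show ?thesis by (subst eq) (intro continuous_intros oint_continuous locint_w)
qed

lemma cum_measurable [measurable]: "cum w \<in> borel_measurable borel"
  by (rule borel_measurable_continuous_onI[OF continuous_cum])

lemma cum_strict_mono:
  assumes "a < b" shows "cum w a < cum w b"
proof (cases "finite_mass w")
  case True
  note f = finite_mass_facts[OF True]
  have i: "integrable lborel (\<lambda>t. indicator {a..<b} t * w t)"
    using integrable_mult_indicator[OF _ f(1), of "{a..<b}"] by simp
  have "cum w b - cum w a = (\<integral>t. indicator {..<b} t * w t - indicator {..<a} t * w t \<partial>lborel)"
    unfolding f(3) by (rule Bochner_Integration.integral_diff[symmetric]) (rule f(4))+
  also have "\<dots> = (\<integral>t. indicator {a..<b} t * w t \<partial>lborel)"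
    using assms by (intro Bochner_Integration.integral_cong refl) (auto simp: indicator_def)
  finally have eq: "cum w b - cum w a = (\<integral>t. indicator {a..<b} t * w t \<partial>lborel)" .
  have "(\<integral>t. indicator {a..<b} t * w t \<partial>lborel) \<noteq> 0"
  proof
    assume "(\<integral>t. indicator {a..<b} t * w t \<partial>lborel) = 0"
    then have "AE t in lborel. indicator {a..<b} t * w t = 0"
      using i by (subst (asm) integral_nonneg_eq_0_iff_AE) (auto simp: less_imp_le[OF w_pos])
    then have "AE t in lborel. t \<notin> {a..<b}"
    proof eventually_elim
      case (elim t) then show ?case using w_pos[of t] by (auto simp: indicator_def split: if_splits)
    qed
    then have "{a..<b} \<in> null_sets lborel" by (subst (asm) AE_iff_null_sets[symmetric]) auto
    then show False using assms by (simp add: null_sets_def)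
  qed
  moreover have "(\<integral>t. indicator {a..<b} t * w t \<partial>lborel) \<ge> 0"
    by (intro Bochner_Integration.integral_nonneg) (simp add: less_imp_le[OF w_pos])
  ultimately show ?thesis using eq by linarith
qed (use assms in \<open>simp add: cum_def\<close>)

lemma cum_less_iff: "cum w a < cum w b \<longleftrightarrow> a < b"
  using cum_strict_mono by (metis linorder_neqE_linordered_idom order_less_asym order_less_irrefl)

lemma cum_le_iff: "cum w a \<le> cum w b \<longleftrightarrow> a \<le> b"
  using cum_less_iff[of b a] by (simp add: not_less[symmetric])

lemma cum_eq_iff: "cum w a = cum w b \<longleftrightarrow> a = b"
  using cum_le_iff by (metis order_antisym order_refl)

lemma cum_limits:
  assumes fin: "finite_mass w"
  shows "(\<lambda>n. cum w (real n)) \<longlonglongrightarrow> mass w" "(\<lambda>n. cum w (- real n)) \<longlonglongrightarrow> 0"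
proof -
  note f = finite_mass_facts[OF fin]
  have lim: "(\<lambda>n. \<integral>t. indicator {..<c n} t * w t \<partial>lborel) \<longlonglongrightarrow> (\<integral>t. g t * w t \<partial>lborel)"
    if ev: "\<And>t. \<forall>\<^sub>F n in sequentially. indicator {..<c n} t = g t" and [measurable]: "g \<in> borel_measurable borel"
    for c :: "nat \<Rightarrow> real" and g :: "real \<Rightarrow> real"
  proof (rule integral_dominated_convergence)
    show "AE t in lborel. (\<lambda>n. indicator {..<c n} t * w t) \<longlonglongrightarrow> g t * w t"
      by (intro AE_I2 tendsto_mult tendsto_const tendsto_eventually ev)
    show "AE t in lborel. norm (indicator {..<c n} t * w t) \<le> w t" for n
      by (intro AE_I2) (auto simp: indicator_def less_imp_le[OF w_pos])
  qed (use f(1) in auto)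
  show "(\<lambda>n. cum w (real n)) \<longlonglongrightarrow> mass w"
    unfolding f(2) f(3)
  proof (rule lim[of real "\<lambda>_. 1", simplified])
    fix t :: real
    show "\<forall>\<^sub>F n in sequentially. indicator {..<real n} t = (1::real)"
      using eventually_less_real[of t] by eventually_elim simp
  qed
  have "(\<lambda>n. \<integral>t. indicator {..<- real n} t * w t \<partial>lborel) \<longlonglongrightarrow> (\<integral>t. 0 * w t \<partial>lborel)"
  proof (rule lim)
    fix t :: real
    show "\<forall>\<^sub>F n in sequentially. indicator {..<- real n} t = (0::real)"
      using eventually_less_real[of "- t"] by eventually_elim auto
  qed simp
  then show "(\<lambda>n. cum w (- real n)) \<longlonglongrightarrow> 0" unfolding f(3) by simp
qed

lemma cum_bounds:
  assumes fin: "finite_mass w" shows "0 < cum w s" "cum w s < mass w"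
proof -
  have le: "cum w a \<le> mass w" "0 \<le> cum w a" for a
  proof -
    have "\<forall>\<^sub>F n in sequentially. cum w a \<le> cum w (real n) \<and> cum w (- real n) \<le> cum w a"
      using eventually_less_real[of "\<bar>a\<bar>"] by eventually_elim (auto simp: cum_le_iff)
    then show "cum w a \<le> mass w" "0 \<le> cum w a"
      using cum_limits[OF fin]
      by (auto intro: tendsto_lowerbound tendsto_upperbound elim!: eventually_mono)
  qed
  show "0 < cum w s" using le(2)[of "s - 1"] cum_strict_mono[of "s - 1" s] by simp
  show "cum w s < mass w" using le(1)[of "s + 1"] cum_strict_mono[of s "s + 1"] by simp
qed

lemma mass_pos: "finite_mass w \<Longrightarrow> mass w > 0"
  using cum_bounds[of 0] by linarith

lemma cum_in_range: "cum w s \<in> fibre_range w"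
  using cum_bounds by (auto simp: fibre_range_def)

lemma cum_surj:
  assumes "y \<in> fibre_range w" shows "\<exists>s. cum w s = y"
proof (cases "finite_mass w")
  case True
  with assms have y: "0 < y" "y < mass w" by (auto simp: fibre_range_def)
  have "\<forall>\<^sub>F n in sequentially. cum w (- real n) < y" "\<forall>\<^sub>F n in sequentially. y < cum w (real n)"
    using order_tendstoD(2)[OF cum_limits(2)[OF True] y(1)] order_tendstoD(1)[OF cum_limits(1)[OF True] y(2)] by auto
  then have "\<forall>\<^sub>F n in sequentially. cum w (- real n) < y \<and> y < cum w (real n)" by eventually_elim simp
  then obtain n where n: "cum w (- real n) < y" "y < cum w (real n)" by (auto simp: eventually_sequentially)
  then have "\<exists>s\<ge>- real n. s \<le> real n \<and> cum w s = y"
    by (intro IVT') (auto intro: continuous_on_subset[OF continuous_cum])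
  then show ?thesis by blast
qed (simp add: cum_def)

lemma rmod_cum: "cum w s rmod mass w = cum w s"
  using cum_bounds[of s] by (cases "finite_mass w") (auto simp: mass_def)

lemma uncum_cum [simp]: "uncum w (cum w s) = s"
proof (cases "finite_mass w")
  case True
  then show ?thesis using cum_bounds(1)[of s] unfolding uncum_def rmod_cum by (auto simp: cum_eq_iff)
qed (simp add: cum_def uncum_def)

lemma cum_uncum:
  assumes "finite_mass w \<Longrightarrow> y rmod mass w \<noteq> 0" shows "cum w (uncum w y) = y rmod mass w"
proof (cases "finite_mass w")
  case True
  have "y rmod mass w \<in> fibre_range w"
    using True assms mass_pos[OF True] rmod_less[of "mass w" y] rmod_nonneg[of "mass w" y]
    by (auto simp: fibre_range_def)
  then obtain s where s: "cum w s = y rmod mass w" using cum_surj by blast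
  then have "uncum w y = s"
    using True assms by (auto simp: uncum_def simp flip: s simp: cum_eq_iff)
  with s show ?thesis by simp
qed (simp add: cum_def uncum_def mass_def)

lemma uncum_rmod: "uncum w (y rmod mass w) = uncum w y"
  by (cases "finite_mass w") (simp_all add: uncum_def mass_infinite)

lemma uncum_rmod_add: "uncum w (y rmod mass w + c) = uncum w (y + c)"
  by (metis rmod_add_left_eq uncum_rmod)

lemma uncum_add_mass: "uncum w (y + mass w) = uncum w y"
  using uncum_rmod_add[of "mass w" y] by (simp add: add.commute)

text \<open>Removes the description operator: sublevel sets of \<open>uncum\<close> are expressed by
  \<open>rmod\<close> and \<open>cum\<close>. Measurability can be read off from this, later also
  jointly in the fibre parameter.\<close>

lemma uncum_le_iff: "uncum w y \<le> c \<longleftrightarrow> (if finite_mass w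
    then (if y rmod mass w = 0 then 0 \<le> c else y rmod mass w \<le> cum w c) else y \<le> c)"
  using cum_uncum[of y] cum_le_iff[of "uncum w y" c] by (cases "finite_mass w") (auto simp: uncum_def mass_infinite)

lemma uncum_measurable [measurable]: "uncum w \<in> borel_measurable borel"
  unfolding borel_measurable_iff_le uncum_le_iff by measurable

lemma fibre_shift_measurable [measurable]: "fibre_shift w c \<in> borel_measurable borel"
  unfolding fibre_shift_def[abs_def] by measurable

lemma fibre_shift_zero [simp]: "fibre_shift w 0 s = s"
  by (simp add: fibre_shift_def)

lemma fibre_shift_add:
  assumes "finite_mass w \<Longrightarrow> (cum w s + c) rmod mass w \<noteq> 0"
  shows "fibre_shift w d (fibre_shift w c s) = fibre_shift w (d + c) s"
  using cum_uncum[OF assms] by (simp add: fibre_shift_def uncum_rmod_add) (simp add: add_ac)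

text \<open>A shift carries at most one point of a finite fibre to infinity, since
  \<open>cum\<close> is injective and shifts are injective modulo the period.\<close>

lemma AE_cum_shift_nonzero: "AE s in lborel. finite_mass w \<longrightarrow> (cum w s + c) rmod mass w \<noteq> 0"
proof (cases "finite_mass w")
  case True
  have "s = s'" if "(cum w s + c) rmod mass w = 0" "(cum w s' + c) rmod mass w = 0" for s s'
  proof -
    have "(cum w s + c - c) rmod mass w = (cum w s' + c - c) rmod mass w"
      using that rmod_diff[of "cum w s + c" "mass w" c] rmod_diff[of "cum w s' + c" "mass w" c] by simp
    then show ?thesis by (simp add: rmod_cum cum_eq_iff)
  qed
  then obtain a where "{s. (cum w s + c) rmod mass w = 0} \<subseteq> {a}" by blast
  then show ?thesis using AE_lborel_singleton[of a] by (auto elim!: eventually_mono)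
qed auto

section \<open>Image measure under the coordinate and invariance under shifts\<close>

lemma emeasure_D_tail:
  assumes fin: "finite_mass w" shows "emeasure D {a<..} = ennreal (mass w - cum w a)"
proof -
  note f = finite_mass_facts[OF fin]
  have i: "integrable lborel (\<lambda>t. indicator {a<..} t * w t)"
    using integrable_mult_indicator[OF _ f(1), of "{a<..}"] by simp
  have "emeasure D {a<..} = (\<integral>\<^sup>+t. ennreal (indicator {a<..} t * w t) \<partial>lborel)"
    by (subst emeasure_density) (auto intro!: nn_integral_cong simp: indicator_def)
  also have "\<dots> = ennreal (\<integral>t. indicator {a<..} t * w t \<partial>lborel)"
    by (intro nn_integral_eq_integral i) (simp add: less_imp_le[OF w_pos])
  also have "(\<integral>t. indicator {a<..} t * w t \<partial>lborel) = (\<integral>t. w t - indicator {..<a} t * w t \<partial>lborel)"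
  proof (rule integral_cong_AE)
    show "AE t in lborel. indicator {a<..} t * w t = w t - indicator {..<a} t * w t"
      using AE_lborel_singleton[of a] by eventually_elim (auto simp: indicator_def)
  qed auto
  also have "\<dots> = mass w - cum w a"
    unfolding f(2) f(3) by (rule Bochner_Integration.integral_diff[OF f(1) f(4)])
  finally show ?thesis .
qed

text \<open>The probability integral transform, not normalised: the weighted measure becomes
  Lebesgue measure on the range of y. For finite mass both measures are compared on half-lines;
  otherwise \<open>cum\<close> is the identity.\<close>

lemma distr_cum: "distr D borel (cum w) = density lborel (indicator (fibre_range w))"
proof (cases "finite_mass w")
  case True
  note m = mass_pos[OF True]
  show ?thesis
  proof (rule measure_eqI_lessThan)
    fix x :: real
    have R: "emeasure (density lborel (indicator (fibre_range w))) {x<..} = ennreal (if x \<le> 0 then mass w else if x < mass w then mass w - x else 0)"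
    proof -
      have "emeasure (density lborel (indicator (fibre_range w))) {x<..} = emeasure lborel ({0<..<mass w} \<inter> {x<..})"
        using True by (subst emeasure_density) (auto simp: fibre_range_def simp flip: indicator_inter_arith)
      also have "{0<..<mass w} \<inter> {x<..} = {max 0 x<..<mass w}" by auto
      finally show ?thesis using m by (auto simp: max_def emeasure_lborel_Ioo)
    qed
    have L: "emeasure (distr D borel (cum w)) {x<..} = emeasure D {s. x < cum w s}"
      by (subst emeasure_distr) (auto simp: vimage_def)
    have "emeasure D {s. x < cum w s} = ennreal (if x \<le> 0 then mass w else if x < mass w then mass w - x else 0)"
    proof -
      consider "x \<le> 0" | "0 < x" "x < mass w" | "x \<ge> mass w" by linarith
      then show ?thesis
      proof cases
        case 1
        then have "{s. x < cum w s} = UNIV" using cum_bounds(1)[OF True] by (auto intro: le_less_trans)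
        moreover have "emeasure D UNIV = ennreal (mass w)"
          using True by (subst emeasure_density) (auto simp: mass_def finite_mass_def less_top)
        ultimately show ?thesis using 1 by simp
      next
        case 2
        then obtain a where a: "cum w a = x" using cum_surj[of x] True by (auto simp: fibre_range_def)
        then have "{s. x < cum w s} = {a<..}" by (auto simp flip: a simp: cum_less_iff)
        then show ?thesis using emeasure_D_tail[OF True, of a] a 2 by simp
      next
        case 3
        then have "{s. x < cum w s} = {}" using cum_bounds(2)[OF True] by (auto simp: not_less intro: order_trans[OF less_imp_le])
        then show ?thesis using 3 m by simp
      qed
    qed
    then show "emeasure (distr D borel (cum w)) {x<..} = emeasure (density lborel (indicator (fibre_range w))) {x<..}"
      "emeasure (distr D borel (cum w)) {x<..} < \<infinity>" unfolding L R by auto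
  qed auto
next
  case False
  then have w1: "w = (\<lambda>_. 1)" and c: "cum w = (\<lambda>s. s)" "fibre_range w = UNIV"
    using w_infinite_mass by (auto simp: cum_def fibre_range_def)
  have "D = lborel" by (subst w1) (simp add: density_1)
  then have "distr D borel (cum w) = distr lborel borel (\<lambda>s. s)" by (simp only: c)
  also have "\<dots> = lborel" using distr_id2[of borel lborel] by simp
  finally show ?thesis by (simp add: c density_1)
qed

lemma nn_integral_cum:
  assumes [measurable]: "F \<in> borel_measurable borel"
  shows "(\<integral>\<^sup>+s. F (cum w s) \<partial>D) = (\<integral>\<^sup>+y. indicator (fibre_range w) y * F y \<partial>lborel)"
proof -
  have [measurable]: "fibre_range w \<in> sets borel" by (auto simp: fibre_range_def)
  have "(\<integral>\<^sup>+s. F (cum w s) \<partial>D) = (\<integral>\<^sup>+y. F y \<partial>distr D borel (cum w))"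
    by (subst nn_integral_distr) auto
  also have "\<dots> = (\<integral>\<^sup>+y. indicator (fibre_range w) y * F y \<partial>lborel)"
    unfolding distr_cum by (subst nn_integral_density) auto
  finally show ?thesis .
qed

text \<open>An integral over a full period does not depend on its starting point: reduce c modulo
  the period m, cut the shifted interval at m and move the part beyond m back by m. For infinite
  mass this is translation invariance on the line.\<close>

lemma nn_integral_periodic:
  assumes [measurable]: "G \<in> borel_measurable borel" and per: "\<And>y c. G (y rmod mass w + c) = G (y + c)"
  shows "(\<integral>\<^sup>+y. indicator (fibre_range w) y * G (y + c) \<partial>lborel) = (\<integral>\<^sup>+y. indicator (fibre_range w) y * G y \<partial>(lborel :: real measure))"
proof (cases "finite_mass w")
  case True
  define m where "m = mass w"
  have m: "m > 0" using mass_pos[OF True] by (simp add: m_def)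
  define c' where "c' = c rmod m"
  have c': "0 \<le> c'" "c' < m" using m rmod_nonneg[of m c] rmod_less[of m c] by (auto simp: c'_def)
  have per1: "G (y + m) = G y" for y using per[of m y] by (simp add: m_def add.commute)
  \<comment> \<open>\<open>fibre_range\<close> leaves out 0, which would spoil the half-open
    cutting.\<close>
  have half: "(\<integral>\<^sup>+y. indicator (fibre_range w) y * F y \<partial>lborel) = (\<integral>\<^sup>+y. indicator {0..<m} y * F y \<partial>lborel)" for F :: "real \<Rightarrow> ennreal"
  proof (rule nn_integral_cong_AE)
    show "AE y in lborel. indicator (fibre_range w) y * F y = indicator {0..<m} y * F y"
      using AE_lborel_singleton[of "0::real"] by eventually_elim (use True in \<open>auto simp: fibre_range_def indicator_def m_def\<close>)
  qed
  have "(\<integral>\<^sup>+y. indicator {0..<m} y * G (y + c) \<partial>lborel) = (\<integral>\<^sup>+y. indicator {c'..<m + c'} (y + c') * G (y + c') \<partial>lborel)"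
  proof (intro nn_integral_cong)
    fix y
    have "G (y + c) = G (y + c')" using per[of c y] by (simp add: c'_def m_def add.commute)
    then show "indicator {0..<m} y * G (y + c) = indicator {c'..<m + c'} (y + c') * G (y + c')" by (auto simp: indicator_def)
  qed
  also have "\<dots> = (\<integral>\<^sup>+y. indicator {c'..<m + c'} y * G y \<partial>lborel)"
    by (rule lborel_translation_integral[of "\<lambda>y. indicator {c'..<m + c'} y * G y"]) measurable
  also have "\<dots> = (\<integral>\<^sup>+y. indicator {c'..<m} y * G y + indicator {m..<m + c'} y * G y \<partial>lborel)"
    using c' by (intro nn_integral_cong) (auto simp: indicator_def)
  also have "\<dots> = (\<integral>\<^sup>+y. indicator {c'..<m} y * G y \<partial>lborel) + (\<integral>\<^sup>+y. indicator {m..<m + c'} y * G y \<partial>lborel)"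
    by (intro nn_integral_add) measurable
  also have "(\<integral>\<^sup>+y. indicator {m..<m + c'} y * G y \<partial>lborel) = (\<integral>\<^sup>+y. indicator {m..<m + c'} (y + m) * G (y + m) \<partial>lborel)"
    by (rule lborel_translation_integral[symmetric, of "\<lambda>y. indicator {m..<m + c'} y * G y"]) measurable
  also have "\<dots> = (\<integral>\<^sup>+y. indicator {0..<c'} y * G y \<partial>lborel)"
    unfolding per1 by (intro nn_integral_cong) (auto simp: indicator_def)
  also have "(\<integral>\<^sup>+y. indicator {c'..<m} y * G y \<partial>lborel) + (\<integral>\<^sup>+y. indicator {0..<c'} y * G y \<partial>lborel) =
    (\<integral>\<^sup>+y. indicator {c'..<m} y * G y + indicator {0..<c'} y * G y \<partial>lborel)"
    by (intro nn_integral_add[symmetric]) measurable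
  also have "\<dots> = (\<integral>\<^sup>+y. indicator {0..<m} y * G y \<partial>lborel)"
    using c' by (intro nn_integral_cong) (auto simp: indicator_def)
  finally show ?thesis unfolding half .
next
  case False
  then show ?thesis using lborel_translation_integral[of G c] by (simp add: fibre_range_def)
qed

lemma nn_integral_fibre_shift:
  assumes [measurable]: "F \<in> borel_measurable borel"
  shows "(\<integral>\<^sup>+s. F (fibre_shift w c s) \<partial>D) = (\<integral>\<^sup>+s. F s \<partial>D)"
proof -
  have "(\<integral>\<^sup>+s. F (fibre_shift w c s) \<partial>D) = (\<integral>\<^sup>+y. indicator (fibre_range w) y * F (uncum w (y + c)) \<partial>lborel)"
    unfolding fibre_shift_def by (rule nn_integral_cum) measurable
  also have "\<dots> = (\<integral>\<^sup>+y. indicator (fibre_range w) y * F (uncum w y) \<partial>lborel)"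
    by (rule nn_integral_periodic) (auto simp: uncum_rmod_add)
  also have "\<dots> = (\<integral>\<^sup>+s. F (uncum w (cum w s)) \<partial>D)"
    by (rule nn_integral_cum[symmetric]) measurable
  finally show ?thesis by simp
qed

lemma AE_cum_shift:
  assumes "AE y in lborel. P y" shows "AE s in lborel. P (cum w s + c)"
proof -
  have "AE y in distr D borel (cum w). P (y + c)"
    unfolding distr_cum by (subst AE_density) (auto simp: fibre_range_def intro: eventually_mono[OF AE_lborel_shift[OF assms]])
  then have "AE s in D. P (cum w s + c)" by (intro AE_distrD[of "cum w" D borel]) auto
  then show ?thesis unfolding AE_D_iff .
qed

lemma AE_rmod_mass_nonzero: "AE y in lborel. finite_mass w \<longrightarrow> y rmod mass w \<noteq> 0"
proof (cases "finite_mass w")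
  case True
  have "countable (range (\<lambda>k::int. of_int k * mass w))" by simp
  then have "AE y in lborel. y \<notin> range (\<lambda>k::int. of_int k * mass w)"
    by (intro AE_not_in countable_imp_null_set_lborel)
  then show ?thesis
  proof eventually_elim
    case (elim y)
    have "y rmod mass w \<noteq> 0"
    proof
      assume "y rmod mass w = 0"
      then have "y = of_int \<lfloor>y / \<bar>mass w\<bar>\<rfloor> * mass w"
        using rmod_eq_diff_floor[of y "mass w"] mass_pos[OF True] by simp
      with elim show False by blast
    qed
    then show ?case by simp
  qed
qed auto

text \<open>On the basic period this is the image measure statement; the remaining y are reached by
  countably many translations by multiples of the period.\<close>

lemma AE_uncum:
  assumes "AE s in lborel. P s" shows "AE y in lborel. P (uncum w y)"
proof -
  obtain N where N: "{s. \<not> P s} \<subseteq> N" "N \<in> null_sets lborel"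
    using assms by (auto simp: eventually_ae_filter)
  then have [measurable]: "N \<in> sets borel" by (auto simp: null_sets_def)
  have [measurable]: "fibre_range w \<in> sets borel" by (auto simp: fibre_range_def)
  have "AE s in D. uncum w (cum w s) \<notin> N"
    unfolding AE_D_iff using AE_not_in[OF N(2)] by simp
  then have "AE y in distr D borel (cum w). uncum w y \<notin> N"
    by (subst AE_distr_iff) auto
  then have base: "AE y in lborel. y \<in> fibre_range w \<longrightarrow> uncum w y \<notin> N"
    unfolding distr_cum by (subst (asm) AE_density) (auto elim!: eventually_mono simp: indicator_def split: if_splits)
  have "AE y in lborel. \<forall>k::int. y + of_int k * mass w \<in> fibre_range w \<longrightarrow> uncum w (y + of_int k * mass w) \<notin> N"
    unfolding AE_all_countable using AE_lborel_shift[OF base] by blast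
  then show ?thesis
    using AE_rmod_mass_nonzero
  proof eventually_elim
    case (elim y)
    show ?case
    proof (cases "finite_mass w")
      case True
      let ?k = "- \<lfloor>y / \<bar>mass w\<bar>\<rfloor>"
      have m: "mass w > 0" by (rule mass_pos[OF True])
      have eq: "y + of_int ?k * mass w = y rmod mass w" using rmod_eq_diff_floor[of y "mass w"] m by simp
      then have "y + of_int ?k * mass w \<in> fibre_range w"
        using True elim(2) m rmod_less[of "mass w" y] rmod_nonneg[of "mass w" y] by (auto simp: fibre_range_def)
      with elim(1) have "uncum w (y rmod mass w) \<notin> N" unfolding eq[symmetric] by blast
      then show ?thesis using N(1) by (auto simp: uncum_rmod)
    next
      case False
      then show ?thesis using elim(1)[rule_format, of 0] N(1) by (auto simp: fibre_range_def)
    qed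
  qed
qed

end

section \<open>Functions and equations on a fibre in the coordinate y\<close>

context fibre_weight
begin

lemma distr_cum_real: "distr D borel (cum w) = density lborel (\<lambda>y. ennreal (indicator (fibre_range w) y))"
  by (simp add: distr_cum ennreal_indicator)

text \<open>The substitution y = \<open>cum w s\<close>. Strict monotonicity carries the orientation
  kernel over exactly, and its support lies inside the range.\<close>

lemma oint_cum:
  assumes [measurable]: "h \<in> borel_measurable borel"
  shows "oint (cum w a) (cum w b) (\<lambda>y. h (uncum w y)) = oint a b (\<lambda>s. w s *\<^sub>R h s)"
proof -
  have [measurable]: "fibre_range w \<in> sets borel" by (auto simp: fibre_range_def)
  have ori: "orient (cum w a) (cum w b) (cum w s) = orient a b s" for s
    by (auto simp: orient_def indicator_def cum_le_iff cum_less_iff)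
  have "oint a b (\<lambda>s. w s *\<^sub>R h s) = (\<integral>s. w s *\<^sub>R (orient a b s *\<^sub>R h s) \<partial>lborel)"
    unfolding oint_def by (simp add: mult.commute)
  also have "\<dots> = (\<integral>s. orient a b s *\<^sub>R h s \<partial>D)"
    by (rule integral_D[symmetric]) measurable
  also have "\<dots> = (\<integral>s. orient (cum w a) (cum w b) (cum w s) *\<^sub>R h (uncum w (cum w s)) \<partial>D)"
    by (simp add: ori)
  also have "\<dots> = (\<integral>y. orient (cum w a) (cum w b) y *\<^sub>R h (uncum w y) \<partial>distr D borel (cum w))"
    by (subst integral_distr) auto
  also have "\<dots> = (\<integral>y. indicator (fibre_range w) y *\<^sub>R (orient (cum w a) (cum w b) y *\<^sub>R h (uncum w y)) \<partial>lborel)"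
    unfolding distr_cum_real by (rule integral_density) auto
  also have "\<dots> = oint (cum w a) (cum w b) (\<lambda>y. h (uncum w y))"
    unfolding oint_def
  proof (intro Bochner_Integration.integral_cong refl)
    fix y
    have "orient (cum w a) (cum w b) y = 0" if "y \<notin> fibre_range w"
      using that cum_in_range[of a] cum_in_range[of b]
      by (auto simp: orient_def indicator_def fibre_range_def split: if_splits)
    then show "indicator (fibre_range w) y *\<^sub>R (orient (cum w a) (cum w b) y *\<^sub>R h (uncum w y)) =
        orient (cum w a) (cum w b) y *\<^sub>R h (uncum w y)" by (auto simp: indicator_def)
  qed
  finally show ?thesis by simp
qed

lemma integral_over_mass:
  assumes [measurable]: "h \<in> borel_measurable borel" and fin: "finite_mass w"
  shows "(\<integral>s. w s *\<^sub>R h s \<partial>lborel) = oint 0 (mass w) (\<lambda>y. h (uncum w y))"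
proof -
  have [measurable]: "fibre_range w \<in> sets borel" by (auto simp: fibre_range_def)
  have "(\<integral>s. w s *\<^sub>R h s \<partial>lborel) = (\<integral>s. h (uncum w (cum w s)) \<partial>D)"
    by (simp add: integral_D)
  also have "\<dots> = (\<integral>y. h (uncum w y) \<partial>distr D borel (cum w))"
    by (subst integral_distr) auto
  also have "\<dots> = (\<integral>y. indicator (fibre_range w) y *\<^sub>R h (uncum w y) \<partial>lborel)"
    unfolding distr_cum_real by (rule integral_density) auto
  also have "\<dots> = oint 0 (mass w) (\<lambda>y. h (uncum w y))"
    unfolding oint_def
  proof (rule integral_cong_AE)
    show "AE y in lborel. indicator (fibre_range w) y *\<^sub>R h (uncum w y) = orient 0 (mass w) y *\<^sub>R h (uncum w y)"
      using AE_lborel_singleton[of "0::real"]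
      by eventually_elim (use fin mass_pos[OF fin] in \<open>auto simp: fibre_range_def orient_def indicator_def\<close>)
  qed measurable
  finally show ?thesis .
qed

lemma L2_fibre_shift:
  assumes f: "f \<in> L2 D"
  shows "(\<lambda>s. f (fibre_shift w c s)) \<in> L2 D" "L2_norm D (\<lambda>s. f (fibre_shift w c s)) = L2_norm D f"
proof -
  have [measurable]: "f \<in> borel_measurable borel" using L2_measurable[OF f] by simp
  have eq: "(\<integral>\<^sup>+s. ennreal ((cmod (f (fibre_shift w c s)))\<^sup>2) \<partial>D) = (\<integral>\<^sup>+s. ennreal ((cmod (f s))\<^sup>2) \<partial>D)"
    by (rule nn_integral_fibre_shift) auto
  show *: "(\<lambda>s. f (fibre_shift w c s)) \<in> L2 D" using f eq by (simp add: L2_iff_nn_integral)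
  have "(L2_norm D (\<lambda>s. f (fibre_shift w c s)))\<^sup>2 = (L2_norm D f)\<^sup>2"
    using eq unfolding nn_integral_L2_norm[OF *] nn_integral_L2_norm[OF f] by simp
  then show "L2_norm D (\<lambda>s. f (fibre_shift w c s)) = L2_norm D f" by (simp add: power2_eq_iff_nonneg)
qed

text \<open>The shifts are isometric, so for almost every s the map t to f
  (\<open>fibre_shift w t s\<close>) is locally square integrable. A single such s suffices, as f
  \<circ> \<open>uncum w\<close> is this map translated by \<open>cum w s\<close>.\<close>

lemma uncum_locally_square_integrable:
  assumes f: "f \<in> L2 D"
  shows "\<forall>n. (\<integral>\<^sup>+y. indicator {-real n..real n} y * ennreal ((cmod (f (uncum w y)))\<^sup>2) \<partial>lborel) \<noteq> \<infinity>"
proof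
  fix n
  have [measurable]: "f \<in> borel_measurable borel" using L2_measurable[OF f] by simp
  have "AE s in D. \<forall>n. (\<integral>\<^sup>+t. indicator {-real n..real n} t * ennreal ((cmod (f (fibre_shift w t s)))\<^sup>2) \<partial>lborel) \<noteq> \<infinity>"
  proof (rule AE_locally_square_integrable[OF sigma_finite_D])
    show "case_prod (\<lambda>t s. f (fibre_shift w t s)) \<in> borel_measurable (borel \<Otimes>\<^sub>M D)"
      unfolding fibre_shift_def by measurable
  qed (auto intro: L2_fibre_shift f order_eq_refl)
  then obtain s where s: "\<forall>n. (\<integral>\<^sup>+t. indicator {-real n..real n} t * ennreal ((cmod (f (fibre_shift w t s)))\<^sup>2) \<partial>lborel) \<noteq> \<infinity>"
    using AE_lborel_ex unfolding AE_D_iff by blast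
  obtain N where N: "real n + \<bar>cum w s\<bar> \<le> real N" using real_arch_simple by blast
  have "(\<integral>\<^sup>+y. indicator {-real n..real n} y * ennreal ((cmod (f (uncum w y)))\<^sup>2) \<partial>lborel) =
     (\<integral>\<^sup>+t. indicator {-real n..real n} (t + cum w s) * ennreal ((cmod (f (uncum w (t + cum w s))))\<^sup>2) \<partial>lborel)"
    by (rule lborel_translation_integral[symmetric, of "\<lambda>y. indicator {-real n..real n} y * ennreal ((cmod (f (uncum w y)))\<^sup>2)"]) measurable
  also have "\<dots> \<le> (\<integral>\<^sup>+t. indicator {-real N..real N} t * ennreal ((cmod (f (fibre_shift w t s)))\<^sup>2) \<partial>lborel)"
    using N by (intro nn_integral_mono) (auto simp: indicator_def fibre_shift_def add.commute)
  finally show "(\<integral>\<^sup>+y. indicator {-real n..real n} y * ennreal ((cmod (f (uncum w y)))\<^sup>2) \<partial>lborel) \<noteq> \<infinity>"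
    using s[rule_format, of N] by (auto simp: top_unique)
qed

lemma locint_uncum: "f \<in> L2 D \<Longrightarrow> locint (\<lambda>y. f (uncum w y))"
  using uncum_locally_square_integrable L2_measurable[of f D]
  by (intro locint_if_locally_square_integrable) (auto intro: measurable_compose[OF uncum_measurable])

text \<open>The majorant w + w |h|^2 is locally integrable, as w is and h is in the weighted
  L^2.\<close>

lemma locint_weighted:
  assumes h: "h \<in> L2 D" shows "locint (\<lambda>s. w s *\<^sub>R h s)"
proof -
  have [measurable]: "h \<in> borel_measurable borel" using L2_measurable[OF h] by simp
  have "(\<integral>\<^sup>+t. indicator {-R..R} t * ennreal (cmod (w t *\<^sub>R h t)) \<partial>lborel) < \<infinity>" for R :: real
  proof -
    have "(\<integral>\<^sup>+t. indicator {-R..R} t * ennreal (cmod (w t *\<^sub>R h t)) \<partial>lborel) \<le>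
      (\<integral>\<^sup>+t. indicator {-R..R} t * ennreal (cmod (complex_of_real (w t))) + ennreal (w t) * ennreal ((cmod (h t))\<^sup>2) \<partial>lborel)"
    proof (intro nn_integral_mono)
      fix t
      have w0: "w t \<ge> 0" using w_pos[of t] by simp
      have "cmod (h t) \<le> 1 + (cmod (h t))\<^sup>2"
        using sum_squares_bound[of 1 "cmod (h t)"] norm_ge_zero[of "h t"] by (simp add: power2_eq_square del: norm_ge_zero)
      then have "w t * cmod (h t) \<le> w t + w t * (cmod (h t))\<^sup>2" using w0 by (metis distrib_left mult_left_mono mult.right_neutral)
      then show "indicator {-R..R} t * ennreal (cmod (w t *\<^sub>R h t)) \<le> indicator {-R..R} t * ennreal (cmod (complex_of_real (w t))) + ennreal (w t) * ennreal ((cmod (h t))\<^sup>2)"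
        using w0 by (auto simp: indicator_def simp flip: ennreal_plus ennreal_mult)
    qed
    also have "\<dots> = (\<integral>\<^sup>+t. indicator {-R..R} t * ennreal (cmod (complex_of_real (w t))) \<partial>lborel) + (\<integral>\<^sup>+t. ennreal (w t) * ennreal ((cmod (h t))\<^sup>2) \<partial>lborel)"
      by (intro nn_integral_add) measurable
    also have "\<dots> < \<infinity>"
      using locint_w h nn_integral_D[of "\<lambda>t. ennreal ((cmod (h t))\<^sup>2)"] by (simp add: locint_def L2_iff_nn_integral)
    finally show ?thesis .
  qed
  then show ?thesis by (simp add: locint_def)
qed

lemma finite_mass_integrable_weighted:
  assumes h: "h \<in> L2 D" and fin: "finite_mass w"
  shows "integrable lborel (\<lambda>s. w s *\<^sub>R h s)"
proof -
  have [measurable]: "h \<in> borel_measurable borel" using L2_measurable[OF h] by simp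
  have "(\<integral>\<^sup>+x. ennreal ((cmod 1)\<^sup>2) \<partial>D) < \<infinity>"
    using fin by (simp add: emeasure_density finite_mass_def)
  then have "(\<lambda>_. 1) \<in> L2 D" by (simp add: L2_iff_nn_integral)
  then have "integrable D (\<lambda>s. h s * 1)" by (intro L2_mult_integrable h)
  then show ?thesis by (subst (asm) integrable_density) (auto simp: less_imp_le[OF w_pos])
qed

text \<open>Let K be the primitive of h in the coordinate y. On a finite fibre its increment over
  one period is the integral of w h, so the side condition says that K is periodic. That is what
  extends the equation from one period to all y; conversely f \<circ> \<open>uncum w\<close> is
  periodic, and \<alpha> \<noteq> 0 forces K to be so.\<close>

lemma fibre_equation_iff:
  assumes f: "f \<in> L2 D" and h: "h \<in> L2 D" and \<alpha>: "\<alpha> \<noteq> 0"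
  shows "(\<exists>c. AE s in lborel. f s = c + \<alpha> * oint 0 s (\<lambda>s. w s *\<^sub>R h s)) \<and> (finite_mass w \<longrightarrow> (\<integral>s. w s *\<^sub>R h s \<partial>lborel) = 0)
    \<longleftrightarrow> (\<exists>c. AE y in lborel. f (uncum w y) = c + \<alpha> * oint 0 y (\<lambda>y. h (uncum w y)))"
proof -
  have [measurable]: "f \<in> borel_measurable borel" "h \<in> borel_measurable borel"
    using L2_measurable[OF f] L2_measurable[OF h] by auto
  have li: "locint (\<lambda>y. h (uncum w y))" by (rule locint_uncum[OF h])
  define K where "K y = oint 0 y (\<lambda>y. h (uncum w y))" for y
  have K_diff: "oint a b (\<lambda>y. h (uncum w y)) = K b - K a" for a b
    using oint_add_endpoints[OF li, of 0 b a] by (simp add: K_def)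
  have wK: "oint 0 s (\<lambda>s. w s *\<^sub>R h s) = K (cum w s) - K (cum w 0)" for s
    using oint_cum[of h 0 s] K_diff by simp
  have K_mass: "K (y + mass w) - K y = (\<integral>s. w s *\<^sub>R h s \<partial>lborel)" if fin: "finite_mass w" for y
  proof -
    have "oint 0 y (\<lambda>y. h (uncum w y)) = oint (mass w) (y + mass w) (\<lambda>y. h (uncum w y))"
      using oint_shift[of 0 y "\<lambda>y. h (uncum w y)" "mass w"] by (simp add: uncum_add_mass)
    then have "K y = K (y + mass w) - K (mass w)" unfolding K_diff by (simp add: K_def)
    then have "K (y + mass w) - K y = K (mass w)" by simp
    also have "\<dots> = (\<integral>s. w s *\<^sub>R h s \<partial>lborel)" using integral_over_mass[OF _ fin, of h] by (simp add: K_def)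
    finally show ?thesis .
  qed
  show ?thesis
  proof
    assume L: "(\<exists>c. AE s in lborel. f s = c + \<alpha> * oint 0 s (\<lambda>s. w s *\<^sub>R h s)) \<and> (finite_mass w \<longrightarrow> (\<integral>s. w s *\<^sub>R h s \<partial>lborel) = 0)"
    then obtain c where c: "AE s in lborel. f s = c + \<alpha> * oint 0 s (\<lambda>s. w s *\<^sub>R h s)" by blast
    have K_rmod: "K (y rmod mass w) = K y" for y
    proof (cases "finite_mass w")
      case True
      then have per: "K (y + mass w) = K y" for y using L K_mass[OF True, of y] by simp
      interpret periodic_fun_simple K "mass w" by standard (rule per)
      show ?thesis using rmod_eq_diff_floor[of y "mass w"] mass_pos[OF True] minus_of_int by simp
    qed (simp add: mass_infinite)
    have "AE y in lborel. f (uncum w y) = (c - \<alpha> * K (cum w 0)) + \<alpha> * K y"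
      using AE_uncum[OF c] AE_rmod_mass_nonzero
    proof eventually_elim
      case (elim y)
      have "cum w (uncum w y) = y rmod mass w" using elim(2) by (intro cum_uncum) auto
      then show ?case using elim(1) K_rmod[of y] unfolding wK by (simp add: algebra_simps)
    qed
    then show "\<exists>c. AE y in lborel. f (uncum w y) = c + \<alpha> * oint 0 y (\<lambda>y. h (uncum w y))"
      unfolding K_def by blast
  next
    assume "\<exists>c. AE y in lborel. f (uncum w y) = c + \<alpha> * oint 0 y (\<lambda>y. h (uncum w y))"
    then obtain c where c: "AE y in lborel. f (uncum w y) = c + \<alpha> * K y" unfolding K_def by blast
    have "AE s in lborel. f s = (c + \<alpha> * K (cum w 0)) + \<alpha> * oint 0 s (\<lambda>s. w s *\<^sub>R h s)"
      using AE_cum_shift[OF c, of 0] unfolding wK by (auto simp: algebra_simps)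
    moreover have "(\<integral>s. w s *\<^sub>R h s \<partial>lborel) = 0" if fin: "finite_mass w"
    proof -
      have "AE y in lborel. K (y + mass w) = K y"
        using c AE_lborel_shift[OF c, of "mass w"]
      proof eventually_elim
        case (elim y)
        then have "\<alpha> * K (y + mass w) = \<alpha> * K y" by (auto simp: uncum_add_mass)
        then show ?case using \<alpha> by auto
      qed
      then obtain y where "K (y + mass w) = K y" using AE_lborel_ex by blast
      then show ?thesis using K_mass[OF fin, of y] by simp
    qed
    ultimately show "(\<exists>c. AE s in lborel. f s = c + \<alpha> * oint 0 s (\<lambda>s. w s *\<^sub>R h s)) \<and> (finite_mass w \<longrightarrow> (\<integral>s. w s *\<^sub>R h s \<partial>lborel) = 0)"
      by blast
  qed
qed

text \<open>In the coordinate y the shift is a translation, so continuity of translations on the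
  line applies to f \<circ> \<open>uncum w\<close>, cut off to make it square integrable.\<close>

lemma fibre_shift_continuous:
  assumes f: "f \<in> L2 D"
  shows "((\<lambda>t. L2_norm D (\<lambda>s. f (fibre_shift w t s) - f s)) \<longlongrightarrow> 0) (at 0)"
proof -
  have [measurable]: "f \<in> borel_measurable borel" using L2_measurable[OF f] by simp
  have [measurable]: "fibre_range w \<in> sets borel" by (auto simp: fibre_range_def)
  \<comment> \<open>One period with a margin of 1 on both sides, so that y + t stays in I for |t| <
    1 and y in the basic period.\<close>
  define I where "I = (if finite_mass w then {-1..mass w + 1} else UNIV)"
  have [measurable]: "I \<in> sets borel" by (simp add: I_def)
  define v where "v y = indicator I y *\<^sub>R f (uncum w y)" for y
  have [measurable]: "v \<in> borel_measurable borel" unfolding v_def[abs_def] by measurable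
  have v: "v \<in> L2 lborel"
  proof (cases "finite_mass w")
    case True
    obtain n where n: "mass w + 1 \<le> real n" using real_arch_simple by blast
    have "(\<integral>\<^sup>+y. ennreal ((cmod (v y))\<^sup>2) \<partial>lborel) \<le>
      (\<integral>\<^sup>+y. indicator {-real n..real n} y * ennreal ((cmod (f (uncum w y)))\<^sup>2) \<partial>lborel)"
      using n mass_pos[OF True] True by (intro nn_integral_mono) (auto simp: v_def I_def indicator_def)
    also have "\<dots> < \<infinity>" using uncum_locally_square_integrable[OF f] by (auto simp: less_top)
    finally show ?thesis by (simp add: L2_iff_nn_integral)
  next
    case False
    then have "v = f" by (auto simp: v_def I_def uncum_def)
    moreover have "D = lborel" using w_infinite_mass[OF False] by (simp add: density_1)
    ultimately show ?thesis using f by simp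
  qed
  have le: "L2_norm D (\<lambda>s. f (fibre_shift w t s) - f s) \<le> L2_norm lborel (\<lambda>y. v (y + t) - v y)" if t: "\<bar>t\<bar> < 1" for t
  proof (rule L2I_nn_integral_le)
    have "(\<integral>\<^sup>+s. ennreal ((cmod (f (fibre_shift w t s) - f s))\<^sup>2) \<partial>D) =
       (\<integral>\<^sup>+s. ennreal ((cmod (f (uncum w (cum w s + t)) - f (uncum w (cum w s))))\<^sup>2) \<partial>D)"
      by (simp add: fibre_shift_def)
    also have "\<dots> = (\<integral>\<^sup>+y. indicator (fibre_range w) y * ennreal ((cmod (f (uncum w (y + t)) - f (uncum w y)))\<^sup>2) \<partial>lborel)"
      by (rule nn_integral_cum) measurable
    also have "\<dots> \<le> (\<integral>\<^sup>+y. ennreal ((cmod (v (y + t) - v y))\<^sup>2) \<partial>lborel)"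
      using t by (intro nn_integral_mono) (auto simp: v_def I_def fibre_range_def indicator_def split: if_splits)
    also have "\<dots> = ennreal ((L2_norm lborel (\<lambda>y. v (y + t) - v y))\<^sup>2)"
      by (rule nn_integral_L2_norm[OF L2_diff(1)[OF L2_translation(1)[OF v] v]])
    finally show "(\<integral>\<^sup>+s. ennreal ((cmod (f (fibre_shift w t s) - f s))\<^sup>2) \<partial>D) \<le> ennreal ((L2_norm lborel (\<lambda>y. v (y + t) - v y))\<^sup>2)" .
  qed auto
  show ?thesis
  proof (rule Lim_null_comparison[OF _ L2_translation_continuous[OF v]])
    show "\<forall>\<^sub>F t in at 0. norm (L2_norm D (\<lambda>s. f (fibre_shift w t s) - f s)) \<le> L2_norm lborel (\<lambda>y. v (y + t) - v y)"
      unfolding eventually_at using le by (intro exI[of _ 1]) (auto simp: dist_real_def)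
  qed
qed

end

section \<open>The fibre operators\<close>

lemma continuous_AE_eq:
  fixes f g :: "real \<Rightarrow> complex"
  assumes "continuous_on UNIV f" "continuous_on UNIV g" and ae: "AE s in lborel. f s = g s"
  shows "f s = g s"
proof -
  have "closed {s. f s = g s}" using assms by (intro closed_Collect_eq)
  moreover have "AE s in lebesgue. s \<in> {s. f s = g s}" using ae by (simp add: AE_lebesgue_iff)
  ultimately have "s \<in> {s. f s = g s}" by (rule mem_closed_if_AE_lebesgue)
  then show ?thesis by simp
qed

section \<open>Limits of primitives at infinity\<close>

lemma sliding_window_tendsto:
  fixes F :: "real \<Rightarrow> real"
  assumes F: "integrable lborel F"
  shows "((\<lambda>s. \<integral>t. indicator {s..s+1} t * F t \<partial>lborel) \<longlongrightarrow> 0) at_top"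
    "((\<lambda>s. \<integral>t. indicator {-s..-s+1} t * F t \<partial>lborel) \<longlongrightarrow> 0) at_top"
proof -
  have m [measurable]: "F \<in> borel_measurable borel" using F by auto
  have lim: "((\<lambda>s. \<integral>t. indicator {a s..a s+1} t * F t \<partial>lborel) \<longlongrightarrow> (\<integral>t. 0 \<partial>(lborel :: real measure))) at_top"
    if ev: "\<And>t. \<forall>\<^sub>F s in at_top. t \<notin> {a s..a s + 1}" for a :: "real \<Rightarrow> real"
  proof (rule integral_dominated_convergence_at_top[where w="\<lambda>t. \<bar>F t\<bar>"])
    show "AE t in lborel. ((\<lambda>s. indicator {a s..a s+1} t * F t) \<longlongrightarrow> 0) at_top"
    proof (intro AE_I2 tendsto_eventually)
      fix t show "\<forall>\<^sub>F s in at_top. indicator {a s..a s+1} t * F t = 0"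
        using ev[of t] by eventually_elim simp
    qed
    show "\<forall>\<^sub>F s in at_top. AE t in lborel. norm (indicator {a s..a s+1} t * F t) \<le> \<bar>F t\<bar>"
      by (intro always_eventually allI AE_I2) (auto simp: indicator_def)
  qed (use F in auto)
  show "((\<lambda>s. \<integral>t. indicator {s..s+1} t * F t \<partial>lborel) \<longlongrightarrow> 0) at_top"
  proof -
    have "\<forall>\<^sub>F s in at_top. t \<notin> {s..s + 1}" for t :: real
      using eventually_gt_at_top[of t] by eventually_elim auto
    then show ?thesis using lim[of "\<lambda>s. s"] by simp
  qed
  have "\<forall>\<^sub>F s in at_top. t \<notin> {-s..-s + 1}" for t :: real
    using eventually_gt_at_top[of "1 - t"] by eventually_elim auto
  then show "((\<lambda>s. \<integral>t. indicator {-s..-s+1} t * F t \<partial>lborel) \<longlongrightarrow> 0) at_top"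
    using lim[of uminus] by simp
qed

lemma integral_window_le:
  fixes s :: real
  assumes F: "F \<in> L2 lborel"
  shows "(\<integral>t. cmod (indicator {s..s+1} t *\<^sub>R F t) \<partial>lborel) \<le> sqrt (\<integral>t. indicator {s..s+1} t * (cmod (F t))\<^sup>2 \<partial>lborel)"
proof -
  have [measurable]: "F \<in> borel_measurable borel" using L2_measurable[OF F] by simp
  define I :: "real \<Rightarrow> complex" where "I t = indicator {s..s+1} t" for t
  have sq: "(cmod (I t))\<^sup>2 = indicator {s..s+1} t" for t by (auto simp: I_def indicator_def)
  have I: "I \<in> L2 lborel"
  proof -
    have "integrable lborel (\<lambda>t. (cmod (I t))\<^sup>2)"
      unfolding sq by (rule integrable_real_indicator) auto
    moreover have "I \<in> borel_measurable borel" unfolding I_def[abs_def] by measurable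
    ultimately show ?thesis by (simp add: L2_def)
  qed
  have nI: "L2_norm lborel I = 1"
    unfolding L2_norm_def sq by (simp add: measure_def)
  have FI: "(\<lambda>t. I t * F t) \<in> L2 lborel"
  proof -
    have "integrable lborel (\<lambda>t. (cmod (I t * F t))\<^sup>2)"
      by (rule Bochner_Integration.integrable_bound[OF L2_integrable[OF F]]) (auto simp: norm_mult I_def indicator_def)
    then show ?thesis using L2_measurable[OF I] by (simp add: L2_def)
  qed
  have "(\<integral>t. cmod (indicator {s..s+1} t *\<^sub>R F t) \<partial>lborel) = (\<integral>t. cmod (I t) * cmod (I t * F t) \<partial>lborel)"
    by (intro Bochner_Integration.integral_cong refl) (auto simp: I_def indicator_def)
  also have "\<dots> \<le> L2_norm lborel I * L2_norm lborel (\<lambda>t. I t * F t)"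
    by (rule integral_mult_le_L2_norm[OF I FI])
  also have "L2_norm lborel (\<lambda>t. I t * F t) = sqrt (\<integral>t. indicator {s..s+1} t * (cmod (F t))\<^sup>2 \<partial>lborel)"
    unfolding L2_norm_def by (intro arg_cong[where f=sqrt] Bochner_Integration.integral_cong refl) (auto simp: I_def indicator_def)
  finally show ?thesis using nI by simp
qed

text \<open>Functions of class H^1 on the line vanish at infinity: |G s| is at most the mean of |G|
  over [s, s + 1] plus the oscillation of G there. Both are bounded by L^2 norms over the window,
  which tend to 0.\<close>

lemma L2_primitive_tendsto_zero:
  assumes k: "k \<in> L2 lborel" "locint k" and G: "G \<in> L2 lborel" and G_eq: "\<And>s. G s = c + oint 0 s k"
  shows "(G \<longlongrightarrow> 0) at_top" "(G \<longlongrightarrow> 0) at_bot"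
proof -
  have [measurable]: "G \<in> borel_measurable borel" "k \<in> borel_measurable borel"
    using L2_measurable[OF G] L2_measurable[OF k(1)] by auto
  define e where "e F s = sqrt (\<integral>t. indicator {s..s+1} t * (cmod (F t))\<^sup>2 \<partial>lborel)" for F :: "real \<Rightarrow> complex" and s
  have cG: "continuous_on UNIV G"
    unfolding G_eq[abs_def] by (intro continuous_intros oint_continuous k)
  have bound: "cmod (G s) \<le> e G s + e k s" for s
  proof -
    have diff: "cmod (G s - G t) \<le> e k s" if t: "t \<in> {s..<s+1}" for t
    proof -
      have "G t - G s = oint s t k"
        using oint_add_endpoints[OF k(2), of 0 t s] by (simp add: G_eq)
      then have "cmod (G s - G t) \<le> (\<integral>x. cmod (orient s t x *\<^sub>R k x) \<partial>lborel)"
        by (metis integral_norm_bound norm_minus_commute oint_def)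
      also have "\<dots> \<le> (\<integral>x. cmod (indicator {s..s+1} x *\<^sub>R k x) \<partial>lborel)"
      proof (rule integral_mono)
        show "integrable lborel (\<lambda>x. cmod (orient s t x *\<^sub>R k x))"
          by (intro integrable_norm locint_orient_integrable k)
        show "integrable lborel (\<lambda>x. cmod (indicator {s..s+1} x *\<^sub>R k x))"
          by (intro integrable_norm locint_integrable[OF k(2), where C=1 and R="max \<bar>s\<bar> \<bar>s+1\<bar>"]) (auto simp: indicator_def)
      qed (use t in \<open>auto simp: orient_def indicator_def\<close>)
      also have "\<dots> \<le> e k s" unfolding e_def by (rule integral_window_le[OF k(1)])
      finally show ?thesis .
    qed
    have li: "locint G" by (rule locint_if_continuous[OF cG])
    have "G s = oint s (s + 1) (\<lambda>t. G s)" by (simp add: oint_const)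
    also have "\<dots> = oint s (s + 1) (\<lambda>t. G t + (G s - G t))" by simp
    also have "\<dots> = oint s (s + 1) G + oint s (s + 1) (\<lambda>t. G s - G t)"
      by (intro oint_add li locint_diff locint_const)
    finally have "cmod (G s) \<le> cmod (oint s (s + 1) G) + cmod (oint s (s + 1) (\<lambda>t. G s - G t))"
      by (metis norm_triangle_ineq)
    also have "cmod (oint s (s + 1) G) \<le> e G s"
    proof -
      have "cmod (oint s (s + 1) G) \<le> (\<integral>x. cmod (orient s (s + 1) x *\<^sub>R G x) \<partial>lborel)"
        unfolding oint_def by (rule integral_norm_bound)
      also have "\<dots> \<le> (\<integral>x. cmod (indicator {s..s+1} x *\<^sub>R G x) \<partial>lborel)"
      proof (rule integral_mono)
        show "integrable lborel (\<lambda>x. cmod (orient s (s + 1) x *\<^sub>R G x))"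
          by (intro integrable_norm locint_orient_integrable li)
        show "integrable lborel (\<lambda>x. cmod (indicator {s..s+1} x *\<^sub>R G x))"
          by (intro integrable_norm locint_integrable[OF li, where C=1 and R="max \<bar>s\<bar> \<bar>s+1\<bar>"]) (auto simp: indicator_def)
      qed (auto simp: orient_def indicator_def)
      also have "\<dots> \<le> e G s" unfolding e_def by (rule integral_window_le[OF G])
      finally show ?thesis .
    qed
    also have "cmod (oint s (s + 1) (\<lambda>t. G s - G t)) \<le> e k s"
    proof -
      have "cmod (oint s (s + 1) (\<lambda>t. G s - G t)) \<le> (\<integral>x. cmod (orient s (s + 1) x *\<^sub>R (G s - G x)) \<partial>lborel)"
        unfolding oint_def by (rule integral_norm_bound)
      also have "\<dots> \<le> (\<integral>x. indicator {s..<s+1} x * e k s \<partial>lborel)"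
      proof (rule integral_mono)
        show "integrable lborel (\<lambda>x. cmod (orient s (s + 1) x *\<^sub>R (G s - G x)))"
          by (intro integrable_norm locint_orient_integrable locint_diff li locint_const)
        show "integrable lborel (\<lambda>x. indicator {s..<s+1} x * e k s)"
          by (intro integrable_mult_left integrable_real_indicator) auto
      qed (use diff in \<open>auto simp: orient_def indicator_def\<close>)
      also have "\<dots> = e k s" by (simp add: measure_def)
      finally show ?thesis .
    qed
    finally show ?thesis by simp
  qed
  have e_lim: "((\<lambda>s. e F s) \<longlongrightarrow> 0) at_top" "((\<lambda>s. e F (- s)) \<longlongrightarrow> 0) at_top" if "F \<in> L2 lborel" for F
    using tendsto_real_sqrt[OF sliding_window_tendsto(1)[OF L2_integrable[OF that]]]
      tendsto_real_sqrt[OF sliding_window_tendsto(2)[OF L2_integrable[OF that]]] by (simp_all add: e_def)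
  show "(G \<longlongrightarrow> 0) at_top"
  proof (rule Lim_null_comparison)
    show "((\<lambda>s. e G s + e k s) \<longlongrightarrow> 0) at_top" using tendsto_add[OF e_lim(1)[OF G] e_lim(1)[OF k(1)]] by simp
  qed (use bound in auto)
  have "((\<lambda>s. G (- s)) \<longlongrightarrow> 0) at_top"
  proof (rule Lim_null_comparison)
    show "((\<lambda>s. e G (- s) + e k (- s)) \<longlongrightarrow> 0) at_top" using tendsto_add[OF e_lim(2)[OF G] e_lim(2)[OF k(1)]] by simp
  qed (use bound in auto)
  then show "(G \<longlongrightarrow> 0) at_bot" by (simp add: filterlim_at_bot_mirror)
qed

lemma oint_limits:
  assumes k: "integrable lborel k"
  shows "((\<lambda>s. oint 0 s k) \<longlongrightarrow> (\<integral>t. indicator {0..} t *\<^sub>R k t \<partial>lborel)) at_top"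
    "((\<lambda>s. oint 0 (- s) k) \<longlongrightarrow> (\<integral>t. - (indicator {..<0} t *\<^sub>R k t) \<partial>lborel)) at_top"
proof -
  have m [measurable]: "k \<in> borel_measurable borel" using k by auto
  have lim: "((\<lambda>s. oint 0 (a s) k) \<longlongrightarrow> (\<integral>t. g t *\<^sub>R k t \<partial>lborel)) at_top"
    if [measurable]: "g \<in> borel_measurable borel" and ev: "\<And>t. \<forall>\<^sub>F s in at_top. orient 0 (a s) t = g t"
    for g a :: "real \<Rightarrow> real"
    unfolding oint_def
  proof (rule integral_dominated_convergence_at_top[where w="\<lambda>t. cmod (k t)"])
    show "AE t in lborel. ((\<lambda>s. orient 0 (a s) t *\<^sub>R k t) \<longlongrightarrow> g t *\<^sub>R k t) at_top"
    proof (intro AE_I2 tendsto_eventually)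
      fix t show "\<forall>\<^sub>F s in at_top. orient 0 (a s) t *\<^sub>R k t = g t *\<^sub>R k t"
        using ev[of t] by eventually_elim simp
    qed
    show "\<forall>\<^sub>F s in at_top. AE t in lborel. norm (orient 0 (a s) t *\<^sub>R k t) \<le> cmod (k t)"
      by (intro always_eventually allI AE_I2) (auto simp: orient_def indicator_def)
  qed (use k in auto)
  have "\<forall>\<^sub>F s in at_top. orient 0 s t = indicator {0..} t" for t
    using eventually_gt_at_top[of "max 0 t"] by eventually_elim (auto simp: orient_def indicator_def)
  then show "((\<lambda>s. oint 0 s k) \<longlongrightarrow> (\<integral>t. indicator {0..} t *\<^sub>R k t \<partial>lborel)) at_top"
    by (intro lim) auto
  have "\<forall>\<^sub>F s in at_top. orient 0 (- s) t = - indicator {..<0} t" for t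
    using eventually_gt_at_top[of "max 0 (- t)"] by eventually_elim (auto simp: orient_def indicator_def)
  then have "((\<lambda>s. oint 0 (- s) k) \<longlongrightarrow> (\<integral>t. (- indicator {..<0} t) *\<^sub>R k t \<partial>lborel)) at_top"
    by (intro lim) auto
  then show "((\<lambda>s. oint 0 (- s) k) \<longlongrightarrow> (\<integral>t. - (indicator {..<0} t *\<^sub>R k t) \<partial>lborel)) at_top" by simp
qed

lemma integral_split_halflines:
  fixes k :: "real \<Rightarrow> complex"
  assumes k: "integrable lborel k"
  shows "(\<integral>t. k t \<partial>lborel) = (\<integral>t. indicator {0..} t *\<^sub>R k t \<partial>lborel) - (\<integral>t. - (indicator {..<0} t *\<^sub>R k t) \<partial>lborel)"
proof -
  have "integrable lborel (\<lambda>t. indicator {0..} t *\<^sub>R k t)" "integrable lborel (\<lambda>t. indicator {..<0} t *\<^sub>R k t)"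
    by (intro integrable_mult_indicator k; simp)+
  then have "(\<integral>t. indicator {0..} t *\<^sub>R k t \<partial>lborel) - (\<integral>t. - (indicator {..<0} t *\<^sub>R k t) \<partial>lborel) =
      (\<integral>t. indicator {0..} t *\<^sub>R k t + indicator {..<0} t *\<^sub>R k t \<partial>lborel)" by simp
  also have "\<dots> = (\<integral>t. k t \<partial>lborel)"
    by (intro Bochner_Integration.integral_cong refl) (auto simp: indicator_def)
  finally show ?thesis by simp
qed

section \<open>The fibre domain as an integrated equation with a boundary condition\<close>

context fibre_weight
begin

text \<open>-i (p / w) f' = h, solved as f' = (i / p) w h and integrated. The second clause is the
  boundary condition of equal limits, which on a fibre of infinite mass is implied by square
  integrability.\<close>

definition fibre_equation :: "real \<Rightarrow> (real \<Rightarrow> complex) \<Rightarrow> (real \<Rightarrow> complex) \<Rightarrow> bool" where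
  "fibre_equation p f h \<longleftrightarrow> (\<exists>c. AE s in lborel. f s = c + (\<i> / p) * oint 0 s (\<lambda>s. w s *\<^sub>R h s)) \<and>
     (finite_mass w \<longrightarrow> (\<integral>s. w s *\<^sub>R h s \<partial>lborel) = 0)"

text \<open>The continuous representative is unique, so the limits may be read off from the
  primitive G. For finite mass they differ by a nonzero multiple of the integral of w h; for
  infinite mass G and its derivative are in L^2, so both limits are 0.\<close>

lemma equal_limits_iff:
  assumes f: "f \<in> L2 D" and h: "h \<in> L2 D" and p: "p > 0"
    and eq: "AE s in lborel. f s = c + (\<i> / complex_of_real p) * oint 0 s (\<lambda>s. w s *\<^sub>R h s)"
    and g: "AE s in lborel. g s = f s"
  shows "equal_limits g \<longleftrightarrow> (finite_mass w \<longrightarrow> (\<integral>s. w s *\<^sub>R h s \<partial>lborel) = 0)"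
proof -
  define \<alpha> where "\<alpha> = \<i> / complex_of_real p"
  have \<alpha>: "\<alpha> \<noteq> 0" using p by (simp add: \<alpha>_def)
  have [measurable]: "f \<in> borel_measurable borel" "h \<in> borel_measurable borel"
    using L2_measurable[OF f] L2_measurable[OF h] by auto
  define G where "G s = c + \<alpha> * oint 0 s (\<lambda>s. w s *\<^sub>R h s)" for s
  have cG: "continuous_on UNIV G"
    unfolding G_def[abs_def] by (intro continuous_intros oint_continuous locint_weighted h)
  have gG: "AE s in lborel. g s = G s" using eq g by eventually_elim (simp add: G_def \<alpha>_def)
  have iff: "equal_limits g \<longleftrightarrow> (\<exists>c. (G \<longlongrightarrow> c) at_top \<and> (G \<longlongrightarrow> c) at_bot)"
  proof
    assume "equal_limits g"
    then obtain G' c where G': "continuous_on UNIV G'" "AE s in lborel. g s = G' s" "(G' \<longlongrightarrow> c) at_top" "(G' \<longlongrightarrow> c) at_bot"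
      unfolding equal_limits_def AE_lebesgue_iff by blast
    have "AE s in lborel. G' s = G s" using G'(2) gG by eventually_elim simp
    then have "G' = G" using continuous_AE_eq[OF G'(1) cG] by blast
    with G' show "\<exists>c. (G \<longlongrightarrow> c) at_top \<and> (G \<longlongrightarrow> c) at_bot" by blast
  next
    assume "\<exists>c. (G \<longlongrightarrow> c) at_top \<and> (G \<longlongrightarrow> c) at_bot"
    then show "equal_limits g" unfolding equal_limits_def AE_lebesgue_iff using cG gG by blast
  qed
  show ?thesis
  proof (cases "finite_mass w")
    case True
    define k where "k s = w s *\<^sub>R h s" for s
    have k: "integrable lborel k" unfolding k_def[abs_def] by (rule finite_mass_integrable_weighted[OF h True])
    define A where "A = (\<integral>t. indicator {0..} t *\<^sub>R k t \<partial>lborel)"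
    define B where "B = (\<integral>t. - (indicator {..<0} t *\<^sub>R k t) \<partial>lborel)"
    have G1: "(G \<longlongrightarrow> c + \<alpha> * A) at_top"
      unfolding G_def[abs_def] A_def using oint_limits(1)[OF k] by (intro tendsto_intros) (simp add: k_def[abs_def])
    have "((\<lambda>s. G (- s)) \<longlongrightarrow> c + \<alpha> * B) at_top"
      unfolding G_def[abs_def] B_def using oint_limits(2)[OF k] by (intro tendsto_intros) (simp add: k_def[abs_def])
    then have G2: "(G \<longlongrightarrow> c + \<alpha> * B) at_bot" by (simp add: filterlim_at_bot_mirror)
    have "(\<exists>c. (G \<longlongrightarrow> c) at_top \<and> (G \<longlongrightarrow> c) at_bot) \<longleftrightarrow> A = B"
    proof
      assume "\<exists>c. (G \<longlongrightarrow> c) at_top \<and> (G \<longlongrightarrow> c) at_bot"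
      then obtain c' where "(G \<longlongrightarrow> c') at_top" "(G \<longlongrightarrow> c') at_bot" by blast
      then have "c' = c + \<alpha> * A" "c' = c + \<alpha> * B"
        using tendsto_unique[OF _ _ G1] tendsto_unique[OF _ _ G2] by (auto simp: trivial_limit_at_top_linorder trivial_limit_at_bot_linorder)
      then have "\<alpha> * A = \<alpha> * B" by (metis add_left_cancel)
      then show "A = B" using \<alpha> by simp
    qed (use G1 G2 in auto)
    also have "\<dots> \<longleftrightarrow> (\<integral>s. w s *\<^sub>R h s \<partial>lborel) = 0"
    proof -
      have "(\<integral>s. k s \<partial>lborel) = A - B" unfolding A_def B_def by (rule integral_split_halflines[OF k])
      then show ?thesis unfolding k_def by simp
    qed
    finally show ?thesis using iff True by simp
  next
    case False
    have D1: "D = lborel" and w1: "w = (\<lambda>_. 1)" using w_infinite_mass[OF False] by (simp_all add: density_1)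
    have k: "(\<lambda>s. \<alpha> * (w s *\<^sub>R h s)) \<in> L2 lborel"
      using L2_cmult(1)[OF h, of \<alpha>] unfolding D1 by (subst w1) simp
    have lk: "locint (\<lambda>s. \<alpha> * (w s *\<^sub>R h s))" by (intro locint_cmult locint_weighted h)
    have fl: "f \<in> L2 lborel" using f unfolding D1 .
    have GL: "G \<in> L2 lborel"
    proof (rule L2_cong_AE[OF fl])
      show "G \<in> borel_measurable lborel" using borel_measurable_continuous_onI[OF cG] by simp
      show "AE s in lborel. f s = G s" using eq unfolding G_def \<alpha>_def .
    qed
    have "G s = c + oint 0 s (\<lambda>s. \<alpha> * (w s *\<^sub>R h s))" for s
      unfolding G_def by (simp only: oint_cmult)
    from L2_primitive_tendsto_zero[OF k lk GL this]
    have "(G \<longlongrightarrow> 0) at_top" "(G \<longlongrightarrow> 0) at_bot" .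
    then show ?thesis using iff False by blast
  qed
qed

lemma fibre_measure_eq:
  assumes ae: "AE s in lborel. v (s, x') = w s"
  shows "fibre_measure v x' = completion D"
proof -
  have w: "w \<in> borel_measurable lebesgue" by (intro measurable_completion) simp
  have "AE s in lebesgue. w s = v (s, x')" unfolding AE_lebesgue_iff using ae by eventually_elim simp
  then have v: "(\<lambda>s. v (s, x')) \<in> borel_measurable lebesgue" by (rule borel_measurable_AE[OF w])
  have "fibre_measure v x' = density lebesgue (\<lambda>s. ennreal (w s))"
    unfolding fibre_measure_def
    using w v ae by (intro density_cong) (auto simp: AE_lebesgue_iff elim!: eventually_mono)
  also have "\<dots> = completion D"
    by (rule completion_density_eq[symmetric]) (auto simp: w_pos)
  finally show ?thesis .
qed

lemma AE_completion_D_iff: "(AE s in completion D. P s) \<longleftrightarrow> (AE s in lborel. P s)"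
  by (simp add: AE_completion_iff AE_D_iff)

lemma L2_fibre_measure_iff:
  assumes v: "AE s in lborel. v (s, x') = w s" and f0: "f0 \<in> borel_measurable borel" and f: "AE s in lborel. f s = f0 s"
  shows "f \<in> L2 (fibre_measure v x') \<longleftrightarrow> f0 \<in> L2 D"
    "f0 \<in> L2 D \<Longrightarrow> L2_norm (fibre_measure v x') f = L2_norm D f0"
proof -
  have fm: "fibre_measure v x' = completion D" by (rule fibre_measure_eq[OF v])
  have sets: "sets (completion D) = sets lebesgue"
    unfolding fm[symmetric] by (simp add: fibre_measure_def)
  have f0m: "f0 \<in> borel_measurable (completion D)" using f0 by (intro measurable_completion) simp
  have f0l: "f0 \<in> borel_measurable lebesgue" using f0 by (intro measurable_completion) simp
  have "AE s in lebesgue. f0 s = f s" unfolding AE_lebesgue_iff using f by eventually_elim simp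
  then have "f \<in> borel_measurable lebesgue" by (rule borel_measurable_AE[OF f0l])
  then have fm': "f \<in> borel_measurable (completion D)" by (simp cong: measurable_cong_sets add: sets measurable_cong_sets[OF sets refl])
  have ae: "AE s in completion D. f s = f0 s" unfolding AE_completion_D_iff by fact
  have ae': "AE s in completion D. f0 s = f s" using ae by eventually_elim simp
  have "f \<in> L2 (completion D) \<longleftrightarrow> f0 \<in> L2 (completion D)"
    using L2_cong_AE[OF _ f0m ae] L2_cong_AE[OF _ fm' ae'] by blast
  then show "f \<in> L2 (fibre_measure v x') \<longleftrightarrow> f0 \<in> L2 D"
    unfolding fm using f0 by (simp add: L2_completion_iff)
  show "L2_norm (fibre_measure v x') f = L2_norm D f0"
    unfolding fm using L2_norm_cong_AE[OF fm' f0m ae] L2_norm_completion[of f0 D] f0 by simp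
qed

text \<open>Since w and \<psi> are positive, the relation can be solved for the derivative, which
  gives the primitive equation; \<open>equal_limits_iff\<close> supplies the boundary condition. The
  choice in \<open>fibre_op\<close> is determined almost everywhere by uniqueness of the
  distributional derivative.\<close>

lemma fibre_dom_iff:
  assumes v: "AE s in lborel. v (s, x') = w s" and p: "\<psi> x' > 0"
    and f: "f0 \<in> L2 D" "AE s in lborel. f s = f0 s" and h: "h0 \<in> L2 D"
  shows "f \<in> fibre_dom \<psi> v x' \<and> (AE s in lborel. h0 s = fibre_op \<psi> v x' f s) \<longleftrightarrow> fibre_equation (\<psi> x') f0 h0"
proof -
  have [measurable]: "f0 \<in> borel_measurable borel" "h0 \<in> borel_measurable borel"
    using L2_measurable[OF f(1)] L2_measurable[OF h] by auto
  define \<alpha> where "\<alpha> = \<i> / complex_of_real (\<psi> x')"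
  define k where "k s = \<alpha> * (w s *\<^sub>R h0 s)" for s
  have k: "locint k" unfolding k_def[abs_def] by (intro locint_cmult locint_weighted h)
  have ok: "oint 0 s k = \<alpha> * oint 0 s (\<lambda>s. w s *\<^sub>R h0 s)" for s
    unfolding k_def[abs_def] by (rule oint_cmult)
  have inv: "h = - \<i> * complex_of_real (\<psi> x' / w s) * g \<longleftrightarrow> g = \<alpha> * (w s *\<^sub>R h)" for h g s
    using p w_pos[of s] by (auto simp: \<alpha>_def field_simps scaleR_conv_of_real)
  have dd: "distr_deriv f k \<longleftrightarrow> (\<exists>c. AE s in lborel. f0 s = c + \<alpha> * oint 0 s (\<lambda>s. w s *\<^sub>R h0 s))"
  proof -
    have "distr_deriv f k \<longleftrightarrow> (\<exists>c. AE s in lborel. f s = c + oint 0 s k)"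
      by (rule distr_deriv_iff_oint[OF k]) simp
    also have "\<dots> \<longleftrightarrow> (\<exists>c. AE s in lborel. f0 s = c + \<alpha> * oint 0 s (\<lambda>s. w s *\<^sub>R h0 s))"
    proof -
      have "(AE s in lborel. f s = c + oint 0 s k) \<longleftrightarrow> (AE s in lborel. f0 s = c + oint 0 s k)" for c
        using f(2) by (auto elim: AE_mp)
      then show ?thesis by (simp add: ok)
    qed
    finally show ?thesis .
  qed
  have distr_cong: "distr_deriv g g2" if "distr_deriv g g1" "AE s in lborel. g1 s = g2 s" for g g1 g2
  proof -
    have "\<forall>a b. g1 absolutely_integrable_on {a..b}" using that(1) by (simp add: distr_deriv_def)
    then obtain k' where k': "locint k'" "AE s in lborel. g1 s = k' s"
      using locint_rep_iff by blast
    have k2: "AE s in lborel. g2 s = k' s" using k'(2) that(2) by eventually_elim simp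
    show ?thesis using that(1) unfolding distr_deriv_iff_oint[OF k'] distr_deriv_iff_oint[OF k'(1) k2] .
  qed
  have rel: "fibre_op_rel \<psi> v x' f h' \<longleftrightarrow> distr_deriv f k" if h': "AE s in lborel. h' s = h0 s" for h'
  proof
    assume "fibre_op_rel \<psi> v x' f h'"
    then obtain g' where g': "distr_deriv f g'" "AE s in lborel. h' s = - \<i> * complex_of_real (\<psi> x' / v (s, x')) * g' s"
      unfolding fibre_op_rel_def AE_lebesgue_iff by blast
    have "AE s in lborel. g' s = k s"
      using g'(2) v h'
    proof eventually_elim
      case (elim s)
      then show ?case using inv[of "h0 s" s "g' s"] by (simp add: k_def)
    qed
    then show "distr_deriv f k" by (rule distr_cong[OF g'(1)])
  next
    assume d: "distr_deriv f k"
    have "AE s in lborel. h' s = - \<i> * complex_of_real (\<psi> x' / v (s, x')) * k s"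
      using v h'
    proof eventually_elim
      case (elim s)
      then show ?case using inv[of "h0 s" s "k s"] by (simp add: k_def)
    qed
    with d show "fibre_op_rel \<psi> v x' f h'" unfolding fibre_op_rel_def AE_lebesgue_iff by blast
  qed
  show ?thesis
  proof
    assume L: "f \<in> fibre_dom \<psi> v x' \<and> (AE s in lborel. h0 s = fibre_op \<psi> v x' f s)"
    then have ex: "\<exists>h. fibre_op_rel \<psi> v x' f h" and el: "equal_limits f" by (auto simp: fibre_dom_def)
    from ex have "fibre_op_rel \<psi> v x' f (fibre_op \<psi> v x' f)" unfolding fibre_op_def by (rule someI_ex)
    then have "distr_deriv f k" by (subst (asm) rel) (use L in \<open>auto elim: eventually_mono\<close>)
    then obtain c where c: "AE s in lborel. f0 s = c + \<alpha> * oint 0 s (\<lambda>s. w s *\<^sub>R h0 s)" unfolding dd by blast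
    then show "fibre_equation (\<psi> x') f0 h0"
      using equal_limits_iff[OF f(1) h p c[unfolded \<alpha>_def] f(2)] el
      unfolding fibre_equation_def \<alpha>_def by blast
  next
    assume R: "fibre_equation (\<psi> x') f0 h0"
    then obtain c where c: "AE s in lborel. f0 s = c + \<alpha> * oint 0 s (\<lambda>s. w s *\<^sub>R h0 s)"
      unfolding fibre_equation_def \<alpha>_def by blast
    have d: "distr_deriv f k" unfolding dd using c by blast
    have el: "equal_limits f"
      using equal_limits_iff[OF f(1) h p c[unfolded \<alpha>_def] f(2)] R unfolding fibre_equation_def by blast
    have ex: "fibre_op_rel \<psi> v x' f h0" using d by (subst rel) auto
    then have "fibre_op_rel \<psi> v x' f (fibre_op \<psi> v x' f)" unfolding fibre_op_def by (rule someI[of "fibre_op_rel \<psi> v x' f"])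
    then obtain g' where g': "distr_deriv f g'" "AE s in lborel. fibre_op \<psi> v x' f s = - \<i> * complex_of_real (\<psi> x' / v (s, x')) * g' s"
      unfolding fibre_op_rel_def AE_lebesgue_iff by blast
    have op: "AE s in lborel. fibre_op \<psi> v x' f s = h0 s"
      using g'(2) v distr_deriv_unique[OF g'(1) d]
    proof eventually_elim
      case (elim s)
      then show ?case using inv[of "h0 s" s "k s"] by (simp add: k_def)
    qed
    have "fibre_op \<psi> v x' f \<in> L2 (fibre_measure v x')" "f \<in> L2 (fibre_measure v x')"
      using L2_fibre_measure_iff(1)[OF v _ op] L2_fibre_measure_iff(1)[OF v _ f(2)] f(1) h by auto
    then show "f \<in> fibre_dom \<psi> v x' \<and> (AE s in lborel. h0 s = fibre_op \<psi> v x' f s)"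
      unfolding fibre_dom_def using ex el op by (auto elim: eventually_mono)
  qed
qed

end

section \<open>The flow on the product space\<close>

lemma AE_lborel_affine:
  assumes "AE y in (lborel :: real measure). P y" "c \<noteq> 0" shows "AE y in lborel. P (a + c * y)"
proof -
  obtain N where N: "{y. \<not> P y} \<subseteq> N" "N \<in> null_sets lborel"
    using assms by (auto simp: eventually_ae_filter)
  have "AE y in lborel. y \<notin> N" using N(2) by (rule AE_not_in)
  then have "AE y in (lborel :: real measure). a + c * y \<notin> N"
    using N(2) assms(2) by (intro AE_borel_affine) (auto dest: null_setsD2)
  then show ?thesis by eventually_elim (use N(1) in auto)
qed

text \<open>P need not be measurable, so its exceptional set is enlarged to a Borel null set before
  Fubini is applied.\<close>

lemma AE_lborel_sections:
  assumes "AE z in (lborel :: (real \<times> 'v::euclidean_space) measure). P z"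
  shows "AE x' in lborel. AE s in lborel. P (s, x')"
proof -
  obtain N where N: "{z. \<not> P z} \<subseteq> N" "N \<in> null_sets (lborel :: (real \<times> 'v) measure)"
    using assms by (auto simp: eventually_ae_filter)
  have [measurable]: "N \<in> sets (lborel \<Otimes>\<^sub>M lborel)" unfolding lborel_prod using N(2) by (rule null_setsD2)
  have "AE z in lborel \<Otimes>\<^sub>M lborel. z \<notin> N"
    unfolding lborel_prod using N(2) by (rule AE_not_in)
  then have "AE s in lborel. AE x' in lborel. (s, x') \<notin> N" by (rule lborel_pair.AE_pair)
  moreover have "(AE s in lborel. AE x' in lborel. (s, x') \<notin> N) \<longleftrightarrow> (AE x' in lborel. AE s in lborel. (s, x') \<notin> N)"
    by (rule lborel_pair.AE_commute) measurable
  ultimately have "AE x' in lborel. AE s in lborel. (s, x') \<notin> N" by blast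
  then show ?thesis
    by eventually_elim (use N(1) in \<open>auto elim!: eventually_mono\<close>)
qed

text \<open>Measurability of P is what allows null sections to be assembled into a null set by
  Tonelli.\<close>

lemma AE_lborel_from_sections:
  assumes [measurable]: "Measurable.pred borel P"
    and "AE x' in lborel. AE s in lborel. P (s, x')"
  shows "AE z in (lborel :: (real \<times> 'v::euclidean_space) measure). P z"
proof -
  have S: "{x \<in> space (lborel \<Otimes>\<^sub>M lborel). P x} \<in> sets (lborel \<Otimes>\<^sub>M lborel)"
    using assms(1) unfolding pred_def lborel_prod by simp
  have "AE s in lborel. AE x' in lborel. P (s, x')"
    using assms(2) by (subst lborel_pair.AE_commute) (use S in auto)
  then have "AE z in lborel \<Otimes>\<^sub>M lborel. P z"
    by (rule lborel_pair.AE_pair_measure[OF S])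
  then show ?thesis unfolding lborel_prod .
qed

lemma borel_section_measurable:
  fixes f :: "real \<times> 'v::euclidean_space \<Rightarrow> 'b::topological_space"
  assumes "f \<in> borel_measurable borel" shows "(\<lambda>s. f (s, x')) \<in> borel_measurable borel"
  using assms by (rule measurable_compose[rotated]) (auto simp: borel_prod[symmetric])

locale fibre_flow =
  fixes \<psi> :: "real ^ 'n \<Rightarrow> real" and w :: "real \<times> (real ^ 'n) \<Rightarrow> real"
  assumes psi_measurable [measurable]: "\<psi> \<in> borel_measurable borel"
    and psi_pos: "\<And>x'. \<psi> x' > 0"
    and weight_measurable: "w \<in> borel_measurable borel"
    and weight_sections: "\<And>x'. fibre_weight (\<lambda>s. w (s, x'))"
begin

abbreviation fw :: "real ^ 'n \<Rightarrow> real \<Rightarrow> real" where "fw x' \<equiv> \<lambda>s. w (s, x')"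

abbreviation M :: "(real \<times> (real ^ 'n)) measure" where "M \<equiv> density lborel (\<lambda>x. ennreal (w x))"

abbreviation FD :: "real ^ 'n \<Rightarrow> real measure" where "FD x' \<equiv> density lborel (\<lambda>s. ennreal (fw x' s))"

definition flow :: "real \<Rightarrow> real \<times> (real ^ 'n) \<Rightarrow> real \<times> (real ^ 'n)" where
  "flow t x = (fibre_shift (fw (snd x)) (t * \<psi> (snd x)) (fst x), snd x)"

lemma weight_pos: "w x > 0"
  using fibre_weight.w_pos[OF weight_sections, of "fst x" "snd x"] by simp

lemma weight_measurable_pair [measurable]: "w \<in> borel_measurable (borel \<Otimes>\<^sub>M borel)"
  using weight_measurable by (simp add: borel_prod)

lemma pred_finite_mass [measurable]:
  assumes [measurable]: "g \<in> N \<rightarrow>\<^sub>M borel"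
  shows "Measurable.pred N (\<lambda>z. finite_mass (fw (g z)))"
  unfolding finite_mass_def by measurable

lemma mass_measurable [measurable]:
  assumes [measurable]: "g \<in> N \<rightarrow>\<^sub>M borel"
  shows "(\<lambda>z. mass (fw (g z))) \<in> borel_measurable N"
  unfolding mass_def by measurable

lemma cum_measurable [measurable]:
  assumes [measurable]: "f \<in> borel_measurable N" "g \<in> N \<rightarrow>\<^sub>M borel"
  shows "(\<lambda>z. cum (fw (g z)) (f z)) \<in> borel_measurable N"
  unfolding cum_def lessThan_def indicator_def mem_Collect_eq by measurable

lemma uncum_measurable [measurable]:
  assumes [measurable]: "f \<in> borel_measurable N" "g \<in> N \<rightarrow>\<^sub>M borel"
  shows "(\<lambda>z. uncum (fw (g z)) (f z)) \<in> borel_measurable N"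
  unfolding borel_measurable_iff_le fibre_weight.uncum_le_iff[OF weight_sections] by measurable

lemma flow_measurable_borel [measurable]:
  assumes [measurable]: "f \<in> borel_measurable N" "g \<in> N \<rightarrow>\<^sub>M borel"
  shows "(\<lambda>z. flow (f z) (g z)) \<in> N \<rightarrow>\<^sub>M borel"
proof -
  have [measurable]: "g \<in> N \<rightarrow>\<^sub>M borel \<Otimes>\<^sub>M borel" using assms(2) by (simp add: borel_prod)
  have "(\<lambda>z. flow (f z) (g z)) \<in> N \<rightarrow>\<^sub>M borel \<Otimes>\<^sub>M borel"
    unfolding flow_def fibre_shift_def by measurable
  then show ?thesis by (simp add: borel_prod)
qed

lemma AE_M_iff: "(AE x in M. P x) \<longleftrightarrow> (AE x in lborel. P x)"
  using weight_measurable by (subst AE_density) (auto simp: weight_pos)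

lemma nn_integral_M:
  assumes F: "F \<in> borel_measurable borel"
  shows "(\<integral>\<^sup>+x. F x \<partial>M) = (\<integral>\<^sup>+x'. (\<integral>\<^sup>+s. F (s, x') \<partial>FD x') \<partial>lborel)"
    "(\<lambda>x'. \<integral>\<^sup>+s. F (s, x') \<partial>FD x') \<in> borel_measurable borel"
proof -
  note [measurable] = weight_measurable F
  have [measurable]: "F \<in> borel_measurable (borel \<Otimes>\<^sub>M borel)" using F by (simp add: borel_prod)
  have m: "(\<lambda>x. ennreal (w x) * F x) \<in> borel_measurable (lborel \<Otimes>\<^sub>M lborel)" by measurable
  have sec: "(\<integral>\<^sup>+s. F (s, x') \<partial>FD x') = (\<integral>\<^sup>+s. ennreal (w (s, x')) * F (s, x') \<partial>lborel)" for x'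
    by (rule nn_integral_density) measurable
  have "(\<integral>\<^sup>+x. F x \<partial>M) = (\<integral>\<^sup>+x. ennreal (w x) * F x \<partial>lborel)"
    by (rule nn_integral_density) (use weight_measurable F in auto)
  also have "\<dots> = (\<integral>\<^sup>+x. ennreal (w x) * F x \<partial>(lborel \<Otimes>\<^sub>M lborel))" by (simp add: lborel_prod)
  also have "\<dots> = (\<integral>\<^sup>+x'. (\<integral>\<^sup>+s. ennreal (w (s, x')) * F (s, x') \<partial>lborel) \<partial>lborel)"
    using lborel_pair.nn_integral_snd[OF m] by simp
  finally show "(\<integral>\<^sup>+x. F x \<partial>M) = (\<integral>\<^sup>+x'. (\<integral>\<^sup>+s. F (s, x') \<partial>FD x') \<partial>lborel)" unfolding sec .
  show "(\<lambda>x'. \<integral>\<^sup>+s. F (s, x') \<partial>FD x') \<in> borel_measurable borel" unfolding sec by measurable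
qed

lemma L2_sections:
  assumes f: "f \<in> L2 M" shows "AE x' in lborel. (\<lambda>s. f (s, x')) \<in> L2 (FD x')"
proof -
  have m: "f \<in> borel_measurable borel" using L2_measurable[OF f] by simp
  then have sq: "(\<lambda>x. ennreal ((cmod (f x))\<^sup>2)) \<in> borel_measurable borel" by measurable
  have "AE x' in lborel. (\<integral>\<^sup>+s. ennreal ((cmod (f (s, x')))\<^sup>2) \<partial>FD x') \<noteq> \<infinity>"
    using f nn_integral_M[OF sq] by (intro nn_integral_PInf_AE) (auto simp: L2_iff_nn_integral)
  then show ?thesis
    by eventually_elim (use borel_section_measurable[OF m] in \<open>auto simp: L2_iff_nn_integral less_top\<close>)
qed

lemma nn_integral_flow_eq:
  assumes F: "F \<in> borel_measurable borel"
  shows "(\<integral>\<^sup>+x. F (flow t x) \<partial>M) = (\<integral>\<^sup>+x. F x \<partial>M)"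
proof -
  note [measurable] = F
  have m: "(\<lambda>x. F (flow t x)) \<in> borel_measurable borel" by measurable
  have "(\<integral>\<^sup>+s. F (flow t (s, x')) \<partial>FD x') = (\<integral>\<^sup>+s. F (s, x') \<partial>FD x')" for x'
    unfolding flow_def fst_conv snd_conv
    by (rule fibre_weight.nn_integral_fibre_shift[OF weight_sections, of "\<lambda>s. F (s, x')"]) (rule borel_section_measurable[OF F])
  then show ?thesis unfolding nn_integral_M(1)[OF m] nn_integral_M(1)[OF F] by simp
qed

text \<open>The group law can fail only at points that \<Phi> t carries to infinity; each finite
  fibre contains at most one of them.\<close>

lemma flow_add_AE: "AE x in lborel. \<forall>s. flow s (flow t x) = flow (s + t) x"
proof -
  have "AE x in lborel. finite_mass (fw (snd x)) \<longrightarrow> (cum (fw (snd x)) (fst x) + t * \<psi> (snd x)) rmod mass (fw (snd x)) \<noteq> 0"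
  proof (rule AE_lborel_from_sections)
    have "Measurable.pred (borel \<Otimes>\<^sub>M borel) (\<lambda>x. finite_mass (fw (snd x)) \<longrightarrow> (cum (fw (snd x)) (fst x) + t * \<psi> (snd x)) rmod mass (fw (snd x)) \<noteq> 0)"
      by measurable
    then show "Measurable.pred borel (\<lambda>x. finite_mass (fw (snd x)) \<longrightarrow> (cum (fw (snd x)) (fst x) + t * \<psi> (snd x)) rmod mass (fw (snd x)) \<noteq> 0)"
      by (simp add: borel_prod)
  qed (simp only: fst_conv snd_conv, rule AE_I2, rule fibre_weight.AE_cum_shift_nonzero[OF weight_sections])
  then show ?thesis
  proof eventually_elim
    case (elim x)
    show ?case
    proof
      fix s
      have "fibre_shift (fw (snd x)) (s * \<psi> (snd x)) (fibre_shift (fw (snd x)) (t * \<psi> (snd x)) (fst x)) =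
         fibre_shift (fw (snd x)) (s * \<psi> (snd x) + t * \<psi> (snd x)) (fst x)"
        using elim by (intro fibre_weight.fibre_shift_add[OF weight_sections]) auto
      then show "flow s (flow t x) = flow (s + t) x" by (simp add: flow_def distrib_right)
    qed
  qed
qed

text \<open>Fibrewise continuity together with dominated convergence in x', the majorant being 4
  times the squared fibre norm of f. Sequences are used for dominated convergence, and \<psi> > 0
  keeps the fibre times away from 0.\<close>

lemma flow_strongly_continuous:
  assumes f: "f \<in> L2 M"
  shows "((\<lambda>t. L2_norm M (\<lambda>x. f (flow t x) - f x)) \<longlongrightarrow> 0) (at 0)"
  unfolding tendsto_at_iff_sequentially
proof (intro allI impI)
  fix \<tau> :: "nat \<Rightarrow> real" assume \<tau>0: "\<forall>i. \<tau> i \<in> UNIV - {0}" and \<tau>: "\<tau> \<longlonglongrightarrow> 0"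
  have m: "f \<in> borel_measurable borel" using L2_measurable[OF f] by simp
  note [measurable] = m
  define u where "u i x' = (\<integral>\<^sup>+s. ennreal ((cmod (f (flow (\<tau> i) (s, x')) - f (s, x')))\<^sup>2) \<partial>FD x')" for i x'
  define b where "b x' = (\<integral>\<^sup>+s. ennreal ((cmod (f (s, x')))\<^sup>2) \<partial>FD x')" for x'
  have mu: "(\<lambda>x. ennreal ((cmod (f (flow (\<tau> i) x) - f x))\<^sup>2)) \<in> borel_measurable borel" for i by measurable
  have mb: "(\<lambda>x. ennreal ((cmod (f x))\<^sup>2)) \<in> borel_measurable borel" by measurable
  have fd: "(\<lambda>x. f (flow (\<tau> i) x) - f x) \<in> L2 M" for i
  proof (rule L2_diff(1)[OF _ f])
    show "(\<lambda>x. f (flow (\<tau> i) x)) \<in> L2 M"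
      using f nn_integral_flow_eq[OF mb, of "\<tau> i"] by (simp add: L2_iff_nn_integral)
  qed
  have "(\<lambda>i. \<integral>\<^sup>+x'. u i x' \<partial>lborel) \<longlonglongrightarrow> (\<integral>\<^sup>+x'. 0 \<partial>(lborel :: (real ^ 'n) measure))"
  proof (rule nn_integral_dominated_convergence[where w="\<lambda>x'. 4 * b x'"])
    show "u i \<in> borel_measurable lborel" for i
      unfolding u_def[abs_def] using nn_integral_M(2)[OF mu] by simp
    show "(\<lambda>x'. 4 * b x') \<in> borel_measurable lborel"
      unfolding b_def using nn_integral_M(2)[OF mb] by simp
    have "(\<integral>\<^sup>+x'. 4 * b x' \<partial>lborel) = 4 * (\<integral>\<^sup>+x. ennreal ((cmod (f x))\<^sup>2) \<partial>M)"
      using nn_integral_M[OF mb] unfolding b_def by (subst nn_integral_cmult) auto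
    then show "(\<integral>\<^sup>+x'. 4 * b x' \<partial>lborel) < \<infinity>"
      using f by (simp add: L2_iff_nn_integral ennreal_mult_less_top)
    have sec: "u i x' = ennreal ((L2_norm (FD x') (\<lambda>s. f (fibre_shift (fw x') (\<tau> i * \<psi> x') s, x') - f (s, x')))\<^sup>2)"
      "(\<lambda>s. f (fibre_shift (fw x') (\<tau> i * \<psi> x') s, x')) \<in> L2 (FD x')"
      "L2_norm (FD x') (\<lambda>s. f (fibre_shift (fw x') (\<tau> i * \<psi> x') s, x')) = L2_norm (FD x') (\<lambda>s. f (s, x'))"
      if x': "(\<lambda>s. f (s, x')) \<in> L2 (FD x')" for i x'
    proof -
      interpret fibre_weight "fw x'" by (rule weight_sections)
      show 1: "(\<lambda>s. f (fibre_shift (fw x') (\<tau> i * \<psi> x') s, x')) \<in> L2 (FD x')"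
        "L2_norm (FD x') (\<lambda>s. f (fibre_shift (fw x') (\<tau> i * \<psi> x') s, x')) = L2_norm (FD x') (\<lambda>s. f (s, x'))"
        by (rule L2_fibre_shift[OF x'])+
      show "u i x' = ennreal ((L2_norm (FD x') (\<lambda>s. f (fibre_shift (fw x') (\<tau> i * \<psi> x') s, x') - f (s, x')))\<^sup>2)"
        unfolding u_def flow_def fst_conv snd_conv
        by (rule nn_integral_L2_norm[OF L2_diff(1)[OF 1(1) x']])
    qed
    show "AE x' in lborel. u i x' \<le> 4 * b x'" for i
      using L2_sections[OF f]
    proof eventually_elim
      case (elim x')
      note s = sec[OF elim, of i]
      have "L2_norm (FD x') (\<lambda>s. f (fibre_shift (fw x') (\<tau> i * \<psi> x') s, x') - f (s, x')) \<le> 2 * L2_norm (FD x') (\<lambda>s. f (s, x'))"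
        using L2_diff(2)[OF s(2) elim] s(3) by simp
      then have "(L2_norm (FD x') (\<lambda>s. f (fibre_shift (fw x') (\<tau> i * \<psi> x') s, x') - f (s, x')))\<^sup>2 \<le> (2 * L2_norm (FD x') (\<lambda>s. f (s, x')))\<^sup>2"
        by (intro power_mono) auto
      then have "u i x' \<le> ennreal (4 * (L2_norm (FD x') (\<lambda>s. f (s, x')))\<^sup>2)"
        unfolding s(1) by (intro ennreal_leI) (simp add: power_mult_distrib)
      also have "\<dots> = 4 * b x'"
        unfolding b_def nn_integral_L2_norm[OF elim] by (simp add: ennreal_mult)
      finally show ?case .
    qed
    show "AE x' in lborel. (\<lambda>i. u i x') \<longlonglongrightarrow> 0"
      using L2_sections[OF f]
    proof eventually_elim
      case (elim x')
      interpret fibre_weight "fw x'" by (rule weight_sections)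
      have "((\<lambda>t. L2_norm (FD x') (\<lambda>s. f (fibre_shift (fw x') t s, x') - f (s, x'))) \<longlongrightarrow> 0) (at 0)"
        by (rule fibre_shift_continuous[OF elim])
      moreover have "(\<lambda>i. \<tau> i * \<psi> x') \<longlonglongrightarrow> 0" using tendsto_mult_left_zero[OF \<tau>] .
      moreover have "\<forall>i. \<tau> i * \<psi> x' \<in> UNIV - {0}" using \<tau>0 psi_pos[of x'] by auto
      ultimately have "((\<lambda>t. L2_norm (FD x') (\<lambda>s. f (fibre_shift (fw x') t s, x') - f (s, x'))) \<circ> (\<lambda>i. \<tau> i * \<psi> x')) \<longlonglongrightarrow> 0"
        unfolding tendsto_at_iff_sequentially by (elim allE[of _ "\<lambda>i. \<tau> i * \<psi> x'"] impE)
      then have "(\<lambda>i. L2_norm (FD x') (\<lambda>s. f (fibre_shift (fw x') (\<tau> i * \<psi> x') s, x') - f (s, x'))) \<longlonglongrightarrow> 0"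
        unfolding comp_def .
      then have "(\<lambda>i. (L2_norm (FD x') (\<lambda>s. f (fibre_shift (fw x') (\<tau> i * \<psi> x') s, x') - f (s, x')))\<^sup>2) \<longlonglongrightarrow> 0\<^sup>2"
        by (intro tendsto_power)
      then have "(\<lambda>i. ennreal ((L2_norm (FD x') (\<lambda>s. f (fibre_shift (fw x') (\<tau> i * \<psi> x') s, x') - f (s, x')))\<^sup>2)) \<longlonglongrightarrow> ennreal (0\<^sup>2)"
        by (rule tendsto_ennrealI)
      then show ?case by (simp add: sec(1)[OF elim])
    qed
  qed auto
  moreover have "(\<integral>\<^sup>+x'. u i x' \<partial>lborel) = ennreal ((L2_norm M (\<lambda>x. f (flow (\<tau> i) x) - f x))\<^sup>2)" for i
    unfolding u_def nn_integral_M(1)[OF mu, symmetric] by (rule nn_integral_L2_norm[OF fd])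
  ultimately have "(\<lambda>i. ennreal ((L2_norm M (\<lambda>x. f (flow (\<tau> i) x) - f x))\<^sup>2)) \<longlonglongrightarrow> ennreal 0" by simp
  then have "(\<lambda>i. (L2_norm M (\<lambda>x. f (flow (\<tau> i) x) - f x))\<^sup>2) \<longlonglongrightarrow> 0"
    by (subst (asm) tendsto_ennreal_iff) auto
  then have "(\<lambda>i. sqrt ((L2_norm M (\<lambda>x. f (flow (\<tau> i) x) - f x))\<^sup>2)) \<longlonglongrightarrow> sqrt 0"
    by (rule tendsto_real_sqrt)
  then show "((\<lambda>t. L2_norm M (\<lambda>x. f (flow t x) - f x)) \<circ> \<tau>) \<longlonglongrightarrow> 0"
    by (simp add: comp_def)
qed

sublocale measure_flow M flow
proof unfold_locales
  show "\<exists>A. countable A \<and> A \<subseteq> sets M \<and> \<Union> A = space M \<and> (\<forall>a\<in>A. emeasure M a \<noteq> \<infinity>)"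
  proof -
    have "sigma_finite_measure M"
      using weight_measurable by (subst sigma_finite_measure.sigma_finite_iff_density_finite[OF sigma_finite_lborel]) auto
    then show ?thesis by (rule sigma_finite_measure.sigma_finite_countable)
  qed
  show "(\<lambda>(t, x). flow t x) \<in> borel \<Otimes>\<^sub>M M \<rightarrow>\<^sub>M M"
  proof -
    have "(\<lambda>z. flow (fst z) (snd z)) \<in> borel \<Otimes>\<^sub>M M \<rightarrow>\<^sub>M borel"
      by (rule flow_measurable_borel) (auto intro!: measurable_compose[OF measurable_snd])
    then show ?thesis by (simp add: case_prod_beta cong: measurable_cong_sets)
  qed
  show "distr M M (flow t) = M" for t
  proof (rule measure_eqI)
    fix A assume A: "A \<in> sets (distr M M (flow t))"
    then have [measurable]: "A \<in> sets borel" by simp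
    have fm: "flow t \<in> M \<rightarrow>\<^sub>M M"
      using flow_measurable_borel[of "\<lambda>_. t" borel "\<lambda>x. x"] by (simp cong: measurable_cong_sets)
    have "emeasure (distr M M (flow t)) A = (\<integral>\<^sup>+x. indicator A x \<partial>distr M M (flow t))"
      using A by simp
    also have "\<dots> = (\<integral>\<^sup>+x. indicator A (flow t x) \<partial>M)"
      by (rule nn_integral_distr[OF fm]) simp
    also have "\<dots> = (\<integral>\<^sup>+x. indicator A x \<partial>M)" by (rule nn_integral_flow_eq) simp
    also have "\<dots> = emeasure M A" by simp
    finally show "emeasure (distr M M (flow t)) A = emeasure M A" .
  qed simp
  show "AE x in M. flow 0 x = x"
    by (simp add: flow_def fibre_weight.fibre_shift_zero[OF weight_sections])
  show "AE x in M. \<forall>s. flow s (flow t x) = flow (s + t) x" for t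
    unfolding AE_M_iff by (rule flow_add_AE)
  show "f \<in> L2 M \<Longrightarrow> ((\<lambda>t. L2_norm M (\<lambda>x. f (flow t x) - f x)) \<longlongrightarrow> 0) (at 0)" for f
    by (rule flow_strongly_continuous)
qed

text \<open>The orbit through (s, x') moves the coordinate y at speed \<psi> x', so y =
  \<open>cum\<close> of s plus \<psi> x' times \<tau> turns a time integral into an integral in
  y.\<close>

lemma psi_times_orbit_int:
  assumes li: "locint (\<lambda>y. h (uncum (fw x') y, x'))"
  shows "complex_of_real (\<psi> x') * orbit_int h t (s, x') =
    oint 0 (cum (fw x') s + t * \<psi> x') (\<lambda>y. h (uncum (fw x') y, x')) - oint 0 (cum (fw x') s) (\<lambda>y. h (uncum (fw x') y, x'))"
proof -
  let ?H = "\<lambda>y. h (uncum (fw x') y, x')"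
  have "complex_of_real (\<psi> x') * orbit_int h t (s, x') = complex_of_real (\<psi> x') * oint 0 t (\<lambda>\<tau>. ?H (\<psi> x' * \<tau> + cum (fw x') s))"
    unfolding orbit_int_def flow_def fibre_shift_def by (simp add: add.commute mult.commute)
  also have "\<dots> = oint (\<psi> x' * 0) (\<psi> x' * t) (\<lambda>y. ?H (y + cum (fw x') s))"
    by (rule oint_scale[OF psi_pos])
  also have "\<dots> = oint (cum (fw x') s) (cum (fw x') s + t * \<psi> x') ?H"
    using oint_shift[of 0 "\<psi> x' * t" ?H "cum (fw x') s"] by (simp add: ac_simps)
  also have "\<dots> = oint 0 (cum (fw x') s + t * \<psi> x') ?H - oint 0 (cum (fw x') s) ?H"
    using oint_add_endpoints[OF li, of 0 "cum (fw x') s + t * \<psi> x'" "cum (fw x') s"] by simp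
  finally show ?thesis .
qed

text \<open>Each orbit runs through its whole fibre. Forward, one typical starting point per fibre
  gives the equation in y; backward, the equation is evaluated at the two ends of the piece of
  orbit.\<close>

lemma flow_gen_iff_fibre_equation:
  assumes f: "f \<in> L2 M" and h: "h \<in> L2 M"
  shows "flow_gen f h \<longleftrightarrow>
    (AE x' in lborel. fibre_weight.fibre_equation (fw x') (\<psi> x') (\<lambda>s. f (s, x')) (\<lambda>s. h (s, x')))"
proof -
  have mf: "f \<in> borel_measurable borel" and mh: "h \<in> borel_measurable borel"
    using L2_measurable[OF f] L2_measurable[OF h] by auto
  note [measurable] = mf mh
  have iff: "fibre_weight.fibre_equation (fw x') (\<psi> x') (\<lambda>s. f (s, x')) (\<lambda>s. h (s, x')) \<longleftrightarrow>
      (\<exists>c. AE y in lborel. f (uncum (fw x') y, x') = c + (\<i> / \<psi> x') * oint 0 y (\<lambda>y. h (uncum (fw x') y, x')))"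
    if "(\<lambda>s. f (s, x')) \<in> L2 (FD x')" "(\<lambda>s. h (s, x')) \<in> L2 (FD x')" for x'
  proof -
    have "\<i> / complex_of_real (\<psi> x') \<noteq> 0" using psi_pos[of x'] by auto
    from fibre_weight.fibre_equation_iff[OF weight_sections that this] show ?thesis
      unfolding fibre_weight.fibre_equation_def[OF weight_sections] .
  qed
  have oi: "(\<lambda>(t, x). orbit_int h t x) \<in> borel_measurable (lborel \<Otimes>\<^sub>M lborel)"
  proof -
    have "(\<lambda>z. orbit_int h (fst z) (snd z)) \<in> borel_measurable (lborel \<Otimes>\<^sub>M lborel)"
      unfolding orbit_int_def by measurable
    then show ?thesis by (simp add: case_prod_beta)
  qed
  show ?thesis
  proof
    assume gen: "flow_gen f h"
    have "AE t in lborel. AE x in lborel. f (flow t x) - f x = \<i> * orbit_int h t x"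
      using gen unfolding flow_gen_def AE_M_iff by simp
    moreover have "Measurable.pred (lborel \<Otimes>\<^sub>M lborel) (\<lambda>(t, x). f (flow t x) - f x = \<i> * orbit_int h t x)"
    proof -
      have [measurable]: "(\<lambda>z. orbit_int h (fst z) (snd z)) \<in> borel_measurable (lborel \<Otimes>\<^sub>M lborel)"
        using oi by (simp add: case_prod_beta)
      show ?thesis unfolding case_prod_beta by measurable
    qed
    \<comment> \<open>The null sets of \<open>flow_gen\<close> depend on t. Joint measurability lets
      the quantifiers be exchanged, so that for almost every x the identity holds at almost every
      time.\<close>
    then have "(AE t in lborel. AE x in lborel. f (flow t x) - f x = \<i> * orbit_int h t x) \<longleftrightarrow>
        (AE x in lborel. AE t in lborel. f (flow t x) - f x = \<i> * orbit_int h t x)"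
      by (intro lborel_pair.AE_commute) (simp add: pred_def case_prod_beta)
    ultimately have "AE x in lborel. AE t in lborel. f (flow t x) - f x = \<i> * orbit_int h t x" by blast
    then have "AE x' in lborel. AE s in lborel. AE t in lborel. f (flow t (s, x')) - f (s, x') = \<i> * orbit_int h t (s, x')"
      by (rule AE_lborel_sections)
    then show "AE x' in lborel. fibre_weight.fibre_equation (fw x') (\<psi> x') (\<lambda>s. f (s, x')) (\<lambda>s. h (s, x'))"
      using L2_sections[OF f] L2_sections[OF h]
    proof eventually_elim
      case (elim x')
      interpret fibre_weight "fw x'" by (rule weight_sections)
      define K where "K y = oint 0 y (\<lambda>y. h (uncum (fw x') y, x'))" for y
      have li: "locint (\<lambda>y. h (uncum (fw x') y, x'))" by (rule locint_uncum[OF elim(3)])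
      have p: "\<psi> x' > 0" by (rule psi_pos)
      \<comment> \<open>A single good starting point is enough, since its orbit in t sweeps out all
        y.\<close>
      obtain s where s: "AE t in lborel. f (flow t (s, x')) - f (s, x') = \<i> * orbit_int h t (s, x')"
        using AE_lborel_ex[OF elim(1)] by blast
      define C where "C = cum (fw x') s"
      have "AE t in lborel. f (uncum (fw x') (C + t * \<psi> x'), x') = (f (s, x') - (\<i> / \<psi> x') * K C) + (\<i> / \<psi> x') * K (C + t * \<psi> x')"
        using s
      proof eventually_elim
        case (elim t)
        have "orbit_int h t (s, x') = (K (C + t * \<psi> x') - K C) / \<psi> x'"
          using psi_times_orbit_int[OF li, of t s] p by (simp add: K_def C_def field_simps)
        moreover have "f (uncum (fw x') (C + t * \<psi> x'), x') = f (s, x') + \<i> * orbit_int h t (s, x')"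
          using elim by (simp add: flow_def fibre_shift_def C_def diff_eq_eq add.commute)
        ultimately show ?case by (simp add: diff_divide_distrib right_diff_distrib)
      qed
      \<comment> \<open>Return from time to the coordinate by t = (y - C) / \<psi> x'.\<close>
      from AE_lborel_affine[OF this, of "1 / \<psi> x'" "- C / \<psi> x'"]
      have "AE y in lborel. f (uncum (fw x') y, x') = (f (s, x') - (\<i> / \<psi> x') * K C) + (\<i> / \<psi> x') * K y"
      proof (rule AE_mp, simp add: p less_imp_neq[OF p, symmetric], intro AE_I2 impI)
        fix y
        have e: "C + (- C / \<psi> x' + 1 / \<psi> x' * y) * \<psi> x' = y" using p by (simp add: field_simps)
        assume "f (uncum (fw x') (C + (- C / \<psi> x' + 1 / \<psi> x' * y) * \<psi> x'), x') =
            (f (s, x') - (\<i> / \<psi> x') * K C) + (\<i> / \<psi> x') * K (C + (- C / \<psi> x' + 1 / \<psi> x' * y) * \<psi> x')"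
        then show "f (uncum (fw x') y, x') = (f (s, x') - (\<i> / \<psi> x') * K C) + (\<i> / \<psi> x') * K y" unfolding e .
      qed
      then show ?case unfolding iff[OF elim(2,3)] K_def by blast
    qed
  next
    assume eq: "AE x' in lborel. fibre_weight.fibre_equation (fw x') (\<psi> x') (\<lambda>s. f (s, x')) (\<lambda>s. h (s, x'))"
    show "flow_gen f h"
      unfolding flow_gen_def AE_M_iff
    proof
      fix t
      have [measurable]: "orbit_int h t \<in> borel_measurable borel"
        using L2_measurable[OF L2_orbit_int[OF h]] by simp
      show "AE x in lborel. f (flow t x) - f x = \<i> * orbit_int h t x"
      proof (rule AE_lborel_from_sections)
        show "Measurable.pred borel (\<lambda>x. f (flow t x) - f x = \<i> * orbit_int h t x)" by measurable
        show "AE x' in lborel. AE s in lborel. f (flow t (s, x')) - f (s, x') = \<i> * orbit_int h t (s, x')"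
          using eq L2_sections[OF f] L2_sections[OF h]
        proof eventually_elim
          case (elim x')
          interpret fibre_weight "fw x'" by (rule weight_sections)
          define K where "K y = oint 0 y (\<lambda>y. h (uncum (fw x') y, x'))" for y
          have li: "locint (\<lambda>y. h (uncum (fw x') y, x'))" by (rule locint_uncum[OF elim(3)])
          have p: "\<psi> x' > 0" by (rule psi_pos)
          obtain c where c: "AE y in lborel. f (uncum (fw x') y, x') = c + (\<i> / \<psi> x') * K y"
            using elim(1) unfolding iff[OF elim(2,3)] K_def by blast
          show ?case
            using AE_cum_shift[OF c, of 0] AE_cum_shift[OF c, of "t * \<psi> x'"]
          proof eventually_elim
            case (elim s)
            have "orbit_int h t (s, x') = (K (cum (fw x') s + t * \<psi> x') - K (cum (fw x') s)) / \<psi> x'"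
              using psi_times_orbit_int[OF li, of t s] p by (simp add: K_def field_simps)
            then show ?case using elim by (simp add: flow_def fibre_shift_def right_diff_distrib diff_divide_distrib)
          qed
        qed
      qed
    qed
  qed
qed

end

section \<open>Splitting a function into invariant part, coboundary and remainder\<close>

text \<open>The weighted measure of \<open>cut_set w r\<close> for r > 0. The two definitions let
  both kinds of fibre share the formulas below; on a finite fibre nothing is cut.\<close>

definition cut_mass :: "(real \<Rightarrow> real) \<Rightarrow> real \<Rightarrow> real" where
  "cut_mass w r = (if finite_mass w then mass w else 2 * r)"

definition cut_set :: "(real \<Rightarrow> real) \<Rightarrow> real \<Rightarrow> real set" where
  "cut_set w r = (if finite_mass w then UNIV else {-r..r})"

definition cut_total :: "(real \<Rightarrow> real) \<Rightarrow> real \<Rightarrow> (real \<Rightarrow> complex) \<Rightarrow> complex" where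
  "cut_total w R f = (\<integral>s. w s *\<^sub>R (indicator (cut_set w R) s *\<^sub>R f s) \<partial>lborel)"

text \<open>The fibrewise projection to invariant functions. On a fibre of infinite mass these would
  be constants in L^2, hence 0. On a finite fibre the value does not depend on R.\<close>

definition cut_mean :: "(real \<Rightarrow> real) \<Rightarrow> real \<Rightarrow> (real \<Rightarrow> complex) \<Rightarrow> complex" where
  "cut_mean w R f = (if finite_mass w then cut_total w R f / mass w else 0)"

text \<open>On a fibre of infinite mass the total is redistributed over the longer interval \<open>[-r, r]\<close>, at small
  \<open>L\<^sup>2\<close> cost; the result has integral \<open>0\<close> on every fibre.\<close>

definition cut_centred :: "(real \<Rightarrow> real) \<Rightarrow> real \<Rightarrow> real \<Rightarrow> (real \<Rightarrow> complex) \<Rightarrow> real \<Rightarrow> complex" where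
  "cut_centred w R r f s = indicator (cut_set w R) s *\<^sub>R f s -
     cut_total w R f * complex_of_real (indicator (cut_set w r) s / cut_mass w r)"

text \<open>The primitive starts at minus infinity; as the centred function has integral 0, it
  vanishes beyond both ends of the cut set.\<close>

definition cut_primitive :: "(real \<Rightarrow> real) \<Rightarrow> real \<Rightarrow> real \<Rightarrow> (real \<Rightarrow> complex) \<Rightarrow> real \<Rightarrow> complex" where
  "cut_primitive w R r f s = (\<integral>t. indicator {..<s} t *\<^sub>R (w t *\<^sub>R cut_centred w R r f t) \<partial>lborel)"

context fibre_weight
begin

lemma fibre_equation_const: "fibre_equation p (\<lambda>_. c) (\<lambda>_. 0)"
  unfolding fibre_equation_def by (auto intro!: exI[of _ c])

context
  fixes f :: "real \<Rightarrow> complex" and R r :: real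
  assumes f: "f \<in> L2 D" and R: "0 < R" "R \<le> r"
begin

lemma f_borel [measurable]: "f \<in> borel_measurable borel"
  using L2_measurable[OF f] by simp

lemma cut_set_measurable [measurable]: "cut_set w c \<in> sets borel"
  by (simp add: cut_set_def)

lemma cut_mass_pos: "c > 0 \<Longrightarrow> cut_mass w c > 0"
  using mass_pos by (simp add: cut_mass_def)

lemma L2_cut_indicator:
  assumes "c > 0"
  shows "(\<lambda>s. complex_of_real (indicator (cut_set w c) s)) \<in> L2 D"
    "L2_norm D (\<lambda>s. complex_of_real (indicator (cut_set w c) s)) = sqrt (cut_mass w c)"
proof -
  have "emeasure D (cut_set w c) = ennreal (cut_mass w c)"
  proof (cases "finite_mass w")
    case True
    then show ?thesis by (simp add: cut_set_def cut_mass_def emeasure_density mass_def finite_mass_def less_top)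
  next
    case False
    then have "D = lborel" using w_infinite_mass[OF False] by (simp add: density_1)
    then show ?thesis using False assms by (simp add: cut_set_def cut_mass_def)
  qed
  moreover have "(\<integral>\<^sup>+s. ennreal ((cmod (complex_of_real (indicator (cut_set w c) s)))\<^sup>2) \<partial>D) = emeasure D (cut_set w c)"
  proof -
    have "(\<integral>\<^sup>+s. ennreal ((cmod (complex_of_real (indicator (cut_set w c) s)))\<^sup>2) \<partial>D) = (\<integral>\<^sup>+s. indicator (cut_set w c) s \<partial>D)"
      by (intro nn_integral_cong) (auto simp: indicator_def)
    then show ?thesis by simp
  qed
  ultimately have eq: "(\<integral>\<^sup>+s. ennreal ((cmod (complex_of_real (indicator (cut_set w c) s)))\<^sup>2) \<partial>D) = ennreal (cut_mass w c)"
    by simp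
  show I: "(\<lambda>s. complex_of_real (indicator (cut_set w c) s)) \<in> L2 D"
    unfolding L2_iff_nn_integral eq by simp
  have "(L2_norm D (\<lambda>s. complex_of_real (indicator (cut_set w c) s)))\<^sup>2 = cut_mass w c"
    using eq unfolding nn_integral_L2_norm[OF I] using cut_mass_pos[OF assms] by simp
  then show "L2_norm D (\<lambda>s. complex_of_real (indicator (cut_set w c) s)) = sqrt (cut_mass w c)"
    by (metis L2_norm_nonneg real_sqrt_unique)
qed

lemma cut_set_mono: "cut_set w R \<subseteq> cut_set w r"
  using R by (auto simp: cut_set_def)

lemma L2_cut:
  "(\<lambda>s. indicator (cut_set w R) s *\<^sub>R f s) \<in> L2 D" "L2_norm D (\<lambda>s. indicator (cut_set w R) s *\<^sub>R f s) \<le> L2_norm D f"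
proof -
  have "(\<integral>\<^sup>+s. ennreal ((cmod (indicator (cut_set w R) s *\<^sub>R f s))\<^sup>2) \<partial>D) \<le> (\<integral>\<^sup>+s. ennreal ((cmod (f s))\<^sup>2) \<partial>D)"
    by (intro nn_integral_mono) (auto simp: indicator_def)
  also have "\<dots> = ennreal ((L2_norm D f)\<^sup>2)" by (rule nn_integral_L2_norm[OF f])
  finally have *: "(\<integral>\<^sup>+s. ennreal ((cmod (indicator (cut_set w R) s *\<^sub>R f s))\<^sup>2) \<partial>D) \<le> ennreal ((L2_norm D f)\<^sup>2)" .
  show "(\<lambda>s. indicator (cut_set w R) s *\<^sub>R f s) \<in> L2 D" "L2_norm D (\<lambda>s. indicator (cut_set w R) s *\<^sub>R f s) \<le> L2_norm D f"
    by (rule L2I_nn_integral_le[OF _ *]; simp)+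
qed

lemma integral_abs_supported_le:
  assumes g: "g \<in> L2 D" and supp: "\<And>s. s \<notin> cut_set w c \<Longrightarrow> g s = 0" and "c > 0"
  shows "integrable D g" "(\<integral>s. cmod (g s) \<partial>D) \<le> sqrt (cut_mass w c) * L2_norm D g"
proof -
  note I = L2_cut_indicator[OF \<open>c > 0\<close>]
  have eq: "complex_of_real (indicator (cut_set w c) s) * g s = g s" for s
    using supp[of s] by (auto simp: indicator_def)
  show "integrable D g" using L2_mult_integrable(2)[OF I(1) g] by (simp add: eq)
  have "(\<integral>s. cmod (g s) \<partial>D) = (\<integral>s. cmod (complex_of_real (indicator (cut_set w c) s)) * cmod (g s) \<partial>D)"
    by (simp only: norm_mult[symmetric] eq)
  also have "\<dots> \<le> sqrt (cut_mass w c) * L2_norm D g"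
    using integral_mult_le_L2_norm[OF I(1) g] by (simp add: I(2))
  finally show "(\<integral>s. cmod (g s) \<partial>D) \<le> sqrt (cut_mass w c) * L2_norm D g" .
qed

lemma cut_total_eq: "cut_total w R f = (\<integral>s. indicator (cut_set w R) s *\<^sub>R f s \<partial>D)"
  unfolding cut_total_def by (rule integral_D[symmetric]) measurable

lemma cut_total_le: "cmod (cut_total w R f) \<le> sqrt (cut_mass w R) * L2_norm D f"
proof -
  have "cmod (cut_total w R f) \<le> (\<integral>s. cmod (indicator (cut_set w R) s *\<^sub>R f s) \<partial>D)"
    unfolding cut_total_eq by (rule integral_norm_bound)
  also have "\<dots> \<le> sqrt (cut_mass w R) * L2_norm D (\<lambda>s. indicator (cut_set w R) s *\<^sub>R f s)"
    by (rule integral_abs_supported_le[OF L2_cut(1)]) (use R in auto)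
  also have "\<dots> \<le> sqrt (cut_mass w R) * L2_norm D f"
    using cut_mass_pos[OF R(1)] by (intro mult_left_mono L2_cut) auto
  finally show ?thesis .
qed

lemma cut_mass_mono: "cut_mass w R \<le> cut_mass w r"
  using R by (simp add: cut_mass_def)

text \<open>By Cauchy-Schwarz the total is at most the root of \<open>cut_mass w R\<close> times
  |f|, while the normalised indicator has norm one over the root of \<open>cut_mass w r\<close>. As
  R \<le> r, the subtracted term has norm at most |f|.\<close>

lemma L2_cut_centred:
  "cut_centred w R r f \<in> L2 D" "L2_norm D (cut_centred w R r f) \<le> 2 * L2_norm D f"
proof -
  have r: "r > 0" using R by simp
  note I = L2_cut_indicator[OF r] and m = cut_mass_pos[OF r]
  have eq: "cut_centred w R r f = (\<lambda>s. indicator (cut_set w R) s *\<^sub>R f s -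
      (cut_total w R f / cut_mass w r) * complex_of_real (indicator (cut_set w r) s))"
    by (auto simp: cut_centred_def)
  show "cut_centred w R r f \<in> L2 D" unfolding eq by (intro L2_diff L2_cut L2_cmult I)
  have "L2_norm D (cut_centred w R r f) \<le> L2_norm D (\<lambda>s. indicator (cut_set w R) s *\<^sub>R f s) +
     cmod (cut_total w R f / cut_mass w r) * sqrt (cut_mass w r)"
    unfolding eq I(2)[symmetric] L2_cmult(2)[OF I(1), symmetric] by (intro L2_diff L2_cut L2_cmult I)
  also have "cmod (cut_total w R f / cut_mass w r) * sqrt (cut_mass w r) \<le> L2_norm D f"
  proof -
    have "cmod (cut_total w R f) \<le> sqrt (cut_mass w r) * L2_norm D f"
      using cut_total_le cut_mass_mono by (meson L2_norm_nonneg mult_right_mono order_trans real_sqrt_le_mono)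
    then have "cmod (cut_total w R f) * sqrt (cut_mass w r) \<le> (sqrt (cut_mass w r) * L2_norm D f) * sqrt (cut_mass w r)"
      using m by (intro mult_right_mono) auto
    also have "\<dots> = cut_mass w r * L2_norm D f" using m by (simp add: mult.commute mult.left_commute)
    finally show ?thesis using m by (simp add: norm_divide divide_le_eq mult.commute)
  qed
  finally show "L2_norm D (cut_centred w R r f) \<le> 2 * L2_norm D f" using L2_cut(2) by linarith
qed

lemma cut_centred_supported: "s \<notin> cut_set w r \<Longrightarrow> cut_centred w R r f s = 0"
  using subsetD[OF cut_set_mono, of s] by (auto simp: cut_centred_def indicator_def)

lemma cut_centred_integrable: "integrable D (cut_centred w R r f)"
  "(\<integral>s. cmod (cut_centred w R r f s) \<partial>D) \<le> 2 * sqrt (cut_mass w r) * L2_norm D f"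
proof -
  have r: "r > 0" using R by simp
  note i = integral_abs_supported_le[OF L2_cut_centred(1) cut_centred_supported r]
  show "integrable D (cut_centred w R r f)" by (rule i(1))
  have "sqrt (cut_mass w r) * L2_norm D (cut_centred w R r f) \<le> sqrt (cut_mass w r) * (2 * L2_norm D f)"
    using cut_mass_pos[OF r] by (intro mult_left_mono L2_cut_centred) auto
  with i(2) show "(\<integral>s. cmod (cut_centred w R r f s) \<partial>D) \<le> 2 * sqrt (cut_mass w r) * L2_norm D f" by simp
qed

lemma cut_centred_measurable [measurable]: "cut_centred w R r f \<in> borel_measurable borel"
  using L2_measurable[OF L2_cut_centred(1)] by simp

lemma integral_cut_centred: "(\<integral>s. w s *\<^sub>R cut_centred w R r f s \<partial>lborel) = 0"
proof -
  have r: "r > 0" using R by simp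
  note I = L2_cut_indicator[OF r] and m = cut_mass_pos[OF r]
  have i1: "integrable D (\<lambda>s. indicator (cut_set w R) s *\<^sub>R f s)"
    by (rule integral_abs_supported_le[OF L2_cut(1)]) (use R in auto)
  have "integrable D (\<lambda>s. complex_of_real (indicator (cut_set w r) s))"
    by (rule integral_abs_supported_le[OF I(1) _ r]) auto
  then have i2: "integrable D (\<lambda>s. cut_total w R f * complex_of_real (indicator (cut_set w r) s / cut_mass w r))"
    by simp
  have "(\<integral>s. complex_of_real (indicator (cut_set w r) s) \<partial>D) = complex_of_real (cut_mass w r)"
  proof -
    have "complex_of_real (indicator (cut_set w r) s) = complex_of_real (indicator (cut_set w r) s) * cnj (complex_of_real (indicator (cut_set w r) s))" for s
      by (auto simp: indicator_def)
    then have "(\<integral>s. complex_of_real (indicator (cut_set w r) s) \<partial>D) =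
        L2_inner D (\<lambda>s. complex_of_real (indicator (cut_set w r) s)) (\<lambda>s. complex_of_real (indicator (cut_set w r) s))"
      unfolding L2_inner_def by presburger
    also have "\<dots> = complex_of_real (cut_mass w r)" unfolding L2_inner_self I(2) using m by simp
    finally show ?thesis .
  qed
  then have "(\<integral>s. cut_total w R f * complex_of_real (indicator (cut_set w r) s / cut_mass w r) \<partial>D) = cut_total w R f"
    using m by simp
  then have "(\<integral>s. cut_centred w R r f s \<partial>D) = 0"
    unfolding cut_centred_def Bochner_Integration.integral_diff[OF i1 i2] by (simp add: cut_total_eq)
  then show ?thesis by (subst (asm) integral_D) auto
qed

lemma cut_centred_weighted_integrable:
  assumes "A \<in> sets borel"
  shows "integrable lborel (\<lambda>t. indicator A t *\<^sub>R (w t *\<^sub>R cut_centred w R r f t))"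
proof -
  have "integrable lborel (\<lambda>t. w t *\<^sub>R cut_centred w R r f t)"
    using cut_centred_integrable(1) by (subst (asm) integrable_density) (auto simp: less_imp_le[OF w_pos])
  then show ?thesis using assms by (intro integrable_mult_indicator) auto
qed

lemma cut_primitive_diff:
  "cut_primitive w R r f s = cut_primitive w R r f 0 + oint 0 s (\<lambda>t. w t *\<^sub>R cut_centred w R r f t)"
proof -
  have "oint 0 s (\<lambda>t. w t *\<^sub>R cut_centred w R r f t) =
    (\<integral>t. indicator {..<s} t *\<^sub>R (w t *\<^sub>R cut_centred w R r f t) - indicator {..<0} t *\<^sub>R (w t *\<^sub>R cut_centred w R r f t) \<partial>lborel)"
    unfolding oint_def
    by (intro Bochner_Integration.integral_cong refl) (auto simp: orient_def indicator_def)
  also have "\<dots> = cut_primitive w R r f s - cut_primitive w R r f 0"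
    unfolding cut_primitive_def by (intro Bochner_Integration.integral_diff cut_centred_weighted_integrable) auto
  finally show ?thesis by simp
qed

lemma cut_primitive_le: "cmod (cut_primitive w R r f s) \<le> 2 * sqrt (cut_mass w r) * L2_norm D f"
proof -
  have "cut_primitive w R r f s = (\<integral>t. w t *\<^sub>R (indicator {..<s} t *\<^sub>R cut_centred w R r f t) \<partial>lborel)"
    unfolding cut_primitive_def by (simp add: mult.commute)
  also have "\<dots> = (\<integral>t. indicator {..<s} t *\<^sub>R cut_centred w R r f t \<partial>D)"
    by (rule integral_D[symmetric]) measurable
  finally have "cmod (cut_primitive w R r f s) \<le> (\<integral>t. cmod (indicator {..<s} t *\<^sub>R cut_centred w R r f t) \<partial>D)"
    by (metis integral_norm_bound)
  also have "\<dots> \<le> (\<integral>t. cmod (cut_centred w R r f t) \<partial>D)"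
    by (intro integral_mono integrable_norm integrable_mult_indicator cut_centred_integrable) (auto simp: indicator_def)
  also have "\<dots> \<le> 2 * sqrt (cut_mass w r) * L2_norm D f" by (rule cut_centred_integrable)
  finally show ?thesis .
qed

lemma cut_primitive_supported:
  assumes "s \<notin> cut_set w r" shows "cut_primitive w R r f s = 0"
proof -
  have s: "s < - r \<or> s > r" using assms by (auto simp: cut_set_def split: if_splits)
  have inf: "\<not> finite_mass w" using assms by (auto simp: cut_set_def)
  show ?thesis
    using s
  proof
    assume "s < - r"
    then have "indicator {..<s} t *\<^sub>R (w t *\<^sub>R cut_centred w R r f t) = 0" for t
      using cut_centred_supported[of t] inf by (auto simp: indicator_def cut_set_def)
    then show ?thesis by (simp only: cut_primitive_def) simp
  next
    assume "s > r"
    then have "indicator {..<s} t *\<^sub>R (w t *\<^sub>R cut_centred w R r f t) = w t *\<^sub>R cut_centred w R r f t" for t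
      using cut_centred_supported[of t] inf by (cases "t < s") (auto simp: cut_set_def)
    then show ?thesis by (simp only: cut_primitive_def integral_cut_centred)
  qed
qed

text \<open>With m = \<open>cut_mass w r\<close>, the primitive is bounded by 2 sqrt m |f| and
  supported on a set of measure m. Squaring and integrating gives (2 m)^2 |f|^2.\<close>

lemma nn_integral_cut_primitive:
  assumes K: "cut_mass w r \<le> K"
  shows "(\<integral>\<^sup>+s. ennreal ((cmod (cut_primitive w R r f s))\<^sup>2) \<partial>D) \<le> ennreal ((2 * K)\<^sup>2) * (\<integral>\<^sup>+s. ennreal ((cmod (f s))\<^sup>2) \<partial>D)"
proof -
  have r: "r > 0" using R by simp
  note I = L2_cut_indicator[OF r] and m = cut_mass_pos[OF r]
  have "(\<integral>\<^sup>+s. ennreal ((cmod (cut_primitive w R r f s))\<^sup>2) \<partial>D) \<le>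
    (\<integral>\<^sup>+s. ennreal ((2 * sqrt (cut_mass w r) * L2_norm D f)\<^sup>2) * ennreal ((cmod (complex_of_real (indicator (cut_set w r) s)))\<^sup>2) \<partial>D)"
  proof (intro nn_integral_mono)
    fix s
    show "ennreal ((cmod (cut_primitive w R r f s))\<^sup>2) \<le>
      ennreal ((2 * sqrt (cut_mass w r) * L2_norm D f)\<^sup>2) * ennreal ((cmod (complex_of_real (indicator (cut_set w r) s)))\<^sup>2)"
      using cut_primitive_supported[of s] power_mono[OF cut_primitive_le[of s], of 2]
      by (cases "s \<in> cut_set w r") (auto intro!: ennreal_leI)
  qed
  also have "\<dots> = ennreal ((2 * sqrt (cut_mass w r) * L2_norm D f)\<^sup>2) * ennreal (cut_mass w r)"
  proof -
    have "(\<integral>\<^sup>+s. ennreal ((cmod (complex_of_real (indicator (cut_set w r) s)))\<^sup>2) \<partial>D) = ennreal (cut_mass w r)"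
      unfolding nn_integral_L2_norm[OF I(1)] I(2) using m by simp
    moreover have "(\<lambda>s. ennreal ((cmod (complex_of_real (indicator (cut_set w r) s)))\<^sup>2)) \<in> borel_measurable D"
      using L2_measurable[OF I(1)] by measurable
    ultimately show ?thesis by (simp only: nn_integral_cmult)
  qed
  also have "\<dots> = ennreal ((2 * cut_mass w r)\<^sup>2 * (L2_norm D f)\<^sup>2)"
    using m by (subst ennreal_mult[symmetric]) (auto simp: power_mult_distrib power2_eq_square mult_ac)
  also have "\<dots> \<le> ennreal ((2 * K)\<^sup>2 * (L2_norm D f)\<^sup>2)"
    using m K by (intro ennreal_leI mult_right_mono power_mono) auto
  also have "\<dots> = ennreal ((2 * K)\<^sup>2) * (\<integral>\<^sup>+s. ennreal ((cmod (f s))\<^sup>2) \<partial>D)"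
    by (simp add: ennreal_mult nn_integral_L2_norm[OF f])
  finally show ?thesis .
qed

lemma fibre_equation_cut:
  assumes p: "p > 0"
  shows "fibre_equation p (\<lambda>s. (\<i> / p) * cut_primitive w R r f s) (cut_centred w R r f)"
proof -
  have "\<exists>c. AE s in lborel. (\<i> / p) * cut_primitive w R r f s = c + (\<i> / p) * oint 0 s (\<lambda>s. w s *\<^sub>R cut_centred w R r f s)"
    by (intro exI[of _ "(\<i> / p) * cut_primitive w R r f 0"] AE_I2, subst cut_primitive_diff) (rule distrib_left)
  then show ?thesis unfolding fibre_equation_def using integral_cut_centred by simp
qed

text \<open>Cauchy-Schwarz against the constant 1 on a fibre of finite mass, as for any mean
  value.\<close>

lemma nn_integral_cut_mean:
  "(\<integral>\<^sup>+s. ennreal ((cmod (cut_mean w R f))\<^sup>2) \<partial>D) \<le> (\<integral>\<^sup>+s. ennreal ((cmod (f s))\<^sup>2) \<partial>D)"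
proof (cases "finite_mass w")
  case True
  have m: "mass w > 0" by (rule mass_pos[OF True])
  have em: "emeasure D UNIV = ennreal (mass w)"
    using True by (simp add: emeasure_density mass_def finite_mass_def less_top)
  have "cmod (cut_total w R f) \<le> sqrt (mass w) * L2_norm D f"
    using cut_total_le True by (simp add: cut_mass_def)
  then have "(cmod (cut_total w R f))\<^sup>2 \<le> (sqrt (mass w) * L2_norm D f)\<^sup>2" by (intro power_mono) auto
  then have le: "(cmod (cut_total w R f))\<^sup>2 \<le> mass w * (L2_norm D f)\<^sup>2" using m by (simp add: power_mult_distrib)
  have "(\<integral>\<^sup>+s. ennreal ((cmod (cut_mean w R f))\<^sup>2) \<partial>D) = ennreal ((cmod (cut_mean w R f))\<^sup>2 * mass w)"
    using m em by (simp add: ennreal_mult)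
  also have "(cmod (cut_mean w R f))\<^sup>2 * mass w = (cmod (cut_total w R f))\<^sup>2 / mass w"
    using True m by (simp add: cut_mean_def norm_divide power_divide power2_eq_square)
  also have "ennreal \<dots> \<le> ennreal ((L2_norm D f)\<^sup>2)"
    using le m by (intro ennreal_leI) (simp add: divide_le_eq mult.commute)
  also have "\<dots> = (\<integral>\<^sup>+s. ennreal ((cmod (f s))\<^sup>2) \<partial>D)" by (simp add: nn_integral_L2_norm[OF f])
  finally show ?thesis .
qed (simp add: cut_mean_def)

text \<open>On a finite fibre the splitting is exact. Otherwise the error is the tail of f outside
  [-R, R] plus the constant A / (2 r) on [-r, r]; the factor 2 comes from |x + y|^2 \<le> 2 |x|^2 +
  2 |y|^2.\<close>

lemma nn_integral_cut_error:
  assumes \<sigma>: "\<sigma> \<ge> 0"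
  defines "Y \<equiv> (if finite_mass w then (\<integral>\<^sup>+s. ennreal ((cmod (f s))\<^sup>2) \<partial>D)
     else (\<integral>\<^sup>+s. ennreal ((1 + s\<^sup>2) powr \<sigma>) * ennreal ((cmod (f s))\<^sup>2) \<partial>lborel))"
  shows "(\<integral>\<^sup>+s. ennreal ((cmod (f s - cut_mean w R f - cut_centred w R r f s))\<^sup>2) \<partial>D) \<le>
     ennreal (2 * ((1 + R\<^sup>2) powr (- \<sigma>) + R / r)) * Y"
proof (cases "finite_mass w")
  case True
  have "f s - cut_mean w R f - cut_centred w R r f s = 0" for s
    using True by (simp add: cut_mean_def cut_centred_def cut_set_def cut_mass_def)
  then show ?thesis by simp
next
  case False
  have r: "r > 0" using R by simp
  have D1: "D = lborel" using w_infinite_mass[OF False] by (simp add: density_1)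
  define A where "A = cut_total w R f"
  have "cmod A \<le> sqrt (2 * R) * L2_norm D f" using cut_total_le False by (simp add: A_def cut_mass_def)
  then have "(cmod A)\<^sup>2 \<le> (sqrt (2 * R) * L2_norm D f)\<^sup>2" by (intro power_mono) auto
  then have A: "(cmod A)\<^sup>2 \<le> 2 * R * (L2_norm D f)\<^sup>2" using R by (simp add: power_mult_distrib)
  have powr1: "(1 + s\<^sup>2) powr \<sigma> \<ge> 1" for s :: real using \<sigma> by (intro ge_one_powr_ge_zero) auto
  have "ennreal ((L2_norm D f)\<^sup>2) = (\<integral>\<^sup>+s. ennreal ((cmod (f s))\<^sup>2) \<partial>lborel)"
    using nn_integral_L2_norm[OF f] unfolding D1 by simp
  also have "\<dots> \<le> Y"
    unfolding Y_def using False powr1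
    by (auto intro!: nn_integral_mono simp: mult_right_mono simp flip: ennreal_mult intro!: ennreal_leI mult_le_cancel_right1[THEN iffD2])
  finally have fY: "ennreal ((L2_norm D f)\<^sup>2) \<le> Y" .
  \<comment> \<open>The tail constant: beyond R the weight of Y is at least (1 +
    R^2)^\<sigma>.\<close>
  define c where "c = 2 * (1 + R\<^sup>2) powr (- \<sigma>)"
  \<comment> \<open>Twice the squared height of the redistributed total on [-r, r].\<close>
  define d where "d = 2 * (cmod A)\<^sup>2 / (2 * r)\<^sup>2"
  have c0: "c \<ge> 0" and d0: "d \<ge> 0" by (auto simp: c_def d_def)
  have pt: "(cmod (f s - cut_mean w R f - cut_centred w R r f s))\<^sup>2 \<le>
      c * ((1 + s\<^sup>2) powr \<sigma> * (cmod (f s))\<^sup>2) + d * indicator {-r..r} s" for s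
  proof -
    define x where "x = (if s \<in> {-R..R} then 0 else f s)"
    define y where "y = A * complex_of_real (indicator {-r..r} s / (2 * r))"
    have xy: "f s - cut_mean w R f - cut_centred w R r f s = x + y"
      using False by (auto simp: x_def y_def A_def cut_mean_def cut_centred_def cut_set_def cut_mass_def)
    have "(cmod (x + y))\<^sup>2 \<le> 2 * (cmod x)\<^sup>2 + 2 * (cmod y)\<^sup>2"
    proof -
      have "(cmod (x + y))\<^sup>2 \<le> (cmod x + cmod y)\<^sup>2" by (intro power_mono norm_triangle_ineq) auto
      also have "\<dots> \<le> 2 * (cmod x)\<^sup>2 + 2 * (cmod y)\<^sup>2"
        using sum_squares_bound[of "cmod x" "cmod y"] by (simp add: power2_sum)
      finally show ?thesis .
    qed
    moreover have "2 * (cmod x)\<^sup>2 \<le> c * ((1 + s\<^sup>2) powr \<sigma> * (cmod (f s))\<^sup>2)"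
    proof (cases "s \<in> {-R..R}")
      case False
      then have "\<bar>R\<bar> \<le> \<bar>s\<bar>" using R by auto
      then have "R\<^sup>2 \<le> s\<^sup>2" by (rule abs_le_square_iff[THEN iffD1])
      then have "(1 + R\<^sup>2) powr \<sigma> \<le> (1 + s\<^sup>2) powr \<sigma>" using \<sigma> by (intro powr_mono2) auto
      moreover have "1 + R\<^sup>2 > 0" by (simp add: add_pos_nonneg)
      then have "(1 + R\<^sup>2) powr \<sigma> > 0" by simp
      ultimately have "1 \<le> (1 + R\<^sup>2) powr (- \<sigma>) * (1 + s\<^sup>2) powr \<sigma>"
        by (simp add: powr_minus field_simps)
      then have "1 * (cmod (f s))\<^sup>2 \<le> ((1 + R\<^sup>2) powr (- \<sigma>) * (1 + s\<^sup>2) powr \<sigma>) * (cmod (f s))\<^sup>2"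
        by (intro mult_right_mono) auto
      then show ?thesis using False by (simp add: x_def c_def)
    qed (auto simp: x_def c_def)
    moreover have "2 * (cmod y)\<^sup>2 = d * indicator {-r..r} s"
      by (auto simp: y_def d_def norm_mult norm_divide power_mult_distrib power_divide indicator_def)
    ultimately show ?thesis unfolding xy by linarith
  qed
  have "(\<integral>\<^sup>+s. ennreal ((cmod (f s - cut_mean w R f - cut_centred w R r f s))\<^sup>2) \<partial>D) \<le>
    (\<integral>\<^sup>+s. ennreal c * (ennreal ((1 + s\<^sup>2) powr \<sigma>) * ennreal ((cmod (f s))\<^sup>2)) + ennreal d * indicator {-r..r} s \<partial>lborel)"
    unfolding D1
  proof (intro nn_integral_mono)
    fix s
    have "ennreal ((cmod (f s - cut_mean w R f - cut_centred w R r f s))\<^sup>2) \<le>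
       ennreal (c * ((1 + s\<^sup>2) powr \<sigma> * (cmod (f s))\<^sup>2) + d * indicator {-r..r} s)"
      by (rule ennreal_leI[OF pt])
    also have "\<dots> = ennreal c * (ennreal ((1 + s\<^sup>2) powr \<sigma>) * ennreal ((cmod (f s))\<^sup>2)) + ennreal d * indicator {-r..r} s"
      using c0 d0 by (simp add: ennreal_mult ennreal_indicator)
    finally show "ennreal ((cmod (f s - cut_mean w R f - cut_centred w R r f s))\<^sup>2) \<le>
       ennreal c * (ennreal ((1 + s\<^sup>2) powr \<sigma>) * ennreal ((cmod (f s))\<^sup>2)) + ennreal d * indicator {-r..r} s" .
  qed
  also have "\<dots> = ennreal c * Y + ennreal d * ennreal (2 * r)"
    unfolding Y_def using False r by (subst nn_integral_add) (auto simp: nn_integral_cmult)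
  also have "ennreal d * ennreal (2 * r) \<le> ennreal (2 * (R / r)) * Y"
  proof -
    have "d * (2 * r) = (cmod A)\<^sup>2 / r" using r by (simp add: d_def power2_eq_square field_simps)
    also have "\<dots> \<le> 2 * R * (L2_norm D f)\<^sup>2 / r" using A r by (intro divide_right_mono) auto
    finally have "d * (2 * r) \<le> 2 * (R / r) * (L2_norm D f)\<^sup>2" by simp
    then have "ennreal d * ennreal (2 * r) \<le> ennreal (2 * (R / r)) * ennreal ((L2_norm D f)\<^sup>2)"
      using R r d0 by (simp add: ennreal_leI flip: ennreal_mult)
    also have "\<dots> \<le> ennreal (2 * (R / r)) * Y" by (intro mult_left_mono fY) auto
    finally show ?thesis .
  qed
  finally have "(\<integral>\<^sup>+s. ennreal ((cmod (f s - cut_mean w R f - cut_centred w R r f s))\<^sup>2) \<partial>D) \<le>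
      ennreal c * Y + ennreal (2 * (R / r)) * Y" by (auto intro: add_left_mono)
  also have "\<dots> = ennreal (2 * ((1 + R\<^sup>2) powr (- \<sigma>) + R / r)) * Y"
    using c0 R r by (simp add: c_def distrib_right[symmetric] distrib_left flip: ennreal_plus)
  finally show ?thesis .
qed

end

end

context fibre_flow
begin

lemma L2_M_by_sections:
  assumes g: "g \<in> borel_measurable borel" and f: "f \<in> L2 M"
    and le: "\<And>x'. (\<lambda>s. f (s, x')) \<in> L2 (FD x') \<Longrightarrow>
      (\<integral>\<^sup>+s. ennreal ((cmod (g (s, x')))\<^sup>2) \<partial>FD x') \<le> ennreal (C\<^sup>2) * (\<integral>\<^sup>+s. ennreal ((cmod (f (s, x')))\<^sup>2) \<partial>FD x')"
    and "C \<ge> 0"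
  shows "g \<in> L2 M" "L2_norm M g \<le> C * L2_norm M f"
proof -
  have mf: "f \<in> borel_measurable borel" using L2_measurable[OF f] by simp
  have g2: "(\<lambda>x. ennreal ((cmod (g x))\<^sup>2)) \<in> borel_measurable borel" using g by measurable
  have f2: "(\<lambda>x. ennreal ((cmod (f x))\<^sup>2)) \<in> borel_measurable borel" using mf by measurable
  have "(\<integral>\<^sup>+x. ennreal ((cmod (g x))\<^sup>2) \<partial>M) = (\<integral>\<^sup>+x'. (\<integral>\<^sup>+s. ennreal ((cmod (g (s, x')))\<^sup>2) \<partial>FD x') \<partial>lborel)"
    by (rule nn_integral_M(1)[OF g2])
  also have "\<dots> \<le> (\<integral>\<^sup>+x'. ennreal (C\<^sup>2) * (\<integral>\<^sup>+s. ennreal ((cmod (f (s, x')))\<^sup>2) \<partial>FD x') \<partial>lborel)"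
    using L2_sections[OF f] by (intro nn_integral_mono_AE) (auto elim!: eventually_mono intro: le)
  also have "\<dots> = ennreal (C\<^sup>2) * (\<integral>\<^sup>+x'. (\<integral>\<^sup>+s. ennreal ((cmod (f (s, x')))\<^sup>2) \<partial>FD x') \<partial>lborel)"
    using nn_integral_M(2)[OF f2] by (intro nn_integral_cmult) simp
  also have "\<dots> = ennreal (C\<^sup>2) * ennreal ((L2_norm M f)\<^sup>2)"
    unfolding nn_integral_M(1)[OF f2, symmetric] nn_integral_L2_norm[OF f] ..
  also have "\<dots> = ennreal ((C * L2_norm M f)\<^sup>2)" by (simp add: power_mult_distrib flip: ennreal_mult)
  finally have *: "(\<integral>\<^sup>+x. ennreal ((cmod (g x))\<^sup>2) \<partial>M) \<le> ennreal ((C * L2_norm M f)\<^sup>2)" .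
  show "g \<in> L2 M" "L2_norm M g \<le> C * L2_norm M f"
    by (rule L2I_nn_integral_le[OF _ *]; use g \<open>C \<ge> 0\<close> in simp)+
qed

lemma section_measurable_compose:
  fixes f :: "real \<times> (real ^ 'n) \<Rightarrow> complex"
  assumes f: "f \<in> borel_measurable borel" and [measurable]: "g \<in> borel_measurable N" "h \<in> N \<rightarrow>\<^sub>M borel"
  shows "(\<lambda>z. f (g z, h z)) \<in> borel_measurable N"
proof -
  have "(\<lambda>z. (g z, h z)) \<in> N \<rightarrow>\<^sub>M borel \<Otimes>\<^sub>M borel" by measurable
  then have "(\<lambda>z. (g z, h z)) \<in> N \<rightarrow>\<^sub>M borel" by (simp add: borel_prod)
  from measurable_compose[OF this f] show ?thesis .
qed

lemma cut_measurable:
  fixes f :: "real \<times> (real ^ 'n) \<Rightarrow> complex"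
  assumes f: "f \<in> borel_measurable borel"
  shows "(\<lambda>x :: real \<times> (real ^ 'n). cut_mean (fw (snd x)) R (\<lambda>s. f (s, snd x))) \<in> borel_measurable borel"
    "(\<lambda>x. cut_centred (fw (snd x)) R r (\<lambda>s. f (s, snd x)) (fst x)) \<in> borel_measurable borel"
    "(\<lambda>x. cut_primitive (fw (snd x)) R r (\<lambda>s. f (s, snd x)) (fst x)) \<in> borel_measurable borel"
proof -
  note [measurable] = section_measurable_compose[OF f]
  \<comment> \<open>The cut set varies with the fibre; written out as a case distinction, its
    indicator is visibly jointly measurable.\<close>
  have set: "indicator (cut_set (fw x') c) s = (if finite_mass (fw x') then 1 else (if - c \<le> s \<and> s \<le> c then 1 else 0 :: real))" for x' c s
    by (auto simp: cut_set_def)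
  have tot [measurable]: "(\<lambda>z. cut_total (fw (g z)) R (\<lambda>s. f (s, g z))) \<in> borel_measurable N"
    if [measurable]: "g \<in> N \<rightarrow>\<^sub>M borel" for g :: "'z \<Rightarrow> real ^ 'n" and N
    unfolding cut_total_def set by measurable
  have cen [measurable]: "(\<lambda>z. cut_centred (fw (g z)) R r (\<lambda>s. f (s, g z)) (h z)) \<in> borel_measurable N"
    if [measurable]: "g \<in> N \<rightarrow>\<^sub>M borel" "h \<in> borel_measurable N" for g :: "'z \<Rightarrow> real ^ 'n" and h N
    unfolding cut_centred_def set cut_mass_def by measurable
  have "(\<lambda>x :: real \<times> (real ^ 'n). cut_mean (fw (snd x)) R (\<lambda>s. f (s, snd x))) \<in> borel_measurable (borel \<Otimes>\<^sub>M borel)"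
    unfolding cut_mean_def by measurable
  then show "(\<lambda>x :: real \<times> (real ^ 'n). cut_mean (fw (snd x)) R (\<lambda>s. f (s, snd x))) \<in> borel_measurable borel" by (simp add: borel_prod)
  have "(\<lambda>x. cut_centred (fw (snd x)) R r (\<lambda>s. f (s, snd x)) (fst x)) \<in> borel_measurable (borel \<Otimes>\<^sub>M borel)"
    by measurable
  then show "(\<lambda>x. cut_centred (fw (snd x)) R r (\<lambda>s. f (s, snd x)) (fst x)) \<in> borel_measurable borel" by (simp add: borel_prod)
  have "(\<lambda>x. cut_primitive (fw (snd x)) R r (\<lambda>s. f (s, snd x)) (fst x)) \<in> borel_measurable (borel \<Otimes>\<^sub>M borel)"
    unfolding cut_primitive_def lessThan_def indicator_def mem_Collect_eq by measurable
  then show "(\<lambda>x. cut_primitive (fw (snd x)) R r (\<lambda>s. f (s, snd x)) (fst x)) \<in> borel_measurable borel" by (simp add: borel_prod)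
qed

text \<open>The radius 1 is a placeholder, as \<open>cut_mean\<close> does not depend on it.\<close>

definition mean_part :: "(real \<times> (real ^ 'n) \<Rightarrow> complex) \<Rightarrow> real \<times> (real ^ 'n) \<Rightarrow> complex" where
  "mean_part f x = cut_mean (fw (snd x)) 1 (\<lambda>s. f (s, snd x))"

text \<open>The density over x' of the squared norm of Y. The cases are told apart by finite mass
  instead of membership in S, and integrals in \<open>ennreal\<close> replace norms, so that it is
  Borel measurable and meaningful for every Borel f.\<close>

definition Y_weight_sq :: "real \<Rightarrow> (real \<times> (real ^ 'n) \<Rightarrow> complex) \<Rightarrow> real ^ 'n \<Rightarrow> ennreal" where
  "Y_weight_sq \<sigma> f x' = (if finite_mass (fw x') then (\<integral>\<^sup>+s. ennreal ((cmod (f (s, x')))\<^sup>2) \<partial>FD x')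
     else (\<integral>\<^sup>+s. ennreal ((1 + s\<^sup>2) powr \<sigma>) * ennreal ((cmod (f (s, x')))\<^sup>2) \<partial>lborel))"

lemma Y_weight_sq_measurable:
  assumes f: "f \<in> borel_measurable borel"
  shows "Y_weight_sq \<sigma> f \<in> borel_measurable borel"
proof -
  have f2: "(\<lambda>x. ennreal ((cmod (f x))\<^sup>2)) \<in> borel_measurable borel" using f by measurable
  note [measurable] = section_measurable_compose[OF f] nn_integral_M(2)[OF f2]
  show ?thesis unfolding Y_weight_sq_def[abs_def] by measurable
qed

lemma nn_integral_section_le_Y_weight_sq:
  assumes "\<sigma> \<ge> 0"
  shows "(\<integral>\<^sup>+s. ennreal ((cmod (f (s, x')))\<^sup>2) \<partial>FD x') \<le> Y_weight_sq \<sigma> f x'"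
proof (cases "finite_mass (fw x')")
  case False
  have "w (s, x') = 1" for s
    using fun_cong[OF fibre_weight.w_infinite_mass[OF weight_sections False], of s] .
  then have D1: "FD x' = lborel" by (simp add: density_1)
  have "ennreal ((cmod (f (s, x')))\<^sup>2) \<le> ennreal ((1 + s\<^sup>2) powr \<sigma>) * ennreal ((cmod (f (s, x')))\<^sup>2)" for s :: real
  proof -
    have "1 \<le> (1 + s\<^sup>2) powr \<sigma>" using assms by (intro ge_one_powr_ge_zero) auto
    then have "1 * (cmod (f (s, x')))\<^sup>2 \<le> (1 + s\<^sup>2) powr \<sigma> * (cmod (f (s, x')))\<^sup>2" by (intro mult_right_mono) auto
    then show ?thesis by (simp add: ennreal_leI flip: ennreal_mult)
  qed
  then show ?thesis unfolding D1 Y_weight_sq_def using False by (simp add: nn_integral_mono)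
qed (simp add: Y_weight_sq_def)

text \<open>The fibrewise estimates hold with constants independent of x' and can be integrated. In
  the bound for g, 1 / l bounds 1 / \<psi>, and max B (2 r) bounds the mass of the cut set on almost
  every fibre of either kind.\<close>

lemma flow_splitting:
  assumes f: "f \<in> L2 M" and l: "l > 0" "\<And>x'. l \<le> \<psi> x'"
    and B: "AE x' in lborel. finite_mass (fw x') \<longrightarrow> mass (fw x') \<le> B"
    and R: "0 < R" "R \<le> r" and \<sigma>: "\<sigma> \<ge> 0"
  shows "mean_part f \<in> L2 M" "flow_gen (mean_part f) (\<lambda>_. 0)" "L2_norm M (mean_part f) \<le> L2_norm M f"
    "\<exists>g q. g \<in> L2 M \<and> q \<in> L2 M \<and> flow_gen g q \<and> L2_norm M g \<le> 2 * max B (2 * r) / l * L2_norm M f \<and>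
      (\<integral>\<^sup>+x. ennreal ((cmod (f x - mean_part f x - q x))\<^sup>2) \<partial>M) \<le>
        ennreal (2 * ((1 + R\<^sup>2) powr (- \<sigma>) + R / r)) * (\<integral>\<^sup>+x'. Y_weight_sq \<sigma> f x' \<partial>lborel)"
proof -
  have mf: "f \<in> borel_measurable borel" using L2_measurable[OF f] by simp
  note cm = cut_measurable[OF mf]
  \<comment> \<open>Moves from the fixed radius 1 of \<open>mean_part\<close> to the radius R used
    in the fibre lemmas.\<close>
  have mean_eq: "mean_part f (s, x') = cut_mean (fw x') R (\<lambda>s. f (s, x'))" for s x'
    by (simp add: mean_part_def cut_mean_def cut_total_def cut_set_def)
  have pm: "mean_part f \<in> borel_measurable borel" unfolding mean_part_def[abs_def] by (rule cm)
  have psec: "(\<integral>\<^sup>+s. ennreal ((cmod (mean_part f (s, x')))\<^sup>2) \<partial>FD x') \<le> ennreal (1\<^sup>2) * (\<integral>\<^sup>+s. ennreal ((cmod (f (s, x')))\<^sup>2) \<partial>FD x')"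
    if "(\<lambda>s. f (s, x')) \<in> L2 (FD x')" for x'
    using fibre_weight.nn_integral_cut_mean[OF weight_sections that R] by (simp add: mean_eq)
  show p: "mean_part f \<in> L2 M" "L2_norm M (mean_part f) \<le> L2_norm M f"
    using L2_M_by_sections[OF pm f psec] by auto
  show "flow_gen (mean_part f) (\<lambda>_. 0)"
    unfolding flow_gen_iff_fibre_equation[OF p(1) L2_zero(1)]
    unfolding mean_eq by (intro AE_I2 fibre_weight.fibre_equation_const[OF weight_sections])
  define q where "q x = cut_centred (fw (snd x)) R r (\<lambda>s. f (s, snd x)) (fst x)" for x
  define G where "G x = cut_primitive (fw (snd x)) R r (\<lambda>s. f (s, snd x)) (fst x)" for x
  define g where "g x = (\<i> / complex_of_real (\<psi> (snd x))) * G x" for x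
  define K where "K = max B (2 * r)"
  have K: "K > 0" using R by (simp add: K_def)
  have qm: "q \<in> borel_measurable borel" and Gm: "G \<in> borel_measurable borel"
    unfolding q_def[abs_def] G_def[abs_def] by (rule cm)+
  have [measurable]: "(\<lambda>x. \<psi> (snd x)) \<in> borel_measurable (borel :: (real \<times> (real ^ 'n)) measure)"
  proof -
    have "(\<lambda>x. \<psi> (snd x)) \<in> borel_measurable ((borel \<Otimes>\<^sub>M borel) :: (real \<times> (real ^ 'n)) measure)" by measurable
    then show ?thesis by (simp add: borel_prod)
  qed
  have gm: "g \<in> borel_measurable borel" unfolding g_def[abs_def] using Gm by measurable
  have "(\<integral>\<^sup>+s. ennreal ((cmod (q (s, x')))\<^sup>2) \<partial>FD x') \<le> ennreal (2\<^sup>2) * (\<integral>\<^sup>+s. ennreal ((cmod (f (s, x')))\<^sup>2) \<partial>FD x')"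
    if x': "(\<lambda>s. f (s, x')) \<in> L2 (FD x')" for x'
  proof -
    note c = fibre_weight.L2_cut_centred[OF weight_sections x' R]
    have "(L2_norm (FD x') (cut_centred (fw x') R r (\<lambda>s. f (s, x'))))\<^sup>2 \<le> (2 * L2_norm (FD x') (\<lambda>s. f (s, x')))\<^sup>2"
      by (intro power_mono c) auto
    then have "ennreal ((L2_norm (FD x') (cut_centred (fw x') R r (\<lambda>s. f (s, x'))))\<^sup>2) \<le> ennreal (2\<^sup>2) * ennreal ((L2_norm (FD x') (\<lambda>s. f (s, x')))\<^sup>2)"
      by (simp only: power_mult_distrib ennreal_leI ennreal_mult[symmetric] zero_le_power2)
    then show ?thesis
      unfolding nn_integral_L2_norm[OF x', symmetric] nn_integral_L2_norm[OF c(1), symmetric] q_def by simp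
  qed
  from L2_M_by_sections(1)[OF qm f this] have q: "q \<in> L2 M" by simp
  have g2: "(\<lambda>x. ennreal ((cmod (g x))\<^sup>2)) \<in> borel_measurable borel" using gm by measurable
  have f2: "(\<lambda>x. ennreal ((cmod (f x))\<^sup>2)) \<in> borel_measurable borel" using mf by measurable
  have "(\<integral>\<^sup>+x. ennreal ((cmod (g x))\<^sup>2) \<partial>M) \<le> ennreal ((2 * K / l * L2_norm M f)\<^sup>2)"
  proof -
    have "(\<integral>\<^sup>+x. ennreal ((cmod (g x))\<^sup>2) \<partial>M) = (\<integral>\<^sup>+x'. (\<integral>\<^sup>+s. ennreal ((cmod (g (s, x')))\<^sup>2) \<partial>FD x') \<partial>lborel)"
      by (rule nn_integral_M(1)[OF g2])
    also have "\<dots> \<le> (\<integral>\<^sup>+x'. ennreal ((2 * K / l)\<^sup>2) * (\<integral>\<^sup>+s. ennreal ((cmod (f (s, x')))\<^sup>2) \<partial>FD x') \<partial>lborel)"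
    proof (intro nn_integral_mono_AE)
      show "AE x' in lborel. (\<integral>\<^sup>+s. ennreal ((cmod (g (s, x')))\<^sup>2) \<partial>FD x') \<le> ennreal ((2 * K / l)\<^sup>2) * (\<integral>\<^sup>+s. ennreal ((cmod (f (s, x')))\<^sup>2) \<partial>FD x')"
        using L2_sections[OF f] B
      proof eventually_elim
        case (elim x')
        interpret fibre_weight "fw x'" by (rule weight_sections)
        have Km: "cut_mass (fw x') r \<le> K" using elim(2) by (auto simp: cut_mass_def K_def)
        have Gs: "(\<lambda>s. ennreal ((cmod (G (s, x')))\<^sup>2)) \<in> borel_measurable borel"
          using borel_section_measurable[OF Gm, of x'] by measurable
        have "(\<integral>\<^sup>+s. ennreal ((cmod (g (s, x')))\<^sup>2) \<partial>FD x') \<le> (\<integral>\<^sup>+s. ennreal ((1 / l)\<^sup>2) * ennreal ((cmod (G (s, x')))\<^sup>2) \<partial>FD x')"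
        proof (intro nn_integral_mono)
          fix s
          have "cmod (g (s, x')) = 1 / \<psi> x' * cmod (G (s, x'))"
            using psi_pos[of x'] by (simp add: g_def norm_mult norm_divide)
          also have "\<dots> \<le> 1 / l * cmod (G (s, x'))"
            using l(1) l(2)[of x'] by (intro mult_right_mono divide_left_mono) auto
          finally have "(cmod (g (s, x')))\<^sup>2 \<le> (1 / l * cmod (G (s, x')))\<^sup>2" by (intro power_mono) auto
          then show "ennreal ((cmod (g (s, x')))\<^sup>2) \<le> ennreal ((1 / l)\<^sup>2) * ennreal ((cmod (G (s, x')))\<^sup>2)"
            by (simp only: power_mult_distrib ennreal_leI ennreal_mult[symmetric] zero_le_power2)
        qed
        also have "\<dots> = ennreal ((1 / l)\<^sup>2) * (\<integral>\<^sup>+s. ennreal ((cmod (G (s, x')))\<^sup>2) \<partial>FD x')"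
          using Gs by (intro nn_integral_cmult) simp
        also have "\<dots> \<le> ennreal ((1 / l)\<^sup>2) * (ennreal ((2 * K)\<^sup>2) * (\<integral>\<^sup>+s. ennreal ((cmod (f (s, x')))\<^sup>2) \<partial>FD x'))"
          using nn_integral_cut_primitive[OF elim(1) R Km] by (intro mult_left_mono) (simp_all add: G_def)
        also have "\<dots> = ennreal ((2 * K / l)\<^sup>2) * (\<integral>\<^sup>+s. ennreal ((cmod (f (s, x')))\<^sup>2) \<partial>FD x')"
          by (simp add: mult.assoc[symmetric] power_divide flip: ennreal_mult)
        finally show ?case .
      qed
    qed
    also have "\<dots> = ennreal ((2 * K / l)\<^sup>2) * (\<integral>\<^sup>+x'. (\<integral>\<^sup>+s. ennreal ((cmod (f (s, x')))\<^sup>2) \<partial>FD x') \<partial>lborel)"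
      using nn_integral_M(2)[OF f2] by (intro nn_integral_cmult) simp
    also have "\<dots> = ennreal ((2 * K / l)\<^sup>2) * ennreal ((L2_norm M f)\<^sup>2)"
      unfolding nn_integral_M(1)[OF f2, symmetric] nn_integral_L2_norm[OF f] ..
    also have "\<dots> = ennreal ((2 * K / l * L2_norm M f)\<^sup>2)"
      by (simp only: power_mult_distrib ennreal_mult[symmetric] zero_le_power2)
    finally show ?thesis .
  qed
  then have g: "g \<in> L2 M" "L2_norm M g \<le> 2 * K / l * L2_norm M f"
    using gm K l(1) by (auto intro!: L2I_nn_integral_le)
  have gen: "flow_gen g q"
    unfolding flow_gen_iff_fibre_equation[OF g(1) q]
    using L2_sections[OF f]
  proof eventually_elim
    case (elim x')
    show ?case
      using fibre_weight.fibre_equation_cut[OF weight_sections elim R psi_pos[of x']]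
      by (simp add: g_def q_def G_def)
  qed
  have e2: "(\<lambda>x. ennreal ((cmod (f x - mean_part f x - q x))\<^sup>2)) \<in> borel_measurable borel" using mf pm qm by measurable
  have err: "(\<integral>\<^sup>+x. ennreal ((cmod (f x - mean_part f x - q x))\<^sup>2) \<partial>M) \<le>
        ennreal (2 * ((1 + R\<^sup>2) powr (- \<sigma>) + R / r)) * (\<integral>\<^sup>+x'. Y_weight_sq \<sigma> f x' \<partial>lborel)"
  proof -
    have "(\<integral>\<^sup>+x. ennreal ((cmod (f x - mean_part f x - q x))\<^sup>2) \<partial>M) =
       (\<integral>\<^sup>+x'. (\<integral>\<^sup>+s. ennreal ((cmod (f (s, x') - mean_part f (s, x') - q (s, x')))\<^sup>2) \<partial>FD x') \<partial>lborel)"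
      by (rule nn_integral_M(1)[OF e2])
    also have "\<dots> \<le> (\<integral>\<^sup>+x'. ennreal (2 * ((1 + R\<^sup>2) powr (- \<sigma>) + R / r)) * Y_weight_sq \<sigma> f x' \<partial>lborel)"
    proof (rule nn_integral_mono_AE)
      show "AE x' in lborel. (\<integral>\<^sup>+s. ennreal ((cmod (f (s, x') - mean_part f (s, x') - q (s, x')))\<^sup>2) \<partial>FD x') \<le>
          ennreal (2 * ((1 + R\<^sup>2) powr (- \<sigma>) + R / r)) * Y_weight_sq \<sigma> f x'"
        using L2_sections[OF f]
      proof eventually_elim
        case (elim x')
        show ?case
          using fibre_weight.nn_integral_cut_error[OF weight_sections elim R \<sigma>]
          unfolding mean_eq q_def Y_weight_sq_def fst_conv snd_conv .
      qed
    qed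
    also have "\<dots> = ennreal (2 * ((1 + R\<^sup>2) powr (- \<sigma>) + R / r)) * (\<integral>\<^sup>+x'. Y_weight_sq \<sigma> f x' \<partial>lborel)"
      using Y_weight_sq_measurable[OF mf] by (intro nn_integral_cmult) simp
    finally show ?thesis .
  qed
  show "\<exists>g q. g \<in> L2 M \<and> q \<in> L2 M \<and> flow_gen g q \<and> L2_norm M g \<le> 2 * max B (2 * r) / l * L2_norm M f \<and>
      (\<integral>\<^sup>+x. ennreal ((cmod (f x - mean_part f x - q x))\<^sup>2) \<partial>M) \<le>
        ennreal (2 * ((1 + R\<^sup>2) powr (- \<sigma>) + R / r)) * (\<integral>\<^sup>+x'. Y_weight_sq \<sigma> f x' \<partial>lborel)"
    using g q gen err unfolding K_def by blast
qed

end

section \<open>Confined weights\<close>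

text \<open>A Borel version of the weight is corrected to be positive everywhere and exactly 1 on
  every fibre of infinite mass. By Fubini this changes only a null set, and almost every fibre has
  finite mass exactly when it lies over S.\<close>

lemma confined_weight_rep:
  fixes v :: "real \<times> (real ^ 'n) \<Rightarrow> real"
  assumes cw: "confined_weight B S v"
  shows "\<exists>w. w \<in> borel_measurable borel \<and> (\<forall>x'. fibre_weight (\<lambda>s. w (s, x'))) \<and> (AE x in lborel. v x = w x) \<and>
    (AE x' in lborel. x' \<in> S \<longleftrightarrow> finite_mass (\<lambda>s. w (s, x'))) \<and>
    (AE x' in lborel. finite_mass (\<lambda>s. w (s, x')) \<longrightarrow> mass (\<lambda>s. w (s, x')) \<le> B)"
proof -
  have v: "v \<in> borel_measurable lebesgue" and vpos: "AE x in lborel. 0 < v x"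
    and v1: "\<And>x' s. x' \<notin> S \<Longrightarrow> v (s, x') = 1"
    and vS: "\<And>x'. x' \<in> S \<Longrightarrow> (\<integral>\<^sup>+ s. ennreal \<bar>v (s, x')\<bar> \<partial>lebesgue) < ennreal B" and B: "B > 0"
    using cw by (auto simp: confined_weight_def AE_completion_iff)
  obtain w0 where w0: "w0 \<in> borel_measurable lborel" "AE x in lborel. v x = w0 x"
    using completion_ex_borel_measurable_real[OF v] by blast
  \<comment> \<open>Positivity holds only almost everywhere so far; 1 is a positive default.\<close>
  define w2 where "w2 x = (if w0 x > 0 then w0 x else 1)" for x
  have w2m: "w2 \<in> borel_measurable borel" unfolding w2_def[abs_def] using w0(1) by measurable
  have [measurable]: "w2 \<in> borel_measurable (borel \<Otimes>\<^sub>M borel)" using w2m by (simp add: borel_prod)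
  have w2pos: "w2 x > 0" for x by (simp add: w2_def)
  have vw2: "AE x in lborel. v x = w2 x" using w0(2) vpos by eventually_elim (simp add: w2_def)
  have sec: "AE x' in lborel. AE s in lborel. v (s, x') = w2 (s, x')" by (rule AE_lborel_sections[OF vw2])
  \<comment> \<open>Outside S a section of w2 equals 1 only almost everywhere, and only for almost
    every x'. \<open>fibre_weight\<close> asks for 1 at every point of every fibre of infinite
    mass.\<close>
  define w where "w x = (if finite_mass (\<lambda>s. w2 (s, snd x)) then w2 x else 1)" for x
  have w_sec: "(\<lambda>s. w (s, x')) = (if finite_mass (\<lambda>s. w2 (s, x')) then (\<lambda>s. w2 (s, x')) else (\<lambda>_. 1))" for x'
    by (auto simp: w_def)
  have inf1: "\<not> finite_mass (\<lambda>_. 1)" by (simp add: finite_mass_def)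
  have fin_iff: "finite_mass (\<lambda>s. w (s, x')) \<longleftrightarrow> finite_mass (\<lambda>s. w2 (s, x'))" for x'
    using inf1 by (simp add: w_sec)
  have "(\<lambda>x. if finite_mass (\<lambda>s. w2 (s, snd x)) then w2 x else 1) \<in> borel_measurable (borel \<Otimes>\<^sub>M borel)"
    unfolding finite_mass_def by measurable
  then have wm: "w \<in> borel_measurable borel" by (simp add: w_def[abs_def] borel_prod)
  have fw: "fibre_weight (\<lambda>s. w (s, x'))" for x'
  proof
    show "(\<lambda>s. w (s, x')) \<in> borel_measurable borel" by (rule borel_section_measurable[OF wm])
    show "w (s, x') > 0" for s using w2pos by (simp add: w_def)
    show "\<not> finite_mass (\<lambda>s. w (s, x')) \<Longrightarrow> (\<lambda>s. w (s, x')) = (\<lambda>_. 1)"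
      using fin_iff[of x'] w_sec[of x'] by simp
  qed
  have key: "AE x' in lborel. (x' \<in> S \<longrightarrow> (\<integral>\<^sup>+s. ennreal (w2 (s, x')) \<partial>lborel) < ennreal B) \<and>
      (x' \<notin> S \<longrightarrow> \<not> finite_mass (\<lambda>s. w2 (s, x')) \<and> (AE s in lborel. w2 (s, x') = 1))"
    using sec
  proof eventually_elim
    case (elim x')
    have "(\<integral>\<^sup>+s. ennreal (w2 (s, x')) \<partial>lborel) < ennreal B" if "x' \<in> S"
    proof -
      have "(\<integral>\<^sup>+s. ennreal (w2 (s, x')) \<partial>lborel) = (\<integral>\<^sup>+s. ennreal \<bar>v (s, x')\<bar> \<partial>lborel)"
        using elim by (intro nn_integral_cong_AE) (auto elim!: eventually_mono simp: less_imp_le[OF w2pos])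
      also have "\<dots> = (\<integral>\<^sup>+s. ennreal \<bar>v (s, x')\<bar> \<partial>lebesgue)" by (simp add: nn_integral_completion)
      finally show ?thesis using vS[OF that] by simp
    qed
    moreover have "AE s in lborel. w2 (s, x') = 1" if "x' \<notin> S"
      using elim v1[OF that] by (auto elim!: eventually_mono)
    moreover have "\<not> finite_mass (\<lambda>s. w2 (s, x'))" if "x' \<notin> S"
    proof -
      have "AE s in lborel. ennreal (w2 (s, x')) = 1"
        using elim by eventually_elim (use v1[OF that] in simp)
      then have "(\<integral>\<^sup>+s. ennreal (w2 (s, x')) \<partial>lborel) = (\<integral>\<^sup>+(s::real). 1 \<partial>lborel)"
        by (rule nn_integral_cong_AE)
      then show ?thesis by (simp add: finite_mass_def)
    qed
    ultimately show ?case by blast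
  qed
  have S: "AE x' in lborel. x' \<in> S \<longleftrightarrow> finite_mass (\<lambda>s. w (s, x'))"
    using key
  proof eventually_elim
    case (elim x')
    then show ?case using fin_iff[of x'] by (auto simp: finite_mass_def intro: less_trans)
  qed
  have mB: "AE x' in lborel. finite_mass (\<lambda>s. w (s, x')) \<longrightarrow> mass (\<lambda>s. w (s, x')) \<le> B"
    using key
  proof eventually_elim
    case (elim x')
    have "mass (\<lambda>s. w (s, x')) \<le> B" if "finite_mass (\<lambda>s. w (s, x'))"
    proof -
      have f2: "finite_mass (\<lambda>s. w2 (s, x'))" using that fin_iff by simp
      then have "(\<integral>\<^sup>+s. ennreal (w2 (s, x')) \<partial>lborel) \<le> ennreal B" using elim by (auto intro: less_imp_le)
      then have "enn2real (\<integral>\<^sup>+s. ennreal (w2 (s, x')) \<partial>lborel) \<le> B" using B by (intro enn2real_leI) auto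
      then show ?thesis using f2 w_sec[of x'] by (simp add: mass_def)
    qed
    then show ?case by blast
  qed
  have "AE x in lborel. \<not> finite_mass (\<lambda>s. w2 (s, snd x)) \<longrightarrow> w2 x = 1"
  proof (rule AE_lborel_from_sections)
    have "Measurable.pred (borel \<Otimes>\<^sub>M borel) (\<lambda>x. \<not> finite_mass (\<lambda>s. w2 (s, snd x)) \<longrightarrow> w2 x = 1)"
      unfolding finite_mass_def by measurable
    then show "Measurable.pred borel (\<lambda>x. \<not> finite_mass (\<lambda>s. w2 (s, snd x)) \<longrightarrow> w2 x = 1)" by (simp add: borel_prod)
    show "AE x' in lborel. AE s in lborel. \<not> finite_mass (\<lambda>u. w2 (u, snd (s, x'))) \<longrightarrow> w2 (s, x') = 1"
      using key
    proof eventually_elim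
      case (elim x')
      show ?case
      proof (cases "x' \<in> S")
        case True
        then have "finite_mass (\<lambda>s. w2 (s, x'))" using elim by (auto simp: finite_mass_def intro: less_trans)
        then show ?thesis by simp
      next
        case False
        then have "AE s in lborel. w2 (s, x') = 1" using elim by blast
        then show ?thesis by eventually_elim simp
      qed
    qed
  qed
  with vw2 have "AE x in lborel. v x = w x" by eventually_elim (auto simp: w_def)
  with wm fw S mB show ?thesis by blast
qed

text \<open>Here v is the given weight and w its Borel version. S enters only up to null sets,
  through finiteness of the mass.\<close>

locale confined_flow = fibre_flow \<psi> w
  for \<psi> :: "real ^ 'n \<Rightarrow> real" and w :: "real \<times> (real ^ 'n) \<Rightarrow> real" +
  fixes v :: "real \<times> (real ^ 'n) \<Rightarrow> real" and S :: "(real ^ 'n) set" and l B :: real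
  assumes v_eq: "AE x in lborel. v x = w x"
    and S_eq: "AE x' in lborel. x' \<in> S \<longleftrightarrow> finite_mass (fw x')"
    and mass_le: "AE x' in lborel. finite_mass (fw x') \<longrightarrow> mass (fw x') \<le> B"
    and l: "l > 0" "\<And>x'. l \<le> \<psi> x'"
begin

abbreviation N :: "(real \<times> (real ^ 'n)) measure" where "N \<equiv> completion M"

lemma completion_M_eq: "N = density lebesgue (\<lambda>x. ennreal (w x))"
  using weight_measurable by (intro completion_density_eq) (auto simp: weight_pos)

lemma borel_measurable_N: "borel_measurable N = borel_measurable lebesgue"
  unfolding completion_M_eq by (rule measurable_cong_sets) auto

lemma weight_measure_eq: "weight_measure v = N"
proof -
  have w: "w \<in> borel_measurable lebesgue" using weight_measurable by (intro measurable_completion) simp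
  have ae: "AE x in lebesgue. w x = v x" unfolding AE_completion_iff using v_eq by eventually_elim simp
  have v: "v \<in> borel_measurable lebesgue" by (rule borel_measurable_AE[OF w ae])
  show ?thesis
    unfolding weight_measure_def completion_M_eq
  proof (rule density_cong)
    show "AE x in lebesgue. ennreal (v x) = ennreal (w x)" using ae by eventually_elim simp
  qed (use v w in measurable)
qed

lemma v_sections: "AE x' in lborel. AE s in lborel. v (s, x') = w (s, x')"
  by (rule AE_lborel_sections[OF v_eq])

lemma borel_rep_sections:
  assumes "f \<in> borel_measurable N"
  shows "borel_rep M f \<in> borel_measurable borel" "AE x' in lborel. AE s in lborel. f (s, x') = borel_rep M f (s, x')"
proof -
  note r = borel_rep[OF assms]
  show "borel_rep M f \<in> borel_measurable borel" using r(1) by simp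
  show "AE x' in lborel. AE s in lborel. f (s, x') = borel_rep M f (s, x')"
    using r(2) unfolding AE_M_iff by (rule AE_lborel_sections)
qed

text \<open>Fibre by fibre, membership in the domain together with the value of the operator is the
  integrated equation. The finiteness condition of \<open>symm_dom\<close> comes from the squared
  norm of h.\<close>

lemma H_op_iff:
  assumes f: "f \<in> L2 N" and h: "h \<in> L2 N"
  shows "(f, h) \<in> H_op \<psi> v \<longleftrightarrow> flow_gen (borel_rep M f) (borel_rep M h)"
proof -
  define f0 where "f0 = borel_rep M f"
  define h0 where "h0 = borel_rep M h"
  have f0: "f0 \<in> L2 M" and h0: "h0 \<in> L2 M" unfolding f0_def h0_def by (rule L2_borel_rep[OF f] L2_borel_rep[OF h])+
  have h0m: "h0 \<in> borel_measurable borel" using L2_measurable[OF h0] by simp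
  have fs: "AE x' in lborel. AE s in lborel. f (s, x') = f0 (s, x')"
    and hs: "AE x' in lborel. AE s in lborel. h (s, x') = h0 (s, x')"
    unfolding f0_def h0_def by (rule borel_rep_sections[OF L2_measurable] f h)+
  let ?op = "\<lambda>x'. fibre_op \<psi> v x' (\<lambda>s. f (s, x'))"
  have fibre: "AE x' in lborel. ((\<lambda>s. f (s, x')) \<in> fibre_dom \<psi> v x' \<and> (AE s in lborel. h (s, x') = ?op x' s) \<longleftrightarrow>
      fibre_weight.fibre_equation (fw x') (\<psi> x') (\<lambda>s. f0 (s, x')) (\<lambda>s. h0 (s, x'))) \<and>
      ((AE s in lborel. h (s, x') = ?op x' s) \<longrightarrow>
        ennreal ((L2_norm (fibre_measure v x') (?op x'))\<^sup>2) = (\<integral>\<^sup>+s. ennreal ((cmod (h0 (s, x')))\<^sup>2) \<partial>FD x'))"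
    using v_sections fs hs L2_sections[OF f0] L2_sections[OF h0]
  proof eventually_elim
    case (elim x')
    interpret fibre_weight "fw x'" by (rule weight_sections)
    have "(AE s in lborel. h (s, x') = ?op x' s) \<longleftrightarrow> (AE s in lborel. h0 (s, x') = ?op x' s)"
    proof
      assume "AE s in lborel. h (s, x') = ?op x' s"
      with elim(3) show "AE s in lborel. h0 (s, x') = ?op x' s" by eventually_elim simp
    next
      assume "AE s in lborel. h0 (s, x') = ?op x' s"
      with elim(3) show "AE s in lborel. h (s, x') = ?op x' s" by eventually_elim simp
    qed
    moreover note fibre_dom_iff[where f="\<lambda>s. f (s, x')" and ?f0.0="\<lambda>s. f0 (s, x')" and ?h0.0="\<lambda>s. h0 (s, x')" and v=v and \<psi>=\<psi>,
        OF elim(1) psi_pos elim(4) elim(2) elim(5)]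
    moreover have "ennreal ((L2_norm (fibre_measure v x') (?op x'))\<^sup>2) = (\<integral>\<^sup>+s. ennreal ((cmod (h0 (s, x')))\<^sup>2) \<partial>FD x')"
      if "AE s in lborel. h0 (s, x') = ?op x' s"
    proof -
      have "AE s in lborel. ?op x' s = h0 (s, x')" using that by eventually_elim simp
      from L2_fibre_measure_iff(2)[where v=v, OF elim(1) borel_section_measurable[OF h0m] this elim(5)]
      show ?thesis by (simp add: nn_integral_L2_norm[OF elim(5)])
    qed
    ultimately show ?case by blast
  qed
  have mem: "(f, h) \<in> H_op \<psi> v \<longleftrightarrow> f \<in> symm_dom \<psi> v \<and> (AE x' in lborel. AE s in lborel. h (s, x') = ?op x' s)"
    unfolding H_op_def using h by (simp add: weight_measure_eq AE_completion_iff)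
  have "(f, h) \<in> H_op \<psi> v \<longleftrightarrow>
     (AE x' in lborel. fibre_weight.fibre_equation (fw x') (\<psi> x') (\<lambda>s. f0 (s, x')) (\<lambda>s. h0 (s, x')))"
  proof
    assume "(f, h) \<in> H_op \<psi> v"
    then have 1: "AE x' in lborel. (\<lambda>s. f (s, x')) \<in> fibre_dom \<psi> v x'" and 2: "AE x' in lborel. AE s in lborel. h (s, x') = ?op x' s"
      unfolding mem symm_dom_def by (auto simp: AE_completion_iff)
    show "AE x' in lborel. fibre_weight.fibre_equation (fw x') (\<psi> x') (\<lambda>s. f0 (s, x')) (\<lambda>s. h0 (s, x'))"
      using 1 2 fibre by eventually_elim blast
  next
    assume eq: "AE x' in lborel. fibre_weight.fibre_equation (fw x') (\<psi> x') (\<lambda>s. f0 (s, x')) (\<lambda>s. h0 (s, x'))"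
    have 1: "AE x' in lborel. (\<lambda>s. f (s, x')) \<in> fibre_dom \<psi> v x'" using eq fibre by eventually_elim blast
    have 2: "AE x' in lborel. AE s in lborel. h (s, x') = ?op x' s" using eq fibre by eventually_elim blast
    have "(\<integral>\<^sup>+x'. ennreal ((L2_norm (fibre_measure v x') (?op x'))\<^sup>2) \<partial>lebesgue) =
      (\<integral>\<^sup>+x'. ennreal ((L2_norm (fibre_measure v x') (?op x'))\<^sup>2) \<partial>lborel)" by (rule nn_integral_completion)
    also have "\<dots> = (\<integral>\<^sup>+x'. (\<integral>\<^sup>+s. ennreal ((cmod (h0 (s, x')))\<^sup>2) \<partial>FD x') \<partial>lborel)"
      using 2 fibre by (intro nn_integral_cong_AE, eventually_elim) blast
    also have "\<dots> = (\<integral>\<^sup>+x. ennreal ((cmod (h0 x))\<^sup>2) \<partial>M)"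
      by (rule nn_integral_M(1)[symmetric]) (use h0m in measurable)
    also have "\<dots> < \<infinity>" using h0 by (simp add: L2_iff_nn_integral)
    finally show "(f, h) \<in> H_op \<psi> v"
      unfolding mem symm_dom_def using f 1 2 by (simp add: weight_measure_eq AE_completion_iff)
  qed
  then show ?thesis
    unfolding f0_def[symmetric] h0_def[symmetric] flow_gen_iff_fibre_equation[OF f0 h0] .
qed

text \<open>The representative of the zero function is zero only almost everywhere, hence the detour
  through \<open>flow_gen_cong_AE\<close>.\<close>

lemma op_kernel_iff: "n \<in> op_kernel (H_op \<psi> v) \<longleftrightarrow> n \<in> L2 N \<and> flow_gen (borel_rep M n) (\<lambda>_. 0)"
proof -
  have z: "(\<lambda>_. 0) \<in> L2 N" by simp
  have "n \<in> op_kernel (H_op \<psi> v) \<Longrightarrow> n \<in> L2 N"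
    by (simp add: op_kernel_def H_op_def symm_dom_def weight_measure_eq)
  moreover have "n \<in> op_kernel (H_op \<psi> v) \<longleftrightarrow> flow_gen (borel_rep M n) (\<lambda>_. 0)" if n: "n \<in> L2 N"
  proof -
    note rz = L2_borel_rep[OF z] and rn = L2_borel_rep[OF n]
    have "n \<in> op_kernel (H_op \<psi> v) \<longleftrightarrow> flow_gen (borel_rep M n) (borel_rep M (\<lambda>_. 0))"
      unfolding op_kernel_def using H_op_iff[OF n z] by simp
    also have "\<dots> \<longleftrightarrow> flow_gen (borel_rep M n) (\<lambda>_. 0)"
    proof
      assume "flow_gen (borel_rep M n) (borel_rep M (\<lambda>_. 0))"
      then show "flow_gen (borel_rep M n) (\<lambda>_. 0)"
        using rz(2) by (intro flow_gen_cong_AE[OF rn(1) rz(1) rn(1) L2_zero(1)]) (auto elim!: eventually_mono)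
    next
      assume "flow_gen (borel_rep M n) (\<lambda>_. 0)"
      then show "flow_gen (borel_rep M n) (borel_rep M (\<lambda>_. 0))"
        using rz(2) by (intro flow_gen_cong_AE[OF rn(1) L2_zero(1) rn(1) rz(1)]) auto
    qed
    finally show ?thesis .
  qed
  ultimately show ?thesis by blast
qed

lemma op_kernel_linear:
  assumes "n \<in> op_kernel (H_op \<psi> v)" "n' \<in> op_kernel (H_op \<psi> v)"
  shows "(\<lambda>x. a * n x + b * n' x) \<in> op_kernel (H_op \<psi> v)"
proof -
  have n: "n \<in> L2 N" "flow_gen (borel_rep M n) (\<lambda>_. 0)" and n': "n' \<in> L2 N" "flow_gen (borel_rep M n') (\<lambda>_. 0)"
    using assms by (auto simp: op_kernel_iff)
  have c: "(\<lambda>x. a * n x + b * n' x) \<in> L2 N" by (intro L2_add L2_cmult n n')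
  note r = L2_borel_rep[OF n(1)] and r' = L2_borel_rep[OF n'(1)] and rc = L2_borel_rep[OF c]
  have comb: "(\<lambda>x. a * borel_rep M n x + b * borel_rep M n' x) \<in> L2 M" by (intro L2_add L2_cmult r r')
  have "flow_gen (\<lambda>x. a * borel_rep M n x + b * borel_rep M n' x) (\<lambda>_. 0)"
    unfolding flow_gen_def
  proof
    fix t
    have "AE x in M. borel_rep M n (flow t x) - borel_rep M n x = 0"
      "AE x in M. borel_rep M n' (flow t x) - borel_rep M n' x = 0"
      using n(2) n'(2) by (simp_all add: flow_gen_def orbit_int_def)
    then show "AE x in M. a * borel_rep M n (flow t x) + b * borel_rep M n' (flow t x) -
        (a * borel_rep M n x + b * borel_rep M n' x) = \<i> * orbit_int (\<lambda>_. 0) t x"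
      by eventually_elim (simp add: orbit_int_def)
  qed
  then have "flow_gen (borel_rep M (\<lambda>x. a * n x + b * n' x)) (\<lambda>_. 0)"
  proof (rule flow_gen_cong_AE[OF comb L2_zero(1) rc(1) L2_zero(1), rotated 2])
    show "AE x in M. a * borel_rep M n x + b * borel_rep M n' x = borel_rep M (\<lambda>x. a * n x + b * n' x) x"
      using r(2) r'(2) rc(2) by eventually_elim simp
  qed simp
  then show ?thesis using c by (simp add: op_kernel_iff)
qed

end

section \<open>The space \<open>\<Y>\<^sup>\<sigma>\<close>\<close>

lemma L2_japanese_measure:
  fixes \<sigma> :: real
  assumes f0: "f0 \<in> borel_measurable borel" and f: "AE s in lborel. f s = f0 s"
  defines "Q \<equiv> (\<integral>\<^sup>+s. ennreal ((1 + s\<^sup>2) powr \<sigma>) * ennreal ((cmod (f0 s))\<^sup>2) \<partial>lborel)"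
  shows "f \<in> L2 (japanese_measure \<sigma>) \<longleftrightarrow> Q < \<infinity>"
    "Q < \<infinity> \<Longrightarrow> ennreal ((L2_norm (japanese_measure \<sigma>) f)\<^sup>2) = Q"
proof -
  have f0l: "f0 \<in> borel_measurable lebesgue" using f0 by (intro measurable_completion) simp
  have ae: "AE s in lebesgue. f0 s = f s" unfolding AE_lebesgue_iff using f by eventually_elim simp
  have fl: "f \<in> borel_measurable lebesgue" by (rule borel_measurable_AE[OF f0l ae])
  have wt: "(\<lambda>s :: real. ennreal ((1 + s\<^sup>2) powr \<sigma>)) \<in> borel_measurable lebesgue"
    by (intro measurable_completion) simp
  have sq: "(\<lambda>s. ennreal ((cmod (f s))\<^sup>2)) \<in> borel_measurable lebesgue" using fl by measurable
  have "(\<integral>\<^sup>+s. ennreal ((cmod (f s))\<^sup>2) \<partial>japanese_measure \<sigma>) =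
      (\<integral>\<^sup>+s. ennreal ((1 + s\<^sup>2) powr \<sigma>) * ennreal ((cmod (f s))\<^sup>2) \<partial>lebesgue)"
    unfolding japanese_measure_def by (rule nn_integral_density[OF wt sq])
  also have "\<dots> = (\<integral>\<^sup>+s. ennreal ((1 + s\<^sup>2) powr \<sigma>) * ennreal ((cmod (f s))\<^sup>2) \<partial>lborel)"
    by (rule nn_integral_completion)
  also have "\<dots> = Q" unfolding Q_def
  proof (rule nn_integral_cong_AE)
    show "AE s in lborel. ennreal ((1 + s\<^sup>2) powr \<sigma>) * ennreal ((cmod (f s))\<^sup>2) =
        ennreal ((1 + s\<^sup>2) powr \<sigma>) * ennreal ((cmod (f0 s))\<^sup>2)"
      using f by eventually_elim simp
  qed
  finally have eq: "(\<integral>\<^sup>+s. ennreal ((cmod (f s))\<^sup>2) \<partial>japanese_measure \<sigma>) = Q" .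
  have m: "f \<in> borel_measurable (japanese_measure \<sigma>)" using fl by (simp add: japanese_measure_def)
  show iff: "f \<in> L2 (japanese_measure \<sigma>) \<longleftrightarrow> Q < \<infinity>" unfolding L2_iff_nn_integral eq using m by simp
  show "ennreal ((L2_norm (japanese_measure \<sigma>) f)\<^sup>2) = Q" if Q: "Q < \<infinity>"
    using nn_integral_L2_norm[of f "japanese_measure \<sigma>"] iff Q eq by simp
qed

text \<open>The difference of two candidates lies in K and is orthogonal to K, so its norm is
  0.\<close>

lemma orth_projection_unique:
  assumes K: "K \<subseteq> L2 M" "\<And>n n' a b. n \<in> K \<Longrightarrow> n' \<in> K \<Longrightarrow> (\<lambda>x. a * n x + b * n' x) \<in> K"
    and f: "f \<in> L2 M"
    and p: "p \<in> K" "\<And>n. n \<in> K \<Longrightarrow> L2_inner M (\<lambda>x. f x - p x) n = 0"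
    and p': "p' \<in> K" "\<And>n. n \<in> K \<Longrightarrow> L2_inner M (\<lambda>x. f x - p' x) n = 0"
  shows "AE x in M. p x = p' x"
proof -
  have pL: "p \<in> L2 M" and pL': "p' \<in> L2 M" using K(1) p(1) p'(1) by auto
  define d where "d x = p x - p' x" for x
  have dK: "d \<in> K" using K(2)[OF p(1) p'(1), of 1 "-1"] by (simp add: d_def[abs_def])
  have dL: "d \<in> L2 M" using dK K(1) by auto
  have "L2_inner M d d = L2_inner M p d - L2_inner M p' d"
    unfolding d_def[abs_def] by (rule L2_inner_diff_left[OF pL pL' dL[unfolded d_def[abs_def]]])
  also have "\<dots> = L2_inner M (\<lambda>x. f x - p' x) d - L2_inner M (\<lambda>x. f x - p x) d"
    by (simp add: L2_inner_diff_left[OF f pL dL] L2_inner_diff_left[OF f pL' dL])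
  also have "\<dots> = 0" using p(2)[OF dK] p'(2)[OF dK] by simp
  finally have "L2_norm M d = 0" by (simp add: L2_inner_self)
  then have "AE x in M. d x = 0" by (simp add: L2_norm_eq_zero_iff[OF dL])
  then show ?thesis by eventually_elim (simp add: d_def)
qed

text \<open>With r = R^2 the quotient R / r is 1 / R, and both terms tend to 0 as R grows.\<close>

lemma powr_remainder_small:
  assumes "\<sigma> > 0" "e > 0"
  shows "\<exists>R>0. \<exists>r\<ge>R. 2 * ((1 + R\<^sup>2) powr (- \<sigma>) + R / r) \<le> (e :: real)"
proof -
  have lim: "filterlim (\<lambda>R :: real. 1 + R\<^sup>2) at_top at_top"
    by (intro filterlim_tendsto_add_at_top[OF tendsto_const] filterlim_pow_at_top filterlim_ident) simp
  have "((\<lambda>R. 2 * ((1 + R\<^sup>2) powr (- \<sigma>) + inverse R)) \<longlongrightarrow> 2 * (0 + 0)) (at_top :: real filter)"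
    using assms(1)
    by (intro tendsto_intros tendsto_neg_powr lim tendsto_inverse_0_at_top filterlim_ident) simp
  then have "\<forall>\<^sub>F R in at_top. 2 * ((1 + R\<^sup>2) powr (- \<sigma>) + inverse R) < e"
    using assms(2) by (simp add: order_tendsto_iff)
  then have "\<forall>\<^sub>F R in at_top. 2 * ((1 + R\<^sup>2) powr (- \<sigma>) + inverse R) < e \<and> R \<ge> 1"
    using eventually_ge_at_top[of 1] by eventually_elim simp
  then obtain R where R: "2 * ((1 + R\<^sup>2) powr (- \<sigma>) + inverse R) < e" "R \<ge> 1"
    using eventually_happens'[OF trivial_limit_at_top_linorder] by blast
  have "R / R\<^sup>2 = inverse R" using R(2) by (simp add: power2_eq_square field_simps)
  moreover have "R \<le> R\<^sup>2" using R(2) by (simp add: power2_eq_square)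
  ultimately show ?thesis using R by (intro exI[of _ R] conjI exI[of _ "R\<^sup>2"]) auto
qed

context confined_flow
begin

lemma Y_weight_sq_le:
  assumes f: "f \<in> borel_measurable borel" and g: "g \<in> borel_measurable borel"
    and le: "AE s in lborel. (cmod (h (s, x')))\<^sup>2 \<le> a * (cmod (f (s, x')))\<^sup>2 + b * (cmod (g (s, x')))\<^sup>2"
    and ab: "a \<ge> 0" "b \<ge> 0"
  shows "Y_weight_sq \<sigma> h x' \<le> ennreal a * Y_weight_sq \<sigma> f x' + ennreal b * Y_weight_sq \<sigma> g x'"
proof -
  note [measurable] = borel_section_measurable[OF f, of x'] borel_section_measurable[OF g, of x']
  have le': "AE s in lborel. ennreal ((cmod (h (s, x')))\<^sup>2) \<le>
      ennreal a * ennreal ((cmod (f (s, x')))\<^sup>2) + ennreal b * ennreal ((cmod (g (s, x')))\<^sup>2)"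
    using le
  proof eventually_elim
    case (elim s)
    then have "ennreal ((cmod (h (s, x')))\<^sup>2) \<le> ennreal (a * (cmod (f (s, x')))\<^sup>2 + b * (cmod (g (s, x')))\<^sup>2)"
      by (rule ennreal_leI)
    then show ?case using ab by (simp add: ennreal_mult)
  qed
  show ?thesis
  proof (cases "finite_mass (fw x')")
    case True
    interpret fibre_weight "fw x'" by (rule weight_sections)
    have "(\<integral>\<^sup>+s. ennreal ((cmod (h (s, x')))\<^sup>2) \<partial>FD x') \<le>
       (\<integral>\<^sup>+s. ennreal a * ennreal ((cmod (f (s, x')))\<^sup>2) + ennreal b * ennreal ((cmod (g (s, x')))\<^sup>2) \<partial>FD x')"
      using le' by (intro nn_integral_mono_AE) (simp add: AE_D_iff)
    also have "\<dots> = ennreal a * (\<integral>\<^sup>+s. ennreal ((cmod (f (s, x')))\<^sup>2) \<partial>FD x') + ennreal b * (\<integral>\<^sup>+s. ennreal ((cmod (g (s, x')))\<^sup>2) \<partial>FD x')"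
      by (simp add: nn_integral_add nn_integral_cmult)
    finally show ?thesis using True by (simp add: Y_weight_sq_def)
  next
    case False
    let ?k = "\<lambda>s :: real. ennreal ((1 + s\<^sup>2) powr \<sigma>)"
    have "(\<integral>\<^sup>+s. ?k s * ennreal ((cmod (h (s, x')))\<^sup>2) \<partial>lborel) \<le>
       (\<integral>\<^sup>+s. ennreal a * (?k s * ennreal ((cmod (f (s, x')))\<^sup>2)) + ennreal b * (?k s * ennreal ((cmod (g (s, x')))\<^sup>2)) \<partial>lborel)"
    proof (rule nn_integral_mono_AE)
      show "AE s in lborel. ?k s * ennreal ((cmod (h (s, x')))\<^sup>2) \<le>
        ennreal a * (?k s * ennreal ((cmod (f (s, x')))\<^sup>2)) + ennreal b * (?k s * ennreal ((cmod (g (s, x')))\<^sup>2))"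
        using le'
      proof eventually_elim
        case (elim s)
        from mult_left_mono[OF this, of "?k s"] show ?case by (simp add: distrib_left mult.left_commute)
      qed
    qed
    also have "\<dots> = ennreal a * (\<integral>\<^sup>+s. ?k s * ennreal ((cmod (f (s, x')))\<^sup>2) \<partial>lborel) +
        ennreal b * (\<integral>\<^sup>+s. ?k s * ennreal ((cmod (g (s, x')))\<^sup>2) \<partial>lborel)"
      by (simp add: nn_integral_add nn_integral_cmult)
    finally show ?thesis using False by (simp add: Y_weight_sq_def)
  qed
qed

text \<open>\<open>L2_norm\<close> is meaningful only for members of L^2, because divergent
  integrals default to 0. So membership is characterised by finiteness, and norms are compared under
  that finiteness only.\<close>

lemma Y_sections:
  fixes \<sigma> :: real
  assumes f: "f \<in> borel_measurable lebesgue"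
  defines "Y \<equiv> Y_weight_sq \<sigma> (borel_rep M f)"
  shows "AE x' in lborel. (((x' \<notin> S \<longrightarrow> (\<lambda>s. f (s, x')) \<in> L2 (japanese_measure \<sigma>)) \<and>
        (x' \<in> S \<longrightarrow> (\<lambda>s. f (s, x')) \<in> L2 (fibre_measure v x'))) \<longleftrightarrow> Y x' < \<infinity>) \<and>
      (x' \<in> S \<longrightarrow> Y x' < \<infinity> \<longrightarrow> ennreal ((L2_norm (fibre_measure v x') (\<lambda>s. f (s, x')))\<^sup>2) = Y x') \<and>
      (x' \<notin> S \<longrightarrow> Y x' < \<infinity> \<longrightarrow> ennreal ((L2_norm (japanese_measure \<sigma>) (\<lambda>s. f (s, x')))\<^sup>2) = Y x')"
proof -
  have fN: "f \<in> borel_measurable N" using f unfolding borel_measurable_N .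
  note r = borel_rep_sections[OF fN]
  show ?thesis
    using r(2) S_eq v_sections
  proof eventually_elim
    case (elim x')
    note sm = borel_section_measurable[OF r(1), of x']
    show ?case
    proof (cases "x' \<in> S")
      case True
      interpret fibre_weight "fw x'" by (rule weight_sections)
      note fm = L2_fibre_measure_iff[where v=v, OF elim(3) sm elim(1)]
      have Y: "Y x' = (\<integral>\<^sup>+s. ennreal ((cmod (borel_rep M f (s, x')))\<^sup>2) \<partial>FD x')"
        using True elim(2) by (simp add: Y_def Y_weight_sq_def)
      have iff: "(\<lambda>s. borel_rep M f (s, x')) \<in> L2 (FD x') \<longleftrightarrow> Y x' < \<infinity>"
        unfolding Y L2_iff_nn_integral using sm by simp
      show ?thesis
        using True fm iff nn_integral_L2_norm[of "\<lambda>s. borel_rep M f (s, x')" "FD x'"] Y by simp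
    next
      case False
      then have Y: "Y x' = (\<integral>\<^sup>+s. ennreal ((1 + s\<^sup>2) powr \<sigma>) * ennreal ((cmod (borel_rep M f (s, x')))\<^sup>2) \<partial>lborel)"
        using elim(2) by (simp add: Y_def Y_weight_sq_def)
      show ?thesis
        using False L2_japanese_measure[where \<sigma>=\<sigma>, OF sm elim(1)] unfolding Y by simp
    qed
  qed
qed

lemma Y_norm_sq_eq:
  assumes f: "f \<in> borel_measurable lebesgue" and fin: "AE x' in lborel. Y_weight_sq \<sigma> (borel_rep M f) x' < \<infinity>"
  shows "Y_norm_sq S v \<sigma> f = (\<integral>\<^sup>+x'. Y_weight_sq \<sigma> (borel_rep M f) x' \<partial>lborel)"
proof -
  define Y where "Y = Y_weight_sq \<sigma> (borel_rep M f)"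
  \<comment> \<open>A Borel set that agrees with S almost everywhere and can be used to split the
    integral.\<close>
  define A where "A = {x'. finite_mass (fw x')}"
  have [measurable]: "Y \<in> borel_measurable borel"
    unfolding Y_def by (intro Y_weight_sq_measurable borel_rep_sections(1) f[folded borel_measurable_N])
  have [measurable]: "A \<in> sets borel"
    using pred_finite_mass[of "\<lambda>x. x" borel] by (simp add: A_def pred_def)
  note sec = Y_sections[OF f, of \<sigma>, folded Y_def] fin[folded Y_def] S_eq
  have "(\<integral>\<^sup>+ x'\<in>S. ennreal ((L2_norm (fibre_measure v x') (\<lambda>s. f (s, x')))\<^sup>2) \<partial>lebesgue) =
     (\<integral>\<^sup>+ x'\<in>S. ennreal ((L2_norm (fibre_measure v x') (\<lambda>s. f (s, x')))\<^sup>2) \<partial>lborel)" by (rule nn_integral_completion)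
  also have "\<dots> = (\<integral>\<^sup>+ x'\<in>A. Y x' \<partial>lborel)"
  proof (rule nn_integral_cong_AE)
    show "AE x' in lborel. ennreal ((L2_norm (fibre_measure v x') (\<lambda>s. f (s, x')))\<^sup>2) * indicator S x' = Y x' * indicator A x'"
      using sec by eventually_elim (auto simp: A_def indicator_def)
  qed
  finally have 1: "(\<integral>\<^sup>+ x'\<in>S. ennreal ((L2_norm (fibre_measure v x') (\<lambda>s. f (s, x')))\<^sup>2) \<partial>lebesgue) = (\<integral>\<^sup>+ x'\<in>A. Y x' \<partial>lborel)" .
  have "(\<integral>\<^sup>+ x'\<in>-S. ennreal ((L2_norm (japanese_measure \<sigma>) (\<lambda>s. f (s, x')))\<^sup>2) \<partial>lebesgue) =
     (\<integral>\<^sup>+ x'\<in>-S. ennreal ((L2_norm (japanese_measure \<sigma>) (\<lambda>s. f (s, x')))\<^sup>2) \<partial>lborel)" by (rule nn_integral_completion)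
  also have "\<dots> = (\<integral>\<^sup>+ x'\<in>-A. Y x' \<partial>lborel)"
  proof (rule nn_integral_cong_AE)
    show "AE x' in lborel. ennreal ((L2_norm (japanese_measure \<sigma>) (\<lambda>s. f (s, x')))\<^sup>2) * indicator (-S) x' = Y x' * indicator (-A) x'"
      using sec by eventually_elim (auto simp: A_def indicator_def)
  qed
  finally have "Y_norm_sq S v \<sigma> f = (\<integral>\<^sup>+ x'\<in>A. Y x' \<partial>lborel) + (\<integral>\<^sup>+ x'\<in>-A. Y x' \<partial>lborel)"
    unfolding Y_norm_sq_def 1 by simp
  also have "\<dots> = (\<integral>\<^sup>+ x'. Y x' * indicator A x' + Y x' * indicator (-A) x' \<partial>lborel)"
    by (rule nn_integral_add[symmetric]) measurable
  also have "\<dots> = (\<integral>\<^sup>+ x'. Y x' \<partial>lborel)" by (intro nn_integral_cong) (auto simp: indicator_def)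
  finally show ?thesis by (simp add: Y_def)
qed

lemma Y_space_iff:
  "f \<in> Y_space S v \<sigma> \<longleftrightarrow> f \<in> borel_measurable lebesgue \<and> (\<integral>\<^sup>+x'. Y_weight_sq \<sigma> (borel_rep M f) x' \<partial>lborel) < \<infinity>"
proof (cases "f \<in> borel_measurable lebesgue")
  case f: True
  let ?Y = "Y_weight_sq \<sigma> (borel_rep M f)"
  let ?L = "\<lambda>x'. (x' \<notin> S \<longrightarrow> (\<lambda>s. f (s, x')) \<in> L2 (japanese_measure \<sigma>)) \<and>
        (x' \<in> S \<longrightarrow> (\<lambda>s. f (s, x')) \<in> L2 (fibre_measure v x'))"
  have iff: "(AE x' in lborel. ?L x') \<longleftrightarrow> (AE x' in lborel. ?Y x' < \<infinity>)"
  proof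
    assume "AE x' in lborel. ?L x'"
    with Y_sections[OF f, of \<sigma>] show "AE x' in lborel. ?Y x' < \<infinity>" by eventually_elim blast
  next
    assume "AE x' in lborel. ?Y x' < \<infinity>"
    with Y_sections[OF f, of \<sigma>] show "AE x' in lborel. ?L x'" by eventually_elim blast
  qed
  have ym: "?Y \<in> borel_measurable lborel"
    using Y_weight_sq_measurable[OF borel_rep_sections(1)[OF f[folded borel_measurable_N]]] by simp
  have fin: "AE x' in lborel. ?Y x' < \<infinity>" if "(\<integral>\<^sup>+x'. ?Y x' \<partial>lborel) < \<infinity>"
  proof -
    have "AE x' in lborel. ?Y x' \<noteq> \<infinity>" using ym that by (intro nn_integral_PInf_AE) auto
    then show ?thesis by eventually_elim (simp add: less_top)
  qed
  have "f \<in> Y_space S v \<sigma> \<longleftrightarrow> (AE x' in lborel. ?L x') \<and> Y_norm_sq S v \<sigma> f < \<infinity>"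
    unfolding Y_space_def using f by (simp add: AE_completion_iff)
  also have "\<dots> \<longleftrightarrow> (AE x' in lborel. ?Y x' < \<infinity>) \<and> (\<integral>\<^sup>+x'. ?Y x' \<partial>lborel) < \<infinity>"
    unfolding iff using Y_norm_sq_eq[OF f] by (intro conj_cong refl) simp
  also have "\<dots> \<longleftrightarrow> (\<integral>\<^sup>+x'. ?Y x' \<partial>lborel) < \<infinity>" using fin by blast
  finally show ?thesis using f by simp
qed (simp add: Y_space_def)

text \<open>The embedding of Y into L^2 with constant 1, as (1 + s^2)^\<sigma> \<ge> 1 on the
  unconfined fibres.\<close>

lemma Y_space_norm:
  assumes f: "f \<in> Y_space S v \<sigma>" and "\<sigma> \<ge> 0"
  shows "Y_norm_sq S v \<sigma> f = (\<integral>\<^sup>+x'. Y_weight_sq \<sigma> (borel_rep M f) x' \<partial>lborel)"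
    "f \<in> L2 N" "L2_norm N f \<le> sqrt (enn2real (Y_norm_sq S v \<sigma> f))"
proof -
  have fm: "f \<in> borel_measurable lebesgue" and int: "(\<integral>\<^sup>+x'. Y_weight_sq \<sigma> (borel_rep M f) x' \<partial>lborel) < \<infinity>"
    using f by (auto simp: Y_space_iff)
  have fN: "f \<in> borel_measurable N" using fm unfolding borel_measurable_N .
  note r = borel_rep[OF fN]
  have rm: "borel_rep M f \<in> borel_measurable borel" using r(1) by simp
  have "AE x' in lborel. Y_weight_sq \<sigma> (borel_rep M f) x' \<noteq> \<infinity>"
    using Y_weight_sq_measurable[OF rm] int by (intro nn_integral_PInf_AE) auto
  then have "AE x' in lborel. Y_weight_sq \<sigma> (borel_rep M f) x' < \<infinity>" by eventually_elim (simp add: less_top)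
  from Y_norm_sq_eq[OF fm this] show eq: "Y_norm_sq S v \<sigma> f = (\<integral>\<^sup>+x'. Y_weight_sq \<sigma> (borel_rep M f) x' \<partial>lborel)" .
  have sq: "(\<lambda>x. ennreal ((cmod (borel_rep M f x))\<^sup>2)) \<in> borel_measurable borel" using rm by measurable
  have "(\<integral>\<^sup>+x. ennreal ((cmod (borel_rep M f x))\<^sup>2) \<partial>M) \<le> Y_norm_sq S v \<sigma> f"
    unfolding nn_integral_M(1)[OF sq] eq
    by (intro nn_integral_mono nn_integral_section_le_Y_weight_sq \<open>\<sigma> \<ge> 0\<close>)
  also have "\<dots> = ennreal ((sqrt (enn2real (Y_norm_sq S v \<sigma> f)))\<^sup>2)" using int eq by simp
  finally have *: "(\<integral>\<^sup>+x. ennreal ((cmod (borel_rep M f x))\<^sup>2) \<partial>M) \<le> ennreal ((sqrt (enn2real (Y_norm_sq S v \<sigma> f)))\<^sup>2)" .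
  note L = L2I_nn_integral_le[OF r(1) *]
  have rN: "borel_rep M f \<in> L2 N" using L(1) r(1) by (simp add: L2_completion_iff)
  have "AE x in N. borel_rep M f x = f x" unfolding AE_completion_iff using r(2) by eventually_elim simp
  then show fL: "f \<in> L2 N" by (rule L2_cong_AE[OF rN fN])
  show "L2_norm N f \<le> sqrt (enn2real (Y_norm_sq S v \<sigma> f))" using L(2) L2_borel_rep(3)[OF fL] by simp
qed

lemma Y_space_linear:
  assumes f: "f \<in> Y_space S v \<sigma>" and g: "g \<in> Y_space S v \<sigma>"
  shows "(\<lambda>x. a * f x + b * g x) \<in> Y_space S v \<sigma>"
proof -
  let ?h = "\<lambda>x. a * f x + b * g x"
  have fm [measurable]: "f \<in> borel_measurable lebesgue" and gm [measurable]: "g \<in> borel_measurable lebesgue"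
    and fi: "(\<integral>\<^sup>+x'. Y_weight_sq \<sigma> (borel_rep M f) x' \<partial>lborel) < \<infinity>"
    and gi: "(\<integral>\<^sup>+x'. Y_weight_sq \<sigma> (borel_rep M g) x' \<partial>lborel) < \<infinity>"
    using f g by (auto simp: Y_space_iff)
  have hm: "?h \<in> borel_measurable lebesgue" by measurable
  note rf = borel_rep_sections[OF fm[folded borel_measurable_N]] and rg = borel_rep_sections[OF gm[folded borel_measurable_N]]
    and rh = borel_rep_sections[OF hm[folded borel_measurable_N]]
  note [measurable] = Y_weight_sq_measurable[OF rf(1), of \<sigma>] Y_weight_sq_measurable[OF rg(1), of \<sigma>]
  have ae: "AE x' in lborel. Y_weight_sq \<sigma> (borel_rep M ?h) x' \<le>
      ennreal (2 * (cmod a)\<^sup>2) * Y_weight_sq \<sigma> (borel_rep M f) x' + ennreal (2 * (cmod b)\<^sup>2) * Y_weight_sq \<sigma> (borel_rep M g) x'"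
    using rf(2) rg(2) rh(2)
  proof eventually_elim
    case (elim x')
    show ?case
    proof (rule Y_weight_sq_le[OF rf(1) rg(1)])
      show "AE s in lborel. (cmod (borel_rep M ?h (s, x')))\<^sup>2 \<le>
          2 * (cmod a)\<^sup>2 * (cmod (borel_rep M f (s, x')))\<^sup>2 + 2 * (cmod b)\<^sup>2 * (cmod (borel_rep M g (s, x')))\<^sup>2"
        using elim
      proof eventually_elim
        case (elim s)
        define p where "p = cmod (a * borel_rep M f (s, x'))"
        define q where "q = cmod (b * borel_rep M g (s, x'))"
        have "borel_rep M ?h (s, x') = a * borel_rep M f (s, x') + b * borel_rep M g (s, x')"
          using elim by simp
        then have "cmod (borel_rep M ?h (s, x')) \<le> p + q" unfolding p_def q_def by (simp only: norm_triangle_ineq)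
        then have "(cmod (borel_rep M ?h (s, x')))\<^sup>2 \<le> (p + q)\<^sup>2" by (intro power_mono) auto
        also have "\<dots> \<le> 2 * p\<^sup>2 + 2 * q\<^sup>2" using zero_le_power2[of "p - q"] by (simp add: power2_sum power2_diff)
        finally show ?case by (simp add: p_def q_def norm_mult power_mult_distrib)
      qed
    qed auto
  qed
  have "(\<integral>\<^sup>+x'. Y_weight_sq \<sigma> (borel_rep M ?h) x' \<partial>lborel) \<le>
     (\<integral>\<^sup>+x'. ennreal (2 * (cmod a)\<^sup>2) * Y_weight_sq \<sigma> (borel_rep M f) x' + ennreal (2 * (cmod b)\<^sup>2) * Y_weight_sq \<sigma> (borel_rep M g) x' \<partial>lborel)"
    by (rule nn_integral_mono_AE[OF ae])
  also have "\<dots> = ennreal (2 * (cmod a)\<^sup>2) * (\<integral>\<^sup>+x'. Y_weight_sq \<sigma> (borel_rep M f) x' \<partial>lborel) +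
      ennreal (2 * (cmod b)\<^sup>2) * (\<integral>\<^sup>+x'. Y_weight_sq \<sigma> (borel_rep M g) x' \<partial>lborel)"
    by (simp add: nn_integral_add nn_integral_cmult)
  also have "\<dots> < \<infinity>" using fi gi by (simp add: ennreal_mult_less_top)
  finally show ?thesis using hm by (simp add: Y_space_iff)
qed

lemma L2_norm_le_1_if_Y_ball:
  assumes "f \<in> Y_ball S v \<sigma>" "\<sigma> \<ge> 0" shows "f \<in> Y_space S v \<sigma>" "L2_norm N f \<le> 1"
proof -
  show f: "f \<in> Y_space S v \<sigma>" using assms(1) by (simp add: Y_ball_def)
  have "L2_norm N f \<le> sqrt (enn2real (Y_norm_sq S v \<sigma> f))" by (rule Y_space_norm(3)[OF f assms(2)])
  also have "\<dots> \<le> 1" using assms(1) by (simp add: Y_ball_def)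
  finally show "L2_norm N f \<le> 1" .
qed

section \<open>Convergence of the time averages\<close>

lemma Y_splitting:
  assumes "\<sigma> > 0" "e > 0"
  shows "\<exists>C\<ge>0. \<forall>f\<in>Y_space S v \<sigma>. \<exists>g q. g \<in> L2 M \<and> q \<in> L2 M \<and> flow_gen g q \<and>
    L2_norm M g \<le> C * L2_norm N f \<and>
    L2_norm M (\<lambda>x. borel_rep M f x - mean_part (borel_rep M f) x - q x) \<le> e * sqrt (enn2real (Y_norm_sq S v \<sigma> f))"
proof -
  \<comment> \<open>The fibre estimates bound the square of the error, hence the target e^2.\<close>
  obtain R r where R: "0 < R" "R \<le> r" and small: "2 * ((1 + R\<^sup>2) powr (- \<sigma>) + R / r) \<le> e\<^sup>2"
    using powr_remainder_small[OF \<open>\<sigma> > 0\<close>, of "e\<^sup>2"] \<open>e > 0\<close> by auto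
  have s0: "\<sigma> \<ge> 0" using \<open>\<sigma> > 0\<close> by simp
  show ?thesis
  proof (intro exI[of _ "2 * max B (2 * r) / l"] conjI ballI)
    show "0 \<le> 2 * max B (2 * r) / l" using R l by auto
    fix f assume f: "f \<in> Y_space S v \<sigma>"
    let ?y = "enn2real (Y_norm_sq S v \<sigma> f)"
    note Y = Y_space_norm[OF f s0]
    note rf = L2_borel_rep[OF Y(2)]
    note sp = flow_splitting[OF rf(1) l mass_le R s0]
    from sp(4) obtain g q where g: "g \<in> L2 M" and q: "q \<in> L2 M" and gq: "flow_gen g q"
      and gn: "L2_norm M g \<le> 2 * max B (2 * r) / l * L2_norm M (borel_rep M f)"
      and e: "(\<integral>\<^sup>+x. ennreal ((cmod (borel_rep M f x - mean_part (borel_rep M f) x - q x))\<^sup>2) \<partial>M) \<le>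
        ennreal (2 * ((1 + R\<^sup>2) powr (- \<sigma>) + R / r)) * (\<integral>\<^sup>+x'. Y_weight_sq \<sigma> (borel_rep M f) x' \<partial>lborel)"
      by blast
    have "Y_norm_sq S v \<sigma> f < \<infinity>" using f by (simp add: Y_space_def)
    then have y: "Y_norm_sq S v \<sigma> f = ennreal ?y" by simp
    have "ennreal (2 * ((1 + R\<^sup>2) powr (- \<sigma>) + R / r)) * (\<integral>\<^sup>+x'. Y_weight_sq \<sigma> (borel_rep M f) x' \<partial>lborel) \<le>
      ennreal (e\<^sup>2) * ennreal ?y"
      unfolding Y(1)[symmetric] using small by (subst y) (intro mult_right_mono ennreal_leI, auto)
    also have "\<dots> = ennreal ((e * sqrt ?y)\<^sup>2)" by (simp add: power_mult_distrib flip: ennreal_mult)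
    finally have e': "(\<integral>\<^sup>+x. ennreal ((cmod (borel_rep M f x - mean_part (borel_rep M f) x - q x))\<^sup>2) \<partial>M) \<le> ennreal ((e * sqrt ?y)\<^sup>2)"
      using e by (rule order_trans[rotated])
    have "L2_norm M (\<lambda>x. borel_rep M f x - mean_part (borel_rep M f) x - q x) \<le> e * sqrt ?y"
      by (rule L2I_nn_integral_le(2)[OF L2_measurable[OF L2_diff(1)[OF L2_diff(1)[OF rf(1) sp(1)] q]] e']) (use \<open>e > 0\<close> in simp)
    then show "\<exists>g q. g \<in> L2 M \<and> q \<in> L2 M \<and> flow_gen g q \<and> L2_norm M g \<le> 2 * max B (2 * r) / l * L2_norm N f \<and>
      L2_norm M (\<lambda>x. borel_rep M f x - mean_part (borel_rep M f) x - q x) \<le> e * sqrt ?y"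
      using g q gq gn rf(3) by auto
  qed
qed

text \<open>The values 1, 1 and 0 for R, r and \<sigma> are arbitrary, since the facts about
  \<open>mean_part\<close> do not involve them.\<close>

lemma mean_part_facts:
  assumes "f \<in> L2 N"
  shows "mean_part (borel_rep M f) \<in> L2 M" "flow_gen (mean_part (borel_rep M f)) (\<lambda>_. 0)"
    "L2_norm M (mean_part (borel_rep M f)) \<le> L2_norm N f"
  using flow_splitting(1-3)[OF L2_borel_rep(1)[OF assms] l mass_le, of 1 1 0] L2_borel_rep(3)[OF assms] by auto

lemma mean_part_in_op_kernel:
  assumes f: "f \<in> L2 N" shows "mean_part (borel_rep M f) \<in> op_kernel (H_op \<psi> v)"
proof -
  note p = mean_part_facts[OF f]
  have pN: "mean_part (borel_rep M f) \<in> L2 N" using p(1) L2_measurable[OF p(1)] by (simp add: L2_completion_iff)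
  note r = L2_borel_rep[OF pN]
  have "flow_gen (borel_rep M (mean_part (borel_rep M f))) (\<lambda>_. 0)"
    by (rule flow_gen_cong_AE[OF p(1) L2_zero(1) r(1) L2_zero(1) r(2) _ p(2)]) simp
  then show ?thesis using pN by (simp add: op_kernel_iff)
qed

lemma mean_part_orthogonal:
  assumes f: "f \<in> Y_space S v \<sigma>" and "\<sigma> > 0" and n: "n \<in> op_kernel (H_op \<psi> v)"
  shows "L2_inner N (\<lambda>x. f x - mean_part (borel_rep M f) x) n = 0"
proof -
  have fL: "f \<in> L2 N" using Y_space_norm(2)[OF f] \<open>\<sigma> > 0\<close> by simp
  have nL: "n \<in> L2 N" and ng: "flow_gen (borel_rep M n) (\<lambda>_. 0)" using n by (auto simp: op_kernel_iff)
  note rf = L2_borel_rep[OF fL] and rn = L2_borel_rep[OF nL] and p = mean_part_facts[OF fL]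
  define f0 where "f0 = borel_rep M f"
  define n0 where "n0 = borel_rep M n"
  define p0 where "p0 = mean_part f0"
  have L: "f0 \<in> L2 M" "n0 \<in> L2 M" "p0 \<in> L2 M" using rf rn p by (simp_all add: f0_def n0_def p0_def)
  have pN: "p0 \<in> L2 N" using L(3) L2_measurable[OF L(3)] by (simp add: L2_completion_iff)
  have f0N: "f0 \<in> L2 N" "n0 \<in> L2 N" using L(1,2) L2_measurable[OF L(1)] L2_measurable[OF L(2)] by (simp_all add: L2_completion_iff)
  have d: "(\<lambda>x. f0 x - p0 x) \<in> L2 M" by (rule L2_diff(1)[OF L(1,3)])
  have ae: "AE x in N. f x = f0 x" "AE x in N. n x = n0 x"
    using rf(2) rn(2) by (simp_all add: AE_completion_iff f0_def n0_def)
  have "L2_inner N (\<lambda>x. f x - p0 x) n = L2_inner N (\<lambda>x. f0 x - p0 x) n0"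
    unfolding L2_inner_def
  proof (rule integral_cong_AE)
    show "AE x in N. (f x - p0 x) * cnj (n x) = (f0 x - p0 x) * cnj (n0 x)"
      using ae by eventually_elim simp
    show "(\<lambda>x. (f x - p0 x) * cnj (n x)) \<in> borel_measurable N"
      by (rule borel_measurable_integrable[OF L2_mult_integrable(3)[OF L2_diff(1)[OF fL pN] nL]])
    show "(\<lambda>x. (f0 x - p0 x) * cnj (n0 x)) \<in> borel_measurable N"
      by (rule borel_measurable_integrable[OF L2_mult_integrable(3)[OF L2_diff(1)[OF f0N(1) pN] f0N(2)]])
  qed
  also have "\<dots> = L2_inner M (\<lambda>x. f0 x - p0 x) n0"
    by (rule L2_inner_completion[OF L2_measurable[OF d] L2_measurable[OF L(2)]])
  finally have eq: "L2_inner N (\<lambda>x. f x - p0 x) n = L2_inner M (\<lambda>x. f0 x - p0 x) n0" .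
  define y where "y = sqrt (enn2real (Y_norm_sq S v \<sigma> f))"
  have le: "cmod (L2_inner M (\<lambda>x. f0 x - p0 x) n0) \<le> e * (y * L2_norm M n0)" if e: "e > 0" for e
  proof -
    obtain g q where g: "g \<in> L2 M" and q: "q \<in> L2 M" and gq: "flow_gen g q"
      and small: "L2_norm M (\<lambda>x. f0 x - p0 x - q x) \<le> e * y"
      using Y_splitting[OF \<open>\<sigma> > 0\<close> e] f unfolding f0_def p0_def y_def by blast
    have "L2_inner M (\<lambda>x. f0 x - p0 x - q x) n0 = L2_inner M (\<lambda>x. f0 x - p0 x) n0 - L2_inner M q n0"
      by (rule L2_inner_diff_left[OF d q L(2)])
    also have "L2_inner M q n0 = 0"
      by (rule L2_inner_coboundary_invariant[OF L(2) ng[folded n0_def] g q gq])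
    finally have "cmod (L2_inner M (\<lambda>x. f0 x - p0 x) n0) \<le> L2_norm M (\<lambda>x. f0 x - p0 x - q x) * L2_norm M n0"
      using L2_Cauchy_Schwarz[OF L2_diff(1)[OF d q] L(2)] by simp
    also have "\<dots> \<le> e * y * L2_norm M n0" by (intro mult_right_mono small) simp
    finally show ?thesis by (simp add: mult.assoc)
  qed
  \<comment> \<open>The bound holds for every e > 0 with the same y and n0, so e can tend to
    0.\<close>
  have "((\<lambda>e. e * (y * L2_norm M n0)) \<longlongrightarrow> 0 * (y * L2_norm M n0)) (at_right 0)"
    by (intro tendsto_intros)
  then have "cmod (L2_inner M (\<lambda>x. f0 x - p0 x) n0) \<le> 0 * (y * L2_norm M n0)"
    by (rule tendsto_lowerbound) (auto simp: eventually_at_filter intro!: always_eventually le)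
  then show ?thesis using eq by (simp add: f0_def p0_def)
qed

section \<open>The projection and the time averages as operators on Y\<close>

abbreviation P :: "(real \<times> (real ^ 'n) \<Rightarrow> complex) \<Rightarrow> real \<times> (real ^ 'n) \<Rightarrow> complex" where
  "P \<equiv> orth_projection N (op_kernel (H_op \<psi> v))"

abbreviation A :: "real \<Rightarrow> (real \<times> (real ^ 'n) \<Rightarrow> complex) \<Rightarrow> real \<times> (real ^ 'n) \<Rightarrow> complex" where
  "A \<equiv> time_average N (H_op \<psi> v)"

lemma op_kernel_subset: "op_kernel (H_op \<psi> v) \<subseteq> L2 N"
  by (auto simp: op_kernel_iff)

text \<open>The choice in \<open>orth_projection\<close> has the defining property only where some
  projection exists; for f in Y, \<open>mean_part\<close> is a witness.\<close>

lemma P_spec: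
  assumes f: "f \<in> Y_space S v \<sigma>" and "\<sigma> > 0"
  shows "P f \<in> op_kernel (H_op \<psi> v)" "n \<in> op_kernel (H_op \<psi> v) \<Longrightarrow> L2_inner N (\<lambda>x. f x - P f x) n = 0"
proof -
  let ?Q = "\<lambda>p. p \<in> op_kernel (H_op \<psi> v) \<and> (\<forall>n\<in>op_kernel (H_op \<psi> v). L2_inner N (\<lambda>x. f x - p x) n = 0)"
  have fL: "f \<in> L2 N" using Y_space_norm(2)[OF f] \<open>\<sigma> > 0\<close> by simp
  have "?Q (mean_part (borel_rep M f))"
    using mean_part_in_op_kernel[OF fL] mean_part_orthogonal[OF f \<open>\<sigma> > 0\<close>] by blast
  then have "?Q (P f)" unfolding orth_projection_def by (rule someI[of ?Q])
  then show "P f \<in> op_kernel (H_op \<psi> v)" "n \<in> op_kernel (H_op \<psi> v) \<Longrightarrow> L2_inner N (\<lambda>x. f x - P f x) n = 0"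
    by auto
qed

lemma P_eq_mean_part:
  assumes f: "f \<in> Y_space S v \<sigma>" and "\<sigma> > 0"
  shows "AE x in N. P f x = mean_part (borel_rep M f) x"
proof (rule orth_projection_unique[OF op_kernel_subset op_kernel_linear])
  show fL: "f \<in> L2 N" using Y_space_norm(2)[OF f] \<open>\<sigma> > 0\<close> by simp
qed (use P_spec[OF f \<open>\<sigma> > 0\<close>] mean_part_in_op_kernel[OF Y_space_norm(2)[OF f]] mean_part_orthogonal[OF f \<open>\<sigma> > 0\<close>] \<open>\<sigma> > 0\<close> in simp_all)

lemma P_L2:
  assumes f: "f \<in> Y_space S v \<sigma>" and "\<sigma> > 0"
  shows "P f \<in> L2 N" "L2_norm N (P f) \<le> L2_norm N f"
proof -
  have fL: "f \<in> L2 N" using Y_space_norm(2)[OF f] \<open>\<sigma> > 0\<close> by simp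
  note p = mean_part_facts[OF fL]
  show PL: "P f \<in> L2 N" using P_spec(1)[OF f \<open>\<sigma> > 0\<close>] op_kernel_subset by blast
  have "L2_norm N (P f) = L2_norm N (mean_part (borel_rep M f))"
    using L2_measurable[OF p(1)] by (intro L2_norm_cong_AE L2_measurable[OF PL] P_eq_mean_part[OF f \<open>\<sigma> > 0\<close>]) (simp add: measurable_completion)
  also have "\<dots> = L2_norm M (mean_part (borel_rep M f))" by (rule L2_norm_completion[OF L2_measurable[OF p(1)]])
  finally show "L2_norm N (P f) \<le> L2_norm N f" using p(3) by simp
qed

lemma P_linear:
  assumes f: "f \<in> Y_space S v \<sigma>" and g: "g \<in> Y_space S v \<sigma>" and "\<sigma> > 0"
  shows "AE x in N. P (\<lambda>x. a * f x + b * g x) x = a * P f x + b * P g x"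
proof (rule orth_projection_unique[OF op_kernel_subset op_kernel_linear])
  let ?h = "\<lambda>x. a * f x + b * g x"
  have s0: "\<sigma> \<ge> 0" using \<open>\<sigma> > 0\<close> by simp
  have h: "?h \<in> Y_space S v \<sigma>" by (rule Y_space_linear[OF f g])
  have fL: "f \<in> L2 N" and gL: "g \<in> L2 N" by (rule Y_space_norm(2)[OF _ s0], fact)+
  show "?h \<in> L2 N" by (rule Y_space_norm(2)[OF h s0])
  show "P ?h \<in> op_kernel (H_op \<psi> v)" by (rule P_spec(1)[OF h \<open>\<sigma> > 0\<close>])
  show "L2_inner N (\<lambda>x. ?h x - P ?h x) n = 0" if n: "n \<in> op_kernel (H_op \<psi> v)" for n
    by (rule P_spec(2)[OF h \<open>\<sigma> > 0\<close> n])
  show "(\<lambda>x. a * P f x + b * P g x) \<in> op_kernel (H_op \<psi> v)"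
    by (intro op_kernel_linear P_spec(1)[OF f \<open>\<sigma> > 0\<close>] P_spec(1)[OF g \<open>\<sigma> > 0\<close>])
  show "L2_inner N (\<lambda>x. ?h x - (a * P f x + b * P g x)) n = 0" if n: "n \<in> op_kernel (H_op \<psi> v)" for n
  proof -
    have nL: "n \<in> L2 N" using n op_kernel_subset by blast
    have "(\<lambda>x. ?h x - (a * P f x + b * P g x)) = (\<lambda>x. a * (f x - P f x) + b * (g x - P g x))"
      by (auto simp: algebra_simps)
    then have "L2_inner N (\<lambda>x. ?h x - (a * P f x + b * P g x)) n =
       a * L2_inner N (\<lambda>x. f x - P f x) n + b * L2_inner N (\<lambda>x. g x - P g x) n"
      using L2_inner_linear_left[OF L2_diff(1)[OF fL P_L2(1)[OF f \<open>\<sigma> > 0\<close>]] L2_diff(1)[OF gL P_L2(1)[OF g \<open>\<sigma> > 0\<close>]] nL] by simp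
    then show ?thesis by (simp add: P_spec(2)[OF f \<open>\<sigma> > 0\<close> n] P_spec(2)[OF g \<open>\<sigma> > 0\<close> n])
  qed
qed

lemma A_facts:
  assumes f: "f \<in> L2 N" and "T > 0"
  shows "A T f \<in> L2 N" "AE x in M. A T f x = flow_average T (borel_rep M f) x"
  using time_average_flow[of "H_op \<psi> v" f T] H_op_iff f \<open>T > 0\<close> by blast+

lemma L2_norm_A:
  assumes f: "f \<in> L2 N" and "T > 0" shows "L2_norm N (A T f) \<le> L2_norm N f"
proof -
  note rf = L2_borel_rep[OF f]
  note av = L2_flow_average[OF rf(1) \<open>T > 0\<close>]
  have "L2_norm N (A T f) = L2_norm N (flow_average T (borel_rep M f))"
    using A_facts(2)[OF f \<open>T > 0\<close>] L2_measurable[OF av(1)]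
    by (intro L2_norm_cong_AE L2_measurable[OF A_facts(1)[OF f \<open>T > 0\<close>]]) (simp_all add: measurable_completion AE_completion_iff)
  also have "\<dots> = L2_norm M (flow_average T (borel_rep M f))" by (rule L2_norm_completion[OF L2_measurable[OF av(1)]])
  finally show ?thesis using av(2) rf(3) by simp
qed

text \<open>\<open>borel_rep\<close> is linear only almost everywhere. The defect D is a null
  function, and its average is null because averaging is a contraction.\<close>

lemma A_linear:
  assumes f: "f \<in> L2 N" and g: "g \<in> L2 N" and "T > 0"
  shows "AE x in N. A T (\<lambda>x. a * f x + b * g x) x = a * A T f x + b * A T g x"
proof -
  let ?h = "\<lambda>x. a * f x + b * g x"
  have h: "?h \<in> L2 N" by (intro L2_add L2_cmult f g)
  note rf = L2_borel_rep[OF f] and rg = L2_borel_rep[OF g] and rh = L2_borel_rep[OF h]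
  have c: "(\<lambda>x. a * borel_rep M f x + b * borel_rep M g x) \<in> L2 M" by (intro L2_add L2_cmult rf rg)
  define D where "D = (\<lambda>x. 1 * borel_rep M ?h x + (- 1) * (a * borel_rep M f x + b * borel_rep M g x))"
  have d: "D \<in> L2 M" unfolding D_def by (intro L2_add L2_cmult rh c)
  note z = L2_flow_average[OF d \<open>T > 0\<close>]
  have "AE x in M. D x = 0" 
    using rf(2) rg(2) rh(2)
  proof eventually_elim
    case (elim x)
    then have "borel_rep M ?h x = a * borel_rep M f x + b * borel_rep M g x" by simp
    then show ?case unfolding D_def by simp
  qed
  then have "L2_norm M D = 0" by (simp only: L2_norm_eq_zero_iff[OF d])
  then have "L2_norm M (flow_average T D) = 0" using z(2) L2_norm_nonneg[of M "flow_average T D"] by simp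
  then have "AE x in M. flow_average T D x = 0" by (simp only: L2_norm_eq_zero_iff[OF z(1)])
  moreover note flow_average_linear[OF rh(1) c, of T 1 "-1", folded D_def] flow_average_linear[OF rf(1) rg(1), of T a b]
    A_facts(2)[OF f \<open>T > 0\<close>] A_facts(2)[OF g \<open>T > 0\<close>] A_facts(2)[OF h \<open>T > 0\<close>]
  ultimately have "AE x in M. A T ?h x = a * A T f x + b * A T g x"
  proof eventually_elim
    case (elim x)
    have "flow_average T (borel_rep M ?h) x - flow_average T (\<lambda>x. a * borel_rep M f x + b * borel_rep M g x) x = 0"
      using elim(1,2) by simp
    then show ?case using elim(3-) by simp
  qed
  then show ?thesis by (simp add: AE_completion_iff)
qed

text \<open>Cauchy-Schwarz, together with the fact that the unit ball of Y lies in the unit ball of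
  L^2.\<close>

lemma Y_dual_norm_le:
  assumes "u \<in> L2 N" "\<sigma> \<ge> 0"
  shows "Y_dual_norm S v \<sigma> (L2_inner (weight_measure v) u) \<le> ennreal (L2_norm N u)"
  unfolding Y_dual_norm_def weight_measure_eq
proof (intro SUP_least ennreal_leI)
  fix r assume "r \<in> Y_ball S v \<sigma>"
  note r = L2_norm_le_1_if_Y_ball[OF this \<open>\<sigma> \<ge> 0\<close>]
  have "cmod (L2_inner N u r) \<le> L2_norm N u * L2_norm N r"
    by (rule L2_Cauchy_Schwarz[OF assms(1) Y_space_norm(2)[OF r(1) \<open>\<sigma> \<ge> 0\<close>]])
  also have "\<dots> \<le> L2_norm N u * 1" by (intro mult_left_mono r) simp
  finally show "cmod (L2_inner N u r) \<le> L2_norm N u" by simp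
qed

lemma as_B_in_B_space:
  assumes "\<sigma> \<ge> 0"
    and V: "\<And>f. f \<in> Y_space S v \<sigma> \<Longrightarrow> V f \<in> L2 N" "\<And>f. f \<in> Y_space S v \<sigma> \<Longrightarrow> L2_norm N (V f) \<le> L2_norm N f"
    and lin: "\<And>f g a b. f \<in> Y_space S v \<sigma> \<Longrightarrow> g \<in> Y_space S v \<sigma> \<Longrightarrow>
      AE x in N. V (\<lambda>x. a * f x + b * g x) x = a * V f x + b * V g x"
  shows "as_B v V \<in> B_space S v \<sigma>"
  unfolding B_space_def mem_Collect_eq
proof (intro conjI ballI allI)
  note YL = Y_space_norm(2)[OF _ \<open>\<sigma> \<ge> 0\<close>]
  show "as_B v V f \<in> Y_dual S v \<sigma>" if f: "f \<in> Y_space S v \<sigma>" for f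
    unfolding Y_dual_def mem_Collect_eq as_B_def
  proof (intro conjI ballI allI)
    fix q r a b assume "q \<in> Y_space S v \<sigma>" "r \<in> Y_space S v \<sigma>"
    then show "L2_inner (weight_measure v) (V f) (\<lambda>x. a * q x + b * r x) =
       cnj a * L2_inner (weight_measure v) (V f) q + cnj b * L2_inner (weight_measure v) (V f) r"
      unfolding weight_measure_eq by (intro L2_inner_linear_right V(1) f YL)
  next
    show "Y_dual_norm S v \<sigma> (\<lambda>r. L2_inner (weight_measure v) (V f) r) < \<infinity>"
      using Y_dual_norm_le[OF V(1)[OF f] \<open>\<sigma> \<ge> 0\<close>] by (simp add: le_less_trans)
  qed
  show "as_B v V (\<lambda>x. a * f x + b * g x) r = a * as_B v V f r + b * as_B v V g r"
    if f: "f \<in> Y_space S v \<sigma>" and g: "g \<in> Y_space S v \<sigma>" and r: "r \<in> Y_space S v \<sigma>" for f g a b r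
  proof -
    have "L2_inner N (V (\<lambda>x. a * f x + b * g x)) r = L2_inner N (\<lambda>x. a * V f x + b * V g x) r"
      by (intro L2_inner_cong_AE lin f g L2_measurable V Y_space_linear L2_add L2_cmult YL r)
    also have "\<dots> = a * L2_inner N (V f) r + b * L2_inner N (V g) r"
      by (intro L2_inner_linear_left V f g YL r)
    finally show ?thesis by (simp add: as_B_def weight_measure_eq)
  qed
  have "B_norm S v \<sigma> (as_B v V) \<le> ennreal 1"
    unfolding B_norm_def
  proof (rule SUP_least)
    fix f assume "f \<in> Y_ball S v \<sigma>"
    note f = L2_norm_le_1_if_Y_ball[OF this \<open>\<sigma> \<ge> 0\<close>]
    have "Y_dual_norm S v \<sigma> (as_B v V f) \<le> ennreal (L2_norm N (V f))"
      unfolding as_B_def by (rule Y_dual_norm_le[OF V(1)[OF f(1)] \<open>\<sigma> \<ge> 0\<close>])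
    also have "\<dots> \<le> ennreal 1" using V(2)[OF f(1)] f(2) by (intro ennreal_leI) simp
    finally show "Y_dual_norm S v \<sigma> (as_B v V f) \<le> ennreal 1" .
  qed
  then show "B_norm S v \<sigma> (as_B v V) < \<infinity>" by (simp add: le_less_trans)
qed

text \<open>The constant C depends on e but not on f or T; this uniformity upgrades strong
  convergence to convergence of operator norms.\<close>

lemma L2_norm_A_minus_P:
  assumes "\<sigma> > 0" "e > 0"
  shows "\<exists>C\<ge>0. \<forall>f\<in>Y_ball S v \<sigma>. \<forall>T>0. L2_norm N (\<lambda>x. A T f x - P f x) \<le> C / T + e"
proof -
  have s0: "\<sigma> \<ge> 0" using \<open>\<sigma> > 0\<close> by simp
  obtain C where C: "C \<ge> 0" and split: "\<forall>f\<in>Y_space S v \<sigma>. \<exists>g q. g \<in> L2 M \<and> q \<in> L2 M \<and> flow_gen g q \<and>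
    L2_norm M g \<le> C * L2_norm N f \<and>
    L2_norm M (\<lambda>x. borel_rep M f x - mean_part (borel_rep M f) x - q x) \<le> e * sqrt (enn2real (Y_norm_sq S v \<sigma> f))"
    using Y_splitting[OF assms] by blast
  have "L2_norm N (\<lambda>x. A T f x - P f x) \<le> C / T + e" if fb: "f \<in> Y_ball S v \<sigma>" and T: "T > 0" for f T
  proof -
    note fY = L2_norm_le_1_if_Y_ball[OF fb s0]
    have y1: "sqrt (enn2real (Y_norm_sq S v \<sigma> f)) \<le> 1" using fb by (simp add: Y_ball_def)
    have fL: "f \<in> L2 N" by (rule Y_space_norm(2)[OF fY(1) s0])
    define f0 where "f0 = borel_rep M f"
    note rf = L2_borel_rep[OF fL, folded f0_def] and p = mean_part_facts[OF fL, folded f0_def]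
    from split fY(1) obtain g q where g: "g \<in> L2 M" and q: "q \<in> L2 M" and gq: "flow_gen g q"
      and gn: "L2_norm M g \<le> C * L2_norm N f"
      and small: "L2_norm M (\<lambda>x. f0 x - mean_part f0 x - q x) \<le> e * sqrt (enn2real (Y_norm_sq S v \<sigma> f))"
      unfolding f0_def by blast
    note av = L2_flow_average[OF rf(1) T]
    have d: "(\<lambda>x. flow_average T f0 x - mean_part f0 x) \<in> L2 M" by (rule L2_diff(1)[OF av(1) p(1)])
    have aeA: "AE x in N. A T f x = flow_average T f0 x" using A_facts(2)[OF fL T] by (simp add: AE_completion_iff f0_def)
    have "L2_norm N (\<lambda>x. A T f x - P f x) = L2_norm N (\<lambda>x. flow_average T f0 x - mean_part f0 x)"
    proof (rule L2_norm_cong_AE)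
      show "AE x in N. A T f x - P f x = flow_average T f0 x - mean_part f0 x"
        using aeA P_eq_mean_part[OF fY(1) \<open>\<sigma> > 0\<close>] by eventually_elim (simp add: f0_def)
      show "(\<lambda>x. A T f x - P f x) \<in> borel_measurable N"
        by (rule L2_measurable[OF L2_diff(1)[OF A_facts(1)[OF fL T] P_L2(1)[OF fY(1) \<open>\<sigma> > 0\<close>]]])
      show "(\<lambda>x. flow_average T f0 x - mean_part f0 x) \<in> borel_measurable N"
        using L2_measurable[OF d] by (rule measurable_completion)
    qed
    also have "\<dots> = L2_norm M (\<lambda>x. flow_average T f0 x - mean_part f0 x)" by (rule L2_norm_completion[OF L2_measurable[OF d]])
    also have "\<dots> \<le> L2_norm M g / T + L2_norm M (\<lambda>x. f0 x - mean_part f0 x - q x)"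
      by (rule flow_average_error[OF p(1,2) g q gq rf(1) T])
    also have "\<dots> \<le> C / T + e"
    proof (rule add_mono)
      have "C * L2_norm N f \<le> C * 1" by (intro mult_left_mono fY C)
      with gn show "L2_norm M g / T \<le> C / T" using T by (intro divide_right_mono) auto
      have "e * sqrt (enn2real (Y_norm_sq S v \<sigma> f)) \<le> e * 1" using y1 \<open>e > 0\<close> by (intro mult_left_mono) auto
      with small show "L2_norm M (\<lambda>x. f0 x - mean_part f0 x - q x) \<le> e" by simp
    qed
    finally show ?thesis .
  qed
  then show ?thesis using C by blast
qed

lemma B_norm_A_minus_P_tendsto:
  assumes "\<sigma> > 0"
  shows "((\<lambda>T. B_norm S v \<sigma> (\<lambda>f r. as_B v (A T) f r - as_B v P f r)) \<longlongrightarrow> 0) at_top"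
proof (rule order_tendstoI)
  have s0: "\<sigma> \<ge> 0" using \<open>\<sigma> > 0\<close> by simp
  \<comment> \<open>A real e below c is shared equally: e / 2 for the splitting error, and e / 2 for
    C / T once T exceeds 2 C / e.\<close>
  fix c :: ennreal assume "c > 0"
  then obtain x where x: "0 < x" "x < c" using dense by blast
  have "x < top" using x(2) top_greatest by (rule less_le_trans)
  then obtain e where xe: "x = ennreal e" "e \<ge> 0" by (cases x) auto
  with x have e: "e > 0" "ennreal e < c" by auto
  obtain C where C: "C \<ge> 0" and le: "\<forall>f\<in>Y_ball S v \<sigma>. \<forall>T>0. L2_norm N (\<lambda>x. A T f x - P f x) \<le> C / T + e / 2"
    using L2_norm_A_minus_P[OF assms, of "e / 2"] e(1) by auto
  show "\<forall>\<^sub>F T in at_top. B_norm S v \<sigma> (\<lambda>f r. as_B v (A T) f r - as_B v P f r) < c"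
    using eventually_gt_at_top[of "2 * C / e"] eventually_gt_at_top[of 0]
  proof eventually_elim
    case (elim T)
    have "C / T \<le> e / 2" using elim e(1) by (simp add: field_simps)
    have "B_norm S v \<sigma> (\<lambda>f r. as_B v (A T) f r - as_B v P f r) \<le> ennreal e"
      unfolding B_norm_def
    proof (rule SUP_least)
      fix f assume fb: "f \<in> Y_ball S v \<sigma>"
      note fY = L2_norm_le_1_if_Y_ball[OF fb s0]
      note AL = A_facts(1)[OF Y_space_norm(2)[OF fY(1) s0] elim(2)] and PL = P_L2(1)[OF fY(1) assms]
      have "Y_dual_norm S v \<sigma> (\<lambda>r. as_B v (A T) f r - as_B v P f r) =
          Y_dual_norm S v \<sigma> (L2_inner (weight_measure v) (\<lambda>x. A T f x - P f x))"
        unfolding Y_dual_norm_def as_B_def weight_measure_eq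
      proof (rule SUP_cong)
        fix r assume "r \<in> Y_ball S v \<sigma>"
        note r = L2_norm_le_1_if_Y_ball[OF this s0]
        show "ennreal (cmod (L2_inner N (A T f) r - L2_inner N (P f) r)) = ennreal (cmod (L2_inner N (\<lambda>x. A T f x - P f x) r))"
          by (simp add: L2_inner_diff_left[OF AL PL Y_space_norm(2)[OF r(1) s0]])
      qed simp
      also have "\<dots> \<le> ennreal (L2_norm N (\<lambda>x. A T f x - P f x))" by (rule Y_dual_norm_le[OF L2_diff(1)[OF AL PL] s0])
      also have "\<dots> \<le> ennreal e"
      proof (rule ennreal_leI)
        have "L2_norm N (\<lambda>x. A T f x - P f x) \<le> C / T + e / 2" using le fb elim(2) by blast
        then show "L2_norm N (\<lambda>x. A T f x - P f x) \<le> e" using \<open>C / T \<le> e / 2\<close> by linarith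
      qed
      finally show "Y_dual_norm S v \<sigma> (\<lambda>r. as_B v (A T) f r - as_B v P f r) \<le> ennreal e" .
    qed
    then show ?case using e(2) by (rule le_less_trans)
  qed
qed simp

lemma ergodic_theorem:
  assumes "\<sigma> > 0"
  shows "T > 0 \<Longrightarrow> as_B v (A T) \<in> B_space S v \<sigma>" "as_B v P \<in> B_space S v \<sigma>"
    "((\<lambda>T. B_norm S v \<sigma> (\<lambda>f r. as_B v (A T) f r - as_B v P f r)) \<longlongrightarrow> 0) at_top"
proof -
  have s0: "\<sigma> \<ge> 0" using assms by simp
  note YL = Y_space_norm(2)[OF _ s0]
  show "as_B v (A T) \<in> B_space S v \<sigma>" if "T > 0"
    by (rule as_B_in_B_space[OF s0]) (intro A_facts(1) L2_norm_A A_linear YL that; assumption)+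
  show "as_B v P \<in> B_space S v \<sigma>"
    by (rule as_B_in_B_space[OF s0]) (intro P_L2[OF _ assms] P_linear[OF _ _ assms]; assumption)+
  show "((\<lambda>T. B_norm S v \<sigma> (\<lambda>f r. as_B v (A T) f r - as_B v P f r)) \<longlongrightarrow> 0) at_top"
    by (rule B_norm_A_minus_P_tendsto[OF assms])
qed

end

theorem theorem5p2:
  fixes \<psi> :: "real ^ 'n \<Rightarrow> real"
    and w :: "real \<times> (real ^ 'n) \<Rightarrow> real"
    and S :: "(real ^ 'n) set"
    and l L M \<sigma> :: real
  assumes "l > 0"
    and "\<And>x'. \<psi> x' > l"
    and "\<And>x' y'. \<bar>\<psi> x' - \<psi> y'\<bar> \<le> L * norm (x' - y')"
    and "confined_weight M S w"
    and "\<sigma> > 1 / 2"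
    and "emeasure lebesgue (- S) > 0"
  shows "let A = time_average (weight_measure w) (H_op \<psi> w);
             P = orth_projection (weight_measure w) (op_kernel (H_op \<psi> w))
         in (\<forall>T>0. as_B w (A T) \<in> B_space S w \<sigma>) \<and> as_B w P \<in> B_space S w \<sigma> \<and>
            ((\<lambda>T. B_norm S w \<sigma> (\<lambda>f r. as_B w (A T) f r - as_B w P f r)) \<longlongrightarrow> 0) at_top"
proof -
  obtain w0 where w0: "w0 \<in> borel_measurable borel" "\<And>x'. fibre_weight (\<lambda>s. w0 (s, x'))"
    "AE x in lborel. w x = w0 x" "AE x' in lborel. x' \<in> S \<longleftrightarrow> finite_mass (\<lambda>s. w0 (s, x'))"
    "AE x' in lborel. finite_mass (\<lambda>s. w0 (s, x')) \<longrightarrow> mass (\<lambda>s. w0 (s, x')) \<le> M"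
    using confined_weight_rep[OF assms(4)] by blast
  have "continuous_on UNIV \<psi>"
    unfolding continuous_on_iff
  proof (intro ballI allI impI)
    fix x' and e :: real assume "e > 0"
    \<comment> \<open>The constant |L| + 1 is positive whatever the sign of L, so it may stand in
      the denominator.\<close>
    have "\<bar>\<psi> y' - \<psi> x'\<bar> < e" if y: "norm (y' - x') < e / (\<bar>L\<bar> + 1)" for y'
    proof -
      have "\<bar>\<psi> y' - \<psi> x'\<bar> \<le> L * norm (y' - x')" by (rule assms(3))
      also have "\<dots> \<le> (\<bar>L\<bar> + 1) * norm (y' - x')" by (intro mult_right_mono) auto
      also have "\<dots> < e" using y by (simp add: field_simps pos_less_divide_eq)
      finally show ?thesis .
    qed
    then show "\<exists>d>0. \<forall>y'\<in>UNIV. dist y' x' < d \<longrightarrow> dist (\<psi> y') (\<psi> x') < e"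
      using \<open>e > 0\<close> by (intro exI[of _ "e / (\<bar>L\<bar> + 1)"]) (auto simp: dist_norm)
  qed
  then have "\<psi> \<in> borel_measurable borel" by (rule borel_measurable_continuous_onI)
  then interpret F: confined_flow \<psi> w0 w S l M
    using w0 assms(1,2) less_trans[OF assms(1,2)]
    by (intro confined_flow.intro fibre_flow.intro confined_flow_axioms.intro) (auto intro: less_imp_le)
  have "\<sigma> > 0" using assms(5) by simp
  then show ?thesis
    unfolding Let_def F.weight_measure_eq using F.ergodic_theorem by blast
qed

end
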